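(* Let $G$ be a compact Lie group. Let $E\to F$ and $E'\to F'$ be vector bundles equipped with fibrewise linear $G$-actions that are transitive on the fibres of the sphere bundles $(E\setminus 0)/\mathbb{R}_{>0}$ and $(E'\setminus 0')/\mathbb{R}_{>0}$, where $0$ and $0'$ denote the zero sections of $E$ and $E'$; fix $G$-invariant fibrewise inner products on $E$ and $E'$, with fibrewise norms denoted $|\cdot|$. Let $\mathcal{O}$ and $\mathcal{O}'$ be $G$-invariant open neighbourhoods of the zero sections in $E$ and $E'$, and let $\varphi \colon \mathcal{O}\to\mathcal{O}'$ be a $G$-equivariant smooth map. Assume that the function on $\mathcal{O}$ given by $e\mapsto|\varphi(e)|^2$ vanishes exactly on the zero section and that its Hessian is non-degenerate on the normal bundle to the zero section. Then there exists a unique smooth map $\psi' \colon \mathcal{O}\circledcirc 0\to\mathcal{O}'\circledcirc 0'$ such that $p'\circ\psi'=\varphi\circ p$, where $p \colon \mathcal{O}\circledcirc 0\to\mathcal{O}$ and $p' \colon \mathcal{O}'\circledcirc 0'\to\mathcal{O}'$ are the blow-down maps. Moreover, $\psi'$ is $G$-equivariant, and its composition with any boundary-defining function on $\mathcal{O}'\circledcirc 0'$ is a boundary-defining function on $\mathcal{O}\circledcirc 0$.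
   Context: Manifolds are smooth, Hausdorff and second countable. Fibrewise linear $G$-actions cover the identity on the base. Radial-squared blowup of a vector bundle along its zero section (denoted here by $\circledcirc$): for a vector bundle $E\to F$ with zero section $0$, let $S_E(0) := (\nu_E(0)\setminus 0)/\mathbb{R}_{>0}$, where $\nu_E(0)$ is the normal bundle of the zero section in $E$ (naturally identified with $E$). As a set, $E\circledcirc 0 := (E\setminus 0)\sqcup S_E(0)$. The blow-down map $p \colon E\circledcirc 0\to E$ is the inclusion on $E\setminus 0$ and on $S_E(0)$ is induced by the bundle projection $\nu_E(0)\to 0$. Let $q \colon E\setminus 0\to S_E(0)$ be the quotient map coming from $E\cong\nu_E(0)$. Given a fibrewise inner product with norm $|\cdot|$, $E\circledcirc 0$ has the unique manifold-with-boundary structure for which the bijection $E\circledcirc 0\to S_E(0)\times\mathbb{R}_{\ge0}$, $x\mapsto(q(x),|x|^2)$ for $x\in E\setminus 0$ and $x\mapsto(x,0)$ for $x\in S_E(0)$, is a diffeomorphism; it is independent of the inner product. Its boundary is $S_E(0)$ and its interior is $E\setminus 0$. Equivalently, with $S\subset E$ the unit sphere bundle, $E\circledcirc 0\cong S\times[0,\infty)$ with blow-down map $(u,s)\mapsto\sqrt{s}\,u$. For an open neighbourhood $\mathcal{O}$ of the zero section, $\mathcal{O}\circledcirc 0 := (\mathcal{O}\setminus 0)\sqcup S_E(0)$ is an open subset of $E\circledcirc 0$. If $G$ acts fibrewise linearly on $E$ (covering the identity on the base $F$) and $\mathcal{O}$ is $G$-invariant, then the restriction of this $G$-action to $\mathcal{O}$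 induces a natural $G$-action on $\mathcal{O}\circledcirc 0$. A boundary-defining function on a manifold-with-boundary $Q$ is a smooth $f \colon Q\to\mathbb{R}_{\ge 0}$ with $f^{-1}(0)=\partial Q$ and $df|_{\partial Q}$ nowhere vanishing. *)

theory Defs
  imports "HOL-Analysis.Analysis" "HOL-Algebra.Group_Action"
begin

section \<open>Smooth maps between subsets of Euclidean spaces\<close>

primrec Ck_on :: "nat \<Rightarrow> 'a::euclidean_space set \<Rightarrow> ('a \<Rightarrow> 'b::euclidean_space) \<Rightarrow> bool" where
  "Ck_on 0 S f \<longleftrightarrow> continuous_on S f"
| "Ck_on (Suc k) S f \<longleftrightarrow> (\<forall>x\<in>S. f differentiable (at x)) \<and>
     (\<forall>v. Ck_on k S (\<lambda>x. frechet_derivative f (at x) v))"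

text \<open>On sets that are not open (relatively open subsets of linear subspaces and of half-spaces),
  smoothness means local extendability to a smooth map on an open set.\<close>

definition smooth_on :: "'a::euclidean_space set \<Rightarrow> ('a \<Rightarrow> 'b::euclidean_space) \<Rightarrow> bool" where
  "smooth_on A f \<longleftrightarrow> (\<forall>x\<in>A. \<exists>U g. open U \<and> x \<in> U \<and> (\<forall>k. Ck_on k U g) \<and> (\<forall>y\<in>A \<inter> U. g y = f y))"


section \<open>Manifolds, possibly with boundary\<close>

text \<open>The coordinate spaces of charts are linear subspaces of a Euclidean type \<open>'a\<close>. Euclidean
  types have positive dimension, so this is what admits zero-dimensional manifolds, such as finite
  groups or a one-point base. The dimension may differ between connected components. The atlas
  is an arbitrary (not necessarily maximal) one.\<close>

record ('p, 'a) mfd =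
  mtop :: "'p topology"
  atlas :: "('p set \<times> ('p \<Rightarrow> 'a)) set"

abbreviation points :: "('p, 'a, 'z) mfd_scheme \<Rightarrow> 'p set" where
  "points M \<equiv> topspace (mtop M)"

definition half_space :: "'a::euclidean_space set \<Rightarrow> 'a \<Rightarrow> 'a set" where
  "half_space V a = {v \<in> V. 0 \<le> a \<bullet> v}"

definition is_chart :: "('p, 'a::euclidean_space) mfd \<Rightarrow> 'p set \<Rightarrow> ('p \<Rightarrow> 'a) \<Rightarrow> bool" where
  "is_chart M U c \<longleftrightarrow> openin (mtop M) U \<and>
     homeomorphic_map (subtopology (mtop M) U) (top_of_set (c ` U)) c \<and>
     (\<exists>V. subspace V \<and>
        (openin (top_of_set V) (c ` U) \<or>
         (\<exists>a\<in>V. a \<noteq> 0 \<and> openin (top_of_set (half_space V a)) (c ` U))))"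

definition compatible :: "'p set \<Rightarrow> ('p \<Rightarrow> 'a::euclidean_space) \<Rightarrow> 'p set \<Rightarrow> ('p \<Rightarrow> 'a) \<Rightarrow> bool" where
  "compatible U c U' c' \<longleftrightarrow>
     smooth_on (c ` (U \<inter> U')) (c' \<circ> inv_into U c) \<and>
     smooth_on (c' ` (U \<inter> U')) (c \<circ> inv_into U' c')"

definition manifold_with_boundary :: "('p, 'a::euclidean_space) mfd \<Rightarrow> bool" where
  "manifold_with_boundary M \<longleftrightarrow>
     Hausdorff_space (mtop M) \<and> second_countable (mtop M) \<and>
     (\<forall>(U, c)\<in>atlas M. is_chart M U c) \<and>
     points M = (\<Union>(U, c)\<in>atlas M. U) \<and>
     (\<forall>(U, c)\<in>atlas M. \<forall>(U', c')\<in>atlas M. compatible U c U' c')"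

definition boundary :: "('p, 'a::euclidean_space) mfd \<Rightarrow> 'p set" where
  "boundary M = {p. \<exists>(U, c)\<in>atlas M. p \<in> U \<and>
     (\<exists>V. subspace V \<and> (\<exists>a\<in>V. a \<noteq> 0 \<and> openin (top_of_set (half_space V a)) (c ` U) \<and> a \<bullet> c p = 0))}"

definition manifold :: "('p, 'a::euclidean_space) mfd \<Rightarrow> bool" where
  "manifold M \<longleftrightarrow> manifold_with_boundary M \<and> boundary M = {}"

definition maximal_atlas :: "('p, 'a::euclidean_space) mfd \<Rightarrow> ('p set \<times> ('p \<Rightarrow> 'a)) set" where
  "maximal_atlas M = {(U, c). is_chart M U c \<and> (\<forall>(U', c')\<in>atlas M. compatible U c U' c')}"

definition smooth_map ::
  "('p, 'a::euclidean_space) mfd \<Rightarrow> ('q, 'b::euclidean_space) mfd \<Rightarrow> ('p \<Rightarrow> 'q) \<Rightarrow> bool" where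
  "smooth_map M N f \<longleftrightarrow> continuous_map (mtop M) (mtop N) f \<and>
     (\<forall>(U, c)\<in>atlas M. \<forall>(U', c')\<in>atlas N.
        smooth_on (c ` {p \<in> U. f p \<in> U'}) (c' \<circ> f \<circ> inv_into U c))"

definition diffeo ::
  "('p, 'a::euclidean_space) mfd \<Rightarrow> ('q, 'b::euclidean_space) mfd \<Rightarrow> ('p \<Rightarrow> 'q) \<Rightarrow> bool" where
  "diffeo M N f \<longleftrightarrow> bij_betw f (points M) (points N) \<and> smooth_map M N f \<and>
     smooth_map N M (inv_into (points M) f)"

text \<open>Only used for linear subspaces and for the half-line.\<close>

definition std_mfd :: "'a::euclidean_space set \<Rightarrow> ('a, 'a) mfd" where
  "std_mfd A = \<lparr>mtop = top_of_set A, atlas = {(A, id)}\<rparr>"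

abbreviation real_mfd :: "(real, real) mfd" where
  "real_mfd \<equiv> std_mfd UNIV"

definition open_submfd :: "('p, 'a) mfd \<Rightarrow> 'p set \<Rightarrow> ('p, 'a) mfd" where
  "open_submfd M W = \<lparr>mtop = subtopology (mtop M) W, atlas = (\<lambda>(U, c). (U \<inter> W, c)) ` atlas M\<rparr>"

text \<open>At most one factor is meant to have a boundary.\<close>

definition prod_mfd :: "('p, 'a) mfd \<Rightarrow> ('q, 'b) mfd \<Rightarrow> ('p \<times> 'q, 'a \<times> 'b) mfd" where
  "prod_mfd M N = \<lparr>mtop = prod_topology (mtop M) (mtop N),
     atlas = (\<lambda>((U, c), (U', c')). (U \<times> U', map_prod c c')) ` (atlas M \<times> atlas N)\<rparr>"

text \<open>The structure on an embedded submanifold \<open>S\<close>, given by the slice charts of the ambient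
  manifold.\<close>

definition embedded_submfd :: "('p, 'a::euclidean_space) mfd \<Rightarrow> 'p set \<Rightarrow> ('p, 'a) mfd" where
  "embedded_submfd M S = \<lparr>mtop = subtopology (mtop M) S,
     atlas = {(U \<inter> S, c) | U c. (U, c) \<in> maximal_atlas M \<and>
       (\<exists>W. subspace W \<and> c ` (U \<inter> S) = c ` U \<inter> W)}\<rparr>"

text \<open>The structure on a set \<open>A\<close> that makes a bijection \<open>f\<close> from \<open>A\<close> to \<open>points N\<close> a
  diffeomorphism.\<close>

definition transported_mfd :: "'p set \<Rightarrow> ('p \<Rightarrow> 'q) \<Rightarrow> ('q, 'a) mfd \<Rightarrow> ('p, 'a) mfd" where
  "transported_mfd A f N = \<lparr>mtop = pullback_topology A f (mtop N),
     atlas = (\<lambda>(U, c). (f -` U \<inter> A, c \<circ> f)) ` atlas N\<rparr>"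


section \<open>Differentials and Hessians\<close>

text \<open>For a chart \<open>(U, c)\<close> at \<open>p\<close>, the tangent space at \<open>p\<close> is represented by
  \<open>span (c ` U)\<close>, which is the linear subspace that \<open>U\<close> is modelled on.\<close>

definition differential_nonzero :: "('p, 'a::euclidean_space) mfd \<Rightarrow> ('p \<Rightarrow> real) \<Rightarrow> 'p \<Rightarrow> bool" where
  "differential_nonzero M f p \<longleftrightarrow> (\<forall>(U, c)\<in>atlas M. p \<in> U \<longrightarrow>
     (\<exists>D. ((f \<circ> inv_into U c) has_derivative D) (at (c p) within c ` U) \<and>
          (\<exists>v\<in>span (c ` U). D v \<noteq> 0)))"

definition boundary_defining :: "('p, 'a::euclidean_space) mfd \<Rightarrow> ('p \<Rightarrow> real) \<Rightarrow> bool" where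
  "boundary_defining Q f \<longleftrightarrow> smooth_map Q real_mfd f \<and> (\<forall>p\<in>points Q. 0 \<le> f p) \<and>
     {p \<in> points Q. f p = 0} = boundary Q \<and> (\<forall>p\<in>boundary Q. differential_nonzero Q f p)"

text \<open>The tangent space at \<open>p\<close> of a submanifold \<open>Z\<close>, as a subspace of \<open>span (c ` U)\<close>.\<close>

definition tangent_in_chart ::
  "('p, 'a::euclidean_space) mfd \<Rightarrow> ('p \<Rightarrow> 'a) \<Rightarrow> 'p set \<Rightarrow> 'p \<Rightarrow> 'a set" where
  "tangent_in_chart M c Z p = {v. \<exists>\<gamma>. smooth_map real_mfd M \<gamma> \<and> range \<gamma> \<subseteq> Z \<and> \<gamma> 0 = p \<and>
     ((c \<circ> \<gamma>) has_vector_derivative v) (at 0)}"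

definition hessian_in_chart ::
  "'p set \<Rightarrow> ('p \<Rightarrow> 'a::euclidean_space) \<Rightarrow> ('p \<Rightarrow> real) \<Rightarrow> 'p \<Rightarrow> 'a \<Rightarrow> 'a \<Rightarrow> real" where
  "hessian_in_chart U c f p u v =
     deriv (\<lambda>s. deriv (\<lambda>t. (f \<circ> inv_into U c) (c p + s *\<^sub>R u + t *\<^sub>R v)) 0) 0"

text \<open>Meant for functions \<open>f\<close> that are critical and constant along \<open>Z\<close>: there the Hessian is a
  well-defined bilinear form on the tangent space of \<open>M\<close> at \<open>p\<close> that annihilates the tangent space
  of \<open>Z\<close>, hence a bilinear form on the normal space, the quotient of the two. The condition says
  that no nonzero normal vector lies in the radical of that form.\<close>

definition hessian_nondegenerate_on_normal_bundle ::
  "('p, 'a::euclidean_space) mfd \<Rightarrow> 'p set \<Rightarrow> ('p \<Rightarrow> real) \<Rightarrow> bool" where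
  "hessian_nondegenerate_on_normal_bundle M Z f \<longleftrightarrow>
     (\<forall>p\<in>Z. \<forall>(U, c)\<in>atlas M. p \<in> U \<longrightarrow>
        (\<forall>u\<in>span (c ` U). u \<notin> tangent_in_chart M c Z p \<longrightarrow>
           (\<exists>v\<in>span (c ` U). hessian_in_chart U c f p u v \<noteq> 0)))"


section \<open>Lie groups and vector bundles\<close>

definition lie_group :: "'g monoid \<Rightarrow> ('g, 'k::euclidean_space) mfd \<Rightarrow> bool" where
  "lie_group G MG \<longleftrightarrow> group G \<and> manifold MG \<and> points MG = carrier G \<and>
     smooth_map (prod_mfd MG MG) MG (\<lambda>(g, h). g \<otimes>\<^bsub>G\<^esub> h) \<and>
     smooth_map MG MG (\<lambda>g. inv\<^bsub>G\<^esub> g)"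

record ('e, 'a, 'f, 'b) vbundle =
  total :: "('e, 'a) mfd"
  base :: "('f, 'b) mfd"
  proj :: "'e \<Rightarrow> 'f"
  vzero :: "'f \<Rightarrow> 'e"
  vadd :: "'e \<Rightarrow> 'e \<Rightarrow> 'e"
  vscale :: "real \<Rightarrow> 'e \<Rightarrow> 'e"

definition fibre :: "('e, 'a, 'f, 'b) vbundle \<Rightarrow> 'f \<Rightarrow> 'e set" where
  "fibre B x = {e \<in> points (total B). proj B e = x}"

definition zero_section :: "('e, 'a, 'f, 'b) vbundle \<Rightarrow> 'e set" where
  "zero_section B = vzero B ` points (base B)"

definition local_trivialization ::
  "('e, 'a::euclidean_space, 'f, 'b::euclidean_space) vbundle \<Rightarrow> 'f set \<Rightarrow> 'a set \<Rightarrow> ('e \<Rightarrow> 'a) \<Rightarrow> bool"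
  where
  "local_trivialization B U W \<tau> \<longleftrightarrow> openin (mtop (base B)) U \<and> subspace W \<and>
     diffeo (open_submfd (total B) {e \<in> points (total B). proj B e \<in> U})
            (prod_mfd (open_submfd (base B) U) (std_mfd W)) (\<lambda>e. (proj B e, \<tau> e)) \<and>
     (\<forall>x\<in>U. \<tau> (vzero B x) = 0 \<and>
        (\<forall>e\<in>fibre B x. \<forall>e'\<in>fibre B x. \<tau> (vadd B e e') = \<tau> e + \<tau> e') \<and>
        (\<forall>e\<in>fibre B x. \<forall>r. \<tau> (vscale B r e) = r *\<^sub>R \<tau> e))"

text \<open>The vector space axioms of the fibres need not be listed, because every fibre is mapped
  bijectively and compatibly with the operations onto a linear subspace \<open>W\<close>. Taking \<open>W\<close> inside the
  coordinate type of the total space is no restriction, as the rank is at most the dimension of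
  the total space. The rank is locally constant.\<close>

definition vector_bundle ::
  "('e, 'a::euclidean_space, 'f, 'b::euclidean_space) vbundle \<Rightarrow> bool" where
  "vector_bundle B \<longleftrightarrow> manifold (total B) \<and> manifold (base B) \<and>
     smooth_map (total B) (base B) (proj B) \<and>
     (\<forall>x\<in>points (base B). vzero B x \<in> fibre B x \<and>
        (\<forall>e\<in>fibre B x. \<forall>e'\<in>fibre B x. vadd B e e' \<in> fibre B x) \<and>
        (\<forall>e\<in>fibre B x. \<forall>r. vscale B r e \<in> fibre B x)) \<and>
     (\<forall>x\<in>points (base B). \<exists>U W \<tau>. x \<in> U \<and> local_trivialization B U W \<tau>)"

definition smooth_section ::
  "('e, 'a::euclidean_space, 'f, 'b::euclidean_space) vbundle \<Rightarrow> 'f set \<Rightarrow> ('f \<Rightarrow> 'e) \<Rightarrow> bool" where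
  "smooth_section B U s \<longleftrightarrow> smooth_map (open_submfd (base B) U) (total B) s \<and>
     (\<forall>x\<in>U. proj B (s x) = x)"

definition fibrewise_inner_product ::
  "('e, 'a::euclidean_space, 'f, 'b::euclidean_space) vbundle \<Rightarrow> ('e \<Rightarrow> 'e \<Rightarrow> real) \<Rightarrow> bool" where
  "fibrewise_inner_product B ip \<longleftrightarrow>
     (\<forall>x\<in>points (base B). \<forall>d\<in>fibre B x. \<forall>e\<in>fibre B x.
        ip d e = ip e d \<and>
        (\<forall>d'\<in>fibre B x. ip (vadd B d d') e = ip d e + ip d' e) \<and>
        (\<forall>r. ip (vscale B r d) e = r * ip d e) \<and>
        (d \<noteq> vzero B x \<longrightarrow> 0 < ip d d)) \<and>
     (\<forall>U s t. openin (mtop (base B)) U \<and> smooth_section B U s \<and> smooth_section B U t \<longrightarrow>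
        smooth_map (open_submfd (base B) U) real_mfd (\<lambda>x. ip (s x) (t x)))"

definition fnorm :: "('e \<Rightarrow> 'e \<Rightarrow> real) \<Rightarrow> 'e \<Rightarrow> real" where
  "fnorm ip e = sqrt (ip e e)"

definition fibrewise_linear_action ::
  "'g monoid \<Rightarrow> ('g, 'k::euclidean_space) mfd \<Rightarrow>
   ('e, 'a::euclidean_space, 'f, 'b::euclidean_space) vbundle \<Rightarrow> ('g \<Rightarrow> 'e \<Rightarrow> 'e) \<Rightarrow> bool" where
  "fibrewise_linear_action G MG B \<rho> \<longleftrightarrow> group_action G (points (total B)) \<rho> \<and>
     smooth_map (prod_mfd MG (total B)) (total B) (\<lambda>(g, e). \<rho> g e) \<and>
     (\<forall>g\<in>carrier G. \<forall>x\<in>points (base B). \<forall>e\<in>fibre B x.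
        \<rho> g e \<in> fibre B x \<and>
        (\<forall>e'\<in>fibre B x. \<rho> g (vadd B e e') = vadd B (\<rho> g e) (\<rho> g e')) \<and>
        (\<forall>r. \<rho> g (vscale B r e) = vscale B r (\<rho> g e)))"

definition invariant_inner_product ::
  "'g monoid \<Rightarrow> ('e, 'a::euclidean_space, 'f, 'b::euclidean_space) vbundle \<Rightarrow>
   ('g \<Rightarrow> 'e \<Rightarrow> 'e) \<Rightarrow> ('e \<Rightarrow> 'e \<Rightarrow> real) \<Rightarrow> bool" where
  "invariant_inner_product G B \<rho> ip \<longleftrightarrow> fibrewise_inner_product B ip \<and>
     (\<forall>g\<in>carrier G. \<forall>x\<in>points (base B). \<forall>d\<in>fibre B x. \<forall>e\<in>fibre B x.
        ip (\<rho> g d) (\<rho> g e) = ip d e)"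


section \<open>The radial-squared blowup along the zero section\<close>

text \<open>The normal bundle of the zero section is identified with the bundle itself, so that
  points of the sphere bundle are open rays in the fibres.\<close>

definition ray :: "('e, 'a, 'f, 'b) vbundle \<Rightarrow> 'e \<Rightarrow> 'e set" where
  "ray B e = {vscale B t e | t. 0 < t}"

definition sphere_bundle :: "('e, 'a, 'f, 'b) vbundle \<Rightarrow> 'e set set" where
  "sphere_bundle B = ray B ` (points (total B) - zero_section B)"

definition transitive_on_sphere_fibres ::
  "'g monoid \<Rightarrow> ('e, 'a, 'f, 'b) vbundle \<Rightarrow> ('g \<Rightarrow> 'e \<Rightarrow> 'e) \<Rightarrow> bool" where
  "transitive_on_sphere_fibres G B \<rho> \<longleftrightarrow>
     (\<forall>x\<in>points (base B). \<forall>r\<in>sphere_bundle B. \<forall>r'\<in>sphere_bundle B.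
        r \<subseteq> fibre B x \<and> r' \<subseteq> fibre B x \<longrightarrow> (\<exists>g\<in>carrier G. \<rho> g ` r = r'))"

text \<open>The smooth structure of the sphere bundle is the one of the unit sphere bundle, an embedded
  submanifold of the total space.\<close>

definition sphere_bundle_mfd ::
  "('e, 'a::euclidean_space, 'f, 'b) vbundle \<Rightarrow> ('e \<Rightarrow> 'e \<Rightarrow> real) \<Rightarrow> ('e set, 'a) mfd" where
  "sphere_bundle_mfd B ip = transported_mfd (sphere_bundle B) (\<lambda>r. THE e. e \<in> r \<and> fnorm ip e = 1)
     (embedded_submfd (total B) {e \<in> points (total B). fnorm ip e = 1})"

definition blowup_set :: "('e, 'a, 'f, 'b) vbundle \<Rightarrow> 'e set \<Rightarrow> ('e + 'e set) set" where
  "blowup_set B N = (N - zero_section B) <+> sphere_bundle B"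

definition blowdown :: "('e, 'a, 'f, 'b) vbundle \<Rightarrow> 'e + 'e set \<Rightarrow> 'e" where
  "blowdown B = case_sum id (\<lambda>r. vzero B (the_elem (proj B ` r)))"

definition blowup_coords ::
  "('e, 'a, 'f, 'b) vbundle \<Rightarrow> ('e \<Rightarrow> 'e \<Rightarrow> real) \<Rightarrow> 'e + 'e set \<Rightarrow> 'e set \<times> real" where
  "blowup_coords B ip = case_sum (\<lambda>e. (ray B e, (fnorm ip e)\<^sup>2)) (\<lambda>r. (r, 0))"

definition blowup_mfd ::
  "('e, 'a::euclidean_space, 'f, 'b) vbundle \<Rightarrow> ('e \<Rightarrow> 'e \<Rightarrow> real) \<Rightarrow> ('e + 'e set, 'a \<times> real) mfd"
  where
  "blowup_mfd B ip = transported_mfd (blowup_set B (points (total B))) (blowup_coords B ip)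
     (prod_mfd (sphere_bundle_mfd B ip) (std_mfd {0..}))"

definition blowup_nbhd ::
  "('e, 'a::euclidean_space, 'f, 'b) vbundle \<Rightarrow> ('e \<Rightarrow> 'e \<Rightarrow> real) \<Rightarrow> 'e set \<Rightarrow>
   ('e + 'e set, 'a \<times> real) mfd" where
  "blowup_nbhd B ip N = open_submfd (blowup_mfd B ip) (blowup_set B N)"

definition blowup_action :: "('g \<Rightarrow> 'e \<Rightarrow> 'e) \<Rightarrow> 'g \<Rightarrow> 'e + 'e set \<Rightarrow> 'e + 'e set" where
  "blowup_action \<rho> g = map_sum (\<rho> g) ((`) (\<rho> g))"

definition invariant_zero_nbhd ::
  "'g monoid \<Rightarrow> ('e, 'a, 'f, 'b) vbundle \<Rightarrow> ('g \<Rightarrow> 'e \<Rightarrow> 'e) \<Rightarrow> 'e set \<Rightarrow> bool" where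
  "invariant_zero_nbhd G B \<rho> N \<longleftrightarrow> openin (mtop (total B)) N \<and> zero_section B \<subseteq> N \<and>
     (\<forall>g\<in>carrier G. \<rho> g ` N \<subseteq> N)"

definition equivariant ::
  "'g monoid \<Rightarrow> 'p set \<Rightarrow> ('g \<Rightarrow> 'p \<Rightarrow> 'p) \<Rightarrow> ('g \<Rightarrow> 'q \<Rightarrow> 'q) \<Rightarrow> ('p \<Rightarrow> 'q) \<Rightarrow> bool" where
  "equivariant G A \<rho> \<rho>' f \<longleftrightarrow> (\<forall>g\<in>carrier G. \<forall>p\<in>A. f (\<rho> g p) = \<rho>' g (f p))"

definition is_blowup_lift ::
  "('e, 'a::euclidean_space, 'f, 'b::euclidean_space) vbundle \<Rightarrow> ('e \<Rightarrow> 'e \<Rightarrow> real) \<Rightarrow> 'e set \<Rightarrow>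
   ('e2, 'a2::euclidean_space, 'f2, 'b2::euclidean_space) vbundle \<Rightarrow> ('e2 \<Rightarrow> 'e2 \<Rightarrow> real) \<Rightarrow> 'e2 set \<Rightarrow>
   ('e \<Rightarrow> 'e2) \<Rightarrow> ('e + 'e set \<Rightarrow> 'e2 + 'e2 set) \<Rightarrow> bool" where
  "is_blowup_lift B ip N B' ip' N' \<phi> \<psi> \<longleftrightarrow>
     smooth_map (blowup_nbhd B ip N) (blowup_nbhd B' ip' N') \<psi> \<and>
     (\<forall>z\<in>blowup_set B N. blowdown B' (\<psi> z) = \<phi> (blowdown B z))"

end

theory Submission
  imports Defs
begin

text \<open>In polar coordinates a point of the blowup is a pair \<open>(u, s)\<close> of a unit vector and a number \<open>s \<ge> 0\<close>, and
  its image under the blow-down map is \<open>sqrt s * u\<close>. The lift has to send \<open>(u, s)\<close> to \<open>(X / |X|, s * |X|\<^sup>2)\<close>, where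
  \<open>X (u, s) = \<phi> (sqrt s * u) / sqrt s\<close>, so that everything depends on \<open>X\<close> extending smoothly and without zeros to
  \<open>s = 0\<close>. The non-degenerate Hessian makes the derivative of \<open>\<phi>\<close> in the fibre direction injective along the zero
  section. Hence \<open>\<phi>\<close> is injective on small balls of the fibres, a small vector has the same stabilizer as its
  image, and transitivity on the sphere fibres forces \<open>\<phi> (- e) = - \<phi> e\<close>. In bundle charts the base component of
  \<open>\<phi> (t * u)\<close> is therefore even in \<open>t\<close> and the fibre component is odd, and by Whitney's theorem on even functions
  \<open>X\<close> is smooth in \<open>s = t\<^sup>2\<close>. Its value at \<open>s = 0\<close> is the injective fibre derivative of \<open>\<phi>\<close>, which is not zero.
  Since \<open>s * |X|\<^sup>2\<close> has the derivative \<open>|X|\<^sup>2 > 0\<close> in \<open>s\<close> at the boundary, boundary-defining functions pull back to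
  boundary-defining functions.\<close>

section \<open>Calculus of smooth maps\<close>

text \<open>Smoothness at a boundary point means that a smooth extension across the boundary exists,
  so a function of \<open>s \<ge> 0\<close> has to be continued to \<open>s < 0\<close>. This is
  done by a Seeley reflection, an infinite weighted sum of dilated mirror images. The dilation
  factors are unbounded, so the half-line is first folded into \<open>[0, 1)\<close>; for even
  functions the derivatives of such a sum are again made of such sums, which gives all orders by
  induction. The Hessian enters because \<open>|\<phi>|\<^sup>2\<close> is a quadratic form in the
  fibre component of \<phi>: if the derivative kills a vertical vector, both factors of every term
  vanish to second order along it, and it lies in the radical. The quotient by \<open>sqrt s\<close>
  at \<open>s = 0\<close> is defined as a limit in the total space, which makes it independent of
  charts and carries equivariance to the boundary. The blowup gets its charts from slice charts of
  the unit sphere bundle in the maximal atlas; these have to be constructed with values in the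
  coordinate space of the total space, and their images shown to be open in a subspace.\<close>

lemma Ck_on_cong:
  assumes "open S" "\<And>x. x \<in> S \<Longrightarrow> f x = g x" "Ck_on k S f"
  shows "Ck_on k S g"
  using assms(2,3)
proof (induction k arbitrary: f g)
  case 0
  then show ?case by (simp cong: continuous_on_cong)
next
  case (Suc k)
  \<comment> \<open>A derivative \<open>at x\<close> looks at a full neighbourhood, so agreement on
    \<open>S\<close> fixes it because \<open>S\<close> is open.\<close>
  have D: "(g has_derivative frechet_derivative f (at x)) (at x)" if "x \<in> S" for x
  proof (rule has_derivative_transform_within_open[OF _ assms(1) that])
    show "(f has_derivative frechet_derivative f (at x)) (at x)"
      using Suc.prems(2) that frechet_derivative_works by auto
  qed (use Suc.prems(1) in auto)
  have E: "frechet_derivative f (at x) = frechet_derivative g (at x)" if "x \<in> S" for x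
    using frechet_derivative_at[OF D[OF that]] .
  show ?case
    unfolding Ck_on.simps
  proof (intro conjI ballI allI)
    show "g differentiable at x" if "x \<in> S" for x
      using D[OF that] unfolding differentiable_def by blast
    show "Ck_on k S (\<lambda>x. frechet_derivative g (at x) v)" for v
      by (rule Suc.IH[of "\<lambda>x. frechet_derivative f (at x) v"]) (use E Suc.prems(2) in auto)
  qed
qed

lemma Ck_on_subset: "Ck_on k S f \<Longrightarrow> T \<subseteq> S \<Longrightarrow> Ck_on k T f"
  by (induction k arbitrary: f) (auto intro: continuous_on_subset)

lemma Ck_on_SucD: "Ck_on (Suc k) S f \<Longrightarrow> Ck_on k S f"
proof (induction k arbitrary: f)
  case 0
  then show ?case
    by (auto intro!: continuous_at_imp_continuous_on differentiable_imp_continuous_within)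
next
  case (Suc k)
  show ?case
    unfolding Ck_on.simps(2)[of k] using Suc.IH Suc.prems unfolding Ck_on.simps(2)[of "Suc k"] by blast
qed

text \<open>\<open>frechet_derivative\<close> is a choice; uniqueness of derivatives allows any
  explicit formula in its place. The inductions over the order of differentiability below run
  through this rule.\<close>

lemma Ck_on_SucI:
  assumes "open S" "\<And>x. x \<in> S \<Longrightarrow> (f has_derivative f' x) (at x)"
    and "\<And>v. Ck_on k S (\<lambda>x. f' x v)"
  shows "Ck_on (Suc k) S f"
  unfolding Ck_on.simps
proof (intro conjI ballI allI)
  show "f differentiable at x" if "x \<in> S" for x
    using assms(2)[OF that] unfolding differentiable_def by blast
  show "Ck_on k S (\<lambda>x. frechet_derivative f (at x) v)" for v
    by (rule Ck_on_cong[OF assms(1) _ assms(3)[of v]]) (metis assms(2) frechet_derivative_at)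
qed

lemma Ck_on_local:
  assumes "\<And>x. x \<in> S \<Longrightarrow> \<exists>U. open U \<and> x \<in> U \<and> Ck_on k U f"
  shows "Ck_on k S f"
  using assms
proof (induction k arbitrary: f)
  case 0
  have "isCont f x" if "x \<in> S" for x
  proof -
    obtain U where "open U" "x \<in> U" "continuous_on U f" using 0 \<open>x \<in> S\<close> by (metis Ck_on.simps(1))
    then show ?thesis by (simp add: continuous_on_eq_continuous_at)
  qed
  then show ?case by (simp add: continuous_at_imp_continuous_on)
next
  case (Suc k)
  show ?case
    unfolding Ck_on.simps
  proof (intro conjI ballI allI)
    show "f differentiable at x" if "x \<in> S" for x using Suc.prems[OF that] by auto
    show "Ck_on k S (\<lambda>x. frechet_derivative f (at x) v)" for v
      by (rule Suc.IH) (use Suc.prems in fastforce)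
  qed
qed

lemma Ck_on_const: "Ck_on k S (\<lambda>x. c)"
  by (induction k arbitrary: c) (auto simp: frechet_derivative_const)

lemma Ck_on_bounded_linear:
  assumes "bounded_linear L" "open S"
  shows "Ck_on k S L"
proof (cases k)
  case 0
  then show ?thesis by (simp add: assms linear_continuous_on)
next
  case (Suc k)
  show ?thesis unfolding Suc
    by (rule Ck_on_SucI[OF assms(2) bounded_linear_imp_has_derivative[OF assms(1)]]) (rule Ck_on_const)
qed

lemma Ck_on_has_derivative:
  assumes "Ck_on (Suc k) S f" "x \<in> S"
  shows "(f has_derivative frechet_derivative f (at x)) (at x)"
  using assms frechet_derivative_works by auto

lemma Ck_on_add:
  assumes "open S" "Ck_on k S f" "Ck_on k S g"
  shows "Ck_on k S (\<lambda>x. f x + g x)"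
  using assms(2,3)
proof (induction k arbitrary: f g)
  case 0
  then show ?case by (auto intro: continuous_intros)
next
  case (Suc k)
  show ?case
  proof (rule Ck_on_SucI[OF assms(1) has_derivative_add[OF Ck_on_has_derivative[OF Suc.prems(1)] Ck_on_has_derivative[OF Suc.prems(2)]]])
    show "Ck_on k S (\<lambda>x. frechet_derivative f (at x) v + frechet_derivative g (at x) v)" for v
      using Suc.IH Suc.prems by simp
  qed
qed

lemma Ck_on_sum:
  assumes "open S" "\<And>i. i \<in> I \<Longrightarrow> Ck_on k S (f i)"
  shows "Ck_on k S (\<lambda>x. \<Sum>i\<in>I. f i x)"
proof (cases "finite I")
  case True
  then show ?thesis using assms(2)
    by (induction I rule: finite_induct) (auto intro: Ck_on_const Ck_on_add[OF assms(1)])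
qed (simp add: Ck_on_const)

lemma Ck_on_bilinear:
  fixes prod :: "'b::euclidean_space \<Rightarrow> 'c::euclidean_space \<Rightarrow> 'd::euclidean_space"
  assumes "bounded_bilinear prod" "open S" "Ck_on k S f" "Ck_on k S g"
  shows "Ck_on k S (\<lambda>x. prod (f x) (g x))"
  using assms(3,4)
proof (induction k arbitrary: f g)
  case 0
  then show ?case by (auto intro: bounded_bilinear.continuous_on[OF assms(1)])
next
  case (Suc k)
  show ?case
  proof (rule Ck_on_SucI[OF assms(2) bounded_bilinear.FDERIV[OF assms(1) Ck_on_has_derivative[OF Suc.prems(1)] Ck_on_has_derivative[OF Suc.prems(2)]]])
    show "Ck_on k S (\<lambda>x. prod (f x) (frechet_derivative g (at x) v) + prod (frechet_derivative f (at x) v) (g x))" for v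
      by (intro Ck_on_add[OF assms(2)] Suc.IH Ck_on_SucD[OF Suc.prems(1)] Ck_on_SucD[OF Suc.prems(2)])
        (use Suc.prems in auto)
  qed
qed

lemma linear_eq_sum_Basis:
  fixes L :: "'b::euclidean_space \<Rightarrow> 'c::real_vector"
  assumes "linear L"
  shows "L v = (\<Sum>b\<in>Basis. (v \<bullet> b) *\<^sub>R L b)"
proof -
  have "L v = L (\<Sum>b\<in>Basis. (v \<bullet> b) *\<^sub>R b)" by (simp add: euclidean_representation)
  also have "\<dots> = (\<Sum>b\<in>Basis. (v \<bullet> b) *\<^sub>R L b)"
    by (simp add: linear_sum[OF assms] linear_scale[OF assms])
  finally show ?thesis .
qed

lemma Ck_on_compose:
  fixes f :: "'a::euclidean_space \<Rightarrow> 'b::euclidean_space" and g :: "'b \<Rightarrow> 'c::euclidean_space"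
  assumes "open S" "Ck_on k S f" "open T" "Ck_on k T g" "f ` S \<subseteq> T"
  shows "Ck_on k S (\<lambda>x. g (f x))"
  using assms(2,4)
proof (induction k arbitrary: g)
  case 0
  then show ?case using assms(5) by (auto intro: continuous_on_compose2)
next
  case (Suc k)
  have Dg: "(g has_derivative frechet_derivative g (at (f x))) (at (f x))" if "x \<in> S" for x
    using Ck_on_has_derivative[OF Suc.prems(2)] that assms(5) by auto
  have Df: "(f has_derivative frechet_derivative f (at x)) (at x)" if "x \<in> S" for x
    using Ck_on_has_derivative[OF Suc.prems(1)] that by auto
  \<comment> \<open>The vector to which the derivative of \<open>g\<close> is applied moves with
    \<open>x\<close>, while the induction hypothesis treats fixed directions; expanding in the basis
    separates the two.\<close>
  have eq: "frechet_derivative g (at (f x)) (frechet_derivative f (at x) v) =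
     (\<Sum>b\<in>Basis. (frechet_derivative f (at x) v \<bullet> b) *\<^sub>R frechet_derivative g (at (f x)) b)" if "x \<in> S" for x v
    by (rule linear_eq_sum_Basis) (use Dg[OF that] has_derivative_linear in blast)
  show ?case
  proof (rule Ck_on_SucI[OF assms(1) has_derivative_compose[OF Df Dg]])
    fix v
    have "Ck_on k S (\<lambda>x. \<Sum>b\<in>Basis. (frechet_derivative f (at x) v \<bullet> b) *\<^sub>R frechet_derivative g (at (f x)) b)"
    proof (intro Ck_on_sum assms(1) Ck_on_bilinear[OF bounded_bilinear_scaleR])
      show "Ck_on k S (\<lambda>x. frechet_derivative f (at x) v \<bullet> b)" for b
        by (intro Ck_on_bilinear[OF bounded_bilinear_inner] assms(1) Ck_on_const) (use Suc.prems in auto)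
      show "Ck_on k S (\<lambda>x. frechet_derivative g (at (f x)) b)" for b
        by (rule Suc.IH) (use Suc.prems Ck_on_SucD in auto)
    qed
    then show "Ck_on k S (\<lambda>x. frechet_derivative g (at (f x)) (frechet_derivative f (at x) v))"
      by (rule Ck_on_cong[OF assms(1), rotated]) (use eq in auto)
  qed auto
qed

lemma Ck_on_real_SucI:
  fixes f :: "real \<Rightarrow> real"
  assumes "open S" "\<And>x. x \<in> S \<Longrightarrow> (f has_real_derivative f' x) (at x)" "Ck_on k S f'"
  shows "Ck_on (Suc k) S f"
proof (rule Ck_on_SucI[OF assms(1)])
  show "(f has_derivative (*) (f' x)) (at x)" if "x \<in> S" for x
    using assms(2)[OF that] by (simp add: has_field_derivative_def)
  show "Ck_on k S (\<lambda>x. f' x * v)" for v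
    by (rule Ck_on_bilinear[OF bounded_bilinear_mult assms(1,3) Ck_on_const])
qed

text \<open>The derivative is a polynomial in \<open>inverse\<close> itself, so the induction feeds
  on its own hypothesis. The same happens for \<open>sqrt\<close>, whose derivative is half the
  inverse of \<open>sqrt\<close>.\<close>

lemma Ck_on_inverse: "Ck_on k (- {0}) (inverse :: real \<Rightarrow> real)"
proof (induction k)
  case 0
  then show ?case by (auto intro!: continuous_intros)
next
  case (Suc k)
  have op: "open (- {0::real})" by auto
  show ?case
  proof (rule Ck_on_real_SucI[OF op])
    show "(inverse has_real_derivative (-1) * (inverse x * inverse x)) (at x)" if "x \<in> - {0}" for x :: real
      using that by (auto intro!: derivative_eq_intros simp: power2_eq_square divide_simps)
    show "Ck_on k (- {0}) (\<lambda>x::real. (-1) * (inverse x * inverse x))"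
      by (intro Ck_on_bilinear[OF bounded_bilinear_mult op] Ck_on_const Suc)
  qed
qed

lemma Ck_on_sqrt: "Ck_on k {0<..} sqrt"
proof (induction k)
  case 0
  then show ?case by (auto intro!: continuous_intros)
next
  case (Suc k)
  have op: "open {0::real<..}" by auto
  show ?case
  proof (rule Ck_on_real_SucI[OF op])
    show "(sqrt has_real_derivative inverse (sqrt x) * (1/2)) (at x)" if "x \<in> {0<..}" for x :: real
      using that by (auto intro!: derivative_eq_intros)
    show "Ck_on k {0<..} (\<lambda>x::real. inverse (sqrt x) * (1/2))"
      by (intro Ck_on_bilinear[OF bounded_bilinear_mult op] Ck_on_const
          Ck_on_compose[OF op Suc _ Ck_on_inverse]) auto
  qed
qed

section \<open>Smooth maps on arbitrary subsets of Euclidean spaces\<close>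

lemma smooth_onI:
  assumes "\<And>x. x \<in> A \<Longrightarrow> \<exists>U g. open U \<and> x \<in> U \<and> (\<forall>k. Ck_on k U g) \<and> (\<forall>y\<in>A \<inter> U. g y = f y)"
  shows "smooth_on A f"
  using assms unfolding smooth_on_def by (intro ballI)

lemma smooth_onE:
  assumes "smooth_on A f" "x \<in> A"
  obtains U g where "open U" "x \<in> U" "\<And>k. Ck_on k U g" "\<And>y. y \<in> A \<Longrightarrow> y \<in> U \<Longrightarrow> g y = f y"
proof -
  have "\<exists>U g. open U \<and> x \<in> U \<and> (\<forall>k. Ck_on k U g) \<and> (\<forall>y\<in>A \<inter> U. g y = f y)"
    using assms unfolding smooth_on_def by (rule bspec)
  then obtain U g where "open U \<and> x \<in> U \<and> (\<forall>k. Ck_on k U g) \<and> (\<forall>y\<in>A \<inter> U. g y = f y)"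
    by (elim exE)
  then show ?thesis by (intro that[of U g]) blast+
qed

lemma smooth_on_open_iff:
  assumes "open U"
  shows "smooth_on U f \<longleftrightarrow> (\<forall>k. Ck_on k U f)"
proof
  assume L: "smooth_on U f"
  show "\<forall>k. Ck_on k U f"
  proof (intro allI Ck_on_local)
    fix k x assume "x \<in> U"
    obtain V g where g: "open V" "x \<in> V" "\<And>k. Ck_on k V g" "\<And>y. y \<in> U \<Longrightarrow> y \<in> V \<Longrightarrow> g y = f y"
      by (rule smooth_onE[OF L \<open>x \<in> U\<close>]) (rule that; assumption)
    have "Ck_on k (U \<inter> V) f"
    proof (rule Ck_on_cong[of _ g])
      show "open (U \<inter> V)" using assms g(1) by blast
      show "Ck_on k (U \<inter> V) g" by (rule Ck_on_subset[OF g(3)]) simp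
    qed (simp add: g(4))
    then show "\<exists>W. open W \<and> x \<in> W \<and> Ck_on k W f"
      using \<open>x \<in> U\<close> g(1,2) assms by blast
  qed
next
  assume "\<forall>k. Ck_on k U f"
  then show "smooth_on U f"
    unfolding smooth_on_def by (intro ballI exI[of _ U] exI[of _ f] conjI assms) simp_all
qed

lemma smooth_on_cong_subset:
  assumes "smooth_on A f" "B \<subseteq> A" "\<And>x. x \<in> B \<Longrightarrow> f x = g x"
  shows "smooth_on B g"
proof (rule smooth_onI)
  fix x assume "x \<in> B"
  then have x: "x \<in> A" using assms(2) by auto
  obtain U h where h: "open U" "x \<in> U" "\<And>k. Ck_on k U h" "\<And>y. y \<in> A \<Longrightarrow> y \<in> U \<Longrightarrow> h y = f y"
    by (rule smooth_onE[OF assms(1) x]) (rule that; assumption)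
  then show "\<exists>U h. open U \<and> x \<in> U \<and> (\<forall>k. Ck_on k U h) \<and> (\<forall>y\<in>B \<inter> U. h y = g y)"
    using assms(2,3) by (intro exI[of _ U] exI[of _ h]) auto
qed

lemma smooth_on_subset: "smooth_on A f \<Longrightarrow> B \<subseteq> A \<Longrightarrow> smooth_on B f"
  by (rule smooth_on_cong_subset[OF _ _ refl])

lemma smooth_on_cong: "smooth_on A f \<Longrightarrow> (\<And>x. x \<in> A \<Longrightarrow> f x = g x) \<Longrightarrow> smooth_on A g"
  by (rule smooth_on_cong_subset[OF _ subset_refl])

lemma smooth_on_local:
  assumes "\<And>x. x \<in> A \<Longrightarrow> \<exists>V. open V \<and> x \<in> V \<and> smooth_on (A \<inter> V) f"
  shows "smooth_on A f"
proof (rule smooth_onI)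
  fix x assume x: "x \<in> A"
  then obtain V where V: "open V" "x \<in> V" "smooth_on (A \<inter> V) f" using assms by blast
  have xV: "x \<in> A \<inter> V" using x V(2) by blast
  obtain U g where g: "open U" "x \<in> U" "\<And>k. Ck_on k U g" "\<And>y. y \<in> A \<inter> V \<Longrightarrow> y \<in> U \<Longrightarrow> g y = f y"
    by (rule smooth_onE[OF V(3) xV]) (rule that; assumption)
  then show "\<exists>U g. open U \<and> x \<in> U \<and> (\<forall>k. Ck_on k U g) \<and> (\<forall>y\<in>A \<inter> U. g y = f y)"
    using V by (intro exI[of _ "U \<inter> V"] exI[of _ g]) (auto intro: Ck_on_subset)
qed

lemma smooth_on_imp_continuous_on: "smooth_on A f \<Longrightarrow> continuous_on A f"
  unfolding continuous_on_eq_continuous_within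
proof
  fix x assume A: "smooth_on A f" "x \<in> A"
  obtain U g where g: "open U" "x \<in> U" "\<And>k. Ck_on k U g" "\<And>y. y \<in> A \<Longrightarrow> y \<in> U \<Longrightarrow> g y = f y"
    by (rule smooth_onE[OF A]) (rule that; assumption)
  have "continuous_on U g" using g(3)[of 0] by simp
  then have "continuous (at x within A) g"
    using g(1,2) by (simp add: continuous_on_eq_continuous_at continuous_at_imp_continuous_at_within)
  then show "continuous (at x within A) f"
    by (rule continuous_transform_within_openin[of _ _ _ "A \<inter> U"])
      (use g \<open>x \<in> A\<close> in \<open>auto simp: openin_open_Int\<close>)
qed

lemma smooth_on_compose:
  assumes "smooth_on A f" "smooth_on B g" "f ` A \<subseteq> B"
  shows "smooth_on A (\<lambda>x. g (f x))"
proof (rule smooth_onI)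
  fix x assume x: "x \<in> A"
  obtain U f1 where f1: "open U" "x \<in> U" "\<And>k. Ck_on k U f1" "\<And>y. y \<in> A \<Longrightarrow> y \<in> U \<Longrightarrow> f1 y = f y"
    by (rule smooth_onE[OF assms(1) x]) (rule that; assumption)
  have fx: "f x \<in> B" using x assms(3) by auto
  obtain V g1 where g1: "open V" "f x \<in> V" "\<And>k. Ck_on k V g1" "\<And>y. y \<in> B \<Longrightarrow> y \<in> V \<Longrightarrow> g1 y = g y"
    by (rule smooth_onE[OF assms(2) fx]) (rule that; assumption)
  have "continuous_on U f1" using f1(3)[of 0] by simp
  then have op: "open (f1 -` V \<inter> U)" using f1(1) g1(1) by (simp add: continuous_open_vimage continuous_on_open_vimage)
  show "\<exists>U h. open U \<and> x \<in> U \<and> (\<forall>k. Ck_on k U h) \<and> (\<forall>y\<in>A \<inter> U. h y = g (f y))"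
  proof (intro exI[of _ "f1 -` V \<inter> U"] exI[of _ "\<lambda>x. g1 (f1 x)"] conjI allI ballI op)
    show "x \<in> f1 -` V \<inter> U" using f1 g1 x by auto
    show "Ck_on k (f1 -` V \<inter> U) (\<lambda>x. g1 (f1 x))" for k
      by (rule Ck_on_compose[OF op Ck_on_subset[OF f1(3)] g1(1,3)]) auto
    show "g1 (f1 y) = g (f y)" if "y \<in> A \<inter> (f1 -` V \<inter> U)" for y
    proof -
      have *: "f1 y = f y" using that f1(4) by auto
      then have "f y \<in> B \<inter> V" using that assms(3) by auto
      then show ?thesis using * g1(4) by simp
    qed
  qed
qed

lemma smooth_on_compose':
  assumes "smooth_on B g" "smooth_on A f" "\<And>x. x \<in> A \<Longrightarrow> f x \<in> B"
  shows "smooth_on A (\<lambda>x. g (f x))"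
  by (rule smooth_on_compose[OF assms(2,1)]) (use assms(3) in auto)

lemma smooth_on_const: "smooth_on A (\<lambda>x. c)"
  by (rule smooth_on_subset[of UNIV]) (auto simp: smooth_on_open_iff Ck_on_const)

lemma smooth_on_bounded_linear: "bounded_linear L \<Longrightarrow> smooth_on A L"
  by (rule smooth_on_subset[of UNIV]) (auto simp: smooth_on_open_iff Ck_on_bounded_linear)

lemma smooth_on_linear:
  fixes L :: "'a::euclidean_space \<Rightarrow> 'b::euclidean_space"
  shows "linear L \<Longrightarrow> smooth_on A L"
  by (simp add: smooth_on_bounded_linear linear_linear)

lemma smooth_on_id: "smooth_on A (\<lambda>x. x)"
  by (rule smooth_on_bounded_linear) (rule bounded_linear_ident)

lemma smooth_on_fst: "smooth_on A f \<Longrightarrow> smooth_on A (\<lambda>x. fst (f x))"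
  by (rule smooth_on_compose'[of UNIV fst]) (auto intro: smooth_on_bounded_linear bounded_linear_fst)

lemma smooth_on_snd: "smooth_on A f \<Longrightarrow> smooth_on A (\<lambda>x. snd (f x))"
  by (rule smooth_on_compose'[of UNIV snd]) (auto intro: smooth_on_bounded_linear bounded_linear_snd)

lemma smooth_on_bilinear:
  fixes prod :: "'b::euclidean_space \<Rightarrow> 'c::euclidean_space \<Rightarrow> 'd::euclidean_space"
  assumes "bounded_bilinear prod" "smooth_on A f" "smooth_on A g"
  shows "smooth_on A (\<lambda>x. prod (f x) (g x))"
proof (rule smooth_onI)
  fix x assume x: "x \<in> A"
  obtain U f1 where f1: "open U" "x \<in> U" "\<And>k. Ck_on k U f1" "\<And>y. y \<in> A \<Longrightarrow> y \<in> U \<Longrightarrow> f1 y = f y"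
    by (rule smooth_onE[OF assms(2) x]) (rule that; assumption)
  obtain V g1 where g1: "open V" "x \<in> V" "\<And>k. Ck_on k V g1" "\<And>y. y \<in> A \<Longrightarrow> y \<in> V \<Longrightarrow> g1 y = g y"
    by (rule smooth_onE[OF assms(3) x]) (rule that; assumption)
  show "\<exists>U h. open U \<and> x \<in> U \<and> (\<forall>k. Ck_on k U h) \<and> (\<forall>y\<in>A \<inter> U. h y = prod (f y) (g y))"
    by (intro exI[of _ "U \<inter> V"] exI[of _ "\<lambda>x. prod (f1 x) (g1 x)"] conjI allI ballI
        Ck_on_bilinear[OF assms(1)])
      (use f1 g1 in \<open>auto intro: Ck_on_subset[of _ U] Ck_on_subset[of _ V]\<close>)
qed

lemma smooth_on_inner: "smooth_on A f \<Longrightarrow> smooth_on A g \<Longrightarrow> smooth_on A (\<lambda>x. f x \<bullet> g x)"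
  by (rule smooth_on_bilinear[OF bounded_bilinear_inner])

lemma smooth_on_scaleR: "smooth_on A f \<Longrightarrow> smooth_on A g \<Longrightarrow> smooth_on A (\<lambda>x. f x *\<^sub>R g x)"
  by (rule smooth_on_bilinear[OF bounded_bilinear_scaleR])

lemma smooth_on_mult:
  fixes f g :: "'a::euclidean_space \<Rightarrow> real"
  shows "smooth_on A f \<Longrightarrow> smooth_on A g \<Longrightarrow> smooth_on A (\<lambda>x. f x * g x)"
  by (rule smooth_on_bilinear[OF bounded_bilinear_mult])

lemma smooth_on_add:
  assumes "smooth_on A f" "smooth_on A g"
  shows "smooth_on A (\<lambda>x. f x + g x)"
proof (rule smooth_onI)
  fix x assume x: "x \<in> A"
  obtain U f1 where f1: "open U" "x \<in> U" "\<And>k. Ck_on k U f1" "\<And>y. y \<in> A \<Longrightarrow> y \<in> U \<Longrightarrow> f1 y = f y"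
    by (rule smooth_onE[OF assms(1) x]) (rule that; assumption)
  obtain V g1 where g1: "open V" "x \<in> V" "\<And>k. Ck_on k V g1" "\<And>y. y \<in> A \<Longrightarrow> y \<in> V \<Longrightarrow> g1 y = g y"
    by (rule smooth_onE[OF assms(2) x]) (rule that; assumption)
  show "\<exists>U h. open U \<and> x \<in> U \<and> (\<forall>k. Ck_on k U h) \<and> (\<forall>y\<in>A \<inter> U. h y = f y + g y)"
    by (intro exI[of _ "U \<inter> V"] exI[of _ "\<lambda>x. f1 x + g1 x"] conjI allI ballI Ck_on_add)
      (use f1 g1 in \<open>auto intro: Ck_on_subset[of _ U] Ck_on_subset[of _ V]\<close>)
qed

lemma smooth_on_sum:
  assumes "\<And>i. i \<in> I \<Longrightarrow> smooth_on A (f i)"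
  shows "smooth_on A (\<lambda>x. \<Sum>i\<in>I. f i x)"
proof (cases "finite I")
  case True
  then show ?thesis using assms
    by (induction I rule: finite_induct) (auto intro: smooth_on_const smooth_on_add)
qed (simp add: smooth_on_const)

lemma smooth_on_uminus: "smooth_on A f \<Longrightarrow> smooth_on A (\<lambda>x. - f x)"
  by (rule smooth_on_compose'[of UNIV uminus])
    (auto intro!: smooth_on_bounded_linear bounded_linear_minus[OF bounded_linear_ident])

lemma smooth_on_diff: "smooth_on A f \<Longrightarrow> smooth_on A g \<Longrightarrow> smooth_on A (\<lambda>x. f x - g x)"
  using smooth_on_add[OF _ smooth_on_uminus, of A f g] by simp

lemma smooth_on_Pair:
  assumes "smooth_on A f" "smooth_on A g"
  shows "smooth_on A (\<lambda>x. (f x, g x))"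
proof -
  have 1: "bounded_linear (\<lambda>y::'b. (y, 0::'c))" by (intro bounded_linear_Pair bounded_linear_ident bounded_linear_zero)
  have 2: "bounded_linear (\<lambda>y::'c. (0::'b, y))" by (intro bounded_linear_Pair bounded_linear_ident bounded_linear_zero)
  have "smooth_on A (\<lambda>x. (f x, 0) + (0, g x))"
    by (rule smooth_on_add; rule smooth_on_compose'[OF smooth_on_bounded_linear[of _ UNIV]])
      (use assms 1 2 in auto)
  then show ?thesis by simp
qed

lemma smooth_on_inverse:
  fixes f :: "'a::euclidean_space \<Rightarrow> real"
  assumes "smooth_on A f" "\<And>x. x \<in> A \<Longrightarrow> f x \<noteq> 0"
  shows "smooth_on A (\<lambda>x. inverse (f x))"
  by (rule smooth_on_compose'[of "- {0}" inverse]) (use assms in \<open>auto simp: smooth_on_open_iff open_delete open_Compl Ck_on_inverse\<close>)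

lemma smooth_on_divide:
  fixes f g :: "'a::euclidean_space \<Rightarrow> real"
  assumes "smooth_on A f" "smooth_on A g" "\<And>x. x \<in> A \<Longrightarrow> g x \<noteq> 0"
  shows "smooth_on A (\<lambda>x. f x / g x)"
  unfolding divide_inverse by (intro smooth_on_mult smooth_on_inverse assms)

lemma smooth_on_sqrt:
  assumes "smooth_on A f" "\<And>x. x \<in> A \<Longrightarrow> 0 < f x"
  shows "smooth_on A (\<lambda>x. sqrt (f x))"
  by (rule smooth_on_compose'[of "{0<..}" sqrt]) (use assms in \<open>auto simp: smooth_on_open_iff Ck_on_sqrt\<close>)

lemma smooth_on_power:
  fixes f :: "'a::euclidean_space \<Rightarrow> real"
  shows "smooth_on A f \<Longrightarrow> smooth_on A (\<lambda>x. f x ^ n)"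
  by (induction n) (auto intro: smooth_on_const smooth_on_mult)

lemmas smooth_on_intros = smooth_on_const smooth_on_id smooth_on_fst smooth_on_snd smooth_on_inner
  smooth_on_scaleR smooth_on_mult smooth_on_add smooth_on_sum smooth_on_uminus smooth_on_diff
  smooth_on_Pair smooth_on_power

lemma smooth_on_has_derivative:
  assumes "open U" "smooth_on U f" "x \<in> U"
  shows "(f has_derivative frechet_derivative f (at x)) (at x)"
proof -
  have "Ck_on (Suc 0) U f" using assms(1,2) smooth_on_open_iff by blast
  then show ?thesis using Ck_on_has_derivative assms(3) by blast
qed

lemma smooth_on_frechet_derivative:
  assumes "open U" "smooth_on U f"
  shows "smooth_on U (\<lambda>x. frechet_derivative f (at x) v)"
  unfolding smooth_on_open_iff[OF assms(1)]
proof
  fix k have "Ck_on (Suc k) U f" using assms by (simp add: smooth_on_open_iff)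
  then show "Ck_on k U (\<lambda>x. frechet_derivative f (at x) v)" by simp
qed

lemma smooth_on_extension_has_derivative:
  assumes "smooth_on A f" "x \<in> A"
  obtains U g where "open U" "x \<in> U" "smooth_on U g" "\<And>y. y \<in> A \<inter> U \<Longrightarrow> g y = f y"
    "(g has_derivative frechet_derivative g (at x)) (at x)"
proof -
  obtain U g where g: "open U" "x \<in> U" "\<And>k. Ck_on k U g" "\<And>y. y \<in> A \<Longrightarrow> y \<in> U \<Longrightarrow> g y = f y"
    by (rule smooth_onE[OF assms]) (rule that; assumption)
  then have "smooth_on U g" by (simp add: smooth_on_open_iff)
  with g show ?thesis using smooth_on_has_derivative that by blast
qed

text \<open>Orthogonal projection, by expansion in an orthonormal basis. Composing with it turns a
  map on a relatively open subset of a subspace into a map on an open set, where derivatives are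
  available.\<close>

lemma linear_closest_point_subspace:
  fixes V :: "'a::euclidean_space set"
  assumes "subspace V"
  obtains P where "linear P" "range P \<subseteq> V" "\<And>v. v \<in> V \<Longrightarrow> P v = v"
proof -
  obtain B where B: "B \<subseteq> V" "pairwise orthogonal B" "\<And>x. x \<in> B \<Longrightarrow> norm x = 1" "independent B" "span B = V"
    using orthonormal_basis_subspace[OF assms] by metis
  define P where "P x = (\<Sum>b\<in>B. (x \<bullet> b) *\<^sub>R b)" for x
  have fB: "finite B" using B(4) independent_imp_finite by blast
  have lin: "linear P" unfolding P_def
    by (rule linearI) (simp_all add: inner_left_distrib scaleR_left_distrib sum.distrib scaleR_sum_right)
  show ?thesis
  proof (rule that[OF lin])
    show "range P \<subseteq> V" unfolding P_def using B(1) assms by (auto intro!: subspace_sum subspace_scale)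
    fix v assume "v \<in> V"
    have "P b = b" if "b \<in> B" for b
    proof -
      have "b \<bullet> c = (if c = b then 1 else 0)" if "c \<in> B" for c
        using B(2,3) \<open>b \<in> B\<close> that by (auto simp: pairwise_def orthogonal_def norm_eq_1)
      then have "P b = (\<Sum>c\<in>B. (if c = b then 1 else 0) *\<^sub>R c)" unfolding P_def by (intro sum.cong) auto
      also have "\<dots> = (\<Sum>c\<in>B. if c = b then c else 0)" by (intro sum.cong) auto
      also have "\<dots> = b" using fB that by simp
      finally show ?thesis .
    qed
    then show "P v = v" using linear_eq_on_span[OF lin linear_id, of B v] \<open>v \<in> V\<close> B(5) by auto
  qed
qed

lemma smooth_on_subspace_projection:
  assumes "linear P" "\<And>v. v \<in> A \<Longrightarrow> P v = v" "range P \<subseteq> V" "openin (top_of_set V) A" "smooth_on A f"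
  shows "open (P -` A)" "smooth_on (P -` A) (\<lambda>x. f (P x))"
proof -
  have "continuous_on UNIV P" using assms(1) linear_continuous_on linear_linear by blast
  moreover obtain T where "open T" "A = V \<inter> T" using assms(4) by (auto simp: openin_open)
  ultimately have "open (P -` T)" by (simp add: open_vimage)
  moreover have "P -` A = P -` T" using \<open>A = V \<inter> T\<close> assms(3) by auto
  ultimately show "open (P -` A)" by simp
  show "smooth_on (P -` A) (\<lambda>x. f (P x))"
    by (rule smooth_on_compose'[OF assms(5)]) (auto intro: smooth_on_linear assms(1))
qed

section \<open>Division of functions by a coordinate\<close>

lemma linear_norm_le_sum_Basis:
  fixes L :: "'a::euclidean_space \<Rightarrow> 'b::real_normed_vector" and c :: real
  assumes "linear L" "\<And>b. b \<in> Basis \<Longrightarrow> norm (L b) \<le> c"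
  shows "norm (L v) \<le> real DIM('a) * c * norm v"
proof -
  have "norm (L v) \<le> (\<Sum>b\<in>Basis. norm ((v \<bullet> b) *\<^sub>R L b))"
    by (subst linear_eq_sum_Basis[OF assms(1)]) (rule norm_sum)
  also have "\<dots> \<le> (\<Sum>b\<in>(Basis::'a set). norm v * c)"
    by (intro sum_mono) (auto intro!: mult_mono assms Basis_le_norm)
  also have "\<dots> = real DIM('a) * c * norm v" by simp
  finally show ?thesis .
qed

text \<open>Pointwise continuity of a family of linear maps is automatically uniform on the unit
  ball, since only the finitely many basis directions have to be controlled.\<close>

lemma continuous_linear_family:
  fixes D :: "'x::euclidean_space \<Rightarrow> 'a::euclidean_space \<Rightarrow> 'b::real_normed_vector"
  assumes "open S" "x0 \<in> S" "\<And>v. continuous_on S (\<lambda>x. D x v)" "\<And>x. x \<in> S \<Longrightarrow> linear (D x)" "e > 0"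
  obtains r where "r > 0" "ball x0 r \<subseteq> S"
    "\<And>x v. x \<in> ball x0 r \<Longrightarrow> norm (D x v - D x0 v) \<le> e * norm v"
proof -
  define c where "c = e / DIM('a)"
  have c: "c > 0" using assms(5) by (simp add: c_def)
  have "\<forall>\<^sub>F x in at x0. norm (D x b - D x0 b) < c" for b
  proof -
    have "isCont (\<lambda>x. D x b) x0" using assms(1-3) by (simp add: continuous_on_eq_continuous_at)
    then show ?thesis using c unfolding isCont_def tendsto_iff dist_norm by blast
  qed
  then have "\<forall>\<^sub>F x in at x0. \<forall>b\<in>(Basis::'a set). norm (D x b - D x0 b) < c"
    by (intro eventually_ball_finite) auto
  then obtain d where d: "d > 0" "\<And>x. x \<noteq> x0 \<Longrightarrow> dist x x0 < d \<Longrightarrow> \<forall>b\<in>(Basis::'a set). norm (D x b - D x0 b) < c"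
    unfolding eventually_at by blast
  obtain d' where d': "d' > 0" "ball x0 d' \<subseteq> S" using assms(1,2) open_contains_ball by blast
  show ?thesis
  proof (rule that[of "min d d'"])
    fix x v assume x: "x \<in> ball x0 (min d d')"
    have lin: "linear (\<lambda>v. D x v - D x0 v)"
      using x d' by (intro linear_compose_sub assms(4,2)) auto
    have "norm (D x b - D x0 b) \<le> c" if "b \<in> Basis" for b
    proof (cases "x = x0")
      case False
      then show ?thesis using d(2)[of x] x that by (force simp: dist_commute)
    qed (use c in simp)
    from linear_norm_le_sum_Basis[OF lin this]
    have "norm (D x v - D x0 v) \<le> real DIM('a) * c * norm v" by simp
    then show "norm (D x v - D x0 v) \<le> e * norm v" by (simp add: c_def)
  qed (use d d' in auto)
qed

text \<open>The mean value inequality for \<open>F - L\<close>, whose derivative is bounded by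
  \<open>e\<close> on the convex set.\<close>

lemma norm_diff_le_of_derivative_close:
  fixes F :: "'a::euclidean_space \<Rightarrow> 'b::euclidean_space"
  assumes "convex S" "\<And>x. x \<in> S \<Longrightarrow> (F has_derivative D x) (at x)" "linear L"
    and "\<And>x v. x \<in> S \<Longrightarrow> norm (D x v - L v) \<le> e * norm v" "x \<in> S" "y \<in> S"
  shows "norm (F x - F y - L (x - y)) \<le> e * norm (x - y)"
proof -
  have "norm ((F x - L x) - (F y - L y)) \<le> e * norm (x - y)"
  proof (rule differentiable_bound[OF assms(1) _ _ assms(5,6)])
    show "((\<lambda>x. F x - L x) has_derivative (\<lambda>v. D x v - L v)) (at x within S)" if "x \<in> S" for x
      using assms(2)[OF that] assms(3)
      by (intro has_derivative_diff bounded_linear_imp_has_derivative)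
        (auto intro: has_derivative_at_withinI simp: linear_linear)
    show "onorm (\<lambda>v. D x v - L v) \<le> e" if "x \<in> S" for x
      by (rule onorm_bound) (use assms(4)[OF that] norm_ge_zero in \<open>auto intro: order_trans\<close>,
        metis assms(4)[OF that] SOME_Basis norm_Basis norm_ge_zero order_trans mult.right_neutral)
  qed
  then show ?thesis by (simp add: linear_diff[OF assms(3)] algebra_simps)
qed

text \<open>The mean value inequality holds on each open half of a ball, which is convex. Continuity
  of \<open>F\<close> carries it to the closed halves, and every point of the ball shares one of
  these with \<open>x0\<close>. This is how a function is glued from its two sides.\<close>

lemma has_derivative_across_hyperplane:
  fixes F :: "'z::euclidean_space \<times> real \<Rightarrow> 'b::euclidean_space"
  assumes "open S" "continuous_on S F"
    and "\<And>x. x \<in> S \<Longrightarrow> snd x \<noteq> 0 \<Longrightarrow> (F has_derivative D x) (at x)"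
    and "\<And>v. continuous_on S (\<lambda>x. D x v)" "\<And>x. x \<in> S \<Longrightarrow> linear (D x)" "x0 \<in> S"
  shows "(F has_derivative D x0) (at x0)"
proof (cases "snd x0 = 0")
  case False
  then show ?thesis using assms by blast
next
  case sx0: True
  have L: "linear (D x0)" using assms by blast
  show ?thesis
    unfolding has_derivative_at_alt
  proof (intro conjI allI impI)
    show "bounded_linear (D x0)" using L linear_linear by blast
    fix e :: real assume "e > 0"
    obtain r where r: "r > 0" "ball x0 r \<subseteq> S"
      "\<And>x v. x \<in> ball x0 r \<Longrightarrow> norm (D x v - D x0 v) \<le> e * norm v"
      by (rule continuous_linear_family[OF assms(1,6,4,5) \<open>e > 0\<close>]) auto
    have half: "norm (F x - F y - D x0 (x - y)) \<le> e * norm (x - y)"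
      if "x \<in> ball x0 r" "y \<in> ball x0 r" "c * snd x > 0" "c * snd y > 0" for x y and c :: real
    proof (rule norm_diff_le_of_derivative_close[where S = "ball x0 r \<inter> {x. c * snd x > 0}" and D = D])
      have "linear (\<lambda>x :: 'z \<times> real. c * snd x)" by (rule linearI) (auto simp: algebra_simps)
      then show "convex (ball x0 r \<inter> {x. c * snd x > 0})"
        using convex_linear_vimage[of "\<lambda>x :: 'z \<times> real. c * snd x" "{0<..}"]
        by (intro convex_Int convex_ball) (simp_all add: vimage_def convex_real_interval)
      show "(F has_derivative D x) (at x)" if "x \<in> ball x0 r \<inter> {x. c * snd x > 0}" for x
        using that r(2) by (intro assms(3)) auto
    qed (use that r(3) L in auto)
    have "norm (F y - F x0 - D x0 (y - x0)) \<le> e * norm (y - x0)" if y: "norm (y - x0) < r" for y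
    proof -
      \<comment> \<open>\<open>c\<close> selects the side of the hyperplane on which
        \<open>y\<close> lies; shifting \<open>y\<close> and \<open>x0\<close> by
        \<open>c * t\<close> in the last coordinate moves both into that open side.\<close>
      define c where "c = (if snd y < 0 then - 1 else 1 :: real)"
      have "y \<in> S" using y r(2) by (auto simp: dist_norm norm_minus_commute)
      then have cont: "isCont F y" "isCont F x0"
        using assms(1,2,6) by (auto simp: continuous_on_eq_continuous_at)
      have lim: "((\<lambda>t. w + (0, t)) \<longlongrightarrow> w) (at 0)" for w :: "'z \<times> real"
      proof -
        have "((\<lambda>t. w + (0, t)) \<longlongrightarrow> w + (0, 0)) (at (0::real))" by (intro tendsto_intros)
        then show ?thesis by (simp add: zero_prod_def[symmetric])
      qed
      have nb: "\<forall>\<^sub>F t in at (0::real). w + (0, t) \<in> ball x0 r" if "w \<in> ball x0 r" for w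
        by (rule topological_tendstoD[OF lim open_ball that])
      have fw: "filterlim (\<lambda>t. c * t) (at 0) (at_right 0)"
        unfolding filterlim_at c_def
        by (auto intro!: tendsto_eq_intros simp: eventually_at_filter)
      have lim': "((\<lambda>t. F (w + (0, c * t))) \<longlongrightarrow> F w) (at_right 0)" if "isCont F w" for w
        by (rule isCont_tendsto_compose[OF that filterlim_compose[OF lim fw]])
      have "norm (F y - F x0 - D x0 (y - x0)) \<le> e * norm (y - x0)"
      proof (rule tendsto_le[of "at_right (0::real)" "\<lambda>_. e * norm (y - x0)" _
              "\<lambda>t. norm (F (y + (0, c * t)) - F (x0 + (0, c * t)) - D x0 (y - x0))"])
        show "((\<lambda>t. norm (F (y + (0, c * t)) - F (x0 + (0, c * t)) - D x0 (y - x0))) \<longlongrightarrow>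
            norm (F y - F x0 - D x0 (y - x0))) (at_right 0)"
          by (intro tendsto_intros lim' cont)
        have 1: "\<forall>\<^sub>F t in at_right (0::real). y + (0, c * t) \<in> ball x0 r"
          using eventually_compose_filterlim[OF nb fw] y by (simp add: dist_norm norm_minus_commute)
        have 2: "\<forall>\<^sub>F t in at_right (0::real). x0 + (0, c * t) \<in> ball x0 r"
          using eventually_compose_filterlim[OF nb fw] r by simp
        have 3: "\<forall>\<^sub>F t in at_right (0::real). t > 0" by (simp add: eventually_at_right_less)
        show "\<forall>\<^sub>F t in at_right 0. norm (F (y + (0, c * t)) - F (x0 + (0, c * t)) - D x0 (y - x0)) \<le> e * norm (y - x0)"
          using 1 2 3
        proof eventually_elim
          case (elim t)
          have "c * snd (y + (0, c * t)) > 0" "c * snd (x0 + (0, c * t)) > 0"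
            using elim(3) sx0 by (auto simp: c_def)
          from half[OF elim(1,2) this] show ?case by simp
        qed
      qed auto
      then show ?thesis .
    qed
    then show "\<exists>d>0. \<forall>y. norm (y - x0) < d \<longrightarrow> norm (F y - F x0 - D x0 (y - x0)) \<le> e * norm (y - x0)"
      using r(1) by blast
  qed
qed

text \<open>Differentiation under the integral sign, iterated: each directional derivative is again
  the integral of a smooth integrand.\<close>

lemma Ck_on_integral_parameter:
  fixes F :: "'x::euclidean_space \<times> real \<Rightarrow> 'c::euclidean_space"
  assumes "open S" "smooth_on S F" "open U" "U \<times> {0..1} \<subseteq> S"
  shows "Ck_on k U (\<lambda>x. integral {0..1} (\<lambda>t. F (x, t)))"
  using assms(2)
proof (induction k arbitrary: F)
  case 0
  have "continuous_on (U \<times> cbox 0 1) (\<lambda>(x, t). F (x, t))"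
    using continuous_on_subset[OF smooth_on_imp_continuous_on[OF 0] assms(4)] by simp
  from integral_continuous_on_param[OF this] show ?case by simp
next
  case (Suc k)
  define D where "D x v = frechet_derivative F (at x) v" for x v
  have der: "(F has_derivative D x) (at x)" if "x \<in> S" for x
    using smooth_on_has_derivative[OF assms(1) Suc.prems that] unfolding D_def by (simp add: eta_contract_eq)
  have smD: "smooth_on S (\<lambda>x. D x v)" for v
    unfolding D_def by (rule smooth_on_frechet_derivative[OF assms(1) Suc.prems])
  show ?case
  proof (rule Ck_on_SucI[OF assms(3)])
    show "Ck_on k U (\<lambda>x. integral {0..1} (\<lambda>t. D (x, t) (v, 0)))" for v
      using Suc.IH[OF smD] .
  next
    fix x0 assume "x0 \<in> U"
    then obtain r where r: "r > 0" "ball x0 r \<subseteq> U" using assms(3) open_contains_ball by blast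
    have inS: "(x, t) \<in> S" if "x \<in> ball x0 r" "t \<in> {0..1}" for x t
      using that r(2) assms(4) by (meson SigmaI subsetD)
    \<comment> \<open>The Leibniz rule asks for the derivative as a continuous family of bounded
      linear functions.\<close>
    define fx where "fx x t = Blinfun (\<lambda>v. D (x, t) (v, 0))" for x t
    have bl: "bounded_linear (\<lambda>v. D (x, t) (v, 0))" if "(x, t) \<in> S" for x t
      by (rule bounded_linear_compose[OF has_derivative_bounded_linear[OF der[OF that]]])
        (intro bounded_linear_Pair bounded_linear_ident bounded_linear_zero)
    have fx: "blinfun_apply (fx x t) = (\<lambda>v. D (x, t) (v, 0))" if "(x, t) \<in> S" for x t
      unfolding fx_def by (rule bounded_linear_Blinfun_apply[OF bl[OF that]])
    have contD: "continuous_on (ball x0 r \<times> {0..1}) (\<lambda>y. D y v)" for v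
      using smooth_on_imp_continuous_on[OF smD] by (rule continuous_on_subset) (use inS in auto)
    have cfx: "continuous_on (ball x0 r \<times> cbox 0 1) (\<lambda>(x, t). fx x t)"
    proof (rule continuous_on_blinfun_componentwise)
      show "continuous_on (ball x0 r \<times> cbox 0 1) (\<lambda>y. blinfun_apply (case y of (x, t) \<Rightarrow> fx x t) i)" for i
        by (rule continuous_on_eq[OF contD[of "(i, 0)", folded cbox_interval]])
          (use inS fx in auto)
    qed
    have "((\<lambda>x. integral (cbox 0 1) (\<lambda>t. F (x, t))) has_derivative integral (cbox 0 1) (fx x0)) (at x0 within ball x0 r)"
    proof (rule leibniz_rule[where f = "\<lambda>x t. F (x, t)" and fx = fx and U = "ball x0 r" and a = 0 and b = 1, OF _ _ cfx])
      show "((\<lambda>x. F (x, t)) has_derivative blinfun_apply (fx x t)) (at x within ball x0 r)"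
        if "x \<in> ball x0 r" "t \<in> cbox 0 1" for x t
      proof -
        have *: "(x, t) \<in> S" using inS that by auto
        have "((\<lambda>x. (x, t)) has_derivative (\<lambda>v. (v, 0))) (at x)"
          by (auto intro!: derivative_eq_intros)
        from has_derivative_compose[OF this der[OF *]] show ?thesis
          by (simp add: fx[OF *] has_derivative_at_withinI)
      qed
      show "(\<lambda>t. F (x, t)) integrable_on cbox 0 1" if "x \<in> ball x0 r" for x
        by (intro integrable_continuous continuous_on_compose2[OF smooth_on_imp_continuous_on[OF Suc.prems], of _ "Pair x"] continuous_intros)
          (use inS that in auto)
    qed (use r in auto)
    moreover have "blinfun_apply (integral (cbox 0 1) (fx x0)) v = integral {0..1} (\<lambda>t. D (x0, t) (v, 0))" for v
    proof -
      have c1: "continuous_on (cbox 0 1) (fx x0)"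
      proof -
        have "continuous_on (cbox 0 1) (\<lambda>t::real. (x0, t))" by (intro continuous_intros)
        moreover have "(\<lambda>t. (x0, t)) ` cbox 0 1 \<subseteq> ball x0 r \<times> cbox 0 1" using r(1) by auto
        ultimately have "continuous_on (cbox 0 1) (\<lambda>t. case (x0, t) of (x, t) \<Rightarrow> fx x t)"
          by (rule continuous_on_compose2[OF cfx])
        then show ?thesis by (simp add: eta_contract_eq)
      qed
      have "((\<lambda>b. blinfun_apply b v) \<circ> fx x0 has_integral blinfun_apply (integral (cbox 0 1) (fx x0)) v) (cbox 0 1)"
        by (rule has_integral_linear[OF integrable_integral[OF integrable_continuous[OF c1]] blinfun.bounded_linear_left])
      then have "integral (cbox 0 1) (\<lambda>t. blinfun_apply (fx x0 t) v) = blinfun_apply (integral (cbox 0 1) (fx x0)) v"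
        by (simp add: integral_unique o_def)
      moreover have "integral (cbox 0 1) (\<lambda>t. blinfun_apply (fx x0 t) v) = integral {0..1} (\<lambda>t. D (x0, t) (v, 0))"
        unfolding cbox_interval by (rule Henstock_Kurzweil_Integration.integral_cong) (use fx inS r in auto)
      ultimately show ?thesis by simp
    qed
    then have "blinfun_apply (integral (cbox 0 1) (fx x0)) = (\<lambda>v. integral {0..1} (\<lambda>t. D (x0, t) (v, 0)))"
      by (rule ext)
    ultimately show "((\<lambda>x. integral {0..1} (\<lambda>t. F (x, t))) has_derivative
        (\<lambda>v. integral {0..1} (\<lambda>t. D (x0, t) (v, 0)))) (at x0)"
      using r(1) by (simp only: at_within_open[OF _ open_ball] centre_in_ball cbox_interval)
  qed
qed

text \<open>Hadamard's lemma: \<open>h (z, t)\<close> is the integral over \<open>u\<close> in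
  \<open>[0, 1]\<close> of the \<open>t\<close>-derivative of \<open>f\<close> at
  \<open>(z, u * t)\<close>.\<close>

lemma smooth_on_divide_coordinate:
  fixes f :: "'z::euclidean_space \<times> real \<Rightarrow> 'c::euclidean_space"
  assumes "open Z" "smooth_on (Z \<times> {-d<..<d}) f" "\<And>z. z \<in> Z \<Longrightarrow> f (z, 0) = 0"
  obtains h where "smooth_on (Z \<times> {-d<..<d}) h"
    "\<And>z t. z \<in> Z \<Longrightarrow> t \<in> {-d<..<d} \<Longrightarrow> f (z, t) = t *\<^sub>R h (z, t)"
proof -
  define U where "U = Z \<times> {-d<..<d}"
  have opU: "open U" unfolding U_def by (intro open_Times assms(1)) auto
  have smU: "smooth_on U f" using assms(2) by (simp add: U_def)
  define ft where "ft x = frechet_derivative f (at x) (0, 1)" for x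
  define m where "m y = (fst (fst y), snd y * snd (fst y))" for y :: "('z \<times> real) \<times> real"
  have smm: "smooth_on A m" for A unfolding m_def by (intro smooth_on_intros)
  have opS: "open (m -` U)"
    by (rule open_vimage[OF opU]) (rule smooth_on_imp_continuous_on[OF smm])
  have smS: "smooth_on (m -` U) (\<lambda>y. ft (m y))"
    by (rule smooth_on_compose'[OF _ smm])
      (use smooth_on_frechet_derivative[OF opU smU] in \<open>auto simp: ft_def\<close>)
  have sub: "U \<times> {0..1} \<subseteq> m -` U"
  proof -
    have "u * t \<in> {-d<..<d}" if "t \<in> {-d<..<d}" "u \<in> {0..1}" for u t :: real
    proof -
      have "\<bar>u * t\<bar> \<le> 1 * \<bar>t\<bar>" unfolding abs_mult using that by (intro mult_right_mono) auto
      then show ?thesis using that by auto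
    qed
    then show ?thesis by (auto simp: U_def m_def)
  qed
  define h where "h x = integral {0..1} (\<lambda>u. ft (m (x, u)))" for x
  have "smooth_on U h"
    unfolding smooth_on_open_iff[OF opU] h_def
    using Ck_on_integral_parameter[OF opS smS opU sub] by blast
  moreover have "f (z, t) = t *\<^sub>R h (z, t)" if z: "z \<in> Z" "t \<in> {-d<..<d}" for z t
  proof -
    have "((\<lambda>u. t *\<^sub>R ft (m ((z, t), u))) has_integral f (z, 1 * t) - f (z, 0 * t)) {0..1}"
    proof (rule fundamental_theorem_of_calculus)
      fix u :: real assume u: "u \<in> {0..1}"
      then have in_U: "(z, u * t) \<in> U" using sub z by (force simp: U_def m_def)
      have 1: "((\<lambda>u. (z, u * t)) has_derivative (\<lambda>v. (0, v * t))) (at u)"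
        by (auto intro!: derivative_eq_intros)
      have 2: "(f has_derivative frechet_derivative f (at (z, u * t))) (at (z, u * t))"
        by (rule smooth_on_has_derivative[OF opU smU in_U])
      have "((\<lambda>u. f (z, u * t)) has_derivative (\<lambda>v. frechet_derivative f (at (z, u * t)) (0, v * t))) (at u)"
        by (rule has_derivative_compose[OF 1 2])
      moreover have "frechet_derivative f (at (z, u * t)) (0, v * t) = v *\<^sub>R t *\<^sub>R ft (m ((z, t), u))" for v
        using linear_scale[OF has_derivative_linear[OF 2], of "v * t" "(0, 1)"] by (simp add: ft_def m_def)
      ultimately show "((\<lambda>u. f (z, u * t)) has_vector_derivative t *\<^sub>R ft (m ((z, t), u))) (at u within {0..1})"
        unfolding has_vector_derivative_def by (simp add: has_derivative_at_withinI)
    qed simp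
    from integral_unique[OF this] have "integral {0..1} (\<lambda>u. t *\<^sub>R ft (m ((z, t), u))) = f (z, t)"
      unfolding mult_1 mult_zero_left assms(3)[OF z(1)] diff_0_right .
    then show ?thesis unfolding h_def by (simp only: integral_cmul)
  qed
  ultimately show ?thesis using that unfolding U_def by blast
qed

section \<open>Smooth extension across a hyperplane by weighted reflections\<close>

text \<open>Seeley's coefficients. If \<open>g s\<close> is the sum of all
  \<open>a j * f (- l j * s)\<close> for \<open>s < 0\<close>, its \<open>n\<close>-th derivative at
  \<open>0\<close> is that of \<open>f\<close> times the sum of all
  \<open>a j * (- l j) ^ n\<close>. The moment conditions make this factor \<open>1\<close> for
  every \<open>n\<close>, and absolute summability permits termwise differentiation.\<close>

definition reflection_weights :: "(nat \<Rightarrow> real) \<Rightarrow> (nat \<Rightarrow> real) \<Rightarrow> bool" where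
  "reflection_weights a l \<longleftrightarrow> (\<forall>j. 0 < l j) \<and>
     (\<forall>n. summable (\<lambda>j. \<bar>a j\<bar> * l j ^ n) \<and> (\<lambda>j. a j * l j ^ n) sums (-1) ^ n)"

text \<open>Differentiating the reflected sum brings down \<open>- l j\<close>; up to sign, the
  moments of the new weights are the old ones shifted by one index.\<close>

lemma reflection_weights_shift:
  assumes "reflection_weights a l"
  shows "reflection_weights (\<lambda>j. - l j * a j) l"
  unfolding reflection_weights_def
proof (intro conjI allI)
  have pos: "0 < l j" for j using assms by (simp add: reflection_weights_def)
  then show "0 < l j" for j .
  fix n
  have "summable (\<lambda>j. \<bar>a j\<bar> * l j ^ Suc n)" "(\<lambda>j. a j * l j ^ Suc n) sums (-1) ^ Suc n"
    using assms unfolding reflection_weights_def by blast+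
  moreover have "(\<lambda>j. \<bar>- l j * a j\<bar> * l j ^ n) = (\<lambda>j. \<bar>a j\<bar> * l j ^ Suc n)"
  proof
    show "\<bar>- l j * a j\<bar> * l j ^ n = \<bar>a j\<bar> * l j ^ Suc n" for j
      using pos[of j] by (simp add: abs_mult)
  qed
  moreover have "(\<lambda>j. - l j * a j * l j ^ n) = (\<lambda>j. - (a j * l j ^ Suc n))" by (simp add: ac_simps)
  moreover have "- ((-1) ^ Suc n) = (-1 :: real) ^ n" by simp
  ultimately show "summable (\<lambda>j. \<bar>- l j * a j\<bar> * l j ^ n)" "(\<lambda>j. - l j * a j * l j ^ n) sums (-1) ^ n"
    by (metis, metis sums_minus)
qed

text \<open>The numbers \<open>b k = (-1)^k q^(-k (k - 1) / 2)\<close>, for integers \<open>k\<close>, satisfy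
  \<open>b k * q^k = - q * b (k - 1)\<close> and \<open>b (1 - k) = - b k\<close>, so all the moments \<open>\<Sum>k. b k * q^(k n)\<close> vanish.
  Hence the moments of \<open>b k / (1 + q^k)\<close> at the points \<open>q^k\<close> alternate in sign. Below, \<open>d m\<close> is
  \<open>b (-m) = - b (m + 1)\<close>.\<close>

lemma exists_reflection_weights: "\<exists>a l. reflection_weights a l"
proof -
  \<comment> \<open>Any \<open>q\<close> for which the leading term of \<open>M 0\<close> dominates
    the tail would do; for \<open>16\<close> the former is \<open>1/2 - 1/17\<close> and the latter
    at most \<open>1/15\<close>.\<close>
  define q :: real where "q = 16"
  define c where "c m = (\<Prod>i<m. q ^ i)" for m
  define d where "d m = (-1) ^ m / c (Suc m)" for m
  have q: "q > 1" "q > 0" "q \<noteq> 0" by (simp_all add: q_def)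
  have cpos: "c m > 0" for m unfolding c_def using q by (simp add: prod_pos)
  have cS: "c (Suc m) = c m * q ^ m" for m by (simp add: c_def)
  \<comment> \<open>The relation \<open>b k * q^k = - q * b (k - 1)\<close> at
    \<open>k = - m\<close>. It also makes \<open>d\<close> decay faster than any geometric sequence,
    so that all moments converge.\<close>
  have dS: "d (Suc m) * q ^ Suc m = - d m" for m
    using cpos[of "Suc m"] cS[of "Suc m"] q by (simp add: d_def divide_simps)
  have d0: "d 0 = 1" by (simp add: d_def c_def)
  have absd: "\<bar>d m\<bar> = 1 / c (Suc m)" for m using cpos[of "Suc m"] by (simp add: d_def abs_mult power_abs)
  have dS': "\<bar>d (Suc m)\<bar> = \<bar>d m\<bar> / q ^ Suc m" for m
    using cS[of "Suc m"] by (simp add: absd)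
  have sumP: "summable (\<lambda>m. \<bar>d m\<bar> * (q ^ Suc m) ^ n)" for n
  proof (rule summable_ratio_test[of "1/q" n])
    fix m assume m: "m \<ge> n"
    have "\<bar>d (Suc m)\<bar> * (q ^ Suc (Suc m)) ^ n = \<bar>d m\<bar> * (q ^ Suc m) ^ n * (q ^ n / q ^ Suc m)"
      using dS'[of m] by (simp add: power_mult_distrib)
    also have "\<dots> \<le> \<bar>d m\<bar> * (q ^ Suc m) ^ n * (1 / q)"
    proof (rule mult_left_mono)
      have "q ^ n \<le> q ^ m" using m q by (simp add: power_increasing)
      then show "q ^ n / q ^ Suc m \<le> 1 / q" using q by (simp add: field_simps)
    qed (use q in auto)
    finally show "norm (\<bar>d (Suc m)\<bar> * (q ^ Suc (Suc m)) ^ n) \<le> 1 / q * norm (\<bar>d m\<bar> * (q ^ Suc m) ^ n)"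
      using q by (simp add: abs_mult power_abs)
  qed (use q in auto)
  have sumd: "summable (\<lambda>m. \<bar>d m\<bar>)" using sumP[of 0] by simp
  have sumN: "summable (\<lambda>m. \<bar>d m\<bar> * (1 / q ^ m) ^ n)" for n
  proof (rule summable_comparison_test'[OF sumd, of 0])
    show "norm (\<bar>d m\<bar> * (1 / q ^ m) ^ n) \<le> \<bar>d m\<bar>" for m
    proof -
      have "(1 / q ^ m) ^ n \<le> 1" using q by (intro power_le_one) (auto simp: one_le_power)
      then show ?thesis using q by (simp add: abs_mult power_abs mult_left_le)
    qed
  qed
  \<comment> \<open>The two halves of the bilateral moment: \<open>N\<close> collects the exponents
    \<open>k = - m\<close> and \<open>P\<close>, up to sign, the exponents
    \<open>k = m + 1\<close>.\<close>
  define P where "P n = (\<Sum>m. d m * (q ^ Suc m) ^ n)" for n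
  define N where "N n = (\<Sum>m. d m * (1 / q ^ m) ^ n)" for n
  have absq: "\<bar>q\<bar> = q" using q by simp
  have sP: "summable (\<lambda>m. d m * (q ^ Suc m) ^ n)" for n
    by (rule summable_rabs_cancel) (use sumP[of n] in \<open>simp add: abs_mult power_abs absq\<close>)
  have sN: "summable (\<lambda>m. d m * (1 / q ^ m) ^ n)" for n
    by (rule summable_rabs_cancel) (use sumN[of n] in \<open>simp add: abs_mult power_abs absq\<close>)
  have PS: "P (Suc n) = q ^ Suc n - q ^ Suc n * P n" for n
  proof -
    have "P (Suc n) = d 0 * (q ^ Suc 0) ^ Suc n + (\<Sum>m. d (Suc m) * (q ^ Suc (Suc m)) ^ Suc n)"
      unfolding P_def using suminf_split_head[OF sP[of "Suc n"]] by simp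
    moreover have "d (Suc m) * (q ^ Suc (Suc m)) ^ Suc n = (- (q ^ Suc n)) * (d m * (q ^ Suc m) ^ n)" for m
    proof -
      have "d (Suc m) * (q ^ Suc (Suc m)) ^ Suc n = q * (d (Suc m) * q ^ Suc m) * (q ^ Suc (Suc m)) ^ n"
        by simp
      also have "\<dots> = (- (q ^ Suc n)) * (d m * (q ^ Suc m) ^ n)"
        unfolding dS by (simp add: power_mult_distrib)
      finally show ?thesis .
    qed
    ultimately show ?thesis unfolding P_def using suminf_mult[OF sP[of n], of "- (q ^ Suc n)"] d0 by simp
  qed
  have NS: "N (Suc n) = q ^ Suc n - q ^ Suc n * N n" for n
  proof -
    have "N n = d 0 * (1 / q ^ 0) ^ n + (\<Sum>m. d (Suc m) * (1 / q ^ Suc m) ^ n)"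
      unfolding N_def using suminf_split_head[OF sN[of n]] by simp
    moreover have "d m * (1 / q ^ m) ^ Suc n = (- (q ^ Suc n)) * (d (Suc m) * (1 / q ^ Suc m) ^ n)" for m
    proof -
      have "d m = - (d (Suc m) * q ^ Suc m)" using dS[of m] by simp
      then show ?thesis using q by (simp add: power_mult_distrib power_divide divide_simps)
    qed
    moreover have "summable (\<lambda>m. d (Suc m) * (1 / q ^ Suc m) ^ n)"
      using sN[of n] summable_Suc_iff[of "\<lambda>m. d m * (1 / q ^ m) ^ n"] by simp
    ultimately show ?thesis
      unfolding N_def using suminf_mult[of "\<lambda>m. d (Suc m) * (1 / q ^ Suc m) ^ n" "- (q ^ Suc n)"] d0
      by (simp add: algebra_simps)
  qed
  \<comment> \<open>Equal recursions with equal start; hence the bilateral moment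
    \<open>N n - P n\<close> is \<open>0\<close> for every \<open>n\<close>.\<close>
  have NP: "N n = P n" for n
    by (induction n) (simp_all add: PS NS, simp add: N_def P_def)
  \<comment> \<open>The coefficients \<open>b k / (1 + q^k)\<close>, for \<open>k = - m\<close> here
    and for \<open>k = m + 1\<close> in \<open>aP\<close>.\<close>
  define aN where "aN m = d m / (1 + 1 / q ^ m)" for m
  define aP where "aP m = - d m / (1 + q ^ Suc m)" for m
  have le: "\<bar>x / (1 + y)\<bar> \<le> \<bar>x\<bar>" if "y > 0" for x y :: real
    using that by (simp add: abs_divide divide_le_eq mult_left_le algebra_simps)
  have aN: "\<bar>aN m\<bar> \<le> \<bar>d m\<bar>" and aP: "\<bar>aP m\<bar> \<le> \<bar>d m\<bar>" for m
    unfolding aN_def aP_def using le[of "1 / q ^ m" "d m"] le[of "q ^ Suc m" "- d m"] q by simp_all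
  have saN: "summable (\<lambda>m. \<bar>aN m\<bar> * (1 / q ^ m) ^ n)" for n
    by (rule summable_comparison_test'[OF sumN[of n], of 0])
      (use aN q in \<open>auto simp: abs_mult power_abs absq intro!: mult_right_mono\<close>)
  have saP: "summable (\<lambda>m. \<bar>aP m\<bar> * (q ^ Suc m) ^ n)" for n
    by (rule summable_comparison_test'[OF sumP[of n], of 0])
      (use aP q in \<open>auto simp: abs_mult power_abs absq intro!: mult_right_mono\<close>)
  have smN: "summable (\<lambda>m. aN m * (1 / q ^ m) ^ n)" for n
    by (rule summable_rabs_cancel) (use saN[of n] in \<open>simp add: abs_mult power_abs absq\<close>)
  have smP: "summable (\<lambda>m. aP m * (q ^ Suc m) ^ n)" for n
    by (rule summable_rabs_cancel) (use saP[of n] in \<open>simp add: abs_mult power_abs absq\<close>)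
  define M where "M n = (\<Sum>m. aN m * (1 / q ^ m) ^ n) + (\<Sum>m. aP m * (q ^ Suc m) ^ n)" for n
  \<comment> \<open>In \<open>M n + M (Suc n)\<close> the factor \<open>1 + q^k\<close> cancels the
    denominators, which leaves \<open>N n - P n = 0\<close>.\<close>
  have MS: "M (Suc n) = - M n" for n
  proof -
    have "aN m * (1 / q ^ m) ^ n + aN m * (1 / q ^ m) ^ Suc n = d m * (1 / q ^ m) ^ n" for m
    proof -
      have "1 + 1 / q ^ m \<noteq> 0" using q by (metis add_pos_pos less_irrefl zero_less_divide_1_iff zero_less_one zero_less_power)
      then have "aN m * (1 + 1 / q ^ m) = d m" unfolding aN_def by simp
      then have "d m * (1 / q ^ m) ^ n = aN m * (1 + 1 / q ^ m) * (1 / q ^ m) ^ n" by simp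
      then show ?thesis by (simp add: algebra_simps)
    qed
    then have 1: "(\<Sum>m. aN m * (1 / q ^ m) ^ n) + (\<Sum>m. aN m * (1 / q ^ m) ^ Suc n) = N n"
      unfolding N_def by (subst suminf_add[OF smN smN]) simp
    have "aP m * (q ^ Suc m) ^ n + aP m * (q ^ Suc m) ^ Suc n = - (d m * (q ^ Suc m) ^ n)" for m
    proof -
      have "1 + q ^ Suc m \<noteq> 0" using q by (metis add_pos_pos less_irrefl zero_less_one zero_less_power)
      then have "aP m * (1 + q ^ Suc m) = - d m" unfolding aP_def by simp
      then have "- (d m * (q ^ Suc m) ^ n) = aP m * (1 + q ^ Suc m) * (q ^ Suc m) ^ n" by simp
      then show ?thesis by (simp add: algebra_simps)
    qed
    then have 2: "(\<Sum>m. aP m * (q ^ Suc m) ^ n) + (\<Sum>m. aP m * (q ^ Suc m) ^ Suc n) = - P n"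
      unfolding P_def suminf_minus[OF sP, symmetric] by (subst suminf_add[OF smP smP]) (rule suminf_cong)
    show ?thesis using 1 2 NP[of n] unfolding M_def by simp
  qed
  \<comment> \<open>The moments alternate already; dividing by \<open>M 0\<close> normalizes them to
    \<open>(-1) ^ n\<close>.\<close>
  have M0: "M 0 \<noteq> 0"
  proof -
    define e where "e m = 1 / (1 + 1 / q ^ m) - 1 / (1 + q ^ Suc m)" for m
    have s: "summable (\<lambda>m. d m * e m)"
      using summable_add[OF smN[of 0] smP[of 0]] by (simp add: e_def aN_def aP_def algebra_simps)
    have eq: "M 0 = (\<Sum>m. d m * e m)"
      using suminf_add[OF smN[of 0] smP[of 0]] by (simp add: M_def e_def aN_def aP_def algebra_simps)
    have e1: "\<bar>e m\<bar> \<le> 1" for m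
    proof -
      have "0 < 1 / (1 + 1 / q ^ m)" "1 / (1 + 1 / q ^ m) \<le> 1" "0 < 1 / (1 + q ^ Suc m)" "1 / (1 + q ^ Suc m) \<le> 1"
        using q by (auto simp: add_pos_pos)
      then show ?thesis unfolding e_def by linarith
    qed
    have dle: "\<bar>d (Suc m)\<bar> \<le> (1/q) ^ Suc m" for m
    proof (induction m)
      case 0
      then show ?case using dS'[of 0] d0 q by simp
    next
      case (Suc m)
      have "\<bar>d (Suc (Suc m))\<bar> \<le> \<bar>d (Suc m)\<bar> / q"
        unfolding dS'[of "Suc m"] using q one_le_power[of q "Suc m"]
        by (intro divide_left_mono) (auto simp: self_le_power mult_le_cancel_left1)
      also have "\<dots> \<le> (1/q) ^ Suc m / q" using Suc q by (intro divide_right_mono) auto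
      finally show ?case by simp
    qed
    have gs: "(\<lambda>m. (1/q) ^ Suc m) sums (1/15)"
      using geometric_sums[of "1/q"] sums_mult[of "\<lambda>m. (1/q) ^ m" _ "1/q"] by (fastforce simp: q_def)
    have "M 0 = d 0 * e 0 + (\<Sum>m. d (Suc m) * e (Suc m))"
      unfolding eq using suminf_split_head[OF s] by simp
    moreover have "norm (\<Sum>m. d (Suc m) * e (Suc m)) \<le> (\<Sum>m. (1/q) ^ Suc m)"
    proof (rule norm_suminf_le)
      show "norm (d (Suc m) * e (Suc m)) \<le> (1/q) ^ Suc m" for m
        unfolding real_norm_def abs_mult using mult_mono[OF dle e1[of "Suc m"]] q by simp
      show "summable (\<lambda>m. (1/q) ^ Suc m)" using gs sums_summable by blast
    qed
    moreover have "(\<Sum>m. (1/q) ^ Suc m) = 1/15" using gs sums_unique by metis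
    moreover have "d 0 * e 0 = 1/2 - 1/17" by (simp add: d0 e_def q_def)
    ultimately show ?thesis by (auto simp: abs_le_iff)
  qed
  \<comment> \<open>The halves are interleaved into one sequence: even indices carry
    \<open>k \<le> 0\<close> and odd ones \<open>k > 0\<close>.\<close>
  define a where "a j = (if even j then aN (j div 2) else aP ((j - 1) div 2)) / M 0" for j
  define l where "l j = (if even j then 1 / q ^ (j div 2) else q ^ Suc ((j - 1) div 2))" for j
  have "reflection_weights a l"
    unfolding reflection_weights_def
  proof (intro conjI allI)
    show "0 < l j" for j using q by (simp add: l_def)
    fix n
    have "(\<lambda>j. if even j then \<bar>aN (j div 2)\<bar> * (1 / q ^ (j div 2)) ^ n else \<bar>aP ((j - 1) div 2)\<bar> * (q ^ Suc ((j - 1) div 2)) ^ n)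
        sums ((\<Sum>m. \<bar>aP m\<bar> * (q ^ Suc m) ^ n) + (\<Sum>m. \<bar>aN m\<bar> * (1 / q ^ m) ^ n))"
      by (rule sums_if[OF summable_sums[OF saP] summable_sums[OF saN]])
    then have "summable (\<lambda>j. (if even j then \<bar>aN (j div 2)\<bar> * (1 / q ^ (j div 2)) ^ n else \<bar>aP ((j - 1) div 2)\<bar> * (q ^ Suc ((j - 1) div 2)) ^ n) / \<bar>M 0\<bar>)"
      using sums_summable summable_divide by blast
    then show "summable (\<lambda>j. \<bar>a j\<bar> * l j ^ n)"
      by (rule summable_cong[THEN iffD1, rotated]) (auto simp: a_def l_def)
    have "(\<lambda>j. if even j then aN (j div 2) * (1 / q ^ (j div 2)) ^ n else aP ((j - 1) div 2) * (q ^ Suc ((j - 1) div 2)) ^ n)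
        sums ((\<Sum>m. aP m * (q ^ Suc m) ^ n) + (\<Sum>m. aN m * (1 / q ^ m) ^ n))"
      by (rule sums_if[OF summable_sums[OF smP] summable_sums[OF smN]])
    then have "(\<lambda>j. (if even j then aN (j div 2) * (1 / q ^ (j div 2)) ^ n else aP ((j - 1) div 2) * (q ^ Suc ((j - 1) div 2)) ^ n) / M 0)
        sums (((\<Sum>m. aP m * (q ^ Suc m) ^ n) + (\<Sum>m. aN m * (1 / q ^ m) ^ n)) / M 0)"
      by (rule sums_divide)
    moreover have "M n = (-1) ^ n * M 0" by (induction n) (simp_all add: MS)
    then have "((\<Sum>m. aP m * (q ^ Suc m) ^ n) + (\<Sum>m. aN m * (1 / q ^ m) ^ n)) / M 0 = (-1) ^ n"
      using M0 by (simp add: M_def add.commute)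
    ultimately have "(\<lambda>j. (if even j then aN (j div 2) * (1 / q ^ (j div 2)) ^ n else aP ((j - 1) div 2) * (q ^ Suc ((j - 1) div 2)) ^ n) / M 0) sums (-1) ^ n"
      by simp
    then show "(\<lambda>j. a j * l j ^ n) sums (-1) ^ n"
      by (rule sums_cong[THEN iffD1, rotated]) (auto simp: a_def l_def)
  qed
  then show ?thesis by blast
qed

text \<open>\<open>t / (1 + t)\<close> compresses the half-line into \<open>[0, 1)\<close>, so the
  dilated arguments \<open>l j * t\<close> stay in the strip where \<open>F\<close> is given,
  however large \<open>l j\<close> is. The square root passes from the variable \<open>s\<close> to
  the radius, in which \<open>F\<close> is even.\<close>

definition half_line_fold :: "real \<Rightarrow> real" where
  "half_line_fold t = sqrt (t / (1 + t))"

lemma half_line_fold_bounds: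
  assumes "0 \<le> t"
  shows "0 \<le> half_line_fold t" "half_line_fold t < 1"
  using assms by (auto simp: half_line_fold_def divide_less_eq)

lemma half_line_fold_pos: "0 < t \<Longrightarrow> 0 < half_line_fold t"
  by (simp add: half_line_fold_def)

lemma half_line_fold_0 [simp]: "half_line_fold 0 = 0"
  by (simp add: half_line_fold_def)

lemma continuous_on_half_line_fold: "continuous_on {0..} half_line_fold"
  unfolding half_line_fold_def by (intro continuous_intros) auto

text \<open>The derivative is expressed through the value of \<open>half_line_fold\<close> itself,
  so that differentiating a folded function gives a folded function again.\<close>

lemma DERIV_half_line_fold:
  assumes "0 < t"
  shows "(half_line_fold has_real_derivative (1 - (half_line_fold t)\<^sup>2)\<^sup>2 / (2 * half_line_fold t)) (at t)"
proof -
  have eq: "half_line_fold = (\<lambda>t. sqrt (t / (1 + t)))" by (rule ext) (rule half_line_fold_def)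
  have "((\<lambda>t. t / (1 + t)) has_real_derivative 1 / (1 + t)\<^sup>2) (at t)"
    using assms by (auto intro!: derivative_eq_intros simp: power2_eq_square)
  from DERIV_real_sqrt[THEN DERIV_chain2, OF _ this]
  have "((\<lambda>t. sqrt (t / (1 + t))) has_real_derivative inverse (sqrt (t / (1 + t))) / 2 * (1 / (1 + t)\<^sup>2)) (at t)"
    using assms by simp
  moreover have "1 - (half_line_fold t)\<^sup>2 = 1 / (1 + t)"
    using assms by (simp add: half_line_fold_def field_simps)
  then have "(1 - (half_line_fold t)\<^sup>2)\<^sup>2 / (2 * half_line_fold t) = inverse (sqrt (t / (1 + t))) / 2 * (1 / (1 + t)\<^sup>2)"
    by (simp only: half_line_fold_def power_divide divide_inverse inverse_mult_distrib power_inverse mult_1) simp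
  ultimately show ?thesis by (simp only: eq)
qed

text \<open>For an even \<open>F\<close>, this extends the function \<open>F (z, half_line_fold s)\<close> of \<open>s \<ge> 0\<close> to negative
  \<open>s\<close>. The derivatives of the extension have the same form, because \<open>d/ds\<close> turns the weights \<open>a j\<close> into
  the weights \<open>- l j * a j\<close>.\<close>

definition reflection_extension ::
  "(nat \<Rightarrow> real) \<Rightarrow> (nat \<Rightarrow> real) \<Rightarrow> ('z \<times> real \<Rightarrow> 'c::euclidean_space) \<Rightarrow> 'z \<times> real \<Rightarrow> 'c" where
  "reflection_extension a l F x =
     (if 0 \<le> snd x then F (fst x, half_line_fold (snd x))
      else \<Sum>j. a j *\<^sub>R F (fst x, half_line_fold (l j * - snd x)))"

lemma continuous_bounded_on_strip:
  fixes F :: "'z::euclidean_space \<times> real \<Rightarrow> 'c::euclidean_space"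
  assumes "continuous_on (Z \<times> {-2<..<2}) F" "K \<subseteq> Z" "compact K"
  obtains C where "C > 0" "\<And>z t. z \<in> K \<Longrightarrow> 0 \<le> t \<Longrightarrow> t \<le> 1 \<Longrightarrow> norm (F (z, t)) \<le> C"
proof -
  have "compact (F ` (K \<times> {0..1}))"
    using assms by (intro compact_continuous_image compact_Times continuous_on_subset[OF assms(1)]) auto
  then obtain C where "C > 0" "\<forall>y\<in>F ` (K \<times> {0..1}). norm y \<le> C"
    using compact_imp_bounded bounded_pos by blast
  then show ?thesis using that by auto
qed

lemma summable_reflection:
  fixes F :: "nat \<Rightarrow> 'c::euclidean_space"
  assumes "reflection_weights a l" "\<And>j. norm (F j) \<le> C"
  shows "summable (\<lambda>j. a j *\<^sub>R F j)"
proof (rule summable_comparison_test'[of "\<lambda>j. \<bar>a j\<bar> * C" 0])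
  have "summable (\<lambda>j. \<bar>a j\<bar> * l j ^ 0)" using assms(1) unfolding reflection_weights_def by blast
  then show "summable (\<lambda>j. \<bar>a j\<bar> * C)" by (intro summable_mult2) simp
  show "norm (a j *\<^sub>R F j) \<le> \<bar>a j\<bar> * C" for j by (simp add: assms(2) mult_left_mono)
qed

text \<open>For \<open>z\<close> in a compact set the series converges uniformly by the M-test. The
  two closed halves fit together at \<open>s = 0\<close> because the weights sum to
  \<open>1\<close>, which is the zeroth moment.\<close>

lemma continuous_on_reflection_extension:
  fixes F :: "'z::euclidean_space \<times> real \<Rightarrow> 'c::euclidean_space"
  assumes "reflection_weights a l" "open Z" "continuous_on (Z \<times> {-2<..<2}) F"
  shows "continuous_on (Z \<times> UNIV) (reflection_extension a l F)"
proof -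
  have lpos: "0 < l j" for j using assms(1) by (simp add: reflection_weights_def)
  have "isCont (reflection_extension a l F) (z0, s0)" if "z0 \<in> Z" for z0 s0
  proof -
    obtain r where r: "r > 0" "cball z0 r \<subseteq> Z" using assms(2) \<open>z0 \<in> Z\<close> open_contains_cball by blast
    define K where "K = cball z0 r"
    have K: "K \<subseteq> Z" "compact K" "closed K" using r by (auto simp: K_def)
    obtain C where C: "C > 0" "\<And>z t. z \<in> K \<Longrightarrow> 0 \<le> t \<Longrightarrow> t \<le> 1 \<Longrightarrow> norm (F (z, t)) \<le> C"
      by (rule continuous_bounded_on_strip[OF assms(3) K(1,2)]) (rule that; assumption)
    have fold_cont: "continuous_on A (\<lambda>x. F (fst x, half_line_fold (c * snd x)))"
      if "A \<subseteq> K \<times> UNIV" "\<And>x. x \<in> A \<Longrightarrow> 0 \<le> c * snd x" for A and c :: real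
    proof (rule continuous_on_compose2[OF assms(3)])
      show "continuous_on A (\<lambda>x. (fst x, half_line_fold (c * snd x)))"
      proof (intro continuous_on_Pair continuous_on_fst continuous_on_id)
        show "continuous_on A (\<lambda>x. half_line_fold (c * snd x))"
        proof (rule continuous_on_compose2[OF continuous_on_half_line_fold])
          show "continuous_on A (\<lambda>x. c * snd x)" by (intro continuous_intros)
          show "(\<lambda>x. c * snd x) ` A \<subseteq> {0..}" using that(2) by blast
        qed
      qed
      show "(\<lambda>x. (fst x, half_line_fold (c * snd x))) ` A \<subseteq> Z \<times> {-2<..<2}"
      proof (intro image_subsetI)
        fix x assume "x \<in> A"
        then have "fst x \<in> Z" using that(1) K(1) by (metis mem_Times_iff subsetD)
        moreover have "0 \<le> half_line_fold (c * snd x)" "half_line_fold (c * snd x) < 1"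
          using half_line_fold_bounds that(2)[OF \<open>x \<in> A\<close>] by blast+
        ultimately show "(fst x, half_line_fold (c * snd x)) \<in> Z \<times> {-2<..<2}" by auto
      qed
    qed
    have c1: "continuous_on (K \<times> {0..}) (reflection_extension a l F)"
      by (rule continuous_on_eq[OF fold_cont[of _ 1]]) (auto simp: reflection_extension_def)
    define G where "G x = (\<Sum>j. a j *\<^sub>R F (fst x, half_line_fold (l j * - snd x)))" for x
    have bound: "norm (F (fst x, half_line_fold (l j * - snd x))) \<le> C" if "x \<in> K \<times> {..0}" for x j
      using that lpos[of j] half_line_fold_bounds[of "l j * - snd x"]
      by (intro C(2)) (auto simp: mult_nonneg_nonpos less_imp_le)
    have fc: "continuous_on (K \<times> {..0}) (\<lambda>x. F (fst x, half_line_fold (l j * - snd x)))" for j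
    proof -
      have 1: "K \<times> {..0} \<subseteq> K \<times> UNIV" by auto
      have 2: "0 \<le> - l j * snd x" if "x \<in> K \<times> {..0}" for x
        using that lpos[of j] by (auto simp: mult_nonneg_nonpos less_imp_le)
      show ?thesis using fold_cont[OF 1 2] by simp
    qed
    have "continuous_on (K \<times> {..0}) G"
    proof (rule uniform_limit_theorem)
      show "\<forall>\<^sub>F n in sequentially. continuous_on (K \<times> {..0}) (\<lambda>x. \<Sum>j<n. a j *\<^sub>R F (fst x, half_line_fold (l j * - snd x)))"
        by (intro always_eventually allI continuous_intros fc)
      show "uniform_limit (K \<times> {..0}) (\<lambda>n x. \<Sum>j<n. a j *\<^sub>R F (fst x, half_line_fold (l j * - snd x))) G sequentially"
        unfolding G_def
      proof (rule Weierstrass_m_test)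
        show "norm (a j *\<^sub>R F (fst x, half_line_fold (l j * - snd x))) \<le> \<bar>a j\<bar> * C" if "x \<in> K \<times> {..0}" for j x
          using bound[OF that, of j] by (simp add: mult_left_mono)
        have "summable (\<lambda>j. \<bar>a j\<bar> * l j ^ 0)" using assms(1) unfolding reflection_weights_def by blast
        then show "summable (\<lambda>j. \<bar>a j\<bar> * C)" by (intro summable_mult2) simp
      qed
    qed simp
    moreover have "G x = reflection_extension a l F x" if "x \<in> K \<times> {..0}" for x
    proof (cases "snd x = 0")
      case True
      have "(\<lambda>j. a j * l j ^ 0) sums (-1) ^ 0" using assms(1) unfolding reflection_weights_def by blast
      then have "(\<lambda>j. a j *\<^sub>R F (fst x, 0)) sums F (fst x, 0)"
        using sums_scaleR_left[of a 1 "F (fst x, 0)"] by simp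
      then show ?thesis using True by (simp add: G_def reflection_extension_def sums_unique[symmetric])
    qed (use that in \<open>auto simp: G_def reflection_extension_def\<close>)
    ultimately have c2: "continuous_on (K \<times> {..0}) (reflection_extension a l F)"
      by (rule continuous_on_eq)
    have "continuous_on (K \<times> {0..} \<union> K \<times> {..0}) (reflection_extension a l F)"
      by (intro continuous_on_closed_Un c1 c2 closed_Times K) auto
    moreover have "K \<times> {0..} \<union> K \<times> {..0::real} = K \<times> UNIV" by auto
    ultimately have "continuous_on (ball z0 r \<times> UNIV) (reflection_extension a l F)"
      using continuous_on_subset[of "K \<times> UNIV" _ "ball z0 r \<times> UNIV"] by (auto simp: K_def subset_iff)
    moreover have "open (ball z0 r \<times> (UNIV :: real set))" by (intro open_Times) auto
    ultimately show ?thesis using r by (simp add: continuous_on_eq_continuous_at)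
  qed
  then show ?thesis by (auto intro!: continuous_at_imp_continuous_on)
qed

text \<open>The chain rule. The assumption on \<open>h\<close> is its defining quotient with the
  factor \<open>2 * half_line_fold s\<close> cleared, the form in which Hadamard's lemma later
  supplies it.\<close>

lemma has_derivative_fold:
  fixes F :: "'z::euclidean_space \<times> real \<Rightarrow> 'c::euclidean_space"
  assumes "open Z" "smooth_on (Z \<times> {-2<..<2}) F" "z \<in> Z" "0 < s"
    and "2 *\<^sub>R half_line_fold s *\<^sub>R h = (1 - (half_line_fold s)\<^sup>2)\<^sup>2 *\<^sub>R
      frechet_derivative F (at (z, half_line_fold s)) (0, 1)"
  shows "((\<lambda>x. F (fst x, half_line_fold (snd x))) has_derivative
    (\<lambda>v. frechet_derivative F (at (z, half_line_fold s)) (fst v, 0) + snd v *\<^sub>R h)) (at (z, s))"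
proof -
  let ?t = "half_line_fold s"
  have t: "0 < ?t" "?t < 1" using half_line_fold_pos half_line_fold_bounds assms(4) by auto
  have opU: "open (Z \<times> {-2<..<2::real})" by (intro open_Times assms(1)) auto
  have DF: "(F has_derivative frechet_derivative F (at (z, ?t))) (at (z, ?t))"
    by (rule smooth_on_has_derivative[OF opU assms(2)]) (use assms(3) t in auto)
  define k where "k = (1 - ?t\<^sup>2)\<^sup>2 / (2 * ?t)"
  have "(half_line_fold has_derivative (\<lambda>v. v * k)) (at s)"
    using DERIV_half_line_fold[OF assms(4)] unfolding has_field_derivative_def k_def
    by (rule has_derivative_eq_rhs) (simp add: fun_eq_iff)
  then have "(half_line_fold has_derivative (\<lambda>v. v * k)) (at (snd (z, s)))" by simp
  from has_derivative_compose[OF has_derivative_snd[OF has_derivative_ident] this]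
  have "((\<lambda>x. half_line_fold (snd x)) has_derivative (\<lambda>v. snd v * k)) (at (z, s))" .
  then have 1: "((\<lambda>x. (fst x, half_line_fold (snd x))) has_derivative (\<lambda>v. (fst v, snd v * k))) (at (z, s))"
    by (intro has_derivative_Pair has_derivative_fst has_derivative_ident)
  have "((\<lambda>x. F (fst x, half_line_fold (snd x))) has_derivative
      (\<lambda>v. frechet_derivative F (at (z, ?t)) (fst v, snd v * k))) (at (z, s))"
    by (rule has_derivative_compose[OF 1]) (simp add: DF)
  moreover have "frechet_derivative F (at (z, ?t)) (fst v, snd v * k) =
      frechet_derivative F (at (z, ?t)) (fst v, 0) + snd v *\<^sub>R h" for v
  proof -
    have lin: "linear (frechet_derivative F (at (z, ?t)))" using DF has_derivative_linear by blast
    have h: "h = k *\<^sub>R frechet_derivative F (at (z, ?t)) (0, 1)"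
    proof -
      have "h = (1 / (2 * ?t)) *\<^sub>R (2 *\<^sub>R ?t *\<^sub>R h)" using t by simp
      also have "\<dots> = k *\<^sub>R frechet_derivative F (at (z, ?t)) (0, 1)"
        unfolding assms(5) using t by (simp add: k_def)
      finally show ?thesis .
    qed
    have "(fst v, snd v * k) = (fst v, 0) + (snd v * k) *\<^sub>R (0, 1)" by simp
    then show ?thesis by (simp only: linear_add[OF lin] linear_scale[OF lin] h scaleR_scaleR)
  qed
  ultimately show ?thesis by simp
qed

text \<open>Termwise differentiation. In the \<open>s\<close>-direction the coefficient
  \<open>a j\<close> turns into \<open>- l j * a j\<close>, which gives the shifted weights.\<close>

lemma has_derivative_reflection_extension_neg:
  fixes F H :: "'z::euclidean_space \<times> real \<Rightarrow> 'c::euclidean_space"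
  assumes w: "reflection_weights a l" and Z: "open Z" and F: "smooth_on (Z \<times> {-2<..<2}) F"
    and H: "continuous_on (Z \<times> {-2<..<2}) H"
    and FH: "\<And>z t. z \<in> Z \<Longrightarrow> t \<in> {0<..<1} \<Longrightarrow>
      2 *\<^sub>R t *\<^sub>R H (z, t) = (1 - t\<^sup>2)\<^sup>2 *\<^sub>R frechet_derivative F (at (z, t)) (0, 1)"
    and z0: "z0 \<in> Z" and s0: "s0 < 0"
  shows "(reflection_extension a l F has_derivative
    (\<lambda>v. reflection_extension a l (\<lambda>y. frechet_derivative F (at y) (fst v, 0)) (z0, s0) +
         snd v *\<^sub>R reflection_extension (\<lambda>j. - l j * a j) l H (z0, s0))) (at (z0, s0))"
proof -
  have lpos: "0 < l j" for j using w by (simp add: reflection_weights_def)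
  obtain r where r: "r > 0" "cball z0 r \<subseteq> Z" using Z z0 open_contains_cball_eq by metis
  define S where "S = ball z0 r \<times> {..<0::real}"
  have S: "open S" "convex S" "(z0, s0) \<in> S"
    using r s0 by (auto simp: S_def intro!: open_Times convex_Times)
  have opU: "open (Z \<times> {-2<..<2::real})" by (intro open_Times Z) auto
  define th where "th j x = (fst x, half_line_fold (l j * - snd x))" for j and x :: "'z \<times> real"
  have th: "th j x \<in> cball z0 r \<times> {0..1}" "th j x \<in> Z \<times> {0<..<1}" if "x \<in> S" for x j
  proof -
    have "0 < l j * - snd x" using that lpos[of j] by (auto simp: S_def intro!: mult_pos_neg)
    then have "0 < half_line_fold (l j * - snd x)" "half_line_fold (l j * - snd x) < 1"
      using half_line_fold_pos half_line_fold_bounds(2)[of "l j * - snd x"] by auto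
    moreover have "fst x \<in> cball z0 r" using that by (auto simp: S_def)
    ultimately show "th j x \<in> cball z0 r \<times> {0..1}" "th j x \<in> Z \<times> {0<..<1}" using r(2) by (auto simp: th_def)
  qed
  define D where "D y v = frechet_derivative F (at y) (v, 0)" for y v
  have DF: "(F has_derivative frechet_derivative F (at y)) (at y)" if "y \<in> Z \<times> {-2<..<2}" for y
    by (rule smooth_on_has_derivative[OF opU F that])
  have linD: "linear (D y)" if "y \<in> Z \<times> {-2<..<2}" for y
  proof -
    have L: "linear (frechet_derivative F (at y))" by (rule has_derivative_linear[OF DF[OF that]])
    show ?thesis
      unfolding D_def using linear_add[OF L, of "(_, 0)" "(_, 0)"] linear_scale[OF L, of _ "(_, 0)"]
      by (intro linearI) simp_all
  qed
  have contD: "continuous_on (Z \<times> {-2<..<2}) (\<lambda>y. D y v)" for v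
    unfolding D_def by (rule smooth_on_imp_continuous_on[OF smooth_on_frechet_derivative[OF opU F]])
  have "\<exists>C>0. \<forall>z t. z \<in> cball z0 r \<longrightarrow> 0 \<le> t \<longrightarrow> t \<le> 1 \<longrightarrow> norm (D (z, t) b) \<le> C" for b
    by (rule continuous_bounded_on_strip[OF contD[of b] r(2) compact_cball]) blast
  then obtain c where c: "\<And>b. c b > 0" "\<And>b z t. z \<in> cball z0 r \<Longrightarrow> 0 \<le> t \<Longrightarrow> t \<le> 1 \<Longrightarrow> norm (D (z, t) b) \<le> c b"
    by metis
  define C1 where "C1 = DIM('z) * (\<Sum>b\<in>(Basis::'z set). c b)"
  have C1: "norm (D y v) \<le> C1 * norm v" if "y \<in> cball z0 r \<times> {0..1}" for y v
    unfolding C1_def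
  proof (rule linear_norm_le_sum_Basis)
    show "linear (D y)" using that r(2) by (intro linD) auto
    show "norm (D y b) \<le> (\<Sum>b\<in>(Basis::'z set). c b)" if "b \<in> Basis" for b
      using c(2)[of "fst y" "snd y" b] \<open>y \<in> _\<close> member_le_sum[of b "Basis :: 'z set" c] c(1) that
      by (force simp: less_imp_le)
  qed
  obtain C2 where C2: "C2 > 0" "\<And>z t. z \<in> cball z0 r \<Longrightarrow> 0 \<le> t \<Longrightarrow> t \<le> 1 \<Longrightarrow> norm (H (z, t)) \<le> C2"
    by (rule continuous_bounded_on_strip[OF H r(2) compact_cball]) (rule that; assumption)
  have C1pos: "C1 \<ge> 0" unfolding C1_def using c(1) by (intro mult_nonneg_nonneg sum_nonneg) (auto simp: less_imp_le)
  obtain C0 where C0: "C0 > 0" "\<And>z t. z \<in> cball z0 r \<Longrightarrow> 0 \<le> t \<Longrightarrow> t \<le> 1 \<Longrightarrow> norm (F (z, t)) \<le> C0"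
    by (rule continuous_bounded_on_strip[OF smooth_on_imp_continuous_on[OF F] r(2) compact_cball]) (rule that; assumption)
  define f where "f j x = a j *\<^sub>R F (th j x)" for j x
  define f' where "f' j x v = a j *\<^sub>R (D (th j x) (fst v) - (l j * snd v) *\<^sub>R H (th j x))" for j x v
  define g' where "g' x v = reflection_extension a l (\<lambda>y. D y (fst v)) x
    + snd v *\<^sub>R reflection_extension (\<lambda>j. - l j * a j) l H x" for x v
  \<comment> \<open>A dominating sequence for the derivatives: the \<open>z\<close>-part costs
    \<open>\<bar>a j\<bar>\<close>, and the \<open>s\<close>-part a further factor
    \<open>l j\<close>.\<close>
  define M where "M j = \<bar>a j\<bar> * C1 + \<bar>a j\<bar> * l j * C2" for j
  have sumM: "summable M"
  proof -
    have "summable (\<lambda>j. \<bar>a j\<bar> * l j ^ 0)" "summable (\<lambda>j. \<bar>a j\<bar> * l j ^ 1)"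
      using w unfolding reflection_weights_def by blast+
    then show ?thesis unfolding M_def by (intro summable_add summable_mult2) simp_all
  qed
  have f'_le: "norm (f' j x v) \<le> M j * norm v" if "x \<in> S" for j x v
  proof -
    have "norm (D (th j x) (fst v) - (l j * snd v) *\<^sub>R H (th j x)) \<le>
        norm (D (th j x) (fst v)) + norm ((l j * snd v) *\<^sub>R H (th j x))"
      by (rule norm_triangle_ineq4)
    also have "norm (D (th j x) (fst v)) \<le> C1 * norm v"
      using C1[OF th(1)[OF that, of j], of "fst v"] norm_fst_le[of "fst v" "snd v"] C1pos unfolding prod.collapse
      by (meson mult_left_mono order_trans)
    also have "norm ((l j * snd v) *\<^sub>R H (th j x)) \<le> l j * C2 * norm v"
    proof -
      have "norm (H (th j x)) \<le> C2" using C2(2)[of "fst (th j x)" "snd (th j x)"] th(1)[OF that, of j] by auto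
      moreover have "\<bar>snd v\<bar> \<le> norm v" using norm_snd_le[of "snd v" "fst v"] by simp
      ultimately have "\<bar>snd v\<bar> * norm (H (th j x)) \<le> norm v * C2" by (intro mult_mono) auto
      then show ?thesis using lpos[of j] by (simp add: abs_mult mult.assoc mult.commute[of C2] mult_left_mono)
    qed
    finally have "\<bar>a j\<bar> * norm (D (th j x) (fst v) - (l j * snd v) *\<^sub>R H (th j x)) \<le> \<bar>a j\<bar> * (C1 * norm v + l j * C2 * norm v)"
      by (intro mult_left_mono) auto
    moreover have "\<bar>a j\<bar> * (C1 * norm v + l j * C2 * norm v) = M j * norm v"
      by (simp add: M_def algebra_simps)
    ultimately show ?thesis unfolding f'_def norm_scaleR by simp
  qed
  have sumf': "summable (\<lambda>j. f' j x v)" if "x \<in> S" for x v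
    by (rule summable_comparison_test'[of "\<lambda>j. M j * norm v" 0]) (use f'_le[OF that] sumM summable_mult2 in auto)
  have g': "g' x v = (\<Sum>j. f' j x v)" if "x \<in> S" for x v
  proof -
    have neg: "\<not> 0 \<le> snd x" using that by (auto simp: S_def)
    have s1: "summable (\<lambda>j. a j *\<^sub>R D (th j x) (fst v))"
      by (rule summable_reflection[OF w, of _ "C1 * norm (fst v)"]) (use C1[OF th(1)[OF that]] in auto)
    have s2: "summable (\<lambda>j. (- l j * a j) *\<^sub>R H (th j x))"
      by (rule summable_reflection[OF reflection_weights_shift[OF w], of _ C2])
        (use C2(2) th(1)[OF that] in \<open>force simp: th_def\<close>)
    have "(\<Sum>j. f' j x v) = (\<Sum>j. a j *\<^sub>R D (th j x) (fst v) + snd v *\<^sub>R ((- l j * a j) *\<^sub>R H (th j x)))"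
      unfolding f'_def by (rule suminf_cong) (simp add: scaleR_diff_right mult_ac)
    also have "\<dots> = (\<Sum>j. a j *\<^sub>R D (th j x) (fst v)) + snd v *\<^sub>R (\<Sum>j. (- l j * a j) *\<^sub>R H (th j x))"
      using suminf_add[OF s1 summable_scaleR_right[OF s2, of "snd v"]] suminf_scaleR_right[OF s2, of "snd v"] by simp
    also have "\<dots> = g' x v" using neg by (simp add: g'_def reflection_extension_def th_def)
    finally show ?thesis by simp
  qed
  have der: "(f j has_derivative f' j x) (at x within S)" if "x \<in> S" for j x
  proof -
    let ?s = "l j * - snd x"
    have sp: "0 < ?s" using that lpos[of j] by (auto simp: S_def intro!: mult_pos_neg)
    have xZ: "fst x \<in> Z" using th(2)[OF that, of j] by (simp add: th_def)
    have "((\<lambda>x. F (fst x, half_line_fold (snd x))) has_derivative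
        (\<lambda>v. D (fst x, half_line_fold ?s) (fst v) + snd v *\<^sub>R H (fst x, half_line_fold ?s))) (at (fst x, ?s))"
      unfolding D_def
      by (rule has_derivative_fold[OF Z F xZ sp], rule FH[OF xZ])
        (use th(2)[OF that, of j] in \<open>auto simp: th_def\<close>)
    moreover have "((\<lambda>x. (fst x, l j * - snd x)) has_derivative (\<lambda>v. (fst v, l j * - snd v))) (at x)"
      by (auto intro!: derivative_eq_intros)
    from has_derivative_compose[OF this calculation, unfolded fst_conv snd_conv]
    have "((\<lambda>x. F (fst x, half_line_fold (l j * - snd x))) has_derivative
        (\<lambda>v. D (th j x) (fst v) + (l j * - snd v) *\<^sub>R H (th j x))) (at x)"
      unfolding th_def .
    from has_derivative_scaleR_right[OF this, of "a j"]
    show ?thesis by (simp add: f_def[abs_def] f'_def[abs_def] th_def has_derivative_at_withinI)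
  qed
  have unif: "\<forall>\<^sub>F n in sequentially. \<forall>x\<in>S. \<forall>v. norm (sum (\<lambda>i. f' i x v) {..<n} - g' x v) \<le> e * norm v" if "e > 0" for e
  proof -
    obtain N where N: "\<forall>n\<ge>N. norm (\<Sum>i. M (i + n)) < e"
      using suminf_exist_split[OF \<open>e > 0\<close> sumM] by (elim exE)
    have "norm (sum (\<lambda>i. f' i x v) {..<n} - g' x v) \<le> e * norm v" if "x \<in> S" "n \<ge> N" for n x v
    proof -
      have "norm (sum (\<lambda>i. f' i x v) {..<n} - g' x v) = norm (\<Sum>i. f' (i + n) x v)"
        unfolding g'[OF that(1)] suminf_minus_initial_segment[OF sumf'[OF that(1)]]
        by (rule norm_minus_commute)
      also have "\<dots> \<le> (\<Sum>i. M (i + n) * norm v)"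
        by (rule norm_suminf_le) (use f'_le[OF that(1)] sumM in \<open>auto intro: summable_mult2 summable_ignore_initial_segment\<close>)
      also have "\<dots> = (\<Sum>i. M (i + n)) * norm v"
        by (rule suminf_mult2[symmetric]) (use sumM summable_ignore_initial_segment in blast)
      also have "\<dots> \<le> e * norm v"
        using N that(2) by (intro mult_right_mono) (auto simp: abs_less_iff intro: less_imp_le)
      finally show ?thesis .
    qed
    then show ?thesis unfolding eventually_sequentially by blast
  qed
  have sumf: "(\<lambda>j. f j x) sums reflection_extension a l F x" if "x \<in> S" for x
  proof -
    have "summable (\<lambda>j. f j x)" unfolding f_def
      by (rule summable_reflection[OF w, of _ C0]) (use C0(2) th(1)[OF that] in \<open>force simp: th_def\<close>)
    moreover have "reflection_extension a l F x = (\<Sum>j. f j x)"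
      using that by (auto simp: reflection_extension_def f_def th_def S_def)
    ultimately show ?thesis by (simp add: summable_sums)
  qed
  obtain g where g: "\<And>x. x \<in> S \<Longrightarrow> (\<lambda>n. f n x) sums g x \<and> (g has_derivative g' x) (at x within S)"
    using has_derivative_series[OF S(2) der unif S(3) sumf[OF S(3)]] by blast
  have "(g has_derivative g' (z0, s0)) (at (z0, s0))"
    using g[OF S(3)] at_within_open[OF S(3,1)] by simp
  then have "(reflection_extension a l F has_derivative g' (z0, s0)) (at (z0, s0))"
    by (rule has_derivative_transform_within_open[OF _ S(1,3)]) (use g sumf sums_unique2 in blast)
  then show ?thesis by (simp add: g'_def[abs_def] D_def)
qed

text \<open>The evenness relation differentiated: derivatives in the \<open>z\<close>-directions
  stay even, and the \<open>t\<close>-derivative becomes odd.\<close>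

lemma frechet_derivative_even:
  fixes F :: "'z::euclidean_space \<times> real \<Rightarrow> 'c::euclidean_space"
  assumes "open Z" "smooth_on (Z \<times> {-d<..<d}) F"
    and "\<And>z t. z \<in> Z \<Longrightarrow> t \<in> {-d<..<d} \<Longrightarrow> F (z, - t) = F (z, t)" "z \<in> Z" "t \<in> {-d<..<d}"
  shows "frechet_derivative F (at (z, - t)) (v, - s) = frechet_derivative F (at (z, t)) (v, s)"
proof -
  have opU: "open (Z \<times> {-d<..<d})" by (intro open_Times assms(1)) auto
  have "(F has_derivative frechet_derivative F (at (z, - t))) (at (z, - t))"
    by (rule smooth_on_has_derivative[OF opU assms(2)]) (use assms(4,5) in auto)
  moreover have "((\<lambda>x. (fst x, - snd x)) has_derivative (\<lambda>v. (fst v, - snd v))) (at (z, t))"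
    by (auto intro!: derivative_eq_intros)
  ultimately have "((\<lambda>x. F (fst x, - snd x)) has_derivative (\<lambda>v. frechet_derivative F (at (z, - t)) (fst v, - snd v))) (at (z, t))"
    using has_derivative_compose[of "\<lambda>x. (fst x, - snd x)" "\<lambda>v. (fst v, - snd v)" "(z, t)" UNIV F] by simp
  then have "(F has_derivative (\<lambda>v. frechet_derivative F (at (z, - t)) (fst v, - snd v))) (at (z, t))"
  proof (rule has_derivative_transform_within_open[OF _ opU])
    show "(z, t) \<in> Z \<times> {-d<..<d}" using assms(4,5) by simp
    show "F (fst x, - snd x) = F x" if "x \<in> Z \<times> {-d<..<d}" for x
      using assms(3)[of "fst x" "snd x"] that unfolding mem_Times_iff prod.collapse by blast
  qed
  from fun_cong[OF frechet_derivative_at[OF this], of "(v, s)"] show ?thesis by simp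
qed

text \<open>Induction on \<open>k\<close> for all weights and all even functions at once. The
  \<open>z\<close>-derivatives of \<open>F\<close> are even; its \<open>t\<close>-derivative is odd,
  hence \<open>t\<close> times an even function, and together with the derivative factor of the fold
  this gives an even \<open>H\<close> for the shifted weights. For \<open>s \<noteq> 0\<close> the
  derivative is computed directly, at \<open>s = 0\<close> it comes from
  \<open>has_derivative_across_hyperplane\<close>.\<close>

lemma smooth_on_reflection_extension:
  fixes F :: "'z::euclidean_space \<times> real \<Rightarrow> 'c::euclidean_space"
  assumes "reflection_weights a l" and Z: "open Z" and "smooth_on (Z \<times> {-2<..<2}) F"
    and "\<And>z t. z \<in> Z \<Longrightarrow> t \<in> {-2<..<2} \<Longrightarrow> F (z, - t) = F (z, t)"
  shows "Ck_on k (Z \<times> UNIV) (reflection_extension a l F)"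
  using assms(1,3,4)
proof (induction k arbitrary: a F)
  case 0
  then show ?case
    using continuous_on_reflection_extension[OF _ Z smooth_on_imp_continuous_on] by simp
next
  case (Suc k)
  note F = Suc.prems(2) and ev = Suc.prems(3)
  have opU: "open (Z \<times> {-2<..<2::real})" by (intro open_Times Z) auto
  define Fv where "Fv v y = frechet_derivative F (at y) (v, 0)" for v y
  define Ft where "Ft y = frechet_derivative F (at y) (0, 1)" for y
  have smFv: "smooth_on (Z \<times> {-2<..<2}) (Fv v)" and smFt: "smooth_on (Z \<times> {-2<..<2}) Ft" for v
    using smooth_on_frechet_derivative[OF opU F] by (simp_all add: Fv_def[abs_def] Ft_def[abs_def])
  have lin: "linear (frechet_derivative F (at y))" if "y \<in> Z \<times> {-2<..<2}" for y
    using smooth_on_has_derivative[OF opU F that] has_derivative_linear by blast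
  have evFv: "Fv v (z, - t) = Fv v (z, t)" if "z \<in> Z" "t \<in> {-2<..<2}" for v z t
    using frechet_derivative_even[OF Z F ev that, of v 0] by (simp add: Fv_def)
  have oddFt: "Ft (z, - t) = - Ft (z, t)" if "z \<in> Z" "t \<in> {-2<..<2}" for z t
  proof -
    have "frechet_derivative F (at (z, - t)) (- (0, 1)) = frechet_derivative F (at (z, t)) (0, 1)"
      using frechet_derivative_even[OF Z F ev that, of 0 1] by simp
    moreover have "frechet_derivative F (at (z, - t)) (- (0, 1)) = - frechet_derivative F (at (z, - t)) (0, 1)"
      by (rule linear_neg[OF lin]) (use that in auto)
    ultimately show ?thesis by (simp add: Ft_def minus_equation_iff)
  qed
  have Ft0: "Ft (z, 0) = 0" if "z \<in> Z" for z
    using oddFt[OF that, of 0] by (simp add: eq_neg_iff_add_eq_0 scaleR_2[symmetric])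
  obtain K where K: "smooth_on (Z \<times> {-2<..<2}) K"
    "\<And>z t. z \<in> Z \<Longrightarrow> t \<in> {-2<..<2} \<Longrightarrow> Ft (z, t) = t *\<^sub>R K (z, t)"
    using smooth_on_divide_coordinate[OF Z smFt Ft0] by blast
  \<comment> \<open>This is \<open>(1 - t\<^sup>2)\<^sup>2 / (2 * t)\<close> times the odd
    derivative \<open>Ft\<close>, with the \<open>t\<close> already cancelled.\<close>
  define H where "H y = ((1 - (snd y)\<^sup>2)\<^sup>2 / 2) *\<^sub>R K y" for y
  have smH: "smooth_on (Z \<times> {-2<..<2}) H"
    unfolding H_def divide_inverse by (intro smooth_on_intros K)
  have evH: "H (z, - t) = H (z, t)" if "z \<in> Z" "t \<in> {-2<..<2}" for z t
  proof -
    have "- t \<in> {-2<..<2}" using that(2) by auto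
    from K(2)[OF that(1) this] have "t *\<^sub>R K (z, - t) = t *\<^sub>R K (z, t)"
      using oddFt[OF that] K(2)[OF that] by (metis minus_equation_iff scaleR_minus_left)
    then show ?thesis by (cases "t = 0") (auto simp: H_def)
  qed
  have FH: "2 *\<^sub>R t *\<^sub>R H (z, t) = (1 - t\<^sup>2)\<^sup>2 *\<^sub>R frechet_derivative F (at (z, t)) (0, 1)"
    if "z \<in> Z" "t \<in> {0<..<1}" for z t
    using K(2)[OF that(1), of t] that(2) by (simp add: H_def Ft_def)
  note w' = reflection_weights_shift[OF Suc.prems(1)]
  define D where "D x v = reflection_extension a l (Fv (fst v)) x
    + snd v *\<^sub>R reflection_extension (\<lambda>j. - l j * a j) l H x" for x v
  have CkD: "Ck_on k (Z \<times> UNIV) (\<lambda>x. D x v)" for v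
    unfolding D_def
    by (intro Ck_on_add Ck_on_bilinear[OF bounded_bilinear_scaleR] Ck_on_const open_Times Z open_UNIV
        Suc.IH Suc.prems(1) w' smFv smH evFv evH)
  have contD: "continuous_on (Z \<times> UNIV) (\<lambda>x. D x v)" for v
    unfolding D_def
    by (intro continuous_intros continuous_on_reflection_extension Suc.prems(1) w' Z
        smooth_on_imp_continuous_on smFv smH)
  have der: "(reflection_extension a l F has_derivative D x) (at x)" if "x \<in> Z \<times> UNIV" "snd x \<noteq> 0" for x
  proof (cases "snd x < 0")
    case True
    have "(reflection_extension a l F has_derivative
        (\<lambda>v. reflection_extension a l (\<lambda>y. frechet_derivative F (at y) (fst v, 0)) (fst x, snd x) +
         snd v *\<^sub>R reflection_extension (\<lambda>j. - l j * a j) l H (fst x, snd x))) (at (fst x, snd x))"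
      by (rule has_derivative_reflection_extension_neg[OF Suc.prems(1) Z F smooth_on_imp_continuous_on[OF smH] FH])
        (use that True in auto)
    then show ?thesis by (simp add: D_def[abs_def] Fv_def[abs_def])
  next
    case False
    then have sp: "0 < snd x" using that(2) by auto
    have xZ: "fst x \<in> Z" using that by auto
    have "((\<lambda>x. F (fst x, half_line_fold (snd x))) has_derivative
      (\<lambda>v. frechet_derivative F (at (fst x, half_line_fold (snd x))) (fst v, 0) + snd v *\<^sub>R H (fst x, half_line_fold (snd x))))
      (at (fst x, snd x))"
      by (rule has_derivative_fold[OF Z F xZ sp], rule FH[OF xZ])
        (use sp half_line_fold_pos half_line_fold_bounds in auto)
    then have "((\<lambda>x. F (fst x, half_line_fold (snd x))) has_derivative D x) (at x)"
      using sp by (simp add: D_def[abs_def] Fv_def[abs_def] reflection_extension_def)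
    then show ?thesis
      by (rule has_derivative_transform_within_open[of _ _ _ _ "UNIV \<times> {0<..}"])
        (use sp in \<open>auto simp: reflection_extension_def intro!: open_Times\<close>, metis mem_Times_iff UNIV_I greaterThan_iff)
  qed
  have linDx: "linear (D x)" if "x \<in> Z \<times> UNIV" for x
  proof (cases "snd x = 0")
    case False
    then show ?thesis using der[OF that] has_derivative_linear by blast
  next
    case True
    then have "D x v = frechet_derivative F (at (fst x, 0)) (fst v, 0) + snd v *\<^sub>R H (fst x, 0)" for v
      by (simp add: D_def Fv_def reflection_extension_def)
    moreover have "linear (\<lambda>v. frechet_derivative F (at (fst x, 0)) (fst v, 0) + snd v *\<^sub>R H (fst x, 0))"
    proof (intro linear_compose_add)
      have "linear (frechet_derivative F (at (fst x, 0)))" by (rule lin) (use that in auto)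
      from linear_compose[OF _ this, of "\<lambda>v :: 'z \<times> real. (fst v, 0)"]
      show "linear (\<lambda>v :: 'z \<times> real. frechet_derivative F (at (fst x, 0)) (fst v, 0))"
        by (simp add: o_def linear_iff)
      show "linear (\<lambda>v :: 'z \<times> real. snd v *\<^sub>R H (fst x, 0))" by (rule linearI) (auto simp: algebra_simps)
    qed
    ultimately show ?thesis by presburger
  qed
  have opZ: "open (Z \<times> (UNIV :: real set))" by (intro open_Times Z) auto
  show ?case
  proof (rule Ck_on_SucI[OF opZ _ CkD])
    show "(reflection_extension a l F has_derivative D x) (at x)" if "x \<in> Z \<times> UNIV" for x
      by (rule has_derivative_across_hyperplane[OF opZ _ der contD linDx that])
        (rule continuous_on_reflection_extension[OF Suc.prems(1) Z smooth_on_imp_continuous_on[OF F]])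
  qed
qed

text \<open>Whitney's theorem on even functions.\<close>

theorem smooth_on_even_sqrt:
  fixes f :: "'z::euclidean_space \<times> real \<Rightarrow> 'c::euclidean_space"
  assumes Z: "open Z" and d: "0 < d" and f: "smooth_on (Z \<times> {-d<..<d}) f"
    and ev: "\<And>z t. z \<in> Z \<Longrightarrow> t \<in> {-d<..<d} \<Longrightarrow> f (z, - t) = f (z, t)"
  shows "smooth_on (Z \<times> {0..<(d / 2)\<^sup>2}) (\<lambda>x. f (fst x, sqrt (snd x)))"
proof -
  \<comment> \<open>Rescaling by \<open>d / 2\<close> brings the strip to the standard interval
    \<open>(-2, 2)\<close>.\<close>
  define c where "c = d / 2"
  have c: "c > 0" using d by (simp add: c_def)
  define F where "F y = f (fst y, c * snd y)" for y
  have cd: "c * t \<in> {-d<..<d}" if "t \<in> {-2<..<2}" for t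
  proof -
    have "\<bar>c * t\<bar> < c * 2" using that c mult_strict_left_mono[of "\<bar>t\<bar>" 2 c] by (auto simp: abs_mult)
    then show ?thesis by (auto simp: c_def)
  qed
  obtain a l where w: "reflection_weights a l" using exists_reflection_weights by blast
  have "smooth_on (Z \<times> UNIV) (reflection_extension a l F)"
  proof -
    have "smooth_on (Z \<times> {-2<..<2}) F"
      unfolding F_def by (rule smooth_on_compose'[OF f]) (use cd in \<open>auto intro!: smooth_on_intros\<close>)
    moreover have "F (z, - t) = F (z, t)" if "z \<in> Z" "t \<in> {-2<..<2}" for z t
      using ev[OF that(1) cd[OF that(2)]] by (simp add: F_def)
    moreover have "open (Z \<times> (UNIV::real set))" by (intro open_Times Z) auto
    ultimately show ?thesis using smooth_on_reflection_extension[OF w Z] smooth_on_open_iff by blast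
  qed
  \<comment> \<open>The map \<open>s / (c\<^sup>2 - s)\<close> undoes the fold:
    \<open>half_line_fold\<close> sends it to \<open>sqrt s / c\<close>. It has its pole at
    \<open>s = c\<^sup>2\<close>, whence the range \<open>s < (d / 2)\<^sup>2\<close>.\<close>
  moreover have "smooth_on (Z \<times> {0..<c\<^sup>2}) (\<lambda>x. (fst x, snd x / (c\<^sup>2 - snd x)))"
    by (intro smooth_on_intros smooth_on_divide) auto
  ultimately have "smooth_on (Z \<times> {0..<c\<^sup>2}) (\<lambda>x. reflection_extension a l F (fst x, snd x / (c\<^sup>2 - snd x)))"
    by (rule smooth_on_compose') auto
  moreover have "reflection_extension a l F (fst x, snd x / (c\<^sup>2 - snd x)) = f (fst x, sqrt (snd x))"
    if "x \<in> Z \<times> {0..<c\<^sup>2}" for x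
  proof -
    define s where "s = snd x"
    have s: "0 \<le> s" "s < c\<^sup>2" using that by (auto simp: s_def)
    then have "1 + s / (c\<^sup>2 - s) = c\<^sup>2 / (c\<^sup>2 - s)" by (simp add: field_simps)
    then have "s / (c\<^sup>2 - s) / (1 + s / (c\<^sup>2 - s)) = s / c\<^sup>2" using s by simp
    then have "half_line_fold (s / (c\<^sup>2 - s)) = sqrt (s / c\<^sup>2)"
      by (simp only: half_line_fold_def)
    then have "c * half_line_fold (s / (c\<^sup>2 - s)) = sqrt s"
      using c by (simp add: real_sqrt_divide)
    then show ?thesis using s by (simp add: reflection_extension_def F_def s_def[symmetric])
  qed
  ultimately show ?thesis unfolding c_def by (rule smooth_on_cong)
qed

section \<open>Smooth maps into and out of manifolds\<close>

text \<open>This is what lets a chart be inserted between two maps; it passes to products, open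
  submanifolds and the blowups.\<close>

definition charted :: "('p, 'a::euclidean_space) mfd \<Rightarrow> bool" where
  "charted M \<longleftrightarrow> points M = (\<Union>(U, c)\<in>atlas M. U) \<and>
     (\<forall>(U, c)\<in>atlas M. openin (mtop M) U \<and>
        homeomorphic_map (subtopology (mtop M) U) (top_of_set (c ` U)) c)"

lemma manifold_with_boundary_imp_charted: "manifold_with_boundary M \<Longrightarrow> charted M"
  unfolding manifold_with_boundary_def charted_def is_chart_def by blast

lemma manifold_imp_charted: "manifold M \<Longrightarrow> charted M"
  by (simp add: manifold_def manifold_with_boundary_imp_charted)

lemma homeomorphic_map_chart:
  assumes "openin (mtop M) U" "homeomorphic_map (subtopology (mtop M) U) (top_of_set (c ` U)) c"
  shows "inj_on c U" "U \<subseteq> points M"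
    "continuous_map (top_of_set (c ` U)) (mtop M) (inv_into U c)"
    "continuous_map (subtopology (mtop M) U) (top_of_set (c ` U)) c"
proof -
  show sub: "U \<subseteq> points M" using assms(1) openin_subset by blast
  show inj: "inj_on c U"
    using homeomorphic_imp_injective_map[OF assms(2)] sub by (simp add: Int_absorb1)
  show cc: "continuous_map (subtopology (mtop M) U) (top_of_set (c ` U)) c"
    using assms(2) homeomorphic_imp_continuous_map by blast
  obtain g where g: "homeomorphic_maps (subtopology (mtop M) U) (top_of_set (c ` U)) c g"
    using assms(2) homeomorphic_map_maps by blast
  have "continuous_map (top_of_set (c ` U)) (mtop M) g"
    using g by (simp add: homeomorphic_maps_def continuous_map_in_subtopology)
  moreover have "g x = inv_into U c x" if x: "x \<in> topspace (top_of_set (c ` U))" for x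
  proof -
    obtain p where p: "p \<in> U" "x = c p" using x by auto
    then have "g (c p) = p" using g sub by (auto simp: homeomorphic_maps_def)
    then show ?thesis using p inj by simp
  qed
  ultimately show "continuous_map (top_of_set (c ` U)) (mtop M) (inv_into U c)"
    by (rule continuous_map_eq)
qed

lemma chartedD:
  assumes "charted M" "(U, c) \<in> atlas M"
  shows "openin (mtop M) U" "inj_on c U" "U \<subseteq> points M"
    "continuous_map (top_of_set (c ` U)) (mtop M) (inv_into U c)"
    "continuous_map (subtopology (mtop M) U) (top_of_set (c ` U)) c"
proof -
  have *: "openin (mtop M) U" "homeomorphic_map (subtopology (mtop M) U) (top_of_set (c ` U)) c"
    using assms unfolding charted_def by auto
  show "openin (mtop M) U" by (rule *(1))
  show "inj_on c U" "U \<subseteq> points M"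
    "continuous_map (top_of_set (c ` U)) (mtop M) (inv_into U c)"
    "continuous_map (subtopology (mtop M) U) (top_of_set (c ` U)) c"
    using homeomorphic_map_chart[OF *] by blast+
qed

lemma charted_cover:
  assumes "charted M" "p \<in> points M"
  obtains U c where "(U, c) \<in> atlas M" "p \<in> U"
  using assms unfolding charted_def by auto

text \<open>Parametrizations of a manifold by a Euclidean set, and in \<open>smooth_to\<close>
  coordinate functions on it. Composites of the two are ordinary smooth maps, so constructions can
  be made with them and converted to \<open>smooth_map\<close> at the end.\<close>

definition smooth_into :: "'x::euclidean_space set \<Rightarrow> ('p, 'a::euclidean_space) mfd \<Rightarrow> ('x \<Rightarrow> 'p) \<Rightarrow> bool" where
  "smooth_into X M g \<longleftrightarrow> continuous_map (top_of_set X) (mtop M) g \<and>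
     (\<forall>(U, c)\<in>atlas M. smooth_on {x \<in> X. g x \<in> U} (\<lambda>x. c (g x)))"

definition smooth_to :: "('p, 'a::euclidean_space) mfd \<Rightarrow> 'p set \<Rightarrow> ('p \<Rightarrow> 'x::euclidean_space) \<Rightarrow> bool" where
  "smooth_to M A f \<longleftrightarrow> openin (mtop M) A \<and>
     (\<forall>(U, c)\<in>atlas M. smooth_on (c ` (U \<inter> A)) (\<lambda>x. f (inv_into U c x)))"

lemma smooth_intoD:
  assumes "smooth_into X M g"
  shows "continuous_map (top_of_set X) (mtop M) g"
    "(U, c) \<in> atlas M \<Longrightarrow> smooth_on {x \<in> X. g x \<in> U} (\<lambda>x. c (g x))"
    "x \<in> X \<Longrightarrow> g x \<in> points M"
  using assms continuous_map_image_subset_topspace[of "top_of_set X" "mtop M" g]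
  unfolding smooth_into_def by auto

lemma smooth_intoI:
  assumes "continuous_map (top_of_set X) (mtop M) g"
    "\<And>U c. (U, c) \<in> atlas M \<Longrightarrow> smooth_on {x \<in> X. g x \<in> U} (\<lambda>x. c (g x))"
  shows "smooth_into X M g"
  using assms unfolding smooth_into_def by auto

lemma smooth_toD:
  assumes "smooth_to M A f"
  shows "openin (mtop M) A"
    "(U, c) \<in> atlas M \<Longrightarrow> smooth_on (c ` (U \<inter> A)) (\<lambda>x. f (inv_into U c x))"
  using assms unfolding smooth_to_def by auto

lemma smooth_toI:
  assumes "openin (mtop M) A"
    "\<And>U c. (U, c) \<in> atlas M \<Longrightarrow> smooth_on (c ` (U \<inter> A)) (\<lambda>x. f (inv_into U c x))"
  shows "smooth_to M A f"
  using assms unfolding smooth_to_def by auto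

lemma continuous_map_openin_preimage:
  assumes "continuous_map (top_of_set X) T g" "openin T U"
  obtains V where "open V" "{x \<in> X. g x \<in> U} = X \<inter> V"
proof -
  have "openin (top_of_set X) {x \<in> X. g x \<in> U}"
    using openin_continuous_map_preimage[OF assms] by simp
  then show ?thesis using that by (auto simp: openin_open)
qed

lemma smooth_into_subset:
  assumes "smooth_into X M g" "Y \<subseteq> X"
  shows "smooth_into Y M g"
proof (rule smooth_intoI)
  show "continuous_map (top_of_set Y) (mtop M) g"
    using continuous_map_from_subtopology_mono[OF smooth_intoD(1)[OF assms(1)] assms(2)] .
  show "smooth_on {x \<in> Y. g x \<in> U} (\<lambda>x. c (g x))" if "(U, c) \<in> atlas M" for U c
    by (rule smooth_on_subset[OF smooth_intoD(2)[OF assms(1) that]]) (use assms(2) in auto)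
qed

lemma smooth_into_cong:
  assumes "smooth_into X M g" "\<And>x. x \<in> X \<Longrightarrow> g x = h x"
  shows "smooth_into X M h"
proof (rule smooth_intoI)
  show "continuous_map (top_of_set X) (mtop M) h"
    using continuous_map_eq[OF smooth_intoD(1)[OF assms(1)]] assms(2) by simp
  show "smooth_on {x \<in> X. h x \<in> U} (\<lambda>x. c (h x))" if "(U, c) \<in> atlas M" for U c
    by (rule smooth_on_cong_subset[OF smooth_intoD(2)[OF assms(1) that]]) (use assms(2) in auto)
qed

lemma continuous_map_top_of_set_local:
  assumes "\<And>x. x \<in> X \<Longrightarrow> \<exists>V. open V \<and> x \<in> V \<and> continuous_map (top_of_set (X \<inter> V)) T g"
  shows "continuous_map (top_of_set X) T g"
proof -
  show ?thesis
    unfolding continuous_map_def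
  proof (intro conjI allI impI)
    have "g x \<in> topspace T" if "x \<in> X" for x
    proof -
      obtain V where "open V" "x \<in> V" "continuous_map (top_of_set (X \<inter> V)) T g" using assms[OF \<open>x \<in> X\<close>] by blast
      then show ?thesis using \<open>x \<in> X\<close> continuous_map_image_subset_topspace[of "top_of_set (X \<inter> V)" T g] by auto
    qed
    then show "g \<in> topspace (top_of_set X) \<rightarrow> topspace T" by auto
    fix U assume U: "openin T U"
    have "openin (top_of_set X) {x \<in> X. g x \<in> U}"
    proof (subst openin_subopen, intro ballI)
      fix x assume x: "x \<in> {x \<in> X. g x \<in> U}"
      then obtain V where V: "open V" "x \<in> V" "continuous_map (top_of_set (X \<inter> V)) T g" using assms by blast
      have "openin (top_of_set (X \<inter> V)) {x \<in> X \<inter> V. g x \<in> U}"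
        using openin_continuous_map_preimage[OF V(3) U] by simp
      moreover have "openin (top_of_set X) (X \<inter> V)" using V(1) by (simp add: openin_open_Int)
      ultimately have "openin (top_of_set X) {x \<in> X \<inter> V. g x \<in> U}" by (rule openin_trans)
      then show "\<exists>W. openin (top_of_set X) W \<and> x \<in> W \<and> W \<subseteq> {x \<in> X. g x \<in> U}"
        using x V(2) by (intro exI[of _ "{x \<in> X \<inter> V. g x \<in> U}"]) auto
    qed
    then show "openin (top_of_set X) {x \<in> topspace (top_of_set X). g x \<in> U}" by simp
  qed
qed

lemma smooth_into_local:
  assumes "\<And>x. x \<in> X \<Longrightarrow> \<exists>V. open V \<and> x \<in> V \<and> smooth_into (X \<inter> V) M g"
  shows "smooth_into X M g"
proof (rule smooth_intoI)
  show "continuous_map (top_of_set X) (mtop M) g"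
    by (rule continuous_map_top_of_set_local) (use assms smooth_intoD(1) in blast)
  fix U c assume c: "(U, c) \<in> atlas M"
  show "smooth_on {x \<in> X. g x \<in> U} (\<lambda>x. c (g x))"
  proof (rule smooth_on_local)
    fix x assume "x \<in> {x \<in> X. g x \<in> U}"
    then obtain V where V: "open V" "x \<in> V" "smooth_into (X \<inter> V) M g" using assms by blast
    have "{x \<in> X. g x \<in> U} \<inter> V = {x \<in> X \<inter> V. g x \<in> U}" by auto
    then show "\<exists>V. open V \<and> x \<in> V \<and> smooth_on ({x \<in> X. g x \<in> U} \<inter> V) (\<lambda>x. c (g x))"
      using V smooth_intoD(2)[OF V(3) c] by (intro exI[of _ V]) simp
  qed
qed

lemma smooth_into_compose_smooth_on:
  assumes "smooth_into X M g" "smooth_on Y h" "\<And>y. y \<in> Y \<Longrightarrow> h y \<in> X"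
  shows "smooth_into Y M (\<lambda>y. g (h y))"
proof (rule smooth_intoI)
  have "continuous_map (top_of_set Y) (top_of_set X) h"
    using smooth_on_imp_continuous_on[OF assms(2)] assms(3) by auto
  from continuous_map_compose[OF this smooth_intoD(1)[OF assms(1)]]
  show "continuous_map (top_of_set Y) (mtop M) (\<lambda>y. g (h y))" by (simp add: o_def)
  show "smooth_on {y \<in> Y. g (h y) \<in> U} (\<lambda>y. c (g (h y)))" if "(U, c) \<in> atlas M" for U c
    by (rule smooth_on_compose'[OF smooth_intoD(2)[OF assms(1) that] smooth_on_subset[OF assms(2)]])
      (use assms(3) in auto)
qed

text \<open>Inserting a chart between \<open>g\<close> and \<open>f\<close> splits the composite,
  near each point, into two maps that are smooth by definition.\<close>

lemma smooth_on_smooth_to_compose: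
  assumes "charted M" "smooth_to M A f" "smooth_into X M g" "\<And>x. x \<in> X \<Longrightarrow> g x \<in> A"
  shows "smooth_on X (\<lambda>x. f (g x))"
proof (rule smooth_on_local)
  fix x assume x: "x \<in> X"
  obtain U c where c: "(U, c) \<in> atlas M" "g x \<in> U"
    using charted_cover[OF assms(1) smooth_intoD(3)[OF assms(3) x]] by blast
  obtain V where V: "open V" "{x \<in> X. g x \<in> U} = X \<inter> V"
    by (rule continuous_map_openin_preimage[OF smooth_intoD(1)[OF assms(3)] chartedD(1)[OF assms(1) c(1)]])
  have "smooth_on (X \<inter> V) (\<lambda>x. f (inv_into U c (c (g x))))"
    by (rule smooth_on_compose'[OF smooth_toD(2)[OF assms(2) c(1)] smooth_intoD(2)[OF assms(3) c(1), unfolded V(2)]])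
      (use V(2) assms(4) in auto)
  then have "smooth_on (X \<inter> V) (\<lambda>x. f (g x))"
  proof (rule smooth_on_cong)
    fix x assume "x \<in> X \<inter> V"
    then have "g x \<in> U" using V(2) by blast
    then show "f (inv_into U c (c (g x))) = f (g x)" by (simp add: inv_into_f_f[OF chartedD(2)[OF assms(1) c(1)]])
  qed
  then show "\<exists>V. open V \<and> x \<in> V \<and> smooth_on (X \<inter> V) (\<lambda>x. f (g x))"
    using V x c(2) by blast
qed

lemma smooth_into_smooth_map_compose:
  assumes "charted M" "charted N" "smooth_map M N f" "smooth_into X M g"
  shows "smooth_into X N (\<lambda>x. f (g x))"
proof (rule smooth_intoI)
  have cf: "continuous_map (mtop M) (mtop N) f" using assms(3) by (simp add: smooth_map_def)
  from continuous_map_compose[OF smooth_intoD(1)[OF assms(4)] cf]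
  show "continuous_map (top_of_set X) (mtop N) (\<lambda>x. f (g x))" by (simp add: o_def)
  fix U c assume c: "(U, c) \<in> atlas N"
  have "smooth_to M {p \<in> points M. f p \<in> U} (\<lambda>p. c (f p))"
  proof (rule smooth_toI)
    show "openin (mtop M) {p \<in> points M. f p \<in> U}"
      by (rule openin_continuous_map_preimage[OF cf chartedD(1)[OF assms(2) c]])
    fix U' c' assume c': "(U', c') \<in> atlas M"
    have "U' \<inter> {p \<in> points M. f p \<in> U} = {p \<in> U'. f p \<in> U}" using chartedD(3)[OF assms(1) c'] by auto
    moreover have "smooth_on (c' ` {p \<in> U'. f p \<in> U}) (c \<circ> f \<circ> inv_into U' c')"
      using assms(3) c c' unfolding smooth_map_def by auto
    ultimately show "smooth_on (c' ` (U' \<inter> {p \<in> points M. f p \<in> U})) (\<lambda>x. c (f (inv_into U' c' x)))"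
      by (simp add: o_def)
  qed
  show "smooth_on {x \<in> X. f (g x) \<in> U} (\<lambda>x. c (f (g x)))"
    by (rule smooth_on_smooth_to_compose[OF assms(1) \<open>smooth_to M _ _\<close> smooth_into_subset[OF assms(4)]])
      (use smooth_intoD(3)[OF assms(4)] in auto)
qed

lemma smooth_mapI:
  assumes "charted M" "\<And>U c. (U, c) \<in> atlas M \<Longrightarrow> smooth_into (c ` U) N (\<lambda>x. f (inv_into U c x))"
  shows "smooth_map M N f"
proof -
  have "continuous_map (mtop M) (mtop N) f"
  proof (rule pasting_lemma[of "atlas M" "mtop M" fst "mtop N" "\<lambda>_. f"])
    fix i assume i: "i \<in> atlas M"
    obtain U c where Uc: "i = (U, c)" by (cases i)
    note c = i[unfolded Uc]
    show "openin (mtop M) (fst i)" using chartedD(1)[OF assms(1) c] Uc by simp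
    have "continuous_map (subtopology (mtop M) U) (mtop N) ((\<lambda>x. f (inv_into U c x)) \<circ> c)"
      by (rule continuous_map_compose[OF chartedD(5)[OF assms(1) c] smooth_intoD(1)[OF assms(2)[OF c]]])
    then have "continuous_map (subtopology (mtop M) U) (mtop N) f"
      by (rule continuous_map_eq) (use chartedD(2,3)[OF assms(1) c] in \<open>auto simp: inv_into_f_f\<close>)
    then show "continuous_map (subtopology (mtop M) (fst i)) (mtop N) f" using Uc by simp
  next
    fix x assume "x \<in> points M"
    then show "\<exists>i. i \<in> atlas M \<and> x \<in> fst i \<and> f x = f x"
      using charted_cover[OF assms(1)] by (metis fst_conv)
  qed simp
  moreover have "smooth_on (c ` {p \<in> U. f p \<in> U'}) (c' \<circ> f \<circ> inv_into U c)"
    if "(U, c) \<in> atlas M" "(U', c') \<in> atlas N" for U c U' c'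
  proof -
    have inj: "inj_on c U" using chartedD(2)[OF assms(1) that(1)] .
    have "{x \<in> c ` U. f (inv_into U c x) \<in> U'} = c ` {p \<in> U. f p \<in> U'}"
      using inj by (auto simp: inv_into_f_f)
    then show ?thesis
      using smooth_intoD(2)[OF assms(2)[OF that(1)] that(2)] by (simp add: o_def)
  qed
  ultimately show ?thesis unfolding smooth_map_def by auto
qed

text \<open>Compatibility with the atlas says precisely that the inverse is a parametrization and
  the chart itself a coordinate function.\<close>

lemma smooth_into_maximal_chart:
  assumes "charted M" "(U, c) \<in> maximal_atlas M"
  shows "smooth_into (c ` U) M (inv_into U c)" "smooth_to M U c" "inj_on c U" "openin (mtop M) U"
proof -
  have ch: "openin (mtop M) U" "homeomorphic_map (subtopology (mtop M) U) (top_of_set (c ` U)) c"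
    and co: "\<And>U' c'. (U', c') \<in> atlas M \<Longrightarrow> compatible U c U' c'"
    using assms(2) unfolding maximal_atlas_def is_chart_def by auto
  show inj: "inj_on c U" and op: "openin (mtop M) U" using homeomorphic_map_chart[OF ch] ch(1) by auto
  show "smooth_into (c ` U) M (inv_into U c)"
  proof (rule smooth_intoI)
    show "continuous_map (top_of_set (c ` U)) (mtop M) (inv_into U c)" using homeomorphic_map_chart[OF ch] by auto
    fix U' c' assume c': "(U', c') \<in> atlas M"
    have "{x \<in> c ` U. inv_into U c x \<in> U'} = c ` (U \<inter> U')" using inj by (auto simp: inv_into_f_f)
    then show "smooth_on {x \<in> c ` U. inv_into U c x \<in> U'} (\<lambda>x. c' (inv_into U c x))"
      using co[OF c'] by (simp add: compatible_def o_def)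
  qed
  show "smooth_to M U c"
  proof (rule smooth_toI[OF op])
    fix U' c' assume c': "(U', c') \<in> atlas M"
    have "U \<inter> U' = U' \<inter> U" by blast
    then show "smooth_on (c' ` (U' \<inter> U)) (\<lambda>x. c (inv_into U' c' x))"
      using co[OF c'] by (simp add: compatible_def o_def)
  qed
qed

text \<open>The way in which a map \<open>c\<close> with explicit inverse \<open>d\<close> is
  recognized as a chart: compatibility with a given chart is the smoothness of \<open>c\<close> and
  \<open>d\<close> read in that chart.\<close>

lemma maximal_atlasI:
  assumes "charted M" "smooth_to M A c" "smooth_into X M d"
    and "\<And>p. p \<in> A \<Longrightarrow> c p \<in> X \<and> d (c p) = p" "\<And>x. x \<in> X \<Longrightarrow> d x \<in> A \<and> c (d x) = x"
    and "continuous_map (subtopology (mtop M) A) euclidean c"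
    and "subspace V" "openin (top_of_set V) X"
  shows "(A, c) \<in> maximal_atlas M"
proof -
  have op: "openin (mtop M) A" by (rule smooth_toD(1)[OF assms(2)])
  have sub: "A \<subseteq> points M" using op openin_subset by blast
  have im: "c ` A = X" using assms(4,5) by force
  have inj: "inj_on c A" by (rule inj_on_inverseI[of _ d]) (use assms(4) in blast)
  have inv: "inv_into A c x = d x" if "x \<in> X" for x
    using inv_into_f_f[OF inj, of "d x"] assms(5)[OF that] by auto
  have "homeomorphic_maps (subtopology (mtop M) A) (top_of_set X) c d"
    unfolding homeomorphic_maps_def
  proof (intro conjI ballI)
    show "continuous_map (subtopology (mtop M) A) (top_of_set X) c"
      using assms(4,6) sub by (auto simp: continuous_map_in_subtopology)
    show "continuous_map (top_of_set X) (subtopology (mtop M) A) d"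
      using smooth_intoD(1)[OF assms(3)] assms(5) by (auto simp: continuous_map_in_subtopology)
  qed (use assms(4,5) sub in auto)
  then have "homeomorphic_map (subtopology (mtop M) A) (top_of_set (c ` A)) c"
    unfolding im using homeomorphic_map_maps by blast
  then have "is_chart M A c" unfolding is_chart_def im using op assms(7,8) by blast
  moreover have "compatible A c U' c'" if c': "(U', c') \<in> atlas M" for U' c'
  proof -
    have eq: "{x \<in> X. d x \<in> U'} = c ` (A \<inter> U')" using assms(4,5) by force
    have "smooth_on (c ` (A \<inter> U')) (\<lambda>x. c' (inv_into A c x))"
      by (rule smooth_on_cong[OF smooth_intoD(2)[OF assms(3) c', unfolded eq]]) (use inv assms(4) in auto)
    moreover have "smooth_on (c' ` (A \<inter> U')) (\<lambda>x. c (inv_into U' c' x))"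
      using smooth_toD(2)[OF assms(2) c'] by (simp add: Int_commute)
    ultimately show ?thesis by (simp add: compatible_def o_def)
  qed
  ultimately show ?thesis unfolding maximal_atlas_def by auto
qed

lemma atlas_subset_maximal_atlas: "manifold_with_boundary M \<Longrightarrow> atlas M \<subseteq> maximal_atlas M"
  unfolding manifold_with_boundary_def maximal_atlas_def by auto

lemma continuous_map_smooth_to:
  assumes "charted M" "smooth_to M A f"
  shows "continuous_map (subtopology (mtop M) A) euclidean f"
proof -
  have sub: "A \<subseteq> points M" using smooth_toD(1)[OF assms(2)] openin_subset by blast
  show ?thesis
  proof (rule pasting_lemma[of "atlas M" _ "\<lambda>i. A \<inter> fst i" _ "\<lambda>_. f"])
    fix i assume i: "i \<in> atlas M"
    obtain U c where Uc: "i = (U, c)" by (cases i)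
    note c = i[unfolded Uc]
    show "openin (subtopology (mtop M) A) (A \<inter> fst i)"
      using chartedD(1)[OF assms(1) c] Uc by (simp add: openin_subtopology_Int2)
    have eq: "subtopology (subtopology (mtop M) A) (A \<inter> U) = subtopology (mtop M) (A \<inter> U)"
      by (simp add: subtopology_subtopology inf.assoc[symmetric])
    have "continuous_map (subtopology (mtop M) (A \<inter> U)) (top_of_set (c ` (U \<inter> A))) c"
      using continuous_map_from_subtopology_mono[OF chartedD(5)[OF assms(1) c], of "A \<inter> U"]
      by (auto simp: continuous_map_in_subtopology)
    from continuous_map_compose[OF this, of euclidean "\<lambda>x. f (inv_into U c x)"]
    have "continuous_map (subtopology (mtop M) (A \<inter> U)) euclidean ((\<lambda>x. f (inv_into U c x)) \<circ> c)"
      using smooth_on_imp_continuous_on[OF smooth_toD(2)[OF assms(2) c]] by simp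
    then have "continuous_map (subtopology (mtop M) (A \<inter> U)) euclidean f"
      by (rule continuous_map_eq) (use chartedD(2)[OF assms(1) c] in \<open>auto simp: inv_into_f_f\<close>)
    then show "continuous_map (subtopology (subtopology (mtop M) A) (A \<inter> fst i)) euclidean f" using Uc eq by simp
  next
    fix x assume "x \<in> topspace (subtopology (mtop M) A)"
    then show "\<exists>i. i \<in> atlas M \<and> x \<in> A \<inter> fst i \<and> f x = f x"
      using charted_cover[OF assms(1)] by (metis IntI fst_conv topspace_subtopology IntD1 IntD2)
  qed simp
qed

lemma smooth_to_subset:
  assumes "smooth_to M A f" "openin (mtop M) B" "B \<subseteq> A"
  shows "smooth_to M B f"
proof (rule smooth_toI[OF assms(2)])
  show "smooth_on (c ` (U \<inter> B)) (\<lambda>x. f (inv_into U c x))" if "(U, c) \<in> atlas M" for U c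
    by (rule smooth_on_subset[OF smooth_toD(2)[OF assms(1) that]]) (use assms(3) in auto)
qed

lemma smooth_to_compose_smooth_on:
  assumes "charted M" "smooth_to M A f" "smooth_on Y h" "\<And>p. p \<in> A \<Longrightarrow> f p \<in> Y"
  shows "smooth_to M A (\<lambda>p. h (f p))"
proof (rule smooth_toI[OF smooth_toD(1)[OF assms(2)]])
  show "smooth_on (c ` (U \<inter> A)) (\<lambda>x. h (f (inv_into U c x)))" if c: "(U, c) \<in> atlas M" for U c
    by (rule smooth_on_compose'[OF assms(3) smooth_toD(2)[OF assms(2) c]])
      (use chartedD(2)[OF assms(1) c] assms(4) in \<open>auto simp: inv_into_f_f\<close>)
qed

lemma smooth_to_Pair:
  assumes "smooth_to M A f" "smooth_to M A g"
  shows "smooth_to M A (\<lambda>p. (f p, g p))"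
  by (rule smooth_toI[OF smooth_toD(1)[OF assms(1)]])
    (auto intro: smooth_on_Pair smooth_toD(2)[OF assms(1)] smooth_toD(2)[OF assms(2)])

lemma smooth_to_local:
  assumes "openin (mtop M) A" "charted M"
    and "\<And>p. p \<in> A \<Longrightarrow> \<exists>B. p \<in> B \<and> B \<subseteq> A \<and> smooth_to M B f"
  shows "smooth_to M A f"
proof (rule smooth_toI[OF assms(1)])
  fix U c assume c: "(U, c) \<in> atlas M"
  note inj = chartedD(2)[OF assms(2) c]
  show "smooth_on (c ` (U \<inter> A)) (\<lambda>x. f (inv_into U c x))"
  proof (rule smooth_on_local)
    fix x assume "x \<in> c ` (U \<inter> A)"
    then obtain p where p: "p \<in> U" "p \<in> A" "x = c p" by auto
    obtain B where B: "p \<in> B" "B \<subseteq> A" "smooth_to M B f" using assms(3)[OF p(2)] by blast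
    obtain V where V: "open V" "{x \<in> c ` U. inv_into U c x \<in> B} = c ` U \<inter> V"
      by (rule continuous_map_openin_preimage[OF chartedD(4)[OF assms(2) c] smooth_toD(1)[OF B(3)]])
    have "{x \<in> c ` U. inv_into U c x \<in> B} = c ` (U \<inter> B)" using inj by (auto simp: inv_into_f_f)
    then have eq: "c ` (U \<inter> A) \<inter> V = c ` (U \<inter> B)" using V(2) B(2) by auto
    have "x \<in> V" using V(2) p B(1) inj by (auto simp: inv_into_f_f)
    then show "\<exists>V. open V \<and> x \<in> V \<and> smooth_on (c ` (U \<inter> A) \<inter> V) (\<lambda>x. f (inv_into U c x))"
      using V(1) smooth_toD(2)[OF B(3) c] eq by (intro exI[of _ V]) simp
  qed
qed

section \<open>Open submanifolds, model spaces and products\<close>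

lemma charted_open_submfd:
  assumes "charted M" "openin (mtop M) A"
  shows "charted (open_submfd M A)"
  unfolding charted_def
proof (intro conjI ballI)
  have "A \<subseteq> points M" using assms(2) openin_subset by blast
  then show "points (open_submfd M A) = (\<Union>(U, c)\<in>atlas (open_submfd M A). U)"
    using assms(1) unfolding charted_def open_submfd_def by auto
  fix i assume "i \<in> atlas (open_submfd M A)"
  then obtain U c where c: "(U, c) \<in> atlas M" and i: "i = (U \<inter> A, c)" by (auto simp: open_submfd_def)
  have hc: "homeomorphic_map (subtopology (mtop M) U) (top_of_set (c ` U)) c"
    using assms(1) c unfolding charted_def by auto
  have inj: "inj_on c U" and sub: "U \<subseteq> points M" and op: "openin (mtop M) U"
    using chartedD[OF assms(1) c] by auto
  have "homeomorphic_map (subtopology (subtopology (mtop M) U) (U \<inter> A)) (subtopology (top_of_set (c ` U)) (c ` (U \<inter> A))) c"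
    by (rule homeomorphic_map_subtopologies[OF hc]) (use sub inj in \<open>auto dest: inj_onD\<close>)
  moreover have "subtopology (subtopology (mtop M) U) (U \<inter> A) = subtopology (subtopology (mtop M) A) (U \<inter> A)"
    by (simp add: subtopology_subtopology inf.absorb2 Int_commute Int_left_commute)
  moreover have "subtopology (top_of_set (c ` U)) (c ` (U \<inter> A)) = top_of_set (c ` (U \<inter> A))"
    by (simp add: subtopology_subtopology image_mono inf.absorb2)
  ultimately show "case i of (U, c) \<Rightarrow> openin (mtop (open_submfd M A)) U \<and>
      homeomorphic_map (subtopology (mtop (open_submfd M A)) U) (top_of_set (c ` U)) c"
    using op by (simp add: i open_submfd_def openin_subtopology_Int)
qed

lemma points_open_submfd: "openin (mtop M) A \<Longrightarrow> points (open_submfd M A) = A"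
  using openin_subset[of "mtop M" A] by (auto simp: open_submfd_def)

lemma smooth_into_open_submfd_iff:
  assumes "\<And>x. x \<in> X \<Longrightarrow> g x \<in> A"
  shows "smooth_into X (open_submfd M A) g \<longleftrightarrow> smooth_into X M g"
proof -
  have "{x \<in> X. g x \<in> U \<inter> A} = {x \<in> X. g x \<in> U}" for U using assms by auto
  then have "(\<forall>(U, c)\<in>atlas (open_submfd M A). smooth_on {x \<in> X. g x \<in> U} (\<lambda>x. c (g x))) \<longleftrightarrow>
      (\<forall>(U, c)\<in>atlas M. smooth_on {x \<in> X. g x \<in> U} (\<lambda>x. c (g x)))"
    by (auto simp: open_submfd_def split_beta)
  moreover have "continuous_map (top_of_set X) (mtop (open_submfd M A)) g \<longleftrightarrow> continuous_map (top_of_set X) (mtop M) g"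
    using assms by (auto simp: open_submfd_def continuous_map_in_subtopology)
  ultimately show ?thesis unfolding smooth_into_def by simp
qed

lemma smooth_to_open_submfdD:
  assumes "charted M" "openin (mtop M) A" "smooth_to (open_submfd M A) B f"
  shows "smooth_to M B f"
proof -
  have op: "openin (mtop M) B"
    using smooth_toD(1)[OF assms(3)] assms(2) by (auto simp: open_submfd_def intro: openin_trans_full)
  have BA: "B \<subseteq> A" using smooth_toD(1)[OF assms(3)] openin_subset by (fastforce simp: open_submfd_def)
  show ?thesis
  proof (rule smooth_toI[OF op])
    fix U c assume c: "(U, c) \<in> atlas M"
    note inj = chartedD(2)[OF assms(1) c]
    have "(U \<inter> A, c) \<in> atlas (open_submfd M A)" using c by (force simp: open_submfd_def)
    from smooth_toD(2)[OF assms(3) this]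
    have "smooth_on (c ` (U \<inter> B)) (\<lambda>x. f (inv_into (U \<inter> A) c x))"
      using BA by (simp add: Int_absorb1 inf.absorb2 inf.assoc)
    then show "smooth_on (c ` (U \<inter> B)) (\<lambda>x. f (inv_into U c x))"
    proof (rule smooth_on_cong)
      fix x assume "x \<in> c ` (U \<inter> B)"
      then obtain p where "p \<in> U" "p \<in> B" "x = c p" by auto
      then show "f (inv_into (U \<inter> A) c x) = f (inv_into U c x)"
        using inj inj_on_subset[OF inj, of "U \<inter> A"] BA by (auto simp: inv_into_f_f)
    qed
  qed
qed

lemma smooth_into_std_mfd_iff:
  "smooth_into X (std_mfd A) g \<longleftrightarrow> smooth_on X g \<and> g ` X \<subseteq> A"
proof
  assume L: "smooth_into X (std_mfd A) g"
  have "g ` X \<subseteq> A" using smooth_intoD(3)[OF L] by (auto simp: std_mfd_def)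
  moreover have "smooth_on {x \<in> X. g x \<in> A} (\<lambda>x. id (g x))"
    by (rule smooth_intoD(2)[OF L, of A id]) (simp add: std_mfd_def)
  moreover have "{x \<in> X. g x \<in> A} = X" using \<open>g ` X \<subseteq> A\<close> by auto
  ultimately show "smooth_on X g \<and> g ` X \<subseteq> A" by simp
next
  assume R: "smooth_on X g \<and> g ` X \<subseteq> A"
  then have "{x \<in> X. g x \<in> A} = X" by auto
  then show "smooth_into X (std_mfd A) g"
    using R smooth_on_imp_continuous_on[of X g] by (auto simp: smooth_into_def std_mfd_def)
qed

lemma charted_std_mfd: "charted (std_mfd A)"
proof -
  have "homeomorphic_map (top_of_set A) (top_of_set A) id" by (rule homeomorphic_map_id[THEN iffD2]) simp
  then show ?thesis by (simp add: charted_def std_mfd_def subtopology_subtopology)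
qed

lemma smooth_to_real_mfd:
  assumes "charted M" "smooth_map M (std_mfd A) f"
  shows "smooth_to M (points M) f"
proof (rule smooth_toI[OF openin_topspace])
  fix U c assume c: "(U, c) \<in> atlas M"
  have "f p \<in> A" if "p \<in> points M" for p
  proof -
    have "continuous_map (mtop M) (top_of_set A) f" using assms(2) by (simp add: smooth_map_def std_mfd_def)
    then show ?thesis using that continuous_map_image_subset_topspace by fastforce
  qed
  then have "{p \<in> U. f p \<in> A} = U \<inter> points M" using chartedD(3)[OF assms(1) c] by auto
  then show "smooth_on (c ` (U \<inter> points M)) (\<lambda>x. f (inv_into U c x))"
    using assms(2) c by (auto simp: smooth_map_def std_mfd_def o_def)
qed

lemma charted_prod_mfd:
  assumes "charted M" "charted N"
  shows "charted (prod_mfd M N)"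
  unfolding charted_def
proof (intro conjI ballI)
  show "points (prod_mfd M N) = (\<Union>(U, c)\<in>atlas (prod_mfd M N). U)"
    using assms unfolding charted_def prod_mfd_def by (fastforce simp: split_beta)
  fix i assume "i \<in> atlas (prod_mfd M N)"
  then obtain U c U' c' where c: "(U, c) \<in> atlas M" "(U', c') \<in> atlas N" and i: "i = (U \<times> U', map_prod c c')"
    by (auto simp: prod_mfd_def)
  have h: "homeomorphic_map (subtopology (mtop M) U) (top_of_set (c ` U)) c" "openin (mtop M) U"
    "homeomorphic_map (subtopology (mtop N) U') (top_of_set (c' ` U')) c'" "openin (mtop N) U'"
    using assms c unfolding charted_def by auto
  obtain d d' where "homeomorphic_maps (subtopology (mtop M) U) (top_of_set (c ` U)) c d"
    "homeomorphic_maps (subtopology (mtop N) U') (top_of_set (c' ` U')) c' d'"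
    using h(1,3) unfolding homeomorphic_map_maps by blast
  then have "homeomorphic_maps (prod_topology (subtopology (mtop M) U) (subtopology (mtop N) U'))
      (prod_topology (top_of_set (c ` U)) (top_of_set (c' ` U'))) (\<lambda>(x, y). (c x, c' y)) (\<lambda>(x, y). (d x, d' y))"
    unfolding homeomorphic_maps_prod by blast
  moreover have "(\<lambda>(x, y). (c x, c' y)) = map_prod c c'" by auto
  ultimately have "homeomorphic_map (prod_topology (subtopology (mtop M) U) (subtopology (mtop N) U'))
      (prod_topology (top_of_set (c ` U)) (top_of_set (c' ` U'))) (map_prod c c')"
    using homeomorphic_map_maps by metis
  moreover have "prod_topology (top_of_set (c ` U)) (top_of_set (c' ` U')) = top_of_set (c ` U \<times> c' ` U')"
    by (simp add: subtopology_Times[symmetric])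
  moreover have "map_prod c c' ` (U \<times> U') = c ` U \<times> c' ` U'" by (rule map_prod_surj_on[OF refl refl])
  ultimately show "case i of (U, c) \<Rightarrow> openin (mtop (prod_mfd M N)) U \<and>
      homeomorphic_map (subtopology (mtop (prod_mfd M N)) U) (top_of_set (c ` U)) c"
    using h by (simp add: i prod_mfd_def subtopology_Times openin_prod_Times_iff)
qed

lemma smooth_into_prod_mfd:
  assumes "smooth_into X M g" "smooth_into X N h"
  shows "smooth_into X (prod_mfd M N) (\<lambda>x. (g x, h x))"
proof (rule smooth_intoI)
  show "continuous_map (top_of_set X) (mtop (prod_mfd M N)) (\<lambda>x. (g x, h x))"
    using smooth_intoD(1)[OF assms(1)] smooth_intoD(1)[OF assms(2)] by (simp add: prod_mfd_def continuous_map_pairedI)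
  fix UU cc assume "(UU, cc) \<in> atlas (prod_mfd M N)"
  then obtain U c U' c' where c: "(U, c) \<in> atlas M" "(U', c') \<in> atlas N" and i: "UU = U \<times> U'" "cc = map_prod c c'"
    by (auto simp: prod_mfd_def)
  show "smooth_on {x \<in> X. (g x, h x) \<in> UU} (\<lambda>x. cc (g x, h x))"
    unfolding i map_prod_simp
    by (intro smooth_on_Pair smooth_on_subset[OF smooth_intoD(2)[OF assms(1) c(1)]]
        smooth_on_subset[OF smooth_intoD(2)[OF assms(2) c(2)]]) auto
qed

lemma smooth_into_atlas_chart:
  assumes "manifold_with_boundary M" "(U, c) \<in> atlas M"
  shows "smooth_into (c ` U) M (inv_into U c)" "smooth_to M U c"
  using smooth_into_maximal_chart[of M U c] assms atlas_subset_maximal_atlas[OF assms(1)]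
    manifold_with_boundary_imp_charted by blast+

lemma smooth_to_compose_smooth_map:
  assumes "manifold_with_boundary M" "charted N" "smooth_map M N f" "smooth_to N A h"
  shows "smooth_to M {p \<in> points M. f p \<in> A} (\<lambda>p. h (f p))"
proof (rule smooth_toI)
  have "continuous_map (mtop M) (mtop N) f" using assms(3) by (simp add: smooth_map_def)
  then show "openin (mtop M) {p \<in> points M. f p \<in> A}"
    by (rule openin_continuous_map_preimage) (rule smooth_toD(1)[OF assms(4)])
  note ch = manifold_with_boundary_imp_charted[OF assms(1)]
  fix U c assume c: "(U, c) \<in> atlas M"
  have "smooth_into (c ` (U \<inter> {p \<in> points M. f p \<in> A})) M (inv_into U c)"
    by (rule smooth_into_subset[OF smooth_into_atlas_chart(1)[OF assms(1) c]]) auto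
  then have "smooth_into (c ` (U \<inter> {p \<in> points M. f p \<in> A})) N (\<lambda>x. f (inv_into U c x))"
    by (rule smooth_into_smooth_map_compose[OF ch assms(2,3)])
  then show "smooth_on (c ` (U \<inter> {p \<in> points M. f p \<in> A})) (\<lambda>x. h (f (inv_into U c x)))"
    by (rule smooth_on_smooth_to_compose[OF assms(2,4)])
      (use chartedD(2)[OF ch c] in \<open>auto simp: inv_into_f_f\<close>)
qed

lemma smooth_into_prod_mfd_snd:
  assumes "charted M" "charted N" "smooth_into X (prod_mfd M N) g"
  shows "smooth_into X N (\<lambda>x. snd (g x))"
proof (rule smooth_intoI)
  have cg: "continuous_map (top_of_set X) (prod_topology (mtop M) (mtop N)) g"
    using smooth_intoD(1)[OF assms(3)] by (simp add: prod_mfd_def)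
  from continuous_map_compose[OF this continuous_map_snd]
  show "continuous_map (top_of_set X) (mtop N) (\<lambda>x. snd (g x))" by (simp add: o_def)
  fix U' c' assume c': "(U', c') \<in> atlas N"
  show "smooth_on {x \<in> X. snd (g x) \<in> U'} (\<lambda>x. c' (snd (g x)))"
  proof (rule smooth_on_local)
    fix x assume x: "x \<in> {x \<in> X. snd (g x) \<in> U'}"
    have "g x \<in> points (prod_mfd M N)" using smooth_intoD(3)[OF assms(3)] x by blast
    then have "fst (g x) \<in> points M" by (simp add: prod_mfd_def mem_Times_iff)
    then obtain U c where c: "(U, c) \<in> atlas M" "fst (g x) \<in> U" using charted_cover[OF assms(1)] by blast
    have at: "(U \<times> U', map_prod c c') \<in> atlas (prod_mfd M N)" using c c' by (force simp: prod_mfd_def)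
    have "openin (prod_topology (mtop M) (mtop N)) (U \<times> U')"
      using chartedD(1)[OF assms(1) c(1)] chartedD(1)[OF assms(2) c'] by (simp add: openin_prod_Times_iff)
    then obtain V where V: "open V" "{x \<in> X. g x \<in> U \<times> U'} = X \<inter> V"
      using continuous_map_openin_preimage[OF cg] by metis
    have "smooth_on (X \<inter> V) (\<lambda>x. snd (map_prod c c' (g x)))"
      using smooth_on_snd[OF smooth_intoD(2)[OF assms(3) at]] V(2) by simp
    then have "smooth_on (X \<inter> V) (\<lambda>x. c' (snd (g x)))" by simp
    then have "smooth_on ({x \<in> X. snd (g x) \<in> U'} \<inter> V) (\<lambda>x. c' (snd (g x)))"
      by (rule smooth_on_subset) auto
    moreover have "g x \<in> U \<times> U'" using c(2) x by (auto simp: mem_Times_iff)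
    then have "x \<in> {x \<in> X. g x \<in> U \<times> U'}" using x by simp
    then have "x \<in> V" unfolding V(2) by simp
    ultimately show "\<exists>V. open V \<and> x \<in> V \<and> smooth_on ({x \<in> X. snd (g x) \<in> U'} \<inter> V) (\<lambda>x. c' (snd (g x)))"
      using V(1) by blast
  qed
qed

text \<open>A half-space chart whose image met the bounding hyperplane would produce a boundary
  point. So the image lies in the open half-space and is open in the whole subspace.\<close>

lemma manifold_chart_open:
  assumes "manifold M" "(U, c) \<in> atlas M"
  obtains V where "subspace V" "openin (top_of_set V) (c ` U)"
proof -
  have "is_chart M U c" using assms unfolding manifold_def manifold_with_boundary_def by auto
  then obtain V where V: "subspace V" "openin (top_of_set V) (c ` U) \<or>
      (\<exists>a\<in>V. a \<noteq> 0 \<and> openin (top_of_set (half_space V a)) (c ` U))"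
    unfolding is_chart_def by blast
  show ?thesis
  proof (cases "openin (top_of_set V) (c ` U)")
    case True
    then show ?thesis using V that by blast
  next
    case False
    then obtain a where a: "a \<in> V" "a \<noteq> 0" "openin (top_of_set (half_space V a)) (c ` U)" using V by blast
    have pos: "a \<bullet> x > 0" if "x \<in> c ` U" for x
    proof -
      obtain p where p: "p \<in> U" "x = c p" using \<open>x \<in> c ` U\<close> by blast
      have "a \<bullet> c p \<noteq> 0"
      proof
        assume "a \<bullet> c p = 0"
        then have "p \<in> boundary M" unfolding boundary_def using assms(2) p(1) V(1) a by blast
        then show False using assms(1) by (simp add: manifold_def)
      qed
      moreover have "x \<in> half_space V a" using openin_imp_subset[OF a(3)] \<open>x \<in> c ` U\<close> by blast
      ultimately show ?thesis using p by (auto simp: half_space_def)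
    qed
    obtain T where T: "open T" "c ` U = half_space V a \<inter> T" using a(3) by (auto simp: openin_open)
    have "c ` U = V \<inter> (T \<inter> {x. a \<bullet> x > 0})" using T(2) pos by (auto simp: half_space_def)
    moreover have "open (T \<inter> {x. a \<bullet> x > 0})" using T(1) open_halfspace_gt by blast
    ultimately have "openin (top_of_set V) (c ` U)" by (auto simp: openin_open)
    then show ?thesis using V that by blast
  qed
qed

section \<open>Charts of vector bundles\<close>

text \<open>A chart of the base combined with a trivialization over it. Both directions, \<beta> and
  \<tau> one way and \<gamma> and \<Psi> the other, are explicit data, so that fibre operations
  become vector operations in \<open>W\<close> without recourse to chosen inverses.\<close>

locale bundle_chart =
  fixes B :: "('e, 'a::euclidean_space, 'f, 'b::euclidean_space) vbundle"
    and U :: "'f set" and \<beta> :: "'f \<Rightarrow> 'b" and \<gamma> :: "'b \<Rightarrow> 'f" and Bs Vb :: "'b set" and W :: "'a set"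
    and \<tau> :: "'e \<Rightarrow> 'a" and \<Psi> :: "'b \<times> 'a \<Rightarrow> 'e"
  assumes vb: "vector_bundle B"
    and open_U: "openin (mtop (base B)) U"
    and subspace_Vb: "subspace Vb" and subspace_W: "subspace W"
    and open_Bs: "openin (top_of_set Vb) Bs"
    and \<beta>: "x \<in> U \<Longrightarrow> \<beta> x \<in> Bs" "x \<in> U \<Longrightarrow> \<gamma> (\<beta> x) = x"
    and \<gamma>: "b \<in> Bs \<Longrightarrow> \<gamma> b \<in> U" "b \<in> Bs \<Longrightarrow> \<beta> (\<gamma> b) = b"
    and smooth_\<beta>: "smooth_to (base B) U \<beta>" and smooth_\<gamma>: "smooth_into Bs (base B) \<gamma>"
    and smooth_\<tau>: "smooth_to (total B) {e \<in> points (total B). proj B e \<in> U} \<tau>"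
    and smooth_\<Psi>: "smooth_into (Bs \<times> W) (total B) \<Psi>"
    and \<tau>: "e \<in> points (total B) \<Longrightarrow> proj B e \<in> U \<Longrightarrow> \<tau> e \<in> W"
    and \<Psi>\<tau>: "e \<in> points (total B) \<Longrightarrow> proj B e \<in> U \<Longrightarrow> \<Psi> (\<beta> (proj B e), \<tau> e) = e"
    and \<Psi>: "b \<in> Bs \<Longrightarrow> \<eta> \<in> W \<Longrightarrow> \<Psi> (b, \<eta>) \<in> points (total B)"
      "b \<in> Bs \<Longrightarrow> \<eta> \<in> W \<Longrightarrow> proj B (\<Psi> (b, \<eta>)) = \<gamma> b"
      "b \<in> Bs \<Longrightarrow> \<eta> \<in> W \<Longrightarrow> \<tau> (\<Psi> (b, \<eta>)) = \<eta>"
    and \<tau>_zero: "x \<in> U \<Longrightarrow> \<tau> (vzero B x) = 0"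
    and \<tau>_add: "x \<in> U \<Longrightarrow> e \<in> fibre B x \<Longrightarrow> e' \<in> fibre B x \<Longrightarrow> \<tau> (vadd B e e') = \<tau> e + \<tau> e'"
    and \<tau>_scale: "x \<in> U \<Longrightarrow> e \<in> fibre B x \<Longrightarrow> \<tau> (vscale B r e) = r *\<^sub>R \<tau> e"
begin

definition P :: "'e set" where "P = {e \<in> points (total B). proj B e \<in> U}"

definition \<Theta> :: "'e \<Rightarrow> 'b \<times> 'a" where "\<Theta> e = (\<beta> (proj B e), \<tau> e)"

lemma bundle_facts:
  "manifold (total B)" "manifold (base B)" "smooth_map (total B) (base B) (proj B)"
  "x \<in> points (base B) \<Longrightarrow> vzero B x \<in> fibre B x"
  "x \<in> points (base B) \<Longrightarrow> e \<in> fibre B x \<Longrightarrow> e' \<in> fibre B x \<Longrightarrow> vadd B e e' \<in> fibre B x"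
  "x \<in> points (base B) \<Longrightarrow> e \<in> fibre B x \<Longrightarrow> vscale B r e \<in> fibre B x"
  using vb unfolding vector_bundle_def by blast+

lemma charted_total: "charted (total B)" and charted_base: "charted (base B)"
  using bundle_facts(1,2) manifold_imp_charted by blast+

lemma U_subset: "U \<subseteq> points (base B)" using open_U openin_subset by blast

lemma smooth_\<Theta>: "smooth_to (total B) P \<Theta>"
proof -
  have "smooth_to (total B) {e \<in> points (total B). proj B e \<in> U} (\<lambda>e. \<beta> (proj B e))"
    using smooth_to_compose_smooth_map[OF _ charted_base bundle_facts(3) smooth_\<beta>] bundle_facts(1)
    by (simp add: manifold_def)
  from smooth_to_Pair[OF this smooth_\<tau>] show ?thesis by (simp add: P_def \<Theta>_def[abs_def])
qed

lemma open_P: "openin (mtop (total B)) P" using smooth_toD(1)[OF smooth_\<Theta>] .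

lemma P_subset: "P \<subseteq> points (total B)" by (auto simp: P_def)

lemma \<Theta>_in: "e \<in> P \<Longrightarrow> \<Theta> e \<in> Bs \<times> W" and \<Psi>_\<Theta>: "e \<in> P \<Longrightarrow> \<Psi> (\<Theta> e) = e"
  using \<beta>(1) \<tau> \<Psi>\<tau> by (auto simp: P_def \<Theta>_def)

lemma \<Psi>_in: "y \<in> Bs \<times> W \<Longrightarrow> \<Psi> y \<in> P" and \<Theta>_\<Psi>: "y \<in> Bs \<times> W \<Longrightarrow> \<Theta> (\<Psi> y) = y"
  using \<Psi> \<gamma> by (auto simp: P_def \<Theta>_def)

lemma \<Psi>_fibre: "b \<in> Bs \<Longrightarrow> \<eta> \<in> W \<Longrightarrow> \<Psi> (b, \<eta>) \<in> fibre B (\<gamma> b)"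
  using \<Psi> by (simp add: fibre_def)

lemma fibre_\<Psi>: "b \<in> Bs \<Longrightarrow> e \<in> fibre B (\<gamma> b) \<Longrightarrow> \<tau> e \<in> W \<and> e = \<Psi> (b, \<tau> e)"
  using \<tau>[of e] \<Psi>\<tau>[of e] \<gamma>[of b] by (simp add: fibre_def)

lemma \<gamma>_point: "b \<in> Bs \<Longrightarrow> \<gamma> b \<in> points (base B)" using \<gamma>(1) U_subset by blast

lemma vscale_\<Psi>: "b \<in> Bs \<Longrightarrow> \<eta> \<in> W \<Longrightarrow> vscale B r (\<Psi> (b, \<eta>)) = \<Psi> (b, r *\<^sub>R \<eta>)"
  using fibre_\<Psi>[of b "vscale B r (\<Psi> (b, \<eta>))"] bundle_facts(6)[OF \<gamma>_point \<Psi>_fibre]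
    \<tau>_scale[OF \<gamma>(1) \<Psi>_fibre] \<Psi>(3) by metis

lemma vadd_\<Psi>: "b \<in> Bs \<Longrightarrow> \<eta> \<in> W \<Longrightarrow> \<xi> \<in> W \<Longrightarrow> vadd B (\<Psi> (b, \<eta>)) (\<Psi> (b, \<xi>)) = \<Psi> (b, \<eta> + \<xi>)"
  using fibre_\<Psi>[of b "vadd B (\<Psi> (b, \<eta>)) (\<Psi> (b, \<xi>))"] bundle_facts(5)[OF \<gamma>_point \<Psi>_fibre \<Psi>_fibre]
    \<tau>_add[OF \<gamma>(1) \<Psi>_fibre \<Psi>_fibre] \<Psi>(3) by metis

lemma vzero_\<Psi>: "b \<in> Bs \<Longrightarrow> vzero B (\<gamma> b) = \<Psi> (b, 0)"
  using fibre_\<Psi>[of b "vzero B (\<gamma> b)"] bundle_facts(4)[OF \<gamma>_point] \<tau>_zero[OF \<gamma>(1)] by metis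

lemma zero_in_W: "0 \<in> W" using subspace_W subspace_0 by blast

lemma \<Psi>_zero_section_iff:
  assumes "b \<in> Bs" "\<eta> \<in> W"
  shows "\<Psi> (b, \<eta>) \<in> zero_section B \<longleftrightarrow> \<eta> = 0"
proof
  assume "\<Psi> (b, \<eta>) \<in> zero_section B"
  then obtain x where x: "x \<in> points (base B)" "\<Psi> (b, \<eta>) = vzero B x" by (auto simp: zero_section_def)
  then have "x = \<gamma> b" using bundle_facts(4)[OF x(1)] \<Psi>(2)[OF assms] by (simp add: fibre_def)
  then have "\<tau> (\<Psi> (b, \<eta>)) = \<tau> (\<Psi> (b, 0))" using x(2) vzero_\<Psi>[OF assms(1)] by simp
  then show "\<eta> = 0" using \<Psi>(3) assms zero_in_W by simp
next
  assume "\<eta> = 0"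
  then show "\<Psi> (b, \<eta>) \<in> zero_section B"
    using vzero_\<Psi>[OF assms(1)] \<gamma>_point[OF assms(1)] unfolding zero_section_def by (metis image_eqI)
qed

lemma open_\<Theta>_range: "openin (top_of_set (Vb \<times> W)) (Bs \<times> W)"
  using open_Bs by (simp add: openin_Times)

lemma subspace_VbW: "subspace (Vb \<times> W)"
  using subspace_Vb subspace_W by (rule subspace_Times)

lemma vscale_\<Theta>:
  assumes "e \<in> P"
  shows "vscale B r e \<in> P" "\<Theta> (vscale B r e) = (fst (\<Theta> e), r *\<^sub>R snd (\<Theta> e))"
proof -
  have y: "\<Theta> e \<in> Bs \<times> W" using \<Theta>_in[OF assms] .
  then have "vscale B r e = \<Psi> (fst (\<Theta> e), r *\<^sub>R snd (\<Theta> e))"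
    using vscale_\<Psi>[of "fst (\<Theta> e)" "snd (\<Theta> e)" r] \<Psi>_\<Theta>[OF assms] by (simp add: mem_Times_iff)
  moreover have "(fst (\<Theta> e), r *\<^sub>R snd (\<Theta> e)) \<in> Bs \<times> W"
    using y subspace_W by (auto simp: subspace_scale mem_Times_iff)
  ultimately show "vscale B r e \<in> P" "\<Theta> (vscale B r e) = (fst (\<Theta> e), r *\<^sub>R snd (\<Theta> e))"
    using \<Psi>_in \<Theta>_\<Psi> by simp_all
qed

lemma zero_section_\<Theta>_iff:
  assumes "e \<in> P"
  shows "e \<in> zero_section B \<longleftrightarrow> snd (\<Theta> e) = 0"
  using \<Psi>_zero_section_iff[of "fst (\<Theta> e)" "snd (\<Theta> e)"] \<Theta>_in[OF assms] \<Psi>_\<Theta>[OF assms]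
  by (simp add: mem_Times_iff)

lemma continuous_map_\<Theta>: "continuous_map (subtopology (mtop (total B)) P) euclidean \<Theta>"
  by (rule continuous_map_smooth_to[OF charted_total smooth_\<Theta>])

end

text \<open>A trivialization and a chart of the base are restricted to the intersection of their
  domains; \<Psi> is the inverse chart on the base variable followed by the inverse
  trivialization.\<close>

lemma exists_bundle_chart:
  fixes B :: "('e, 'a::euclidean_space, 'f, 'b::euclidean_space) vbundle"
  assumes B: "vector_bundle B" and x: "x \<in> points (base B)"
  shows "\<exists>U \<beta> \<gamma> Bs Vb W \<tau> \<Psi>. bundle_chart B U \<beta> \<gamma> Bs Vb W \<tau> \<Psi> \<and> x \<in> U"
proof -
  have mt: "manifold (total B)" and mb: "manifold (base B)" and pr: "smooth_map (total B) (base B) (proj B)"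
    using B unfolding vector_bundle_def by blast+
  note ct = manifold_imp_charted[OF mt] and cb = manifold_imp_charted[OF mb]
  have mtb: "manifold_with_boundary (total B)" and mbb: "manifold_with_boundary (base B)"
    using mt mb by (simp_all add: manifold_def)
  obtain U1 W \<tau> where U1: "x \<in> U1" and lt: "local_trivialization B U1 W \<tau>"
    using B x unfolding vector_bundle_def by blast
  obtain U2 c where c: "(U2, c) \<in> atlas (base B)" and U2: "x \<in> U2" by (rule charted_cover[OF cb x])
  obtain V where V: "subspace V" "openin (top_of_set V) (c ` U2)" by (rule manifold_chart_open[OF mb c])
  have opU1: "openin (mtop (base B)) U1" and W: "subspace W"
    and fibre_ops: "\<And>x. x \<in> U1 \<Longrightarrow> \<tau> (vzero B x) = 0"
      "\<And>x e e'. x \<in> U1 \<Longrightarrow> e \<in> fibre B x \<Longrightarrow> e' \<in> fibre B x \<Longrightarrow> \<tau> (vadd B e e') = \<tau> e + \<tau> e'"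
      "\<And>x e r. x \<in> U1 \<Longrightarrow> e \<in> fibre B x \<Longrightarrow> \<tau> (vscale B r e) = r *\<^sub>R \<tau> e"
    using lt unfolding local_trivialization_def by blast+
  define E1 where "E1 = {e \<in> points (total B). proj B e \<in> U1}"
  define F where "F e = (proj B e, \<tau> e)" for e
  define ME where "ME = open_submfd (total B) E1"
  define MP where "MP = prod_mfd (open_submfd (base B) U1) (std_mfd W)"
  have "continuous_map (mtop (total B)) (mtop (base B)) (proj B)" using pr by (simp add: smooth_map_def)
  then have opE1: "openin (mtop (total B)) E1"
    unfolding E1_def using opU1 openin_continuous_map_preimage by blast
  have pME: "points ME = E1" unfolding ME_def by (rule points_open_submfd[OF opE1])
  have pMP: "points MP = U1 \<times> W"
    using points_open_submfd[OF opU1] by (simp add: MP_def prod_mfd_def std_mfd_def open_submfd_def)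
  have diff: "bij_betw F E1 (U1 \<times> W)" "smooth_map ME MP F" "smooth_map MP ME (inv_into E1 F)"
    using lt pME pMP unfolding local_trivialization_def diffeo_def F_def[abs_def] ME_def E1_def MP_def by auto
  have cME: "charted ME" unfolding ME_def by (rule charted_open_submfd[OF ct opE1])
  have cMU: "charted (open_submfd (base B) U1)" by (rule charted_open_submfd[OF cb opU1])
  have cMP: "charted MP" unfolding MP_def by (intro charted_prod_mfd cMU charted_std_mfd)
  define U where "U = U1 \<inter> U2"
  define \<gamma> where "\<gamma> = inv_into U2 c"
  define \<Psi> where "\<Psi> y = inv_into E1 F (\<gamma> (fst y), snd y)" for y
  note inj = chartedD(2)[OF cb c]
  have \<gamma>c: "\<gamma> (c x) = x" if "x \<in> U2" for x using inj that by (simp add: \<gamma>_def)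
  have FE: "e \<in> E1 \<Longrightarrow> F e \<in> U1 \<times> W" for e using diff(1) bij_betwE by blast
  have invF: "e \<in> E1 \<Longrightarrow> inv_into E1 F (F e) = e" for e
    using diff(1) by (simp add: bij_betw_def inv_into_f_f)
  have Finv: "y \<in> U1 \<times> W \<Longrightarrow> inv_into E1 F y \<in> E1 \<and> F (inv_into E1 F y) = y" for y
    using diff(1) by (metis bij_betw_imp_surj_on f_inv_into_f inv_into_into)
  have "smooth_into (c ` U2) (base B) \<gamma>" unfolding \<gamma>_def by (rule smooth_into_atlas_chart(1)[OF mbb c])
  then have s\<gamma>: "smooth_into (c ` U) (base B) \<gamma>" by (rule smooth_into_subset) (auto simp: U_def)
  have opU: "openin (mtop (base B)) U" unfolding U_def using opU1 chartedD(1)[OF cb c] by blast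
  have opBs: "openin (top_of_set V) (c ` U)"
  proof -
    obtain T where T: "open T" "{x \<in> c ` U2. inv_into U2 c x \<in> U1} = c ` U2 \<inter> T"
      by (rule continuous_map_openin_preimage[OF chartedD(4)[OF cb c] opU1])
    have "{x \<in> c ` U2. inv_into U2 c x \<in> U1} = c ` U" using inj by (auto simp: U_def inv_into_f_f)
    then have "openin (top_of_set (c ` U2)) (c ` U)" using T by (metis openin_open_Int)
    then show ?thesis using V(2) openin_trans by blast
  qed
  have "bundle_chart B U c \<gamma> (c ` U) V W \<tau> \<Psi>"
  proof (unfold_locales)
    show "vector_bundle B" "openin (mtop (base B)) U" "subspace V" "subspace W"
      "openin (top_of_set V) (c ` U)" "smooth_into (c ` U) (base B) \<gamma>" by fact+
    show "smooth_to (base B) U c"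
      by (rule smooth_to_subset[OF smooth_into_atlas_chart(2)[OF mbb c] opU]) (auto simp: U_def)
    show "c x \<in> c ` U" "\<gamma> (c x) = x" if "x \<in> U" for x using that \<gamma>c by (auto simp: U_def)
    show "\<gamma> b \<in> U" "c (\<gamma> b) = b" if "b \<in> c ` U" for b using that \<gamma>c by (auto simp: U_def)
    show "\<tau> (vzero B x) = 0" if "x \<in> U" for x using that fibre_ops(1) by (simp add: U_def)
    show "\<tau> (vadd B e e') = \<tau> e + \<tau> e'" if "x \<in> U" "e \<in> fibre B x" "e' \<in> fibre B x" for x e e'
      using that fibre_ops(2) by (auto simp: U_def)
    show "\<tau> (vscale B r e) = r *\<^sub>R \<tau> e" if "x \<in> U" "e \<in> fibre B x" for x e r
      using that fibre_ops(3) by (auto simp: U_def)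
    show "\<tau> e \<in> W" "\<Psi> (c (proj B e), \<tau> e) = e" if "e \<in> points (total B)" "proj B e \<in> U" for e
    proof -
      have e: "e \<in> E1" using that by (simp add: E1_def U_def)
      then show "\<tau> e \<in> W" using FE[OF e] by (simp add: F_def)
      show "\<Psi> (c (proj B e), \<tau> e) = e"
        using invF[OF e] \<gamma>c that(2) by (simp add: \<Psi>_def F_def U_def)
    qed
    show "\<Psi> (b, \<eta>) \<in> points (total B)" "proj B (\<Psi> (b, \<eta>)) = \<gamma> b" "\<tau> (\<Psi> (b, \<eta>)) = \<eta>"
      if "b \<in> c ` U" "\<eta> \<in> W" for b \<eta>
    proof -
      have "\<gamma> b \<in> U1" using that(1) \<gamma>c by (auto simp: U_def)
      then have "\<Psi> (b, \<eta>) \<in> E1 \<and> F (\<Psi> (b, \<eta>)) = (\<gamma> b, \<eta>)"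
        unfolding \<Psi>_def using Finv[of "(\<gamma> b, \<eta>)"] that(2) by simp
      then show "\<Psi> (b, \<eta>) \<in> points (total B)" "proj B (\<Psi> (b, \<eta>)) = \<gamma> b" "\<tau> (\<Psi> (b, \<eta>)) = \<eta>"
        by (auto simp: E1_def F_def)
    qed
    have "smooth_into (c ` U \<times> W) (base B) (\<lambda>y. \<gamma> (fst y))"
      by (rule smooth_into_compose_smooth_on[OF s\<gamma>]) (auto intro!: smooth_on_intros)
    then have "smooth_into (c ` U \<times> W) (open_submfd (base B) U1) (\<lambda>y. \<gamma> (fst y))"
      by (subst smooth_into_open_submfd_iff) (auto simp: U_def \<gamma>c)
    moreover have "smooth_into (c ` U \<times> W) (std_mfd W) snd"
      by (subst smooth_into_std_mfd_iff) (auto intro!: smooth_on_snd smooth_on_id)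
    ultimately have "smooth_into (c ` U \<times> W) MP (\<lambda>y. (\<gamma> (fst y), snd y))"
      unfolding MP_def by (rule smooth_into_prod_mfd)
    from smooth_into_smooth_map_compose[OF cMP cME diff(3) this]
    have "smooth_into (c ` U \<times> W) ME \<Psi>" by (simp add: \<Psi>_def[abs_def])
    moreover have "\<Psi> y \<in> E1" if "y \<in> c ` U \<times> W" for y
      using smooth_intoD(3)[OF \<open>smooth_into _ ME \<Psi>\<close> that] pME by simp
    ultimately show "smooth_into (c ` U \<times> W) (total B) \<Psi>"
      unfolding ME_def by (subst (asm) smooth_into_open_submfd_iff) auto
    have "smooth_to (total B) E1 \<tau>"
    proof (rule smooth_toI[OF opE1])
      fix Ut ct' assume ct': "(Ut, ct') \<in> atlas (total B)"
      have in1: "inv_into Ut ct' x \<in> E1" if "x \<in> ct' ` (Ut \<inter> E1)" for x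
        using that chartedD(2)[OF ct ct'] by (auto simp: inv_into_f_f)
      have "smooth_into (ct' ` (Ut \<inter> E1)) (total B) (inv_into Ut ct')"
        by (rule smooth_into_subset[OF smooth_into_atlas_chart(1)[OF mtb ct']]) auto
      then have "smooth_into (ct' ` (Ut \<inter> E1)) ME (inv_into Ut ct')"
        unfolding ME_def by (subst smooth_into_open_submfd_iff) (use in1 in auto)
      from smooth_into_smooth_map_compose[OF cME cMP diff(2) this]
      have "smooth_into (ct' ` (Ut \<inter> E1)) MP (\<lambda>x. F (inv_into Ut ct' x))" .
      from smooth_into_prod_mfd_snd[OF cMU charted_std_mfd this[unfolded MP_def]]
      show "smooth_on (ct' ` (Ut \<inter> E1)) (\<lambda>x. \<tau> (inv_into Ut ct' x))"
          unfolding smooth_into_std_mfd_iff F_def snd_conv by (rule conjunct1)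
    qed
    then show "smooth_to (total B) {e \<in> points (total B). proj B e \<in> U} \<tau>"
    proof (rule smooth_to_subset)
      show "openin (mtop (total B)) {e \<in> points (total B). proj B e \<in> U}"
        by (rule openin_continuous_map_preimage[OF \<open>continuous_map _ _ (proj B)\<close> opU])
    qed (auto simp: E1_def U_def)
  qed
  moreover have "x \<in> U" using U1 U2 by (simp add: U_def)
  ultimately show ?thesis by (intro exI conjI)
qed

lemma exists_bundle_chart_at:
  fixes B :: "('e, 'a::euclidean_space, 'f, 'b::euclidean_space) vbundle"
  assumes "vector_bundle B" "e \<in> points (total B)"
  shows "\<exists>U \<beta> \<gamma> Bs Vb W \<tau> \<Psi>. bundle_chart B U \<beta> \<gamma> Bs Vb W \<tau> \<Psi> \<and> e \<in> bundle_chart.P B U"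
proof -
  have "continuous_map (mtop (total B)) (mtop (base B)) (proj B)"
    using assms(1) by (simp add: vector_bundle_def smooth_map_def)
  then have "proj B e \<in> points (base B)" using assms(2) continuous_map_image_subset_topspace by fast
  from exists_bundle_chart[OF assms(1) this] obtain U \<beta> \<gamma> Bs Vb W \<tau> \<Psi>
    where *: "bundle_chart B U \<beta> \<gamma> Bs Vb W \<tau> \<Psi>" "proj B e \<in> U" by (elim exE conjE)
  then have "e \<in> bundle_chart.P B U" using assms(2) bundle_chart.P_def[OF *(1)] by simp
  with *(1) show ?thesis by (intro exI conjI)
qed

lemma orthonormal_expansion:
  fixes W :: "'a::euclidean_space set"
  assumes "subspace W"
  obtains F where "finite F" "F \<subseteq> W" "\<And>w. w \<in> W \<Longrightarrow> w = (\<Sum>u\<in>F. (w \<bullet> u) *\<^sub>R u)"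
proof -
  obtain F where F: "F \<subseteq> W" "pairwise orthogonal F" "\<And>x. x \<in> F \<Longrightarrow> norm x = 1" "independent F" "span F = W"
    using orthonormal_basis_subspace[OF assms] by metis
  have fin: "finite F" using F(4) independent_imp_finite by blast
  have "w = (\<Sum>u\<in>F. (w \<bullet> u) *\<^sub>R u)" if w: "w \<in> W" for w
  proof -
    define L where "L w = (\<Sum>u\<in>F. (w \<bullet> u) *\<^sub>R u)" for w
    have lin: "linear L" unfolding L_def
      by (rule linearI) (simp_all add: inner_left_distrib scaleR_left_distrib sum.distrib scaleR_sum_right)
    have "L b = b" if b: "b \<in> F" for b
    proof -
      have "b \<bullet> c = (if c = b then 1 else 0)" if "c \<in> F" for c
        using F(2,3) b that by (auto simp: pairwise_def orthogonal_def norm_eq_1)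
      then have "L b = (\<Sum>c\<in>F. if c = b then c else 0)" unfolding L_def by (intro sum.cong) auto
      then show ?thesis using fin b by simp
    qed
    then have "L w = id w" using linear_eq_on_span[OF lin linear_id, of F w] w F(5) by simp
    then show ?thesis by (simp add: L_def)
  qed
  then show ?thesis using that fin F(1) by blast
qed

section \<open>Fibrewise inner products in bundle coordinates\<close>

context bundle_chart
begin

context
  fixes ip assumes ip: "fibrewise_inner_product B ip"
begin

lemma ip_commute: "b \<in> Bs \<Longrightarrow> \<eta> \<in> W \<Longrightarrow> \<xi> \<in> W \<Longrightarrow> ip (\<Psi> (b, \<eta>)) (\<Psi> (b, \<xi>)) = ip (\<Psi> (b, \<xi>)) (\<Psi> (b, \<eta>))"
  using ip \<gamma>_point \<Psi>_fibre unfolding fibrewise_inner_product_def by blast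

lemma ip_add:
  assumes "b \<in> Bs" "\<eta> \<in> W" "\<eta>' \<in> W" "\<xi> \<in> W"
  shows "ip (\<Psi> (b, \<eta> + \<eta>')) (\<Psi> (b, \<xi>)) = ip (\<Psi> (b, \<eta>)) (\<Psi> (b, \<xi>)) + ip (\<Psi> (b, \<eta>')) (\<Psi> (b, \<xi>))"
proof -
  have "ip (vadd B (\<Psi> (b, \<eta>)) (\<Psi> (b, \<eta>'))) (\<Psi> (b, \<xi>)) = ip (\<Psi> (b, \<eta>)) (\<Psi> (b, \<xi>)) + ip (\<Psi> (b, \<eta>')) (\<Psi> (b, \<xi>))"
    using ip \<gamma>_point \<Psi>_fibre assms unfolding fibrewise_inner_product_def by blast
  then show ?thesis using vadd_\<Psi> assms by simp
qed

lemma ip_scale: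
  assumes "b \<in> Bs" "\<eta> \<in> W" "\<xi> \<in> W"
  shows "ip (\<Psi> (b, r *\<^sub>R \<eta>)) (\<Psi> (b, \<xi>)) = r * ip (\<Psi> (b, \<eta>)) (\<Psi> (b, \<xi>))"
proof -
  have "ip (vscale B r (\<Psi> (b, \<eta>))) (\<Psi> (b, \<xi>)) = r * ip (\<Psi> (b, \<eta>)) (\<Psi> (b, \<xi>))"
    using ip \<gamma>_point \<Psi>_fibre assms unfolding fibrewise_inner_product_def by blast
  then show ?thesis using vscale_\<Psi> assms by simp
qed

lemma ip_pos:
  assumes "b \<in> Bs" "\<eta> \<in> W" "\<eta> \<noteq> 0"
  shows "0 < ip (\<Psi> (b, \<eta>)) (\<Psi> (b, \<eta>))"
proof -
  have "\<Psi> (b, \<eta>) \<noteq> vzero B (\<gamma> b)"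
    using vzero_\<Psi>[OF assms(1)] \<Psi>(3)[OF assms(1,2)] \<Psi>(3)[OF assms(1) zero_in_W] assms(3) by auto
  then show ?thesis using ip \<gamma>_point[OF assms(1)] \<Psi>_fibre[OF assms(1,2)] unfolding fibrewise_inner_product_def by blast
qed

lemma ip_scale2:
  assumes "b \<in> Bs" "\<eta> \<in> W"
  shows "ip (\<Psi> (b, r *\<^sub>R \<eta>)) (\<Psi> (b, r *\<^sub>R \<eta>)) = r\<^sup>2 * ip (\<Psi> (b, \<eta>)) (\<Psi> (b, \<eta>))"
  using ip_scale[OF assms(1,2), of "r *\<^sub>R \<eta>" r] ip_scale[OF assms assms(2), of r]
    ip_commute[OF assms(1,2), of "r *\<^sub>R \<eta>"] subspace_scale[OF subspace_W assms(2)]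
  by (simp add: power2_eq_square)

lemma ip_sum:
  assumes "b \<in> Bs" "finite F" "F \<subseteq> W" "\<xi> \<in> W"
  shows "ip (\<Psi> (b, \<Sum>u\<in>F. c u *\<^sub>R u)) (\<Psi> (b, \<xi>)) = (\<Sum>u\<in>F. c u * ip (\<Psi> (b, u)) (\<Psi> (b, \<xi>)))"
  using assms(2,3)
proof (induction F rule: finite_induct)
  case empty
  show ?case using ip_scale[OF assms(1) zero_in_W assms(4), of 0] by simp
next
  case (insert u F)
  have 1: "c u *\<^sub>R u \<in> W" using insert.prems subspace_scale[OF subspace_W] by blast
  have 2: "(\<Sum>u\<in>F. c u *\<^sub>R u) \<in> W"
    by (rule subspace_sum[OF subspace_W]) (use insert.prems subspace_scale[OF subspace_W] in auto)
  have 3: "u \<in> W" "F \<subseteq> W" using insert.prems by auto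
  show ?case
    unfolding sum.insert[OF insert.hyps]
    by (simp only: ip_add[OF assms(1) 1 2 assms(4)] ip_scale[OF assms(1) 3(1) assms(4)] insert.IH[OF 3(2)])
qed

text \<open>The Gram matrix with respect to a fixed frame of \<open>W\<close>. Inner products are
  postulated to be smooth along smooth sections; the frame vectors give such sections, and the
  expansion turns this into smoothness in all variables.\<close>

lemma ip_expansion:
  obtains F where "finite F" "F \<subseteq> W"
    "\<And>b \<eta> \<xi>. b \<in> Bs \<Longrightarrow> \<eta> \<in> W \<Longrightarrow> \<xi> \<in> W \<Longrightarrow> ip (\<Psi> (b, \<eta>)) (\<Psi> (b, \<xi>)) =
       (\<Sum>u\<in>F. \<Sum>u'\<in>F. (\<eta> \<bullet> u) * (\<xi> \<bullet> u') * ip (\<Psi> (b, u)) (\<Psi> (b, u')))"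
proof -
  obtain F where F: "finite F" "F \<subseteq> W" "\<And>w. w \<in> W \<Longrightarrow> w = (\<Sum>u\<in>F. (w \<bullet> u) *\<^sub>R u)"
    by (rule orthonormal_expansion[OF subspace_W]) (rule that; assumption)
  have "ip (\<Psi> (b, \<eta>)) (\<Psi> (b, \<xi>)) = (\<Sum>u\<in>F. \<Sum>u'\<in>F. (\<eta> \<bullet> u) * (\<xi> \<bullet> u') * ip (\<Psi> (b, u)) (\<Psi> (b, u')))"
    if b: "b \<in> Bs" "\<eta> \<in> W" "\<xi> \<in> W" for b \<eta> \<xi>
  proof -
    have "ip (\<Psi> (b, \<eta>)) (\<Psi> (b, \<xi>)) = (\<Sum>u\<in>F. (\<eta> \<bullet> u) * ip (\<Psi> (b, u)) (\<Psi> (b, \<xi>)))"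
      using ip_sum[OF b(1) F(1,2) b(3), of "\<lambda>u. \<eta> \<bullet> u"] F(3)[OF b(2)] by simp
    also have "\<dots> = (\<Sum>u\<in>F. (\<eta> \<bullet> u) * (\<Sum>u'\<in>F. (\<xi> \<bullet> u') * ip (\<Psi> (b, u)) (\<Psi> (b, u'))))"
    proof (rule sum.cong[OF refl])
      fix u assume "u \<in> F"
      then have u: "u \<in> W" using F(2) by blast
      have "ip (\<Psi> (b, u)) (\<Psi> (b, \<xi>)) = ip (\<Psi> (b, \<xi>)) (\<Psi> (b, u))" using ip_commute b u by blast
      also have "\<dots> = (\<Sum>u'\<in>F. (\<xi> \<bullet> u') * ip (\<Psi> (b, u')) (\<Psi> (b, u)))"
        using ip_sum[OF b(1) F(1,2) u, of "\<lambda>u. \<xi> \<bullet> u"] F(3)[OF b(3)] by simp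
      also have "\<dots> = (\<Sum>u'\<in>F. (\<xi> \<bullet> u') * ip (\<Psi> (b, u)) (\<Psi> (b, u')))"
        by (rule sum.cong[OF refl]) (use ip_commute[OF b(1)] u F(2) in auto)
      finally show "(\<eta> \<bullet> u) * ip (\<Psi> (b, u)) (\<Psi> (b, \<xi>)) = (\<eta> \<bullet> u) * (\<Sum>u'\<in>F. (\<xi> \<bullet> u') * ip (\<Psi> (b, u)) (\<Psi> (b, u')))"
        by simp
    qed
    finally show ?thesis by (simp add: sum_distrib_left mult.assoc)
  qed
  then show ?thesis using that[OF F(1,2)] by blast
qed

text \<open>Constant vectors of a trivialization are the sections to which the smoothness axiom of
  the inner product is applied.\<close>

lemma smooth_frame:
  assumes "u \<in> W"
  shows "smooth_section B U (\<lambda>x. \<Psi> (\<beta> x, u))"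
  unfolding smooth_section_def
proof (intro conjI ballI)
  have mbb: "manifold_with_boundary (base B)" using bundle_facts(2) by (simp add: manifold_def)
  show "smooth_map (open_submfd (base B) U) (total B) (\<lambda>x. \<Psi> (\<beta> x, u))"
  proof (rule smooth_mapI[OF charted_open_submfd[OF charted_base open_U]])
    fix U' c assume "(U', c) \<in> atlas (open_submfd (base B) U)"
    then obtain U1 where U1: "(U1, c) \<in> atlas (base B)" "U' = U1 \<inter> U" by (auto simp: open_submfd_def)
    note inj = chartedD(2)[OF charted_base U1(1)]
    have inj': "inj_on c U'" using inj U1(2) inj_on_subset by blast
    have eq: "inv_into U' c x = inv_into U1 c x" "inv_into U1 c x \<in> U" if "x \<in> c ` U'" for x
      using that inj inj' U1(2) by (auto simp: inv_into_f_f)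
    have "smooth_into (c ` U') (base B) (inv_into U1 c)"
      by (rule smooth_into_subset[OF smooth_into_atlas_chart(1)[OF mbb U1(1)]]) (use U1(2) in auto)
    from smooth_on_smooth_to_compose[OF charted_base smooth_\<beta> this]
    have "smooth_on (c ` U') (\<lambda>x. \<beta> (inv_into U1 c x))" using eq(2) by blast
    then have "smooth_on (c ` U') (\<lambda>x. (\<beta> (inv_into U1 c x), u))" by (intro smooth_on_Pair smooth_on_const)
    from smooth_into_compose_smooth_on[OF smooth_\<Psi> this]
    have "smooth_into (c ` U') (total B) (\<lambda>x. \<Psi> (\<beta> (inv_into U1 c x), u))" using eq(2) \<beta>(1) assms by simp
    then show "smooth_into (c ` U') (total B) (\<lambda>x. \<Psi> (\<beta> (inv_into U' c x), u))"
      by (rule smooth_into_cong) (use eq(1) in simp)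
  qed
qed (use \<Psi>(2) \<beta> assms in auto)

lemma smooth_on_ip_frame:
  assumes "u \<in> W" "u' \<in> W"
  shows "smooth_on Bs (\<lambda>b. ip (\<Psi> (b, u)) (\<Psi> (b, u')))"
proof -
  have "smooth_map (open_submfd (base B) U) real_mfd (\<lambda>x. ip (\<Psi> (\<beta> x, u)) (\<Psi> (\<beta> x, u')))"
    using ip smooth_frame[OF assms(1)] smooth_frame[OF assms(2)] open_U unfolding fibrewise_inner_product_def by blast
  from smooth_to_real_mfd[OF charted_open_submfd[OF charted_base open_U] this]
  have "smooth_to (open_submfd (base B) U) U (\<lambda>x. ip (\<Psi> (\<beta> x, u)) (\<Psi> (\<beta> x, u')))"
    by (simp add: points_open_submfd[OF open_U])
  from smooth_to_open_submfdD[OF charted_base open_U this]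
  have "smooth_on Bs (\<lambda>b. ip (\<Psi> (\<beta> (\<gamma> b), u)) (\<Psi> (\<beta> (\<gamma> b), u')))"
    by (rule smooth_on_smooth_to_compose[OF charted_base _ smooth_\<gamma>]) (rule \<gamma>(1))
  then show ?thesis by (rule smooth_on_cong) (simp add: \<gamma>)
qed

lemma smooth_on_ip: "smooth_on (Bs \<times> W) (\<lambda>y. ip (\<Psi> y) (\<Psi> y))"
proof -
  obtain F where F: "finite F" "F \<subseteq> W"
    "\<And>b \<eta> \<xi>. b \<in> Bs \<Longrightarrow> \<eta> \<in> W \<Longrightarrow> \<xi> \<in> W \<Longrightarrow> ip (\<Psi> (b, \<eta>)) (\<Psi> (b, \<xi>)) =
       (\<Sum>u\<in>F. \<Sum>u'\<in>F. (\<eta> \<bullet> u) * (\<xi> \<bullet> u') * ip (\<Psi> (b, u)) (\<Psi> (b, u')))"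
    by (rule ip_expansion) (rule that; assumption)
  have "smooth_on (Bs \<times> W) (\<lambda>y. \<Sum>u\<in>F. \<Sum>u'\<in>F. (snd y \<bullet> u) * (snd y \<bullet> u') * ip (\<Psi> (fst y, u)) (\<Psi> (fst y, u')))"
  proof (intro smooth_on_sum smooth_on_mult smooth_on_inner smooth_on_snd smooth_on_id smooth_on_const)
    fix u u' assume "u \<in> F" "u' \<in> F"
    then show "smooth_on (Bs \<times> W) (\<lambda>y. ip (\<Psi> (fst y, u)) (\<Psi> (fst y, u')))"
      by (intro smooth_on_compose'[OF smooth_on_ip_frame smooth_on_fst[OF smooth_on_id]]) (use F(2) in auto)
  qed
  then show ?thesis by (rule smooth_on_cong) (use F(3) in auto)
qed

end

end

section \<open>Scalar multiplication and norms in vector bundles\<close>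

text \<open>The definition of a bundle lists no vector space laws for its fibres; each is read off
  in a bundle chart, where scaling is that of \<open>W\<close>.\<close>

lemma vector_bundle_scale:
  assumes "vector_bundle B" "e \<in> points (total B)"
  shows "vscale B r e \<in> points (total B)" "proj B (vscale B r e) = proj B e"
    "vscale B r (vscale B s e) = vscale B (r * s) e" "vscale B 1 e = e"
    "vscale B r e \<in> zero_section B \<longleftrightarrow> r = 0 \<or> e \<in> zero_section B"
    "vscale B 0 e = vzero B (proj B e)" "proj B e \<in> points (base B)"
    "e \<in> zero_section B \<longleftrightarrow> e = vzero B (proj B e)"
proof -
  obtain U \<beta> \<gamma> Bs Vb W \<tau> \<Psi> where bc: "bundle_chart B U \<beta> \<gamma> Bs Vb W \<tau> \<Psi>" and eP: "e \<in> bundle_chart.P B U"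
    using exists_bundle_chart_at[OF assms] by (elim exE conjE)
  interpret bundle_chart B U \<beta> \<gamma> Bs Vb W \<tau> \<Psi> by (rule bc)
  obtain b \<eta> where y: "\<Theta> e = (b, \<eta>)" by (cases "\<Theta> e")
  then have b: "b \<in> Bs" "\<eta> \<in> W" and e: "e = \<Psi> (b, \<eta>)" using \<Theta>_in[OF eP] \<Psi>_\<Theta>[OF eP] by auto
  have sc: "r *\<^sub>R \<eta> \<in> W" for r using b subspace_scale[OF subspace_W] by blast
  show "vscale B r e \<in> points (total B)" "proj B (vscale B r e) = proj B e"
    "vscale B r (vscale B s e) = vscale B (r * s) e" "vscale B 1 e = e"
    "vscale B r e \<in> zero_section B \<longleftrightarrow> r = 0 \<or> e \<in> zero_section B"
    using b sc by (simp_all add: e vscale_\<Psi> \<Psi> \<Psi>_zero_section_iff)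
  show "vscale B 0 e = vzero B (proj B e)" using b by (simp add: e vscale_\<Psi> \<Psi> vzero_\<Psi>)
  show "proj B e \<in> points (base B)" using b \<gamma>_point by (simp add: e \<Psi>)
  show "e \<in> zero_section B \<longleftrightarrow> e = vzero B (proj B e)"
    using b zero_in_W \<Psi>(3)[of b] by (auto simp: e \<Psi>_zero_section_iff \<Psi>(2) vzero_\<Psi>) metis
qed

lemma fnorm_facts:
  assumes "vector_bundle B" "fibrewise_inner_product B ip" "e \<in> points (total B)"
  shows "fnorm ip e = 0 \<longleftrightarrow> e \<in> zero_section B" "0 \<le> ip e e" "fnorm ip (vscale B r e) = \<bar>r\<bar> * fnorm ip e"
    "(fnorm ip e)\<^sup>2 = ip e e" "0 \<le> fnorm ip e"
proof -
  obtain U \<beta> \<gamma> Bs Vb W \<tau> \<Psi> where bc: "bundle_chart B U \<beta> \<gamma> Bs Vb W \<tau> \<Psi>" and eP: "e \<in> bundle_chart.P B U"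
    using exists_bundle_chart_at[OF assms(1,3)] by (elim exE conjE)
  interpret bundle_chart B U \<beta> \<gamma> Bs Vb W \<tau> \<Psi> by (rule bc)
  obtain b \<eta> where y: "\<Theta> e = (b, \<eta>)" by (cases "\<Theta> e")
  then have b: "b \<in> Bs" "\<eta> \<in> W" and e: "e = \<Psi> (b, \<eta>)" using \<Theta>_in[OF eP] \<Psi>_\<Theta>[OF eP] by auto
  have z: "ip (\<Psi> (b, 0)) (\<Psi> (b, 0)) = 0" using ip_scale[OF assms(2) b(1) zero_in_W zero_in_W, of 0] by simp
  have sc: "r *\<^sub>R \<eta> \<in> W" using b subspace_scale[OF subspace_W] by blast
  have pos: "0 < ip e e" if "\<eta> \<noteq> 0" using ip_pos[OF assms(2) b that] by (simp add: e)
  show nn: "0 \<le> ip e e" using pos z by (cases "\<eta> = 0") (auto simp: e less_imp_le)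
  show "fnorm ip e = 0 \<longleftrightarrow> e \<in> zero_section B"
    using pos z \<Psi>_zero_section_iff[OF b] by (cases "\<eta> = 0") (auto simp: e fnorm_def)
  show "fnorm ip (vscale B r e) = \<bar>r\<bar> * fnorm ip e"
    using ip_scale2[OF assms(2) b, of r] by (simp add: e fnorm_def vscale_\<Psi>[OF b] real_sqrt_mult)
  show "(fnorm ip e)\<^sup>2 = ip e e" "0 \<le> fnorm ip e" using nn by (simp_all add: fnorm_def)
qed

lemma smooth_to_ip:
  assumes "vector_bundle B" "fibrewise_inner_product B ip"
  shows "smooth_to (total B) (points (total B)) (\<lambda>e. ip e e)"
proof (rule smooth_to_local[OF openin_topspace])
  show "charted (total B)" using assms(1) manifold_imp_charted unfolding vector_bundle_def by blast
  fix e assume e: "e \<in> points (total B)"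
  obtain U \<beta> \<gamma> Bs Vb W \<tau> \<Psi> where bc: "bundle_chart B U \<beta> \<gamma> Bs Vb W \<tau> \<Psi>" and eP: "e \<in> bundle_chart.P B U"
    using exists_bundle_chart_at[OF assms(1) e] by (elim exE conjE)
  interpret bundle_chart B U \<beta> \<gamma> Bs Vb W \<tau> \<Psi> by (rule bc)
  have "smooth_to (total B) P (\<lambda>e. ip (\<Psi> (\<Theta> e)) (\<Psi> (\<Theta> e)))"
    by (rule smooth_to_compose_smooth_on[OF charted_total smooth_\<Theta> smooth_on_ip[OF assms(2)]]) (rule \<Theta>_in)
  then have "smooth_to (total B) P (\<lambda>e. ip e e)"
    unfolding smooth_to_def
  proof (elim conjE, intro conjI ballI)
    fix i assume all: "\<forall>(U, c)\<in>atlas (total B). smooth_on (c ` (U \<inter> P))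
      (\<lambda>x. ip (\<Psi> (\<Theta> (inv_into U c x))) (\<Psi> (\<Theta> (inv_into U c x))))" and i: "i \<in> atlas (total B)"
    obtain U1 c where Uc: "i = (U1, c)" by (cases i)
    have "smooth_on (c ` (U1 \<inter> P)) (\<lambda>x. ip (\<Psi> (\<Theta> (inv_into U1 c x))) (\<Psi> (\<Theta> (inv_into U1 c x))))"
      using all i Uc by auto
    then have "smooth_on (c ` (U1 \<inter> P)) (\<lambda>x. ip (inv_into U1 c x) (inv_into U1 c x))"
      by (rule smooth_on_cong)
        (use chartedD(2)[OF charted_total i[unfolded Uc]] \<Psi>_\<Theta> in \<open>auto simp: inv_into_f_f\<close>)
    then show "case i of (U, c) \<Rightarrow> smooth_on (c ` (U \<inter> P)) (\<lambda>x. ip (inv_into U c x) (inv_into U c x))"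
      by (simp add: Uc)
  qed
  then show "\<exists>A. e \<in> A \<and> A \<subseteq> points (total B) \<and> smooth_to (total B) A (\<lambda>e. ip e e)"
    using eP P_subset by blast
qed

lemma smooth_into_vscale:
  assumes "vector_bundle B" "smooth_into X (total B) g" "smooth_on X h"
  shows "smooth_into X (total B) (\<lambda>x. vscale B (h x) (g x))"
proof (rule smooth_into_local)
  fix x assume x: "x \<in> X"
  obtain U \<beta> \<gamma> Bs Vb W \<tau> \<Psi> where bc: "bundle_chart B U \<beta> \<gamma> Bs Vb W \<tau> \<Psi>" and eP: "g x \<in> bundle_chart.P B U"
    using exists_bundle_chart_at[OF assms(1) smooth_intoD(3)[OF assms(2) x]] by (elim exE conjE)
  interpret bundle_chart B U \<beta> \<gamma> Bs Vb W \<tau> \<Psi> by (rule bc)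
  obtain V where V: "open V" "{x \<in> X. g x \<in> P} = X \<inter> V"
    by (rule continuous_map_openin_preimage[OF smooth_intoD(1)[OF assms(2)] open_P])
  have gP: "g x \<in> P" if "x \<in> X \<inter> V" for x using that unfolding V(2)[symmetric] by simp
  have "smooth_into (X \<inter> V) (total B) g" by (rule smooth_into_subset[OF assms(2)]) blast
  from smooth_on_smooth_to_compose[OF charted_total smooth_\<Theta> this gP]
  have s\<Theta>: "smooth_on (X \<inter> V) (\<lambda>x. \<Theta> (g x))" .
  have sh: "smooth_on (X \<inter> V) h" by (rule smooth_on_subset[OF assms(3)]) blast
  have "smooth_on (X \<inter> V) (\<lambda>x. (fst (\<Theta> (g x)), h x *\<^sub>R snd (\<Theta> (g x))))"
    by (intro smooth_on_intros s\<Theta> sh)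
  from smooth_into_compose_smooth_on[OF smooth_\<Psi> this]
  have "smooth_into (X \<inter> V) (total B) (\<lambda>x. \<Psi> (fst (\<Theta> (g x)), h x *\<^sub>R snd (\<Theta> (g x))))"
    using vscale_\<Theta>[OF gP] \<Theta>_in by metis
  then have "smooth_into (X \<inter> V) (total B) (\<lambda>x. vscale B (h x) (g x))"
    by (rule smooth_into_cong) (metis vscale_\<Theta> gP \<Psi>_\<Theta>)
  moreover have "x \<in> V" using V(2) x eP by blast
  ultimately show "\<exists>V. open V \<and> x \<in> V \<and> smooth_into (X \<inter> V) (total B) (\<lambda>x. vscale B (h x) (g x))"
    using V(1) by blast
qed

text \<open>Pasted together from the open sets over which it holds; the domains of bundle charts are
  such sets and cover the total space.\<close>

lemma continuous_map_vscale:
  fixes B :: "('e, 'a::euclidean_space, 'f, 'b::euclidean_space) vbundle"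
  assumes "vector_bundle B"
  shows "continuous_map (prod_topology euclideanreal (mtop (total B))) (mtop (total B)) (\<lambda>x. vscale B (fst x) (snd x))"
proof -
  define \<A> where "\<A> = {A. openin (mtop (total B)) A \<and>
    continuous_map (prod_topology euclideanreal (subtopology (mtop (total B)) A)) (mtop (total B)) (\<lambda>x. vscale B (fst x) (snd x))}"
  show ?thesis
  proof (rule pasting_lemma[of \<A> _ "\<lambda>A. UNIV \<times> A" _ "\<lambda>_ x. vscale B (fst x) (snd x)"])
    fix A assume A: "A \<in> \<A>"
    show "openin (prod_topology euclideanreal (mtop (total B))) (UNIV \<times> A)"
      using A by (simp add: \<A>_def openin_prod_Times_iff)
    show "continuous_map (subtopology (prod_topology euclideanreal (mtop (total B))) (UNIV \<times> A)) (mtop (total B)) (\<lambda>x. vscale B (fst x) (snd x))"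
      using A by (simp add: \<A>_def subtopology_Times)
  next
    fix x assume "x \<in> topspace (prod_topology euclideanreal (mtop (total B)))"
    then have e: "snd x \<in> points (total B)" by auto
    obtain U \<beta> \<gamma> Bs Vb W \<tau> \<Psi> where bc: "bundle_chart B U \<beta> \<gamma> Bs Vb W \<tau> \<Psi>" and eP: "snd x \<in> bundle_chart.P B U"
      using exists_bundle_chart_at[OF assms e] by (elim exE conjE)
    interpret bundle_chart B U \<beta> \<gamma> Bs Vb W \<tau> \<Psi> by (rule bc)
    let ?T = "prod_topology euclideanreal (subtopology (mtop (total B)) P)"
    have tsP: "topspace ?T = UNIV \<times> P" using P_subset by auto
    have "continuous_map ?T euclidean (\<Theta> \<circ> snd)"
      by (rule continuous_map_compose[OF continuous_map_snd continuous_map_\<Theta>])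
    then have "continuous_map ?T (prod_topology euclideanreal euclidean) (\<lambda>x. (fst x, (\<Theta> \<circ> snd) x))"
      by (intro continuous_map_pairedI continuous_map_fst)
    moreover have "continuous_map (prod_topology euclideanreal euclidean) euclidean
       (\<lambda>y :: real \<times> 'b \<times> 'a. (fst (snd y), fst y *\<^sub>R snd (snd y)))"
      by (auto intro!: continuous_intros)
    ultimately have "continuous_map ?T euclidean
        ((\<lambda>y. (fst (snd y), fst y *\<^sub>R snd (snd y))) \<circ> (\<lambda>x. (fst x, (\<Theta> \<circ> snd) x)))"
      by (rule continuous_map_compose)
    then have "continuous_map ?T (top_of_set (Bs \<times> W)) (\<lambda>x. (fst (\<Theta> (snd x)), fst x *\<^sub>R snd (\<Theta> (snd x))))"
      using \<Theta>_in subspace_scale[OF subspace_W] tsP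
      by (auto simp: continuous_map_in_subtopology o_def mem_Times_iff)
    from continuous_map_compose[OF this smooth_intoD(1)[OF smooth_\<Psi>]]
    have "continuous_map ?T (mtop (total B)) (\<lambda>x. \<Psi> (fst (\<Theta> (snd x)), fst x *\<^sub>R snd (\<Theta> (snd x))))"
      by (simp add: o_def)
    then have "continuous_map ?T (mtop (total B)) (\<lambda>x. vscale B (fst x) (snd x))"
    proof (rule continuous_map_eq)
      fix x assume "x \<in> topspace ?T"
      then have "x \<in> UNIV \<times> P" by (simp only: tsP)
      then have "snd x \<in> P" by (simp only: mem_Times_iff)
      then show "\<Psi> (fst (\<Theta> (snd x)), fst x *\<^sub>R snd (\<Theta> (snd x))) = vscale B (fst x) (snd x)"
        using vscale_\<Theta>[of "snd x" "fst x"] \<Psi>_\<Theta>[of "vscale B (fst x) (snd x)"] by simp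
    qed
    then have "P \<in> \<A>" using open_P by (simp add: \<A>_def)
    then show "\<exists>A. A \<in> \<A> \<and> x \<in> UNIV \<times> A \<and> vscale B (fst x) (snd x) = vscale B (fst x) (snd x)"
      using eP by (intro exI[of _ P] conjI) (simp_all add: mem_Times_iff)
  qed simp
qed

section \<open>Charts adapted to the unit sphere bundle\<close>

text \<open>The limit is taken from the right because later the path
  \<open>x + t *\<^sub>R v\<close> is known to stay in the relevant chart image for small positive
  \<open>t\<close>.\<close>

lemma has_derivative_directional:
  assumes "(F has_derivative D) (at x)"
  shows "((\<lambda>t. (F (x + t *\<^sub>R v) - F x) /\<^sub>R t) \<longlongrightarrow> D v) (at_right 0)"
proof -
  have "((\<lambda>t. x + t *\<^sub>R v) has_derivative (\<lambda>t. t *\<^sub>R v)) (at (0::real))"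
    by (auto intro!: derivative_eq_intros)
  from has_derivative_compose[OF this, of F D]
  have 1: "((\<lambda>t. F (x + t *\<^sub>R v)) has_derivative (\<lambda>t. D (t *\<^sub>R v))) (at (0::real))" using assms by simp
  have D: "D (t *\<^sub>R v) = t *\<^sub>R D v" for t
    using has_derivative_linear[OF assms] by (rule linear_scale)
  have "((\<lambda>t. F (x + t *\<^sub>R v)) has_derivative (\<lambda>t. D (t *\<^sub>R v))) (at_right (0::real))"
    using 1 by (rule has_derivative_at_withinI)
  then have "((\<lambda>t. (1 / norm (t - 0)) *\<^sub>R (F (x + t *\<^sub>R v) - (F (x + 0 *\<^sub>R v) + D ((t - 0) *\<^sub>R v)))) \<longlongrightarrow> 0) (at_right 0)"
    unfolding has_derivative_within by (rule conjunct2)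
  moreover have "\<forall>\<^sub>F t in at_right 0. (1 / norm (t - 0)) *\<^sub>R (F (x + t *\<^sub>R v) - (F (x + 0 *\<^sub>R v) + D ((t - 0) *\<^sub>R v))) =
      (F (x + t *\<^sub>R v) - F x) /\<^sub>R t - D v"
    using eventually_at_right_less[of "0::real"]
    by eventually_elim (simp add: D algebra_simps divide_inverse)
  ultimately have "((\<lambda>t. (F (x + t *\<^sub>R v) - F x) /\<^sub>R t - D v) \<longlongrightarrow> 0) (at_right 0)"
    by (rule Lim_transform_eventually)
  then show ?thesis by (rule LIM_zero_cancel)
qed

lemma tendsto_at_right_in_closed:
  fixes f :: "real \<Rightarrow> 'a::topological_space"
  assumes "(f \<longlongrightarrow> l) (at_right 0)" "closed S" "\<forall>\<^sub>F t in at_right 0. f t \<in> S"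
  shows "l \<in> S"
  by (rule Lim_in_closed_set[OF assms(2,3) _ assms(1)]) simp

text \<open>\<open>g\<close> and \<open>k\<close> will be extensions of chart transitions beyond a
  subspace or a half-space, so they invert each other along certain directions and for small
  positive \<open>t\<close>. One-sided directional derivatives are enough.\<close>

lemma derivative_left_inverse:
  assumes g: "(g has_derivative Dg) (at y)" and k: "(k has_derivative Dk) (at (g y))"
    and "\<forall>\<^sub>F t in at_right 0. k (g (y + t *\<^sub>R v)) = y + t *\<^sub>R v" and "k (g y) = y"
  shows "Dk (Dg v) = v"
proof -
  have "((\<lambda>x. k (g x)) has_derivative (\<lambda>x. Dk (Dg x))) (at y)" by (rule has_derivative_compose[OF g k])
  from has_derivative_directional[OF this, of v]
  have "((\<lambda>t. (k (g (y + t *\<^sub>R v)) - y) /\<^sub>R t) \<longlongrightarrow> Dk (Dg v)) (at_right 0)" using assms(4) by simp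
  moreover have "\<forall>\<^sub>F t in at_right 0. (k (g (y + t *\<^sub>R v)) - y) /\<^sub>R t = v"
    using assms(3) eventually_at_right_less[of 0] by eventually_elim simp
  then have "((\<lambda>t. (k (g (y + t *\<^sub>R v)) - y) /\<^sub>R t) \<longlongrightarrow> v) (at_right 0)" by (rule tendsto_eventually)
  ultimately show ?thesis using tendsto_unique[of "at_right (0::real)"] by (metis trivial_limit_at_right_real)
qed

lemma eventually_path_in_open:
  fixes x v :: "'a::real_normed_vector"
  assumes "open S" "x \<in> S"
  shows "\<forall>\<^sub>F t in at_right 0. x + t *\<^sub>R v \<in> S"
proof -
  have "((\<lambda>t. x + t *\<^sub>R v) \<longlongrightarrow> x + 0 *\<^sub>R v) (at_right 0)" by (intro tendsto_intros)
  then show ?thesis using topological_tendstoD[OF _ assms(1)] assms(2) by fastforce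
qed

text \<open>Invariance of the boundary: a half-space chart of the maximal atlas cannot reach its
  bounding hyperplane. At such a point the inward vector \<open>a\<close> would correspond to some
  \<open>w\<close> in a chart \<open>c0\<close> with open image, where \<open>- w\<close> is an
  admissible direction too; carried back, \<open>- a\<close> would also point into the
  half-space.\<close>

lemma maximal_chart_open:
  assumes M: "manifold M" and c: "(U, c) \<in> maximal_atlas M"
  obtains V where "subspace V" "openin (top_of_set V) (c ` U)"
proof -
  note ch = manifold_imp_charted[OF M]
  have mb: "manifold_with_boundary M" using M by (simp add: manifold_def)
  note cmax = smooth_into_maximal_chart[OF ch c]
  have "is_chart M U c" using c by (auto simp: maximal_atlas_def)
  then obtain V where V: "subspace V" "openin (top_of_set V) (c ` U) \<or>
      (\<exists>a\<in>V. a \<noteq> 0 \<and> openin (top_of_set (half_space V a)) (c ` U))"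
    unfolding is_chart_def by blast
  show ?thesis
  proof (cases "openin (top_of_set V) (c ` U)")
    case True
    then show ?thesis using V that by blast
  next
    case False
    then obtain a where a: "a \<in> V" "a \<noteq> 0" "openin (top_of_set (half_space V a)) (c ` U)" using V by blast
    have pos: "a \<bullet> c p > 0" if p: "p \<in> U" for p
    proof (rule ccontr)
      have "c p \<in> half_space V a" using openin_imp_subset[OF a(3)] p by blast
      moreover assume "\<not> a \<bullet> c p > 0"
      ultimately have ap: "a \<bullet> c p = 0" "c p \<in> V" by (auto simp: half_space_def)
      have "p \<in> points M" using p cmax(4) openin_subset by blast
      then obtain U0 c0 where c0: "(U0, c0) \<in> atlas M" "p \<in> U0" by (rule charted_cover[OF ch])
      obtain V0 where V0: "subspace V0" "openin (top_of_set V0) (c0 ` U0)" by (rule manifold_chart_open[OF M c0(1)])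
      note inj0 = chartedD(2)[OF ch c0(1)]
      have s1: "smooth_on {x \<in> c ` U. inv_into U c x \<in> U0} (\<lambda>x. c0 (inv_into U c x))"
        by (rule smooth_intoD(2)[OF cmax(1) c0(1)])
      have s2: "smooth_on (c0 ` (U0 \<inter> U)) (\<lambda>x. c (inv_into U0 c0 x))"
        by (rule smooth_toD(2)[OF cmax(2) c0(1)])
      have in1: "c p \<in> {x \<in> c ` U. inv_into U c x \<in> U0}" using p c0 cmax(3) by simp
      have in2: "c0 p \<in> c0 ` (U0 \<inter> U)" using p c0 by blast
      obtain Ug g where g: "open Ug" "c p \<in> Ug" "smooth_on Ug g"
        "\<And>y. y \<in> {x \<in> c ` U. inv_into U c x \<in> U0} \<inter> Ug \<Longrightarrow> g y = c0 (inv_into U c y)"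
        "(g has_derivative frechet_derivative g (at (c p))) (at (c p))"
        by (rule smooth_on_extension_has_derivative[OF s1 in1]) (rule that; assumption)
      obtain Uk k where k: "open Uk" "c0 p \<in> Uk" "smooth_on Uk k"
        "\<And>y. y \<in> c0 ` (U0 \<inter> U) \<inter> Uk \<Longrightarrow> k y = c (inv_into U0 c0 y)"
        "(k has_derivative frechet_derivative k (at (c0 p))) (at (c0 p))"
        by (rule smooth_on_extension_has_derivative[OF s2 in2]) (rule that; assumption)
      have gcp: "g (c p) = c0 p" using g(2,4) in1 cmax(3) p by simp
      have kcp: "k (c0 p) = c p" using k(2,4) in2 inj0 c0 by simp
      obtain T1 where T1: "open T1" "c ` U = half_space V a \<inter> T1" using a(3) by (auto simp: openin_open)
      obtain T2 where T2: "open T2" "{x \<in> c ` U. inv_into U c x \<in> U0} = c ` U \<inter> T2"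
        by (rule continuous_map_openin_preimage[OF smooth_intoD(1)[OF cmax(1)] chartedD(1)[OF ch c0(1)]])
      obtain T3 where T3: "open T3" "c0 ` U0 = V0 \<inter> T3" using V0(2) by (auto simp: openin_open)
      obtain T4 where T4: "open T4" "{x \<in> c0 ` U0. inv_into U0 c0 x \<in> U} = c0 ` U0 \<inter> T4"
        by (rule continuous_map_openin_preimage[OF chartedD(4)[OF ch c0(1)] cmax(4)])
      have ev1: "\<forall>\<^sub>F t in at_right 0. c p + t *\<^sub>R a \<in> {x \<in> c ` U. inv_into U c x \<in> U0} \<inter> Ug"
      proof -
        have "c p \<in> T1 \<inter> T2 \<inter> Ug" using in1 T1(2) T2(2) g(2) by blast
        then have "\<forall>\<^sub>F t in at_right 0. c p + t *\<^sub>R a \<in> T1 \<inter> T2 \<inter> Ug"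
          by (intro eventually_path_in_open open_Int T1 T2 g)
        then show ?thesis using eventually_at_right_less[of 0]
        proof eventually_elim
          case (elim t)
          have "c p + t *\<^sub>R a \<in> half_space V a"
            using ap a V(1) elim(2) by (auto simp: half_space_def inner_add_right subspace_add subspace_scale)
          then have "c p + t *\<^sub>R a \<in> c ` U \<inter> T2" using elim(1) T1(2) by blast
          then show ?case using T2(2) elim(1) by blast
        qed
      qed
      define w where "w = frechet_derivative g (at (c p)) a"
      have gin: "\<forall>\<^sub>F t in at_right 0. g (c p + t *\<^sub>R a) \<in> c0 ` (U0 \<inter> U) \<and> k (g (c p + t *\<^sub>R a)) = c p + t *\<^sub>R a"
      proof -
        have "isCont g (c p)" using g(5) has_derivative_continuous by blast
        then have "((\<lambda>t. g (c p + t *\<^sub>R a)) \<longlongrightarrow> g (c p)) (at_right 0)"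
          by (rule isCont_tendsto_compose) (auto intro!: tendsto_eq_intros)
        then have "\<forall>\<^sub>F t in at_right 0. g (c p + t *\<^sub>R a) \<in> Uk"
          using topological_tendstoD[OF _ k(1)] k(2) gcp by metis
        with ev1 show ?thesis
        proof eventually_elim
          case (elim t)
          then obtain p' where p': "p' \<in> U" "p' \<in> U0" "c p + t *\<^sub>R a = c p'" using cmax(3) by auto
          have gp': "g (c p') = c0 p'" using g(4)[OF elim(1)] p' cmax(3) by simp
          moreover have "k (c0 p') = c p'"
            using k(4)[of "c0 p'"] elim(2) p' gp' inj0 by auto
          ultimately show ?case using p' by auto
        qed
      qed
      have Dk: "frechet_derivative k (at (c0 p)) w = a"
        unfolding w_def
        by (rule derivative_left_inverse[OF g(5), of k]) (use k(5) gcp kcp gin in \<open>auto elim: eventually_mono\<close>)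
      have wV0: "w \<in> V0"
      proof (rule tendsto_at_right_in_closed[OF has_derivative_directional[OF g(5), of a, folded w_def] closed_subspace[OF V0(1)]])
        show "\<forall>\<^sub>F t in at_right 0. (g (c p + t *\<^sub>R a) - g (c p)) /\<^sub>R t \<in> V0"
          using gin
        proof eventually_elim
          case (elim t)
          have "g (c p + t *\<^sub>R a) \<in> V0" "g (c p) \<in> V0" using elim T3(2) gcp c0(2) by blast+
          then show ?case using V0(1) by (simp add: subspace_diff subspace_scale)
        qed
      qed
      \<comment> \<open>Here the openness of the image of \<open>c0\<close> is used: the path may
        also leave in the direction opposite to \<open>w\<close>.\<close>
      have ev2: "\<forall>\<^sub>F t in at_right 0. c0 p + t *\<^sub>R (- w) \<in> c0 ` (U0 \<inter> U) \<inter> Uk"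
      proof -
        have "c0 p \<in> {x \<in> c0 ` U0. inv_into U0 c0 x \<in> U}" using c0(2) p inj0 by simp
        then have "c0 p \<in> T3 \<inter> T4 \<inter> Uk" using T3(2) T4(2) k(2) by blast
        then have "\<forall>\<^sub>F t in at_right 0. c0 p + t *\<^sub>R (- w) \<in> T3 \<inter> T4 \<inter> Uk"
          by (intro eventually_path_in_open open_Int T3 T4 k)
        then show ?thesis
        proof eventually_elim
          case (elim t)
          have "c0 p \<in> V0" using c0(2) T3(2) by blast
          then have "c0 p + t *\<^sub>R (- w) \<in> V0" using V0(1) wV0 by (intro subspace_add subspace_scale subspace_neg)
          then have "c0 p + t *\<^sub>R (- w) \<in> c0 ` U0 \<inter> T4" using T3(2) elim by blast
          then have "c0 p + t *\<^sub>R (- w) \<in> c0 ` (U0 \<inter> U)" unfolding T4(2)[symmetric] using inj0 by auto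
          then show ?case using elim by blast
        qed
      qed
      have lim: "((\<lambda>t. a \<bullet> ((k (c0 p + t *\<^sub>R (- w)) - k (c0 p)) /\<^sub>R t)) \<longlongrightarrow> a \<bullet> frechet_derivative k (at (c0 p)) (- w)) (at_right 0)"
        by (intro tendsto_intros has_derivative_directional k(5))
      have "a \<bullet> frechet_derivative k (at (c0 p)) (- w) \<in> {0..}"
      proof (rule tendsto_at_right_in_closed[OF lim])
        show "\<forall>\<^sub>F t in at_right 0. a \<bullet> ((k (c0 p + t *\<^sub>R (- w)) - k (c0 p)) /\<^sub>R t) \<in> {0..}"
          using ev2 eventually_at_right_less[of 0]
        proof eventually_elim
          case (elim t)
          then obtain p' where p': "p' \<in> U" "p' \<in> U0" "c0 p + t *\<^sub>R (- w) = c0 p'" by blast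
          have "k (c0 p') = c p'" using k(4)[of "c0 p'"] elim p' inj0 by auto
          moreover have "c p' \<in> half_space V a" using T1(2) p' by blast
          ultimately show ?case using elim(2) kcp ap p'(3) by (simp add: half_space_def inner_diff_right)
        qed
      qed simp
      moreover have "frechet_derivative k (at (c0 p)) (- w) = - a"
        using Dk linear_neg[OF has_derivative_linear[OF k(5)], of w] by simp
      ultimately have "a \<bullet> a \<le> 0" by simp
      then show False using a(2) by (simp add: inner_gt_zero_iff[symmetric] del: inner_gt_zero_iff)
    qed
    obtain T where T: "open T" "c ` U = half_space V a \<inter> T" using a(3) by (auto simp: openin_open)
    have "a \<bullet> x > 0" if "x \<in> c ` U" for x using pos that by blast
    then have "c ` U = V \<inter> (T \<inter> {x. a \<bullet> x > 0})" using T(2) by (auto simp: half_space_def)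
    moreover have "open (T \<inter> {x. a \<bullet> x > 0})" using T(1) open_halfspace_gt by blast
    ultimately have "openin (top_of_set V) (c ` U)" by (auto simp: openin_open)
    then show ?thesis using V that by blast
  qed
qed

text \<open>Slice charts must have values in \<open>'a\<close>, whereas a bundle chart has them in
  \<open>'b \<times> 'a\<close>. The transition from the bundle chart to a chart of the total space
  has a derivative that is injective on the model space, and this linear map recodes the
  coordinates.\<close>

lemma (in bundle_chart) exists_linear_embedding:
  assumes e: "e \<in> P"
  obtains L :: "'b \<times> 'a \<Rightarrow> 'a" where "linear L" "inj_on L (Vb \<times> W)"
proof -
  define y where "y = \<Theta> e"
  have y: "y \<in> Bs \<times> W" "\<Psi> y = e" using \<Theta>_in[OF e] \<Psi>_\<Theta>[OF e] by (auto simp: y_def)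
  have "e \<in> points (total B)" using e P_subset by blast
  then obtain U1 c where c: "(U1, c) \<in> atlas (total B)" "e \<in> U1" by (rule charted_cover[OF charted_total])
  note inj = chartedD(2)[OF charted_total c(1)]
  define A where "A = {y \<in> Bs \<times> W. \<Psi> y \<in> U1}"
  have s1: "smooth_on A (\<lambda>y. c (\<Psi> y))" unfolding A_def by (rule smooth_intoD(2)[OF smooth_\<Psi> c(1)])
  have s2: "smooth_on (c ` (U1 \<inter> P)) (\<lambda>x. \<Theta> (inv_into U1 c x))" by (rule smooth_toD(2)[OF smooth_\<Theta> c(1)])
  have yA: "y \<in> A" using y c by (simp add: A_def)
  have cP: "c e \<in> c ` (U1 \<inter> P)" using e c by blast
  obtain Ug g where g: "open Ug" "y \<in> Ug" "smooth_on Ug g" "\<And>y. y \<in> A \<inter> Ug \<Longrightarrow> g y = c (\<Psi> y)"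
    "(g has_derivative frechet_derivative g (at y)) (at y)"
    by (rule smooth_on_extension_has_derivative[OF s1 yA]) (rule that; assumption)
  obtain Uk k where k: "open Uk" "c e \<in> Uk" "smooth_on Uk k"
    "\<And>x. x \<in> c ` (U1 \<inter> P) \<inter> Uk \<Longrightarrow> k x = \<Theta> (inv_into U1 c x)"
    "(k has_derivative frechet_derivative k (at (c e))) (at (c e))"
    by (rule smooth_on_extension_has_derivative[OF s2 cP]) (rule that; assumption)
  have gy: "g y = c e" using g(2,4) yA y by auto
  have kg: "k (g y') = y'" if "y' \<in> A" "y' \<in> Ug" "g y' \<in> Uk" for y'
  proof -
    have "\<Psi> y' \<in> U1 \<inter> P" "g y' = c (\<Psi> y')" using that g(4) \<Psi>_in by (auto simp: A_def)
    then show ?thesis using k(4)[of "g y'"] that inj \<Theta>_\<Psi> by (auto simp: A_def inv_into_f_f)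
  qed
  obtain T1 where T1: "open T1" "A = (Bs \<times> W) \<inter> T1"
    unfolding A_def by (rule continuous_map_openin_preimage[OF smooth_intoD(1)[OF smooth_\<Psi>] chartedD(1)[OF charted_total c(1)]])
  obtain T2 where T2: "open T2" "Bs \<times> W = (Vb \<times> W) \<inter> T2" using open_\<Theta>_range by (auto simp: openin_open)
  define L where "L = frechet_derivative g (at y)"
  have linL: "linear L" unfolding L_def using has_derivative_linear[OF g(5)] .
  have DkL: "frechet_derivative k (at (c e)) (L v) = v" if v: "v \<in> Vb \<times> W" for v
    unfolding L_def
  proof (rule derivative_left_inverse[OF g(5), of k])
    show "(k has_derivative frechet_derivative k (at (c e))) (at (g y))" using k(5) gy by simp
    show "k (g y) = y" by (rule kg[OF yA g(2)]) (use gy k(2) in simp)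
    have "isCont g y" using g(5) has_derivative_continuous by blast
    then have "((\<lambda>t. g (y + t *\<^sub>R v)) \<longlongrightarrow> g y) (at_right 0)"
      by (rule isCont_tendsto_compose) (auto intro!: tendsto_eq_intros)
    then have "\<forall>\<^sub>F t in at_right 0. g (y + t *\<^sub>R v) \<in> Uk"
      using topological_tendstoD[OF _ k(1)] k(2) gy by metis
    moreover have "y \<in> (Vb \<times> W) \<inter> T2 \<inter> T1" using yA unfolding T1(2) T2(2) .
    then have "y \<in> T1 \<inter> T2 \<inter> Ug" using g(2) by (simp only: Int_iff)
    then have "\<forall>\<^sub>F t in at_right 0. y + t *\<^sub>R v \<in> T1 \<inter> T2 \<inter> Ug"
      by (intro eventually_path_in_open open_Int T1 T2 g)
    ultimately show "\<forall>\<^sub>F t in at_right 0. k (g (y + t *\<^sub>R v)) = y + t *\<^sub>R v"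
    proof eventually_elim
      case (elim t)
      have "y \<in> Vb \<times> W" using openin_imp_subset[OF open_\<Theta>_range] y(1) by (rule subsetD)
      then have "y + t *\<^sub>R v \<in> Vb \<times> W"
        by (intro subspace_add[OF subspace_VbW] subspace_scale[OF subspace_VbW] v)
      then have "y + t *\<^sub>R v \<in> (Vb \<times> W) \<inter> T2 \<inter> T1" using elim by (simp only: Int_iff)
      then have "y + t *\<^sub>R v \<in> A" unfolding T1(2) T2(2) .
      then show ?case using kg elim by (simp only: Int_iff)
    qed
  qed
  have "inj_on L (Vb \<times> W)" by (rule inj_on_inverseI[of _ "frechet_derivative k (at (c e))"]) (rule DkL)
  with linL show ?thesis by (rule that)
qed

text \<open>In a bundle chart, the sphere bundle is straightened by central projection of the fibre to an affine
  hyperplane, with \<open>|e|\<^sup>2 - 1\<close> as the remaining coordinate.\<close>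

lemma exists_sphere_slice_chart:
  fixes B :: "('e, 'a::euclidean_space, 'f, 'b::euclidean_space) vbundle"
  assumes B: "vector_bundle B" and ip: "fibrewise_inner_product B ip"
    and e0: "e0 \<in> points (total B)" "e0 \<notin> zero_section B"
  defines "S \<equiv> {e \<in> points (total B). fnorm ip e = 1}"
  obtains A and c :: "'e \<Rightarrow> 'a" and T where "e0 \<in> A" "(A, c) \<in> maximal_atlas (total B)" "subspace T" "c ` (A \<inter> S) = c ` A \<inter> T"
proof -
  obtain U \<beta> \<gamma> Bs Vb W \<tau> \<Psi> where bc: "bundle_chart B U \<beta> \<gamma> Bs Vb W \<tau> \<Psi>" and eP: "e0 \<in> bundle_chart.P B U"
    using exists_bundle_chart_at[OF B e0(1)] by (elim exE conjE)
  interpret bundle_chart B U \<beta> \<gamma> Bs Vb W \<tau> \<Psi> by (rule bc)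
  obtain L :: "'b \<times> 'a \<Rightarrow> 'a" where L: "linear L" "inj_on L (Vb \<times> W)"
    by (rule exists_linear_embedding[OF eP]) (rule that; assumption)
  obtain L' where L': "linear L'" "\<And>y. y \<in> Vb \<times> W \<Longrightarrow> L' (L y) = y"
    using linear_exists_left_inverse_on[OF L(1) subspace_VbW L(2)] by metis
  define h where "h = snd (\<Theta> e0)"
  define n where "n = h \<bullet> h"
  have hW: "h \<in> W" and h0: "h \<noteq> 0"
    using \<Theta>_in[OF eP] zero_section_\<Theta>_iff[OF eP] e0(2) by (auto simp: h_def mem_Times_iff)
  then have n0: "0 < n" by (simp add: n_def)
  define q where "q y = ip (\<Psi> y) (\<Psi> y)" for y
  have smq: "smooth_on (Bs \<times> W) q" unfolding q_def[abs_def] by (rule smooth_on_ip[OF ip])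
  have qpos: "0 < q (b, \<eta>)" if "b \<in> Bs" "\<eta> \<in> W" "\<eta> \<bullet> h > 0" for b \<eta>
  proof -
    have "\<eta> \<noteq> 0" using that(3) by auto
    then show ?thesis unfolding q_def by (rule ip_pos[OF ip that(1,2)])
  qed
  have qsc: "q (b, r *\<^sub>R \<eta>) = r\<^sup>2 * q (b, \<eta>)" if "b \<in> Bs" "\<eta> \<in> W" for b \<eta> r
    unfolding q_def by (rule ip_scale2[OF ip that])
  \<comment> \<open>Here \<open>h\<close> is the fibre coordinate of \<open>e0\<close>. With \<eta>
    for \<open>snd y\<close>, \<open>(n / (\<eta> \<bullet> h)) \<eta>\<close> is the central
    projection to the hyperplane \<open>\<eta> \<bullet> h = n\<close>; subtracting \<open>h\<close>
    moves it into the orthogonal complement of \<open>h\<close>, and \<open>q y - 1\<close> is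
    entered along \<open>h\<close>.\<close>
  define R where "R y = (fst y, (n / (snd y \<bullet> h)) *\<^sub>R snd y - h + (q y - 1) *\<^sub>R h)" for y
  \<comment> \<open>The part orthogonal to \<open>h\<close>, plus \<open>h\<close>: this is the
    point of the affine hyperplane on the ray in question. \<open>R'\<close> then scales it to the
    prescribed value of \<open>q\<close>.\<close>
  define \<kappa> where "\<kappa> y = (fst y, snd y + (1 - (snd y \<bullet> h) / n) *\<^sub>R h)" for y :: "'b \<times> 'a"
  define R' where "R' y = (fst y, sqrt ((1 + (snd y \<bullet> h) / n) / q (\<kappa> y)) *\<^sub>R snd (\<kappa> y))" for y
  define D where "D = {y \<in> Bs \<times> W. snd y \<bullet> h > 0}"
  \<comment> \<open>The bound \<open>- n\<close> says that the prescribed value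
    \<open>1 + (snd y \<bullet> h) / n\<close> of \<open>q\<close> is positive.\<close>
  define I where "I = {y \<in> Bs \<times> W. snd y \<bullet> h > - n}"
  have \<kappa>: "\<kappa> y \<in> Bs \<times> W" "snd (\<kappa> y) \<bullet> h = n" if "y \<in> Bs \<times> W" for y
    using that hW n0 by (auto simp: \<kappa>_def mem_Times_iff n_def inner_add_left intro!: subspace_add[OF subspace_W] subspace_scale[OF subspace_W])
      (simp add: algebra_simps)
  have snR: "snd (R y) \<bullet> h = (q y - 1) * n" if "y \<in> D" for y
    using that n0 by (simp add: R_def D_def inner_add_left inner_diff_left n_def)
  have R1: "R y \<in> I" "R' (R y) = y" if y: "y \<in> D" for y
  proof -
    obtain b \<eta> where eq: "y = (b, \<eta>)" by (cases y)
    have b: "b \<in> Bs" "\<eta> \<in> W" "0 < \<eta> \<bullet> h" using y by (auto simp: D_def eq)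
    note qp = qpos[OF b]
    have "(n / (\<eta> \<bullet> h)) *\<^sub>R \<eta> - h + (q y - 1) *\<^sub>R h \<in> W"
      by (intro subspace_add[OF subspace_W] subspace_diff[OF subspace_W] subspace_scale[OF subspace_W] b hW)
    moreover have "(q y - 1) * n > - n" using qp n0 by (simp add: eq algebra_simps)
    ultimately show "R y \<in> I" using snR[OF y] b by (simp add: I_def R_def eq)
    have "(snd (R y) \<bullet> h) / n = q y - 1" using snR[OF y] n0 by simp
    then have "\<kappa> (R y) = (b, (n / (\<eta> \<bullet> h)) *\<^sub>R \<eta> - h + ((q y - 1) *\<^sub>R h + (1 - (q y - 1)) *\<^sub>R h))"
      unfolding \<kappa>_def by (simp add: R_def eq)
    then have k1: "\<kappa> (R y) = (b, (n / (\<eta> \<bullet> h)) *\<^sub>R \<eta>)"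
      unfolding scaleR_left_distrib[symmetric] by simp
    have "(1 + (snd (R y) \<bullet> h) / n) / q (\<kappa> (R y)) = ((\<eta> \<bullet> h) / n)\<^sup>2"
      using snR[OF y] n0 qp b(3) unfolding k1 qsc[OF b(1,2)] by (simp add: eq power_divide)
    then have "sqrt ((1 + (snd (R y) \<bullet> h) / n) / q (\<kappa> (R y))) = (\<eta> \<bullet> h) / n"
      using b(3) n0 by simp
    then show "R' (R y) = y" unfolding R'_def k1 using b(3) n0 by (simp add: eq R_def)
  qed
  have R2: "R' y \<in> D" "R (R' y) = y" if y: "y \<in> I" for y
  proof -
    obtain b \<zeta> where eq: "y = (b, \<zeta>)" by (cases y)
    have b: "b \<in> Bs" "\<zeta> \<in> W" "- n < \<zeta> \<bullet> h" using y by (auto simp: I_def eq)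
    define w where "w = snd (\<kappa> y)"
    have w: "w \<in> W" "w \<bullet> h = n" using \<kappa>[of y] b by (auto simp: w_def eq mem_Times_iff)
    have kw: "\<kappa> y = (b, w)" by (simp add: w_def \<kappa>_def eq)
    have qp: "0 < q (b, w)" using qpos[OF b(1) w(1)] w(2) n0 by simp
    have r: "0 < 1 + (\<zeta> \<bullet> h) / n" using b(3) n0 by (simp add: field_simps)
    define l where "l = sqrt ((1 + (\<zeta> \<bullet> h) / n) / q (b, w))"
    have l: "0 < l" using qp r by (simp add: l_def)
    have R'y: "R' y = (b, l *\<^sub>R w)" unfolding R'_def kw l_def by (simp add: eq)
    then show "R' y \<in> D" using b w l n0 by (simp add: D_def subspace_scale[OF subspace_W])
    have ql: "q (b, l *\<^sub>R w) = 1 + (\<zeta> \<bullet> h) / n"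
      unfolding qsc[OF b(1) w(1)] l_def using qp r by simp
    have "(n / (l *\<^sub>R w \<bullet> h)) *\<^sub>R (l *\<^sub>R w) = w" using w(2) l n0 by simp
    then have "R (R' y) = (b, w - h + ((\<zeta> \<bullet> h) / n) *\<^sub>R h)" unfolding R'y by (simp add: R_def ql)
    also have "\<dots> = y" by (simp add: w_def \<kappa>_def eq algebra_simps)
    finally show "R (R' y) = y" .
  qed
  have smR: "smooth_on D R"
    unfolding R_def
    by (intro smooth_on_intros smooth_on_divide smooth_on_subset[OF smq]) (auto simp: D_def)
  have smR': "smooth_on I R'"
  proof -
    have sk: "smooth_on I \<kappa>" unfolding \<kappa>_def divide_inverse by (intro smooth_on_intros)
    have sq: "smooth_on I (\<lambda>y. q (\<kappa> y))"
      by (rule smooth_on_compose'[OF smq sk]) (use \<kappa>(1) in \<open>auto simp: I_def\<close>)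
    have p: "0 < q (\<kappa> y)" if "y \<in> I" for y
      using qpos[of "fst (\<kappa> y)" "snd (\<kappa> y)"] \<kappa>[of y] that n0 by (auto simp: I_def mem_Times_iff)
    have p2: "0 < 1 + (snd y \<bullet> h) / n" if "y \<in> I" for y using that n0 by (auto simp: I_def field_simps)
    have "smooth_on I (\<lambda>y. (1 + (snd y \<bullet> h) / n) / q (\<kappa> y))"
      by (intro smooth_on_divide smooth_on_add smooth_on_const smooth_on_inner smooth_on_snd smooth_on_id sq)
        (use p n0 in auto, metis less_irrefl)
    then have "smooth_on I (\<lambda>y. sqrt ((1 + (snd y \<bullet> h) / n) / q (\<kappa> y)))"
      by (rule smooth_on_sqrt) (use p p2 in auto)
    then show ?thesis unfolding R'_def by (intro smooth_on_intros sk)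
  qed
  define A where "A = {e \<in> P. snd (\<Theta> e) \<bullet> h > 0}"
  define c where "c e = L (R (\<Theta> e))" for e
  define d where "d x = \<Psi> (R' (L' x))" for x
  have e0A: "e0 \<in> A" using eP n0 by (simp add: A_def h_def[symmetric] n_def)
  have AD: "\<Theta> e \<in> D" if "e \<in> A" for e using that \<Theta>_in by (auto simp: A_def D_def)
  have DA: "\<Psi> y \<in> A" if "y \<in> D" for y using that \<Psi>_in \<Theta>_\<Psi> by (auto simp: A_def D_def)
  have "I \<subseteq> Bs \<times> W" by (auto simp: I_def)
  then have IV: "I \<subseteq> Vb \<times> W" using openin_imp_subset[OF open_\<Theta>_range] by (rule order_trans)
  have opA: "openin (mtop (total B)) A"
  proof -
    have "openin (subtopology (mtop (total B)) P) {e \<in> topspace (subtopology (mtop (total B)) P). \<Theta> e \<in> {y. snd y \<bullet> h > 0}}"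
      by (rule openin_continuous_map_preimage[OF continuous_map_\<Theta>])
        (auto intro!: open_Collect_less continuous_intros)
    moreover have "{e \<in> topspace (subtopology (mtop (total B)) P). \<Theta> e \<in> {y. snd y \<bullet> h > 0}} = A"
      using P_subset by (auto simp: A_def)
    ultimately show ?thesis using openin_trans_full[OF _ open_P] by simp
  qed
  have cd: "c e \<in> L ` I" "d (c e) = e" if e: "e \<in> A" for e
  proof -
    show "c e \<in> L ` I" using R1(1)[OF AD[OF e]] by (simp add: c_def)
    have "L' (L (R (\<Theta> e))) = R (\<Theta> e)" using L'(2) R1(1)[OF AD[OF e]] IV by blast
    then show "d (c e) = e" using R1(2)[OF AD[OF e]] \<Psi>_\<Theta> e by (simp add: c_def d_def A_def)
  qed
  have dc: "d x \<in> A" "c (d x) = x" if x: "x \<in> L ` I" for x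
  proof -
    obtain y where y: "y \<in> I" "x = L y" using x by blast
    have Lx: "L' x = y" using L'(2) IV y by blast
    show "d x \<in> A" using DA R2(1)[OF y(1)] by (simp add: d_def Lx)
    have "\<Theta> (\<Psi> (R' y)) = R' y" using \<Theta>_\<Psi> R2(1)[OF y(1)] by (simp add: D_def)
    then show "c (d x) = x" unfolding c_def d_def Lx using R2(2)[OF y(1)] y(2) by simp
  qed
  have max: "(A, c) \<in> maximal_atlas (total B)"
  proof (rule maximal_atlasI[OF charted_total])
    show smc: "smooth_to (total B) A c"
      unfolding c_def
      by (rule smooth_to_compose_smooth_on[OF charted_total smooth_to_subset[OF smooth_\<Theta> opA],
            where h = "\<lambda>y. L (R y)" and Y = D])
        (use AD smooth_on_compose'[OF smooth_on_linear[OF L(1)] smR, of UNIV] in \<open>auto simp: A_def\<close>)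
    show "smooth_into (L ` I) (total B) d"
      unfolding d_def
    proof (rule smooth_into_compose_smooth_on[OF smooth_\<Psi>])
      show "smooth_on (L ` I) (\<lambda>x. R' (L' x))"
        by (rule smooth_on_compose'[OF smR' smooth_on_linear[OF L'(1)]]) (use L'(2) IV in auto)
      show "R' (L' x) \<in> Bs \<times> W" if "x \<in> L ` I" for x
        using that R2(1) L'(2) IV by (force simp: D_def)
    qed
    show "continuous_map (subtopology (mtop (total B)) A) euclidean c"
      by (rule continuous_map_smooth_to[OF charted_total smc])
    show "subspace (L ` (Vb \<times> W))" by (rule linear_subspace_image[OF L(1) subspace_VbW])
    show "openin (top_of_set (L ` (Vb \<times> W))) (L ` I)"
    proof -
      obtain O1 where O1: "open O1" "Bs \<times> W = (Vb \<times> W) \<inter> O1" using open_\<Theta>_range by (auto simp: openin_open)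
      define O2 where "O2 = O1 \<inter> {y. snd y \<bullet> h > - n}"
      have "open {y :: 'b \<times> 'a. snd y \<bullet> h > - n}" by (intro open_Collect_less continuous_intros)
      then have "open O2" unfolding O2_def using O1(1) by blast
      then have "open (L' -` O2)" by (rule open_vimage) (use L'(1) linear_continuous_on linear_linear in blast)
      moreover have "L ` I = L ` (Vb \<times> W) \<inter> L' -` O2"
      proof -
        have I: "I = (Vb \<times> W) \<inter> O2" using O1(2) by (auto simp: I_def O2_def)
        show ?thesis unfolding I using L'(2) by force
      qed
      ultimately show ?thesis by (auto simp: openin_open)
    qed
  qed (use cd dc in blast)+
  \<comment> \<open>The unit sphere bundle is where the coordinate along \<open>h\<close>
    vanishes.\<close>
  define T where "T = L ` (Vb \<times> {\<zeta> \<in> W. \<zeta> \<bullet> h = 0})"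
  have subH: "subspace {\<zeta> \<in> W. \<zeta> \<bullet> h = 0}"
    using subspace_W by (auto simp: subspace_def inner_add_left)
  have T: "subspace T" unfolding T_def by (rule linear_subspace_image[OF L(1) subspace_Times[OF subspace_Vb subH]])
  have S_iff: "e \<in> S \<longleftrightarrow> snd (R (\<Theta> e)) \<bullet> h = 0" if e: "e \<in> A" for e
  proof -
    have ep: "e \<in> P" "e \<in> points (total B)" using e P_subset by (auto simp: A_def)
    have "q (\<Theta> e) = (fnorm ip e)\<^sup>2" using fnorm_facts(4)[OF B ip ep(2)] \<Psi>_\<Theta>[OF ep(1)] by (simp add: q_def)
    then have "snd (R (\<Theta> e)) \<bullet> h = 0 \<longleftrightarrow> (fnorm ip e)\<^sup>2 = 1" using snR[OF AD[OF e]] n0 by simp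
    also have "\<dots> \<longleftrightarrow> fnorm ip e = 1"
      using fnorm_facts(5)[OF B ip ep(2)] by (auto simp: power2_eq_1_iff)
    finally show ?thesis using ep by (simp add: S_def)
  qed
  have "c ` (A \<inter> S) = c ` A \<inter> T"
  proof (intro equalityI subsetI)
    fix x assume "x \<in> c ` (A \<inter> S)"
    then obtain e where e: "e \<in> A" "e \<in> S" "x = c e" by blast
    have "R (\<Theta> e) \<in> Vb \<times> W" using R1(1)[OF AD[OF e(1)]] IV by blast
    then have "R (\<Theta> e) \<in> Vb \<times> {\<zeta> \<in> W. \<zeta> \<bullet> h = 0}" using S_iff[OF e(1)] e(2) by (simp add: mem_Times_iff)
    then show "x \<in> c ` A \<inter> T" using e by (auto simp: T_def c_def)
  next
    fix x assume "x \<in> c ` A \<inter> T"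
    then obtain e y where e: "e \<in> A" "x = c e" and y: "y \<in> Vb \<times> {\<zeta> \<in> W. \<zeta> \<bullet> h = 0}" "x = L y"
      unfolding T_def by blast
    have "R (\<Theta> e) \<in> Vb \<times> W" using R1(1)[OF AD[OF e(1)]] IV by blast
    moreover have "y \<in> Vb \<times> W" using y(1) by auto
    moreover have "L (R (\<Theta> e)) = L y" using e(2) y(2) by (simp add: c_def)
    ultimately have "R (\<Theta> e) = y" using L(2) by (meson inj_onD)
    then have "e \<in> S" using S_iff[OF e(1)] y(1) by auto
    then show "x \<in> c ` (A \<inter> S)" using e by blast
  qed
  with e0A max T show ?thesis by (rule that)
qed

section \<open>The blowup in polar coordinates\<close>

locale blowup_domain =
  fixes B :: "('e, 'a::euclidean_space, 'f, 'b::euclidean_space) vbundle"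
    and ip :: "'e \<Rightarrow> 'e \<Rightarrow> real" and N :: "'e set"
  assumes vb: "vector_bundle B" and ip: "fibrewise_inner_product B ip"
    and open_N: "openin (mtop (total B)) N" and zero_N: "zero_section B \<subseteq> N"
begin

definition S :: "'e set" where "S = {e \<in> points (total B). fnorm ip e = 1}"

definition rep :: "'e set \<Rightarrow> 'e" where "rep r = (THE e. e \<in> r \<and> fnorm ip e = 1)"

text \<open>Unit vector and squared length; boundary points have second coordinate \<open>0\<close>.
  The blowup is handled throughout by these pairs, with \<open>unpol\<close> as the way
  back.\<close>

definition pol :: "'e + 'e set \<Rightarrow> 'e \<times> real" where "pol z = map_prod rep id (blowup_coords B ip z)"

definition unpol :: "'e \<Rightarrow> real \<Rightarrow> 'e + 'e set" where
  "unpol u s = (if s = 0 then Inr (ray B u) else Inl (vscale B (sqrt s) u))"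

abbreviation "Bl \<equiv> blowup_nbhd B ip N"
abbreviation "BN \<equiv> blowup_set B N"

lemma manifold_total: "manifold (total B)" using vb unfolding vector_bundle_def by blast
lemma charted_total: "charted (total B)" using manifold_total manifold_imp_charted by blast
lemma N_points: "N \<subseteq> points (total B)" using open_N openin_subset by blast
lemmas scale = vector_bundle_scale[OF vb]
lemmas norm = fnorm_facts[OF vb ip]

lemma fnorm_pos: "e \<in> points (total B) \<Longrightarrow> e \<notin> zero_section B \<Longrightarrow> 0 < fnorm ip e"
  using norm(1,5)[of e] by (simp add: order_less_le)

lemma S_points: "u \<in> S \<Longrightarrow> u \<in> points (total B)" and S_norm: "u \<in> S \<Longrightarrow> fnorm ip u = 1"
  by (simp_all add: S_def)

lemma S_nonzero: "u \<in> S \<Longrightarrow> u \<notin> zero_section B"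
  using norm(1)[OF S_points] S_norm by fastforce

lemma ray_scale:
  assumes "e \<in> points (total B)" "0 < t"
  shows "ray B (vscale B t e) = ray B e"
proof -
  have 1: "vscale B s (vscale B t e) = vscale B (s * t) e" for s by (rule scale(3)[OF assms(1)])
  have 2: "vscale B s e = vscale B (s / t) (vscale B t e)" for s
    using 1[of "s / t"] assms(2) by simp
  show ?thesis
  proof (intro equalityI subsetI)
    fix x assume "x \<in> ray B (vscale B t e)"
    then obtain s where "0 < s" "x = vscale B (s * t) e" unfolding ray_def 1 by blast
    then show "x \<in> ray B e" using assms(2) unfolding ray_def by (intro CollectI exI[of _ "s * t"]) simp
  next
    fix x assume "x \<in> ray B e"
    then obtain s where s: "0 < s" "x = vscale B s e" unfolding ray_def by blast
    then show "x \<in> ray B (vscale B t e)"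
      using assms(2) 2[of s] unfolding ray_def by (intro CollectI exI[of _ "s / t"]) simp
  qed
qed

lemma rep_ray:
  assumes "e \<in> points (total B)" "e \<notin> zero_section B"
  shows "rep (ray B e) = vscale B (1 / fnorm ip e) e"
  unfolding rep_def
proof (rule the_equality)
  note p = fnorm_pos[OF assms]
  show "vscale B (1 / fnorm ip e) e \<in> ray B e \<and> fnorm ip (vscale B (1 / fnorm ip e) e) = 1"
    using p norm(3)[OF assms(1)] by (auto simp: ray_def)
  fix x assume x: "x \<in> ray B e \<and> fnorm ip x = 1"
  then obtain t where t: "0 < t" "x = vscale B t e" by (auto simp: ray_def)
  then have "t * fnorm ip e = 1" using x norm(3)[OF assms(1), of t] by simp
  then have "t = 1 / fnorm ip e" using p by (simp add: field_simps)
  then show "x = vscale B (1 / fnorm ip e) e" using t by simp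
qed

lemma unit_in_S:
  assumes "e \<in> points (total B)" "e \<notin> zero_section B"
  shows "vscale B (1 / fnorm ip e) e \<in> S"
  using scale(1)[OF assms(1)] norm(3)[OF assms(1)] fnorm_pos[OF assms] by (simp add: S_def)

lemma rep_ray_S: "u \<in> S \<Longrightarrow> rep (ray B u) = u"
  using rep_ray[OF S_points S_nonzero] S_norm scale(4)[OF S_points] by simp

lemma sphere_bundle_rep:
  assumes "r \<in> sphere_bundle B"
  shows "rep r \<in> S" "ray B (rep r) = r"
proof -
  obtain e where e: "e \<in> points (total B)" "e \<notin> zero_section B" "r = ray B e"
    using assms by (auto simp: sphere_bundle_def)
  show "rep r \<in> S" using unit_in_S[OF e(1,2)] rep_ray[OF e(1,2)] e(3) by simp
  show "ray B (rep r) = r"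
    using rep_ray[OF e(1,2)] ray_scale[OF e(1), of "1 / fnorm ip e"] fnorm_pos[OF e(1,2)] e(3) by simp
qed

lemma ray_sphere_bundle: "e \<in> points (total B) \<Longrightarrow> e \<notin> zero_section B \<Longrightarrow> ray B e \<in> sphere_bundle B"
  by (auto simp: sphere_bundle_def)

lemma pol_Inl: "e \<in> points (total B) \<Longrightarrow> e \<notin> zero_section B \<Longrightarrow> pol (Inl e) = (vscale B (1 / fnorm ip e) e, (fnorm ip e)\<^sup>2)"
  by (simp add: pol_def blowup_coords_def rep_ray)

lemma pol_Inr: "pol (Inr r) = (rep r, 0)"
  by (simp add: pol_def blowup_coords_def)

lemma BN_cases:
  assumes "z \<in> BN"
  obtains e where "z = Inl e" "e \<in> N" "e \<in> points (total B)" "e \<notin> zero_section B"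
  | r where "z = Inr r" "r \<in> sphere_bundle B"
  using assms N_points by (auto simp: blowup_set_def)

lemma pol_in:
  assumes "z \<in> BN"
  shows "fst (pol z) \<in> S" "0 \<le> snd (pol z)" "unpol (fst (pol z)) (snd (pol z)) = z"
    "vscale B (sqrt (snd (pol z))) (fst (pol z)) \<in> N"
proof -
  have "fst (pol z) \<in> S \<and> 0 \<le> snd (pol z) \<and> unpol (fst (pol z)) (snd (pol z)) = z \<and>
    vscale B (sqrt (snd (pol z))) (fst (pol z)) \<in> N"
  proof (cases rule: BN_cases[OF assms])
    case (1 e)
    have p: "0 < fnorm ip e" by (rule fnorm_pos[OF 1(3,4)])
    have "vscale B (fnorm ip e) (vscale B (1 / fnorm ip e) e) = e"
      using scale(3)[OF 1(3), of "fnorm ip e" "1 / fnorm ip e"] scale(4)[OF 1(3)] p by simp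
    then show ?thesis using p unit_in_S[OF 1(3,4)] 1 by (simp add: pol_Inl[OF 1(3,4)] unpol_def)
  next
    case (2 r)
    have u: "rep r \<in> points (total B)" using sphere_bundle_rep(1)[OF 2(2)] S_points by blast
    have "vscale B 0 (rep r) \<in> zero_section B" using scale(5)[OF u] by blast
    then show ?thesis using sphere_bundle_rep[OF 2(2)] zero_N by (auto simp: 2(1) pol_Inr unpol_def)
  qed
  then show "fst (pol z) \<in> S" "0 \<le> snd (pol z)" "unpol (fst (pol z)) (snd (pol z)) = z"
    "vscale B (sqrt (snd (pol z))) (fst (pol z)) \<in> N" by blast+
qed

lemma unpol_in:
  assumes "u \<in> S" "0 \<le> s" "vscale B (sqrt s) u \<in> N"
  shows "unpol u s \<in> BN" "pol (unpol u s) = (u, s)"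
proof -
  have u: "u \<in> points (total B)" "u \<notin> zero_section B" using S_points S_nonzero assms(1) by blast+
  have "unpol u s \<in> BN \<and> pol (unpol u s) = (u, s)"
  proof (cases "s = 0")
    case True
    then show ?thesis
      using ray_sphere_bundle[OF u] rep_ray_S[OF assms(1)] by (auto simp: unpol_def blowup_set_def pol_Inr)
  next
    case False
    then have s: "0 < s" using assms(2) by simp
    let ?e = "vscale B (sqrt s) u"
    have e: "?e \<in> points (total B)" "?e \<notin> zero_section B" using scale(1,5)[OF u(1)] u(2) s by auto
    have n: "fnorm ip ?e = sqrt s" using norm(3)[OF u(1)] S_norm[OF assms(1)] s by simp
    have "vscale B (1 / sqrt s) ?e = u" using scale(3,4)[OF u(1)] s by simp
    then show ?thesis using s e assms(3) InlI[of ?e "N - zero_section B" "sphere_bundle B"]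
      by (simp add: unpol_def pol_Inl n blowup_set_def)
  qed
  then show "unpol u s \<in> BN" "pol (unpol u s) = (u, s)" by blast+
qed

lemma BN_subset: "BN \<subseteq> blowup_set B (points (total B))"
  using N_points by (auto simp: blowup_set_def)

lemma coords_in:
  assumes "z \<in> blowup_set B (points (total B))"
  shows "fst (blowup_coords B ip z) \<in> sphere_bundle B" "0 \<le> snd (blowup_coords B ip z)"
    "rep (fst (blowup_coords B ip z)) \<in> S"
proof -
  have "fst (blowup_coords B ip z) \<in> sphere_bundle B \<and> 0 \<le> snd (blowup_coords B ip z)"
    using assms ray_sphere_bundle by (auto simp: blowup_set_def blowup_coords_def)
  then show "fst (blowup_coords B ip z) \<in> sphere_bundle B" "0 \<le> snd (blowup_coords B ip z)"
    "rep (fst (blowup_coords B ip z)) \<in> S" using sphere_bundle_rep(1) by blast+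
qed

section \<open>Topology and charts of the blowup\<close>

definition sphere_topology :: "'e set topology" where
  "sphere_topology = pullback_topology (sphere_bundle B) rep (subtopology (mtop (total B)) S)"

lemma mtop_Bl: "mtop Bl = subtopology (pullback_topology (blowup_set B (points (total B))) (blowup_coords B ip)
    (prod_topology sphere_topology (top_of_set {0..}))) BN"
  by (simp add: blowup_nbhd_def open_submfd_def blowup_mfd_def transported_mfd_def prod_mfd_def
      sphere_bundle_mfd_def std_mfd_def embedded_submfd_def sphere_topology_def rep_def[abs_def] S_def)

lemma points_Bl: "points Bl = BN"
proof -
  have "x \<in> blowup_coords B ip -` topspace (prod_topology sphere_topology (top_of_set {0..}))"
    if "x \<in> blowup_set B (points (total B))" for x
    using coords_in[OF that] S_points
    by (auto simp: sphere_topology_def topspace_pullback_topology mem_Times_iff)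
  then show ?thesis
    unfolding mtop_Bl topspace_subtopology topspace_pullback_topology using BN_subset by blast
qed

lemma continuous_map_fst_pol: "continuous_map (mtop Bl) (mtop (total B)) (\<lambda>z. fst (pol z))"
  and continuous_map_snd_pol: "continuous_map (mtop Bl) euclideanreal (\<lambda>z. snd (pol z))"
proof -
  let ?T = "prod_topology sphere_topology (top_of_set {0::real..})"
  have co: "continuous_map (mtop Bl) ?T (blowup_coords B ip)"
    unfolding mtop_Bl
    using continuous_map_from_subtopology[OF continuous_map_pullback[OF continuous_map_id]] by simp
  have "continuous_map sphere_topology (subtopology (mtop (total B)) S) rep"
    unfolding sphere_topology_def using continuous_map_pullback[OF continuous_map_id] by fastforce
  then have re: "continuous_map sphere_topology (mtop (total B)) rep"
    by (simp add: continuous_map_in_subtopology)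
  have "continuous_map (mtop Bl) (mtop (total B)) (rep \<circ> (fst \<circ> blowup_coords B ip))"
    by (rule continuous_map_compose[OF continuous_map_compose[OF co continuous_map_fst] re])
  then show "continuous_map (mtop Bl) (mtop (total B)) (\<lambda>z. fst (pol z))"
    by (simp add: pol_def o_def)
  have "continuous_map (mtop Bl) (top_of_set {0..}) (snd \<circ> blowup_coords B ip)"
    by (rule continuous_map_compose[OF co continuous_map_snd])
  then show "continuous_map (mtop Bl) euclideanreal (\<lambda>z. snd (pol z))"
    by (simp add: pol_def o_def continuous_map_in_subtopology)
qed

text \<open>The universal property of the two nested pullback topologies, that of the sphere bundle
  and that of the blowup.\<close>

lemma continuous_map_into_Bl:
  assumes "\<And>x. x \<in> topspace X \<Longrightarrow> h x \<in> BN"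
    and "continuous_map X (mtop (total B)) (\<lambda>x. fst (pol (h x)))"
    and "continuous_map X euclideanreal (\<lambda>x. snd (pol (h x)))"
  shows "continuous_map X (mtop Bl) h"
proof -
  have sub: "topspace X \<subseteq> h -` blowup_set B (points (total B))" using assms(1) BN_subset by blast
  have hx: "h x \<in> blowup_set B (points (total B))" if "x \<in> topspace X" for x
    using assms(1)[OF that] BN_subset by blast
  have eq: "fst (pol z) = rep (fst (blowup_coords B ip z))" "snd (pol z) = snd (blowup_coords B ip z)" for z
    by (simp_all add: pol_def)
  have "continuous_map X sphere_topology (\<lambda>x. fst (blowup_coords B ip (h x)))"
    unfolding sphere_topology_def
  proof (rule continuous_map_pullback')
    have "continuous_map X (mtop (total B)) (rep \<circ> (\<lambda>x. fst (blowup_coords B ip (h x))))"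
      using assms(2) unfolding eq o_def .
    then show "continuous_map X (subtopology (mtop (total B)) S) (rep \<circ> (\<lambda>x. fst (blowup_coords B ip (h x))))"
      unfolding continuous_map_in_subtopology using coords_in(3)[OF hx] by (simp add: image_subset_iff)
    show "topspace X \<subseteq> (\<lambda>x. fst (blowup_coords B ip (h x))) -` sphere_bundle B"
      using coords_in(1)[OF hx] by (simp add: subset_iff)
  qed
  moreover have "continuous_map X (top_of_set {0..}) (\<lambda>x. snd (blowup_coords B ip (h x)))"
    unfolding continuous_map_in_subtopology using assms(3) coords_in(2)[OF hx]
    by (simp add: eq image_subset_iff)
  ultimately have "continuous_map X (prod_topology sphere_topology (top_of_set {0..}))
      (\<lambda>x. (fst (blowup_coords B ip (h x)), snd (blowup_coords B ip (h x))))"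
    by (rule continuous_map_pairedI)
  then have "continuous_map X (prod_topology sphere_topology (top_of_set {0..})) (blowup_coords B ip \<circ> h)"
    unfolding prod.collapse o_def .
  then have "continuous_map X (pullback_topology (blowup_set B (points (total B))) (blowup_coords B ip)
    (prod_topology sphere_topology (top_of_set {0..}))) h"
    using sub by (rule continuous_map_pullback')
  then show ?thesis unfolding mtop_Bl using assms(1) by (auto simp: continuous_map_in_subtopology)
qed

definition slice_chart :: "'e set \<Rightarrow> ('e \<Rightarrow> 'a) \<Rightarrow> 'a set \<Rightarrow> bool" where
  "slice_chart U c W \<longleftrightarrow> (U, c) \<in> maximal_atlas (total B) \<and> subspace W \<and> c ` (U \<inter> S) = c ` U \<inter> W"

abbreviation "dom_Bl U \<equiv> {z \<in> BN. fst (pol z) \<in> U}"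
abbreviation "chart_Bl c \<equiv> (\<lambda>z. (c (fst (pol z)), snd (pol z)))"

text \<open>Unfolds the transported product atlas into the form used from here on: a slice chart for
  the unit vector together with the squared length.\<close>

lemma atlas_Bl: "atlas Bl = {(dom_Bl U, chart_Bl c) |U c. \<exists>W. slice_chart U c W}"
proof -
  have set_eq: "(blowup_coords B ip -` ((rep -` (U \<inter> S) \<inter> sphere_bundle B) \<times> {0..})) \<inter> blowup_set B (points (total B)) \<inter> BN
      = dom_Bl U" for U
    using coords_in BN_subset by (auto simp: pol_def mem_Times_iff)
  have fun_eq: "map_prod (c \<circ> rep) id \<circ> blowup_coords B ip = chart_Bl c" for c :: "'e \<Rightarrow> 'a"
    by (simp add: pol_def fun_eq_iff map_prod_def split_beta)
  have A: "atlas (embedded_submfd (total B) S) = (\<lambda>i. (fst i \<inter> S, snd i)) ` {i. \<exists>W. slice_chart (fst i) (snd i) W}"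
  proof (intro equalityI subsetI)
    fix x assume "x \<in> atlas (embedded_submfd (total B) S)"
    then obtain U c W where "x = (U \<inter> S, c)" "slice_chart U c W"
      unfolding embedded_submfd_def slice_chart_def by auto
    then show "x \<in> (\<lambda>i. (fst i \<inter> S, snd i)) ` {i. \<exists>W. slice_chart (fst i) (snd i) W}"
      by (intro image_eqI[of _ _ "(U, c)"]) auto
  next
    fix x assume "x \<in> (\<lambda>i. (fst i \<inter> S, snd i)) ` {i. \<exists>W. slice_chart (fst i) (snd i) W}"
    then obtain i W where "x = (fst i \<inter> S, snd i)" "slice_chart (fst i) (snd i) W" by blast
    then show "x \<in> atlas (embedded_submfd (total B) S)"
      unfolding embedded_submfd_def slice_chart_def mfd.simps
      by (intro CollectI exI[of _ "fst i"] exI[of _ "snd i"] conjI exI[of _ W]) simp_all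
  qed
  have times: "X \<times> {k} = (\<lambda>x. (x, k)) ` X" for X :: "('e set set \<times> ('e set \<Rightarrow> 'a)) set" and k :: "real set \<times> (real \<Rightarrow> real)"
    by auto
  have "atlas Bl = (\<lambda>i. (((blowup_coords B ip -` ((rep -` (fst i \<inter> S) \<inter> sphere_bundle B) \<times> {0..})) \<inter> blowup_set B (points (total B)) \<inter> BN),
      map_prod (snd i \<circ> rep) id \<circ> blowup_coords B ip)) ` {i. \<exists>W. slice_chart (fst i) (snd i) W}"
    unfolding blowup_nbhd_def open_submfd_def blowup_mfd_def transported_mfd_def prod_mfd_def
      sphere_bundle_mfd_def std_mfd_def rep_def[abs_def, symmetric] S_def[symmetric] mfd.simps A times image_image
    by (simp only: split_beta fst_conv snd_conv)
  also have "\<dots> = (\<lambda>i. (dom_Bl (fst i), chart_Bl (snd i))) ` {i. \<exists>W. slice_chart (fst i) (snd i) W}"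
    unfolding set_eq fun_eq ..
  also have "\<dots> = {(dom_Bl U, chart_Bl c) |U c. \<exists>W. slice_chart U c W}"
  proof (intro equalityI subsetI)
    fix x assume "x \<in> {(dom_Bl U, chart_Bl c) |U c. \<exists>W. slice_chart U c W}"
    then obtain U c W where "slice_chart U c W" "x = (dom_Bl U, chart_Bl c)" by blast
    then show "x \<in> (\<lambda>i. (dom_Bl (fst i), chart_Bl (snd i))) ` {i. \<exists>W. slice_chart (fst i) (snd i) W}"
      by (intro image_eqI[of _ _ "(U, c)"]) auto
  qed auto
  finally show ?thesis .
qed

lemma smooth_into_Bl:
  assumes "\<And>x. x \<in> X \<Longrightarrow> h x \<in> BN" "smooth_into X (total B) (\<lambda>x. fst (pol (h x)))"
    and "smooth_on X (\<lambda>x. snd (pol (h x)))"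
  shows "smooth_into X Bl h"
proof (rule smooth_intoI)
  show "continuous_map (top_of_set X) (mtop Bl) h"
    by (rule continuous_map_into_Bl) (use assms smooth_intoD(1)[OF assms(2)] smooth_on_imp_continuous_on[OF assms(3)] in auto)
  fix U' c' assume "(U', c') \<in> atlas Bl"
  then obtain U c W where sl: "slice_chart U c W" and eq: "U' = dom_Bl U" "c' = chart_Bl c"
    unfolding atlas_Bl by blast
  have "(U, c) \<in> maximal_atlas (total B)" using sl by (simp add: slice_chart_def)
  note mc = smooth_into_maximal_chart[OF charted_total this]
  have "smooth_on {x \<in> X. h x \<in> U'} (\<lambda>x. c (fst (pol (h x))))"
    by (rule smooth_on_smooth_to_compose[OF charted_total mc(2) smooth_into_subset[OF assms(2)]]) (auto simp: eq)
  moreover have "smooth_on {x \<in> X. h x \<in> U'} (\<lambda>x. snd (pol (h x)))"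
    by (rule smooth_on_subset[OF assms(3)]) auto
  ultimately show "smooth_on {x \<in> X. h x \<in> U'} (\<lambda>x. c' (h x))"
    unfolding eq by (rule smooth_on_Pair)
qed

text \<open>The image of \<open>chart_Bl c\<close>, as \<open>image_chart_Bl\<close> shows, written
  in coordinates so that its openness can be examined.\<close>

definition image_Bl :: "'e set \<Rightarrow> ('e \<Rightarrow> 'a) \<Rightarrow> ('a \<times> real) set" where
  "image_Bl U c = {x. fst x \<in> c ` (U \<inter> S) \<and> 0 \<le> snd x \<and> vscale B (sqrt (snd x)) (inv_into U c (fst x)) \<in> N}"

context
  fixes U c W assumes slice: "slice_chart U c W"
begin

lemma slice_max: "(U, c) \<in> maximal_atlas (total B)"
  using slice by (simp add: slice_chart_def)

lemmas slice_smooth = smooth_into_maximal_chart[OF charted_total slice_max]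

lemma inv_slice: "x \<in> c ` (U \<inter> S) \<Longrightarrow> inv_into U c x \<in> U \<inter> S \<and> c (inv_into U c x) = x"
  using slice_smooth(3) by (auto simp: inv_into_f_f)

lemma chart_Bl_in: "z \<in> dom_Bl U \<Longrightarrow> chart_Bl c z \<in> image_Bl U c \<and> unpol (inv_into U c (c (fst (pol z)))) (snd (pol z)) = z"
  using pol_in[of z] slice_smooth(3) by (auto simp: image_Bl_def inv_into_f_f)

lemma unchart_Bl_in:
  assumes "x \<in> image_Bl U c"
  shows "unpol (inv_into U c (fst x)) (snd x) \<in> dom_Bl U"
    "pol (unpol (inv_into U c (fst x)) (snd x)) = (inv_into U c (fst x), snd x)"
    "chart_Bl c (unpol (inv_into U c (fst x)) (snd x)) = x"
proof -
  have x: "fst x \<in> c ` (U \<inter> S)" "0 \<le> snd x" "vscale B (sqrt (snd x)) (inv_into U c (fst x)) \<in> N"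
    using assms by (simp_all add: image_Bl_def)
  note u = inv_slice[OF x(1)]
  have "inv_into U c (fst x) \<in> S" using u by blast
  note up = unpol_in[OF this x(2,3)]
  show "unpol (inv_into U c (fst x)) (snd x) \<in> dom_Bl U" using up u by simp
  show "pol (unpol (inv_into U c (fst x)) (snd x)) = (inv_into U c (fst x), snd x)" by (rule up)
  show "chart_Bl c (unpol (inv_into U c (fst x)) (snd x)) = x" using up u by simp
qed

lemma image_chart_Bl: "chart_Bl c ` dom_Bl U = image_Bl U c"
proof (intro equalityI subsetI)
  fix x assume x: "x \<in> image_Bl U c"
  show "x \<in> chart_Bl c ` dom_Bl U"
    using imageI[OF unchart_Bl_in(1)[OF x], of "chart_Bl c"] unfolding unchart_Bl_in(3)[OF x] .
next
  fix x assume "x \<in> chart_Bl c ` dom_Bl U"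
  then obtain z where z: "z \<in> dom_Bl U" "x = chart_Bl c z" by (rule imageE)
  show "x \<in> image_Bl U c" using chart_Bl_in[OF z(1)] z(2) by simp
qed

lemma inj_chart_Bl: "inj_on (chart_Bl c) (dom_Bl U)"
proof (rule inj_on_inverseI[of _ "\<lambda>x. unpol (inv_into U c (fst x)) (snd x)"])
  show "unpol (inv_into U c (fst (chart_Bl c z))) (snd (chart_Bl c z)) = z" if "z \<in> dom_Bl U" for z
    using chart_Bl_in[OF that] by simp
qed

lemma inv_chart_Bl:
  assumes "x \<in> image_Bl U c"
  shows "inv_into (dom_Bl U) (chart_Bl c) x = unpol (inv_into U c (fst x)) (snd x)"
proof -
  have "inv_into (dom_Bl U) (chart_Bl c) (chart_Bl c (unpol (inv_into U c (fst x)) (snd x))) = unpol (inv_into U c (fst x)) (snd x)"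
    by (rule inv_into_f_f[OF inj_chart_Bl unchart_Bl_in(1)[OF assms]])
  then show ?thesis unfolding unchart_Bl_in(3)[OF assms] .
qed

lemma smooth_into_unchart_fst: "smooth_into (image_Bl U c) (total B) (\<lambda>x. inv_into U c (fst x))"
  by (rule smooth_into_compose_smooth_on[OF slice_smooth(1)]) (auto simp: image_Bl_def intro!: smooth_on_fst smooth_on_id)

lemma smooth_into_unchart_Bl: "smooth_into (image_Bl U c) Bl (\<lambda>x. unpol (inv_into U c (fst x)) (snd x))"
proof (rule smooth_into_Bl)
  show "unpol (inv_into U c (fst x)) (snd x) \<in> BN" if "x \<in> image_Bl U c" for x
    using unchart_Bl_in(1)[OF that] by simp
  show "smooth_into (image_Bl U c) (total B) (\<lambda>x. fst (pol (unpol (inv_into U c (fst x)) (snd x))))"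
    by (rule smooth_into_cong[OF smooth_into_unchart_fst]) (simp add: unchart_Bl_in(2))
  show "smooth_on (image_Bl U c) (\<lambda>x. snd (pol (unpol (inv_into U c (fst x)) (snd x))))"
    by (rule smooth_on_cong[OF smooth_on_snd[OF smooth_on_id]]) (simp add: unchart_Bl_in(2))
qed

lemma open_dom_Bl: "openin (mtop Bl) (dom_Bl U)"
  using openin_continuous_map_preimage[OF continuous_map_fst_pol slice_smooth(4)] by (simp add: points_Bl)

lemma homeomorphic_map_chart_Bl: "homeomorphic_map (subtopology (mtop Bl) (dom_Bl U)) (top_of_set (chart_Bl c ` dom_Bl U)) (chart_Bl c)"
proof -
  have ts: "topspace (subtopology (mtop Bl) (dom_Bl U)) = dom_Bl U"
    using points_Bl by auto
  have "homeomorphic_maps (subtopology (mtop Bl) (dom_Bl U)) (top_of_set (image_Bl U c)) (chart_Bl c)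
    (\<lambda>x. unpol (inv_into U c (fst x)) (snd x))"
    unfolding homeomorphic_maps_def
  proof (intro conjI ballI)
    have "continuous_map (subtopology (mtop Bl) (dom_Bl U)) (subtopology (mtop (total B)) U) (\<lambda>z. fst (pol z))"
      using continuous_map_from_subtopology[OF continuous_map_fst_pol, of "dom_Bl U"]
      by (auto simp: continuous_map_in_subtopology)
    from continuous_map_compose[OF this continuous_map_smooth_to[OF charted_total slice_smooth(2)]]
    have "continuous_map (subtopology (mtop Bl) (dom_Bl U)) euclidean (\<lambda>z. c (fst (pol z)))" by (simp add: o_def)
    then have "continuous_map (subtopology (mtop Bl) (dom_Bl U)) (prod_topology euclidean euclideanreal) (chart_Bl c)"
      by (rule continuous_map_pairedI) (rule continuous_map_from_subtopology[OF continuous_map_snd_pol])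
    moreover have "prod_topology (euclidean :: 'a topology) euclideanreal = euclidean" by simp
    ultimately have "continuous_map (subtopology (mtop Bl) (dom_Bl U)) euclidean (chart_Bl c)"
      by (simp only:)
    then show "continuous_map (subtopology (mtop Bl) (dom_Bl U)) (top_of_set (image_Bl U c)) (chart_Bl c)"
      unfolding continuous_map_in_subtopology ts using chart_Bl_in by (simp add: image_subset_iff)
    show "continuous_map (top_of_set (image_Bl U c)) (subtopology (mtop Bl) (dom_Bl U)) (\<lambda>x. unpol (inv_into U c (fst x)) (snd x))"
      unfolding continuous_map_in_subtopology
      by (intro conjI smooth_intoD(1)[OF smooth_into_unchart_Bl] Pi_I unchart_Bl_in(1)) simp
    show "unpol (inv_into U c (fst (chart_Bl c z))) (snd (chart_Bl c z)) = z" if "z \<in> topspace (subtopology (mtop Bl) (dom_Bl U))" for z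
      using chart_Bl_in[of z] that unfolding ts by simp
    show "chart_Bl c (unpol (inv_into U c (fst x)) (snd x)) = x" if "x \<in> topspace (top_of_set (image_Bl U c))" for x
      by (rule unchart_Bl_in(3)) (use that in simp)
  qed
  then show ?thesis unfolding image_chart_Bl using homeomorphic_map_maps by blast
qed

text \<open>The slice chart has open image in a subspace, its slice is cut out by the subspace
  \<open>W\<close>, and lying in \<open>N\<close> is an open condition because scaling is continuous
  jointly with the factor \<open>sqrt s\<close>, also at \<open>s = 0\<close>.\<close>

lemma image_Bl_open:
  obtains T where "subspace T" "c ` (U \<inter> S) \<subseteq> T" "openin (top_of_set (T \<times> {0..})) (image_Bl U c)"
proof -
  obtain V where V: "subspace V" "openin (top_of_set V) (c ` U)" by (rule maximal_chart_open[OF manifold_total slice_max])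
  have W: "subspace W" "c ` (U \<inter> S) = c ` U \<inter> W" using slice by (simp_all add: slice_chart_def)
  obtain O1 where O1: "open O1" "c ` U = V \<inter> O1" using V(2) by (auto simp: openin_open)
  let ?T = "V \<inter> W"
  have T: "subspace ?T" using V W by (simp add: subspace_inter)
  have eq: "c ` (U \<inter> S) = ?T \<inter> O1" using W(2) O1(2) by blast
  define Y where "Y = c ` (U \<inter> S) \<times> {0::real..}"
  have "smooth_into Y (total B) (\<lambda>x. inv_into U c (fst x))"
    by (rule smooth_into_compose_smooth_on[OF slice_smooth(1)]) (auto simp: Y_def intro!: smooth_on_fst smooth_on_id)
  then have "continuous_map (top_of_set Y) (prod_topology euclideanreal (mtop (total B))) (\<lambda>x. (sqrt (snd x), inv_into U c (fst x)))"
    by (intro continuous_map_pairedI smooth_intoD(1)) (auto intro!: continuous_intros)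
  from continuous_map_compose[OF this continuous_map_vscale[OF vb]]
  have "continuous_map (top_of_set Y) (mtop (total B)) (\<lambda>x. vscale B (sqrt (snd x)) (inv_into U c (fst x)))"
    by (simp add: o_def)
  then obtain O2 where O2: "open O2" "{x \<in> Y. vscale B (sqrt (snd x)) (inv_into U c (fst x)) \<in> N} = Y \<inter> O2"
    by (rule continuous_map_openin_preimage[OF _ open_N]) (rule that; assumption)
  have "image_Bl U c = {x \<in> Y. vscale B (sqrt (snd x)) (inv_into U c (fst x)) \<in> N}"
    by (auto simp: image_Bl_def Y_def mem_Times_iff)
  also have "\<dots> = (?T \<times> {0..}) \<inter> ((O1 \<times> UNIV) \<inter> O2)" unfolding O2(2) by (auto simp: Y_def eq)
  finally have "image_Bl U c = (?T \<times> {0..}) \<inter> ((O1 \<times> UNIV) \<inter> O2)" .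
  moreover have "open ((O1 \<times> UNIV) \<inter> O2)" using O1(1) O2(1) by (intro open_Int open_Times) auto
  ultimately have "openin (top_of_set (?T \<times> {0..})) (image_Bl U c)" by (metis openin_open_Int)
  then show ?thesis using T eq by (intro that[of ?T]) auto
qed

end

lemma slice_chart_at:
  assumes "u \<in> S"
  obtains U c W where "slice_chart U c W" "u \<in> U"
proof -
  obtain A and c :: "'e \<Rightarrow> 'a" and T where *: "u \<in> A" "(A, c) \<in> maximal_atlas (total B)" "subspace T"
    "c ` (A \<inter> {e \<in> points (total B). fnorm ip e = 1}) = c ` A \<inter> T"
    by (rule exists_sphere_slice_chart[OF vb ip S_points[OF assms] S_nonzero[OF assms]]) (rule that; assumption)
  then have "slice_chart A c T" by (simp add: slice_chart_def S_def)
  then show ?thesis using *(1) by (rule that)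
qed

lemma charted_Bl: "charted Bl"
  unfolding charted_def
proof (intro conjI ballI)
  show "points Bl = (\<Union>(U, c)\<in>atlas Bl. U)"
    unfolding points_Bl
  proof (intro equalityI subsetI)
    fix z assume z: "z \<in> BN"
    obtain U c W where U: "slice_chart U c W" "fst (pol z) \<in> U"
      by (rule slice_chart_at[OF pol_in(1)[OF z]]) (rule that; assumption)
    then have "(dom_Bl U, chart_Bl c) \<in> atlas Bl" unfolding atlas_Bl by blast
    moreover have "z \<in> (case (dom_Bl U, chart_Bl c) of (U, c) \<Rightarrow> U)" using z U by simp
    ultimately show "z \<in> (\<Union>(U, c)\<in>atlas Bl. U)" by (rule UN_I)
  next
    fix z assume "z \<in> (\<Union>(U, c)\<in>atlas Bl. U)"
    then obtain i where i: "i \<in> atlas Bl" "z \<in> (case i of (U, c) \<Rightarrow> U)" by (rule UN_E)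
    then obtain U c where "i = (dom_Bl U, chart_Bl c)" unfolding atlas_Bl by blast
    then show "z \<in> BN" using i(2) by simp
  qed
  fix i assume "i \<in> atlas Bl"
  then obtain U c W where sl: "slice_chart U c W" and i: "i = (dom_Bl U, chart_Bl c)" unfolding atlas_Bl by blast
  show "case i of (U, c) \<Rightarrow> openin (mtop Bl) U \<and> homeomorphic_map (subtopology (mtop Bl) U) (top_of_set (c ` U)) c"
    unfolding i prod.case using open_dom_Bl[OF sl] homeomorphic_map_chart_Bl[OF sl] by blast
qed

end

lemma boundaryI:
  assumes "(U, c) \<in> atlas M" "p \<in> U" "subspace V" "a \<in> V" "a \<noteq> 0"
    "openin (top_of_set (half_space V a)) (c ` U)" "a \<bullet> c p = 0"
  shows "p \<in> boundary M"
  unfolding boundary_def using assms by blast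

lemma boundaryE:
  assumes "p \<in> boundary M"
  obtains U c V a where "(U, c) \<in> atlas M" "p \<in> U" "subspace V" "a \<in> V" "a \<noteq> 0"
    "openin (top_of_set (half_space V a)) (c ` U)" "a \<bullet> c p = 0"
  using assms unfolding boundary_def by blast

context blowup_domain
begin

text \<open>\<open>boundary\<close> accepts any half-space presentation of a chart image, so
  interior points have to be excluded for all of them. Near an interior point the image is open in
  the full subspace \<open>L\<close>, so every direction of \<open>L\<close> stays in the
  half-space; the vector \<open>a\<close> itself belongs to \<open>L\<close>, and the direction
  \<open>- a\<close> is contradictory.\<close>

lemma boundary_Bl: "boundary Bl = Inr ` sphere_bundle B"
proof (intro equalityI subsetI)
  fix z :: "'e + 'e set" assume "z \<in> Inr ` sphere_bundle B"
  then obtain r where r: "r \<in> sphere_bundle B" "z = Inr r" by blast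
  then have z: "z \<in> BN" by (auto simp: blowup_set_def)
  obtain U c W where sl: "slice_chart U c W" and u: "fst (pol z) \<in> U"
    by (rule slice_chart_at[OF pol_in(1)[OF z]]) (rule that; assumption)
  obtain T where T: "subspace T" "openin (top_of_set (T \<times> {0..})) (image_Bl U c)"
    by (rule image_Bl_open[OF sl]) (rule that; assumption)
  have half: "half_space (T \<times> UNIV) (0, 1 :: real) = T \<times> {0..}" by (auto simp: half_space_def inner_real_def)
  have "(dom_Bl U, chart_Bl c) \<in> atlas Bl" unfolding atlas_Bl using sl by blast
  moreover have "z \<in> dom_Bl U" using z u by blast
  moreover have "subspace (T \<times> (UNIV :: real set))" using T(1) by (intro subspace_Times) auto
  moreover have "(0, 1) \<in> T \<times> (UNIV :: real set)" using T(1) subspace_0 by auto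
  moreover have "((0, 1) :: 'a \<times> real) \<noteq> 0" by (simp add: zero_prod_def)
  moreover have "openin (top_of_set (half_space (T \<times> UNIV) (0, 1))) (chart_Bl c ` dom_Bl U)"
    unfolding half image_chart_Bl[OF sl] by (rule T(2))
  moreover have "(0, 1) \<bullet> chart_Bl c z = 0" using r(2) by (simp add: pol_Inr)
  ultimately show "z \<in> boundary Bl" by (rule boundaryI)
next
  fix z assume "z \<in> boundary Bl"
  then obtain U' c' V a where ch: "(U', c') \<in> atlas Bl" "z \<in> U'" and V: "subspace V" "a \<in> V" "a \<noteq> 0"
    "openin (top_of_set (half_space V a)) (c' ` U')" "a \<bullet> c' z = 0" by (rule boundaryE)
  obtain U c W where sl: "slice_chart U c W" and eq: "U' = dom_Bl U" "c' = chart_Bl c" using ch(1) unfolding atlas_Bl by blast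
  have zU: "z \<in> dom_Bl U" and zB: "z \<in> BN" using ch(2) eq by auto
  have V': "openin (top_of_set (half_space V a)) (image_Bl U c)" "a \<bullet> chart_Bl c z = 0"
    using V(4,5) unfolding eq image_chart_Bl[OF sl] by auto
  obtain T where T: "subspace T" "openin (top_of_set (T \<times> {0..})) (image_Bl U c)"
    by (rule image_Bl_open[OF sl]) (rule that; assumption)
  show "z \<in> Inr ` sphere_bundle B"
  proof (cases rule: BN_cases[OF zB])
    case (2 r)
    then show ?thesis by blast
  next
    case (1 e)
    define x where "x = chart_Bl c z"
    have x: "x \<in> image_Bl U c" using chart_Bl_in[OF sl zU] by (simp add: x_def)
    have sx: "0 < snd x" using pol_Inl[OF 1(3,4)] fnorm_pos[OF 1(3,4)] by (simp add: x_def 1(1))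
    obtain O1 where O1: "open O1" "image_Bl U c = (T \<times> {0..}) \<inter> O1" using T(2) by (auto simp: openin_open)
    obtain O2 where O2: "open O2" "image_Bl U c = half_space V a \<inter> O2" using V'(1) by (auto simp: openin_open)
    define L where "L = T \<times> (UNIV :: real set)"
    have L: "subspace L" unfolding L_def using T(1) by (intro subspace_Times) auto
    have x1: "x \<in> T \<times> {0..}" "x \<in> O1" using x unfolding O1(2) by simp_all
    then have xL: "x \<in> L" by (simp add: L_def mem_Times_iff)
    have op: "open (O1 \<inter> {y. 0 < snd y})" using O1(1) by (intro open_Int open_Collect_less continuous_intros)
    have in1: "x \<in> O1 \<inter> {y. 0 < snd y}" using x1(2) sx by simp
    have small: "\<forall>\<^sub>F t in at_right 0. x + t *\<^sub>R v \<in> image_Bl U c" if v: "v \<in> L" for v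
      using eventually_path_in_open[OF op in1, of v]
    proof eventually_elim
      case (elim t)
      have "x + t *\<^sub>R v \<in> L" by (intro subspace_add[OF L] subspace_scale[OF L] xL v)
      then have "x + t *\<^sub>R v \<in> T \<times> {0..}"
        using elim by (simp add: L_def mem_Times_iff)
      then show ?case using elim unfolding O1(2) by (simp only: Int_iff)
    qed
    have ge: "0 \<le> a \<bullet> v" if v: "v \<in> L" for v
    proof -
      have "\<forall>\<^sub>F t in at_right 0. x + t *\<^sub>R v \<in> image_Bl U c \<and> (0::real) < t"
        using small[OF v] eventually_at_right_less[of "0::real"] by (rule eventually_conj)
      then have "\<exists>t::real. x + t *\<^sub>R v \<in> image_Bl U c \<and> 0 < t"
        by (rule eventually_happens'[rotated]) simp
      then obtain t :: real where t: "x + t *\<^sub>R v \<in> image_Bl U c" "0 < t" by (elim exE conjE)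
      have "0 \<le> a \<bullet> (x + t *\<^sub>R v)" using t(1) unfolding O2(2) by (simp add: half_space_def)
      then show ?thesis using V'(2) t(2) by (simp add: x_def[symmetric] inner_add_right zero_le_mult_iff)
    qed
    have "a \<in> L"
    proof -
      have "x \<in> O2" using x unfolding O2(2) by simp
      then have "\<forall>\<^sub>F t in at_right 0. x + t *\<^sub>R a \<in> O2 \<and> (0::real) < t"
        by (rule eventually_conj[OF eventually_path_in_open[OF O2(1)] eventually_at_right_less[of "0::real"]])
      then have "\<exists>t::real. x + t *\<^sub>R a \<in> O2 \<and> 0 < t"
        by (rule eventually_happens'[rotated]) simp
      then obtain t :: real where t: "x + t *\<^sub>R a \<in> O2" "0 < t" by (elim exE conjE)
      have "x \<in> V" using x unfolding O2(2) by (simp add: half_space_def)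
      then have "x + t *\<^sub>R a \<in> half_space V a"
        using V'(2) V(1,2) t(2) by (simp add: half_space_def inner_add_right x_def[symmetric] subspace_add subspace_scale)
      then have "x + t *\<^sub>R a \<in> image_Bl U c" using t(1) unfolding O2(2) by simp
      then have "x + t *\<^sub>R a \<in> L" unfolding O1(2) L_def by (simp add: mem_Times_iff)
      then have "(1 / t) *\<^sub>R ((x + t *\<^sub>R a) - x) \<in> L" by (intro subspace_scale[OF L] subspace_diff[OF L] xL)
      then show ?thesis using t(2) by simp
    qed
    then have "0 \<le> a \<bullet> (- a)" by (intro ge subspace_neg[OF L])
    then have "a \<bullet> a \<le> 0" by simp
    then show ?thesis using V(3) by (simp add: inner_gt_zero_iff[symmetric] del: inner_gt_zero_iff)
  qed
qed

end

section \<open>Equivariant maps commute with the antipodal map\<close>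

text \<open>If \<open>v = w + g w\<close> were nonzero, some \<open>k\<close> would carry \<open>w\<close> to a multiple of \<open>v\<close>. As the stabilizer of \<open>w\<close>
  fixes \<open>v\<close>, \<open>k\<close> maps the fixed space \<open>F\<close> of the stabilizer into itself, hence onto itself. But \<open>g\<close> fixes
  \<open>v\<close>, so it fixes \<open>k F = F\<close> pointwise, and in particular \<open>w\<close>.\<close>

lemma antipodal_of_transitive:
  fixes G (structure) and act :: "'g \<Rightarrow> 'v::euclidean_space \<Rightarrow> 'v"
  assumes G: "group G" and W: "subspace W"
    and lin: "\<And>g. g \<in> carrier G \<Longrightarrow> linear (act g)"
    and inW: "\<And>g w. g \<in> carrier G \<Longrightarrow> w \<in> W \<Longrightarrow> act g w \<in> W"
    and mult: "\<And>g h w. g \<in> carrier G \<Longrightarrow> h \<in> carrier G \<Longrightarrow> w \<in> W \<Longrightarrow> act (g \<otimes> h) w = act g (act h w)"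
    and one: "\<And>w. w \<in> W \<Longrightarrow> act \<one> w = w"
    and g: "g \<in> carrier G" and w: "w \<in> W" and gg: "act g (act g w) = w"
    and stab: "\<And>h. h \<in> carrier G \<Longrightarrow> act h w = w \<Longrightarrow> act h (act g w) = act g w"
    and ne: "act g w \<noteq> w"
    and trans: "\<And>v. v \<in> W \<Longrightarrow> v \<noteq> 0 \<Longrightarrow> \<exists>k\<in>carrier G. \<exists>c>0. act k w = c *\<^sub>R v"
  shows "act g w = - w"
proof (rule ccontr)
  interpret group G by (rule G)
  define v where "v = w + act g w"
  assume "act g w \<noteq> - w"
  then have v0: "v \<noteq> 0" by (simp add: v_def eq_neg_iff_add_eq_0 add.commute)
  have vW: "v \<in> W" unfolding v_def by (intro subspace_add[OF W] w inW g)
  have gv: "act g v = v" unfolding v_def linear_add[OF lin[OF g]] gg by (rule add.commute)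
  obtain k c where k: "k \<in> carrier G" "c > 0" "act k w = c *\<^sub>R v" using trans[OF vW v0] by blast
  have conj: "inv k \<otimes> h \<otimes> k \<in> carrier G" "act (inv k \<otimes> h \<otimes> k) z = act (inv k) (act h (act k z))"
    if "h \<in> carrier G" "z \<in> W" for h z
    using that k(1) mult[of "inv k \<otimes> h" k z] mult[of "inv k" h "act k z"] inW by auto
  have invk: "act (inv k) (act k z) = z" "act k (act (inv k) z) = z" if "z \<in> W" for z
    using mult[of "inv k" k z] mult[of k "inv k" z] one[OF that] k(1) that by auto
  define F where "F = {z \<in> W. \<forall>h\<in>carrier G. act h w = w \<longrightarrow> act h z = z}"
  have FW: "F \<subseteq> W" by (auto simp: F_def)
  have subF: "subspace F"
    unfolding subspace_def F_def using W subspace_0[OF W] subspace_add[OF W] subspace_scale[OF W]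
      linear_0[OF lin] linear_add[OF lin] linear_scale[OF lin] by auto
  have wF: "w \<in> F" using w by (auto simp: F_def)
  have fixv: "act h v = v" if "h \<in> carrier G" "act h w = w" for h
    unfolding v_def linear_add[OF lin[OF that(1)]] using that stab by simp
  \<comment> \<open>If \<open>h\<close> fixes \<open>v\<close>, it fixes \<open>act k w\<close>,
    which is a multiple of \<open>v\<close>. So its conjugate by \<open>k\<close> fixes
    \<open>w\<close>, and then every \<open>z\<close> in \<open>F\<close>.\<close>
  have key: "act h (act k z) = act k z" if h: "h \<in> carrier G" "act h v = v" and z: "z \<in> F" for h z
  proof -
    have zW: "z \<in> W" using z FW by blast
    have "act h (act k w) = act k w" unfolding k(3) linear_scale[OF lin[OF h(1)]] h(2) ..
    then have "act (inv k \<otimes> h \<otimes> k) w = w" using conj(2)[OF h(1) w] invk(1)[OF w] by simp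
    then have "act (inv k \<otimes> h \<otimes> k) z = z" using z conj(1)[OF h(1) w] by (simp add: F_def)
    then have "act (inv k) (act h (act k z)) = z" using conj(2)[OF h(1) zW] by simp
    then show ?thesis using invk(2)[of "act h (act k z)"] inW k(1) h(1) zW by metis
  qed
  have "act k ` F \<subseteq> F"
  proof
    fix y assume "y \<in> act k ` F"
    then obtain z where z: "z \<in> F" "y = act k z" by blast
    have "act h y = y" if "h \<in> carrier G" "act h w = w" for h
      unfolding z(2) by (rule key[OF that(1) fixv[OF that] z(1)])
    moreover have "y \<in> W" using z FW inW[OF k(1)] by blast
    ultimately show "y \<in> F" by (simp add: F_def)
  qed
  moreover have "subspace (act k ` F)" by (rule linear_subspace_image[OF lin[OF k(1)] subF])
  moreover have "dim (act k ` F) = dim F"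
  proof (rule dim_image_eq[OF lin[OF k(1)]])
    have "inj_on (act k) F" by (rule inj_on_inverseI[of _ "act (inv k)"]) (use invk(1) FW in blast)
    moreover have "span F = F" using subF span_eq_iff by blast
    ultimately show "inj_on (act k) (span F)" by (simp only:)
  qed
  ultimately have "act k ` F = F" using subF by (intro subspace_dim_equal) auto
  then obtain z where z: "z \<in> F" "w = act k z" using wF by blast
  have "act g w = w" unfolding z(2) by (rule key[OF g gv z(1)])
  then show False using ne by blast
qed

section \<open>Equivariant maps between bundles with transitive action on the fibre spheres\<close>

locale sphere_transitive_bundle = blowup_domain B ip N
  for B :: "('e, 'a::euclidean_space, 'f, 'b::euclidean_space) vbundle" and ip N +
  fixes G :: "'g monoid" and \<rho> :: "'g \<Rightarrow> 'e \<Rightarrow> 'e"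
  assumes action: "group_action G (points (total B)) \<rho>"
    and action_fibre: "g \<in> carrier G \<Longrightarrow> e \<in> points (total B) \<Longrightarrow> proj B (\<rho> g e) = proj B e"
    and action_add: "g \<in> carrier G \<Longrightarrow> e \<in> points (total B) \<Longrightarrow> e' \<in> points (total B) \<Longrightarrow> proj B e = proj B e' \<Longrightarrow>
      \<rho> g (vadd B e e') = vadd B (\<rho> g e) (\<rho> g e')"
    and action_scale: "g \<in> carrier G \<Longrightarrow> e \<in> points (total B) \<Longrightarrow> \<rho> g (vscale B r e) = vscale B r (\<rho> g e)"
    and action_continuous: "g \<in> carrier G \<Longrightarrow> continuous_map (mtop (total B)) (mtop (total B)) (\<rho> g)"
    and transitive: "transitive_on_sphere_fibres G B \<rho>"
    and action_norm: "g \<in> carrier G \<Longrightarrow> e \<in> points (total B) \<Longrightarrow> fnorm ip (\<rho> g e) = fnorm ip e"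
    and action_N: "g \<in> carrier G \<Longrightarrow> e \<in> N \<Longrightarrow> \<rho> g e \<in> N"
begin

lemma group_G: "group G" using action group_action.group_hom group_hom.axioms(1) by blast

lemma action_points: "g \<in> carrier G \<Longrightarrow> e \<in> points (total B) \<Longrightarrow> \<rho> g e \<in> points (total B)"
  using action group_action.element_image by fastforce

lemma action_mult: "g \<in> carrier G \<Longrightarrow> h \<in> carrier G \<Longrightarrow> e \<in> points (total B) \<Longrightarrow> \<rho> (g \<otimes>\<^bsub>G\<^esub> h) e = \<rho> g (\<rho> h e)"
  using group_action.composition_rule[OF action] by blast

lemma action_one: "e \<in> points (total B) \<Longrightarrow> \<rho> \<one>\<^bsub>G\<^esub> e = e"
  using group_action.id_eq_one[OF action] by (metis restrict_apply')

lemma action_zero_iff: "g \<in> carrier G \<Longrightarrow> e \<in> points (total B) \<Longrightarrow> \<rho> g e \<in> zero_section B \<longleftrightarrow> e \<in> zero_section B"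
  using norm(1) action_points action_norm by metis

lemma action_ray: "g \<in> carrier G \<Longrightarrow> e \<in> points (total B) \<Longrightarrow> \<rho> g ` ray B e = ray B (\<rho> g e)"
  unfolding ray_def using action_scale by (auto simp: image_iff) metis+

lemma transitive_rays:
  assumes "e \<in> points (total B)" "e \<notin> zero_section B" "e' \<in> points (total B)" "e' \<notin> zero_section B" "proj B e = proj B e'"
  obtains g c where "g \<in> carrier G" "0 < c" "\<rho> g e = vscale B c e'"
proof -
  have sub: "ray B x \<subseteq> fibre B (proj B e)" if "x \<in> points (total B)" "proj B x = proj B e" for x
    using that scale(1,2)[OF that(1)] by (auto simp: ray_def fibre_def)
  have "\<exists>g\<in>carrier G. \<rho> g ` ray B e = ray B e'"
    using transitive scale(7)[OF assms(1)] ray_sphere_bundle[OF assms(1,2)] ray_sphere_bundle[OF assms(3,4)]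
      sub[OF assms(1) refl] sub[OF assms(3) assms(5)[symmetric]]
    unfolding transitive_on_sphere_fibres_def by simp
  then obtain g where g: "g \<in> carrier G" "\<rho> g ` ray B e = ray B e'" by blast
  have "e \<in> ray B e" using scale(4)[OF assms(1)] unfolding ray_def by (intro CollectI exI[of _ 1]) simp
  then have "\<rho> g e \<in> ray B e'" using g(2) by blast
  then obtain c where "0 < c" "\<rho> g e = vscale B c e'" unfolding ray_def by blast
  then show ?thesis using g(1) that by blast
qed

text \<open>Transitivity moves the ray of \<open>e\<close> to the opposite ray, and invariance of
  the norm then fixes the scale.\<close>

lemma exists_antipodal_element:
  assumes "e \<in> points (total B)" "e \<notin> zero_section B"
  obtains g where "g \<in> carrier G" "\<rho> g e = vscale B (-1) e"
proof -
  have m: "vscale B (-1) e \<in> points (total B)" "vscale B (-1) e \<notin> zero_section B" "proj B e = proj B (vscale B (-1) e)"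
    using scale(1,2,5)[OF assms(1)] assms(2) by auto
  obtain g c where g: "g \<in> carrier G" "0 < c" "\<rho> g e = vscale B c (vscale B (-1) e)"
    by (rule transitive_rays[OF assms m]) (rule that; assumption)
  have "fnorm ip e = c * fnorm ip e"
    using action_norm[OF g(1) assms(1)] norm(3)[OF m(1), of c] norm(3)[OF assms(1), of "-1"] g(2,3) by simp
  then have "c = 1" using fnorm_pos[OF assms] by simp
  then show ?thesis using g scale(4)[OF m(1)] by (intro that[OF g(1)]) simp
qed

end

locale equivariant_bundle_map =
  E: sphere_transitive_bundle E ip N G \<rho> + E': sphere_transitive_bundle E' ip' N' G \<rho>'
  for E :: "('e, 'a::euclidean_space, 'f, 'b::euclidean_space) vbundle" and ip N
    and E' :: "('e2, 'a2::euclidean_space, 'f2, 'b2::euclidean_space) vbundle" and ip' N'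
    and G :: "'g monoid" and \<rho> \<rho>' +
  fixes \<phi> :: "'e \<Rightarrow> 'e2"
  assumes smooth: "smooth_map (open_submfd (total E) N) (open_submfd (total E') N') \<phi>"
    and equiv: "g \<in> carrier G \<Longrightarrow> e \<in> N \<Longrightarrow> \<phi> (\<rho> g e) = \<rho>' g (\<phi> e)"
    and zero_iff: "e \<in> N \<Longrightarrow> \<phi> e \<in> zero_section E' \<longleftrightarrow> e \<in> zero_section E"
begin

lemma charted_sub: "charted (open_submfd (total E) N)" and charted_sub': "charted (open_submfd (total E') N')"
  by (rule charted_open_submfd[OF E.charted_total E.open_N], rule charted_open_submfd[OF E'.charted_total E'.open_N])

lemma continuous_\<phi>: "continuous_map (subtopology (mtop (total E)) N) (subtopology (mtop (total E')) N') \<phi>"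
  using smooth by (simp add: smooth_map_def open_submfd_def)

lemma \<phi>_N': "e \<in> N \<Longrightarrow> \<phi> e \<in> N'"
  using continuous_map_image_subset_topspace[OF continuous_\<phi>] E.N_points by auto

lemma \<phi>_points: "e \<in> N \<Longrightarrow> \<phi> e \<in> points (total E')"
  using \<phi>_N' E'.N_points by blast

lemma smooth_into_\<phi>:
  assumes "smooth_into X (total E) h" "\<And>x. x \<in> X \<Longrightarrow> h x \<in> N"
  shows "smooth_into X (total E') (\<lambda>x. \<phi> (h x))"
proof -
  have "smooth_into X (open_submfd (total E) N) h"
    using assms by (simp add: smooth_into_open_submfd_iff)
  from smooth_into_smooth_map_compose[OF charted_sub charted_sub' smooth this]
  have "smooth_into X (open_submfd (total E') N') (\<lambda>x. \<phi> (h x))" .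
  then show ?thesis by (subst (asm) smooth_into_open_submfd_iff) (use \<phi>_N' assms(2) in auto)
qed

text \<open>The antipode of a nonzero vector lies in its orbit, and \<open>N\<close> is
  invariant.\<close>

lemma antipodal_N: "e \<in> N \<Longrightarrow> vscale E (-1) e \<in> N"
proof (cases "e \<in> zero_section E")
  case True
  assume "e \<in> N"
  then have "vscale E (-1) e \<in> zero_section E" using E.scale(5)[of e] E.N_points True by blast
  then show ?thesis using E.zero_N by blast
next
  case False
  assume e: "e \<in> N"
  then have "e \<in> points (total E)" using E.N_points by blast
  then obtain g where "g \<in> carrier G" "\<rho> g e = vscale E (-1) e"
    by (rule E.exists_antipodal_element[OF _ False]) (rule that; assumption)
  then show ?thesis using E.action_N e by metis
qed

text \<open>Transfers \<open>antipodal_of_transitive\<close> to the fibre of \<open>E'\<close>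
  through \<open>\<phi> e\<close>. The group element taking \<open>e\<close> to its antipode takes
  \<open>\<phi> e\<close> to the value at the antipode; the assumption \<open>inj\<close> says that
  the stabilizer of \<open>\<phi> e\<close> fixes \<open>e\<close>, hence also the antipode of
  \<open>e\<close> and its image.\<close>

lemma \<phi>_antipodal:
  assumes e: "e \<in> N" "e \<notin> zero_section E"
    and inj: "\<And>h. h \<in> carrier G \<Longrightarrow> \<phi> (\<rho> h e) = \<phi> e \<Longrightarrow> \<rho> h e = e"
  shows "\<phi> (vscale E (-1) e) = vscale E' (-1) (\<phi> e)"
proof -
  have ep: "e \<in> points (total E)" using E.N_points e(1) by blast
  obtain g where g: "g \<in> carrier G" "\<rho> g e = vscale E (-1) e"
    by (rule E.exists_antipodal_element[OF ep e(2)]) (rule that; assumption)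
  have fp: "\<phi> e \<in> points (total E')" and fz: "\<phi> e \<notin> zero_section E'" using \<phi>_points[OF e(1)] zero_iff[OF e(1)] e(2) by auto
  obtain U \<beta> \<gamma> Bs Vb W \<tau> \<Psi> where bc: "bundle_chart E' U \<beta> \<gamma> Bs Vb W \<tau> \<Psi>" and eP: "\<phi> e \<in> bundle_chart.P E' U"
    using exists_bundle_chart_at[OF E'.vb fp] by (elim exE conjE)
  interpret C: bundle_chart E' U \<beta> \<gamma> Bs Vb W \<tau> \<Psi> by (rule bc)
  define b where "b = fst (C.\<Theta> (\<phi> e))"
  define w where "w = snd (C.\<Theta> (\<phi> e))"
  have b: "b \<in> Bs" and w: "w \<in> W" and ew: "\<phi> e = \<Psi> (b, w)"
    using C.\<Theta>_in[OF eP] C.\<Psi>_\<Theta>[OF eP] by (auto simp: b_def w_def mem_Times_iff)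
  obtain Q where Q: "linear Q" "range Q \<subseteq> W" "\<And>v. v \<in> W \<Longrightarrow> Q v = v"
    by (rule linear_closest_point_subspace[OF C.subspace_W]) (rule that; assumption)
  \<comment> \<open>Composition with the projection \<open>Q\<close> onto \<open>W\<close> makes the
    action linear on the whole Euclidean type.\<close>
  define act where "act h z = \<tau> (\<rho>' h (\<Psi> (b, Q z)))" for h z
  have QW: "Q z \<in> W" for z using Q(2) by blast
  have \<Psi>p: "\<Psi> (b, z) \<in> points (total E')" if "z \<in> W" for z using C.\<Psi>(1)[OF b that] .
  have inf: "\<rho>' h (\<Psi> (b, z)) \<in> fibre E' (\<gamma> b)" if "h \<in> carrier G" "z \<in> W" for h z
    using E'.action_points[OF that(1) \<Psi>p[OF that(2)]] E'.action_fibre[OF that(1) \<Psi>p[OF that(2)]] C.\<Psi>(2)[OF b that(2)]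
    by (simp add: fibre_def)
  have act: "act h z \<in> W" "\<rho>' h (\<Psi> (b, z)) = \<Psi> (b, act h z)" if "h \<in> carrier G" "z \<in> W" for h z
    using C.fibre_\<Psi>[OF b inf[OF that]] Q(3)[OF that(2)] by (simp_all add: act_def)
  have "act g w = - w"
  proof (rule antipodal_of_transitive[OF E'.group_G C.subspace_W, where act = act])
    fix h assume h: "h \<in> carrier G"
    show "linear (act h)"
    proof (rule linearI)
      fix x y
      have pr: "proj E' (\<Psi> (b, Q x)) = proj E' (\<Psi> (b, Q y))" using C.\<Psi>(2)[OF b] QW by simp
      have "\<rho>' h (vadd E' (\<Psi> (b, Q x)) (\<Psi> (b, Q y))) = vadd E' (\<rho>' h (\<Psi> (b, Q x))) (\<rho>' h (\<Psi> (b, Q y)))"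
        by (rule E'.action_add[OF h \<Psi>p[OF QW] \<Psi>p[OF QW] pr])
      then show "act h (x + y) = act h x + act h y"
        using C.\<tau>_add[OF C.\<gamma>(1)[OF b] inf[OF h QW] inf[OF h QW]] C.vadd_\<Psi>[OF b QW QW]
        by (simp add: act_def linear_add[OF Q(1)])
    next
      fix r x
      have "\<rho>' h (vscale E' r (\<Psi> (b, Q x))) = vscale E' r (\<rho>' h (\<Psi> (b, Q x)))"
        by (rule E'.action_scale[OF h \<Psi>p[OF QW]])
      then show "act h (r *\<^sub>R x) = r *\<^sub>R act h x"
        using C.\<tau>_scale[OF C.\<gamma>(1)[OF b] inf[OF h QW]] C.vscale_\<Psi>[OF b QW]
        by (simp add: act_def linear_scale[OF Q(1)])
    qed
    show "act h z \<in> W" if "z \<in> W" for z by (rule act(1)[OF h that])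
    show "act (h \<otimes>\<^bsub>G\<^esub> k) z = act h (act k z)" if "k \<in> carrier G" "z \<in> W" for k z
    proof -
      have "\<rho>' (h \<otimes>\<^bsub>G\<^esub> k) (\<Psi> (b, z)) = \<rho>' h (\<Psi> (b, act k z))"
        using E'.action_mult[OF h that(1) \<Psi>p[OF that(2)]] act(2)[OF that] by simp
      then show ?thesis using Q(3)[OF that(2)] Q(3)[OF act(1)[OF that]] by (simp add: act_def)
    qed
  next
    show "act \<one>\<^bsub>G\<^esub> z = z" if "z \<in> W" for z
      using E'.action_one[OF \<Psi>p[OF that]] Q(3)[OF that] C.\<Psi>(3)[OF b that] by (simp add: act_def)
    show "g \<in> carrier G" "w \<in> W" by fact+
    have gw: "\<Psi> (b, act g w) = \<phi> (vscale E (-1) e)" using equiv[OF g(1) e(1)] act(2)[OF g(1) w] ew g(2) by simp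
    have me: "vscale E (-1) e \<in> N" by (rule antipodal_N[OF e(1)])
    have gme: "\<rho> g (vscale E (-1) e) = e"
      using E.action_scale[OF g(1) ep, of "-1"] g(2) E.scale(3)[OF ep, of "-1" "-1"] E.scale(4)[OF ep] by simp
    have "\<Psi> (b, act g (act g w)) = \<rho>' g (\<Psi> (b, act g w))" using act(2)[OF g(1) act(1)[OF g(1) w]] by simp
    also have "\<dots> = \<phi> e" unfolding gw using equiv[OF g(1) me] gme by simp
    finally have "\<tau> (\<Psi> (b, act g (act g w))) = \<tau> (\<Psi> (b, w))" using ew by simp
    then show "act g (act g w) = w" using C.\<Psi>(3)[OF b] act(1)[OF g(1)] w by simp
    show "act h (act g w) = act g w" if h: "h \<in> carrier G" "act h w = w" for h
    proof -
      have "\<phi> (\<rho> h e) = \<phi> e" using equiv[OF h(1) e(1)] act(2)[OF h(1) w] h(2) ew by simp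
      then have "\<rho> h e = e" by (rule inj[OF h(1)])
      then have "\<rho> h (vscale E (-1) e) = vscale E (-1) e" using E.action_scale[OF h(1) ep] by simp
      then have "\<rho>' h (\<Psi> (b, act g w)) = \<Psi> (b, act g w)" using equiv[OF h(1) me] gw by simp
      then have "\<tau> (\<Psi> (b, act h (act g w))) = \<tau> (\<Psi> (b, act g w))" using act(2)[OF h(1) act(1)[OF g(1) w]] by simp
      then show ?thesis using C.\<Psi>(3)[OF b] act(1) h(1) g(1) w by simp
    qed
    \<comment> \<open>Otherwise \<open>g\<close> would fix \<open>e\<close>, and the nonzero vector
      \<open>e\<close> would be its own antipode.\<close>
    show "act g w \<noteq> w"
    proof
      assume "act g w = w"
      then have "\<phi> (\<rho> g e) = \<phi> e" using gw ew g(2) by simp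
      then have "\<rho> g e = e" by (rule inj[OF g(1)])
      then have "vscale E 1 e = vscale E (-1) e" using g(2) E.scale(4)[OF ep] by simp
      moreover obtain U0 \<beta>0 \<gamma>0 Bs0 Vb0 W0 \<tau>0 \<Psi>0 where bc0: "bundle_chart E U0 \<beta>0 \<gamma>0 Bs0 Vb0 W0 \<tau>0 \<Psi>0"
        and eP0: "e \<in> bundle_chart.P E U0"
        using exists_bundle_chart_at[OF E.vb ep] by (elim exE conjE)
      interpret D: bundle_chart E U0 \<beta>0 \<gamma>0 Bs0 Vb0 W0 \<tau>0 \<Psi>0 by (rule bc0)
      have "snd (D.\<Theta> (vscale E 1 e)) = 1 *\<^sub>R snd (D.\<Theta> e)" "snd (D.\<Theta> (vscale E (-1) e)) = (-1) *\<^sub>R snd (D.\<Theta> e)"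
        using D.vscale_\<Theta>(2)[OF eP0] by simp_all
      ultimately have "snd (D.\<Theta> e) = - snd (D.\<Theta> e)" by simp
      then have "snd (D.\<Theta> e) = 0" by (simp add: eq_neg_iff_add_eq_0 scaleR_2[symmetric])
      then show False using D.zero_section_\<Theta>_iff[OF eP0] e(2) by simp
    qed
    show "\<exists>k\<in>carrier G. \<exists>c>0. act k w = c *\<^sub>R v" if v: "v \<in> W" "v \<noteq> 0" for v
    proof -
      have "\<Psi> (b, v) \<notin> zero_section E'" using C.\<Psi>_zero_section_iff[OF b v(1)] v(2) by simp
      moreover have "proj E' (\<phi> e) = proj E' (\<Psi> (b, v))" unfolding ew using C.\<Psi>(2)[OF b] v(1) w by simp
      ultimately obtain k c where k: "k \<in> carrier G" "0 < c" "\<rho>' k (\<phi> e) = vscale E' c (\<Psi> (b, v))"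
        by (rule E'.transitive_rays[OF fp fz \<Psi>p[OF v(1)]]) (rule that; assumption)
      have "\<tau> (\<Psi> (b, act k w)) = \<tau> (\<Psi> (b, c *\<^sub>R v))"
        using k(3) act(2)[OF k(1) w] C.vscale_\<Psi>[OF b v(1)] ew by simp
      then have "act k w = c *\<^sub>R v" using C.\<Psi>(3)[OF b] act(1)[OF k(1) w] subspace_scale[OF C.subspace_W v(1)] by simp
      then show ?thesis using k by blast
    qed
  qed
  then have "\<phi> (vscale E (-1) e) = \<Psi> (b, (-1) *\<^sub>R w)"
    using equiv[OF g(1) e(1)] act(2)[OF g(1) w] ew g(2) by simp
  then show ?thesis using C.vscale_\<Psi>[OF b w, of "-1"] ew by simp
qed

end

section \<open>Consequences of the non-degenerate Hessian\<close>

text \<open>Every term of the twice applied product rule contains a factor \<open>\<alpha> i\<close>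
  or \<open>\<beta> i\<close> at \<open>x0\<close>, or its derivative along \<open>u\<close>, and
  all of these vanish. The function \<open>f\<close> is compared with the sum just on the plane
  through \<open>x0\<close>, which is all that the chart representation of a function
  provides.\<close>

lemma iterated_deriv_zero:
  fixes \<alpha> \<beta> :: "'i \<Rightarrow> 'a::euclidean_space \<Rightarrow> real"
  assumes O: "open O1" "x0 \<in> O1"
    and sm: "\<And>i. i \<in> I \<Longrightarrow> smooth_on O1 (\<alpha> i)" "\<And>i. i \<in> I \<Longrightarrow> smooth_on O1 (\<beta> i)"
    and z: "\<And>i. i \<in> I \<Longrightarrow> \<alpha> i x0 = 0" "\<And>i. i \<in> I \<Longrightarrow> \<beta> i x0 = 0"
    and d: "\<And>i. i \<in> I \<Longrightarrow> frechet_derivative (\<alpha> i) (at x0) u = 0" "\<And>i. i \<in> I \<Longrightarrow> frechet_derivative (\<beta> i) (at x0) u = 0"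
    and f: "\<And>s t. x0 + s *\<^sub>R u + t *\<^sub>R v \<in> O1 \<Longrightarrow> f (x0 + s *\<^sub>R u + t *\<^sub>R v) = (\<Sum>i\<in>I. \<alpha> i (x0 + s *\<^sub>R u + t *\<^sub>R v) * \<beta> i (x0 + s *\<^sub>R u + t *\<^sub>R v))"
  shows "deriv (\<lambda>s. deriv (\<lambda>t. f (x0 + s *\<^sub>R u + t *\<^sub>R v)) 0) 0 = 0"
proof -
  have line: "(g \<circ> (\<lambda>t. x + t *\<^sub>R w) has_real_derivative frechet_derivative g (at x) w) (at 0)"
    if "smooth_on O1 g" "x \<in> O1" for g :: "'a \<Rightarrow> real" and x w
  proof -
    have g: "(g has_derivative frechet_derivative g (at x)) (at (x + 0 *\<^sub>R w))"
      using smooth_on_has_derivative[OF O(1) that] by simp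
    have "((\<lambda>t. x + t *\<^sub>R w) has_derivative (\<lambda>t. t *\<^sub>R w)) (at (0::real))"
      by (auto intro!: derivative_eq_intros)
    from has_derivative_compose[OF this g]
    have "((\<lambda>t. g (x + t *\<^sub>R w)) has_derivative (\<lambda>t. frechet_derivative g (at x) (t *\<^sub>R w))) (at 0)" .
    moreover have "(\<lambda>t. frechet_derivative g (at x) (t *\<^sub>R w)) = (*) (frechet_derivative g (at x) w)"
      using linear_scale[OF has_derivative_linear[OF g]] by (simp add: fun_eq_iff mult.commute)
    ultimately show ?thesis by (simp add: has_field_derivative_def o_def)
  qed
  define \<Xi> where "\<Xi> x = (\<Sum>i\<in>I. frechet_derivative (\<alpha> i) (at x) v * \<beta> i x + \<alpha> i x * frechet_derivative (\<beta> i) (at x) v)" for x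
  have inner: "deriv (\<lambda>t. f (x0 + s *\<^sub>R u + t *\<^sub>R v)) 0 = \<Xi> (x0 + s *\<^sub>R u)" if s: "x0 + s *\<^sub>R u \<in> O1" for s
  proof (rule DERIV_imp_deriv)
    let ?x = "x0 + s *\<^sub>R u"
    have "((\<lambda>t. \<Sum>i\<in>I. \<alpha> i (?x + t *\<^sub>R v) * \<beta> i (?x + t *\<^sub>R v)) has_real_derivative \<Xi> ?x) (at 0)"
      unfolding \<Xi>_def
    proof (rule DERIV_sum)
      fix i assume i: "i \<in> I"
      from DERIV_mult[OF line[OF sm(1)[OF i] s, of v] line[OF sm(2)[OF i] s, of v]]
      show "((\<lambda>t. \<alpha> i (?x + t *\<^sub>R v) * \<beta> i (?x + t *\<^sub>R v)) has_real_derivative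
          frechet_derivative (\<alpha> i) (at ?x) v * \<beta> i ?x + \<alpha> i ?x * frechet_derivative (\<beta> i) (at ?x) v) (at 0)"
        by (simp add: o_def add.commute mult.commute)
    qed
    note Dsum = this
    have "open ((\<lambda>t. ?x + t *\<^sub>R v) -` O1)"
      by (rule open_vimage[OF O(1)]) (intro continuous_intros)
    then have "\<forall>\<^sub>F t in nhds 0. ?x + t *\<^sub>R v \<in> O1"
      using s eventually_nhds_in_open[of "(\<lambda>t. ?x + t *\<^sub>R v) -` O1" 0] by simp
    then have "\<forall>\<^sub>F t in nhds 0. f (?x + t *\<^sub>R v) = (\<Sum>i\<in>I. \<alpha> i (?x + t *\<^sub>R v) * \<beta> i (?x + t *\<^sub>R v))"
      by (rule eventually_mono) (rule f)
    from DERIV_cong_ev[OF refl this refl, THEN iffD2, OF Dsum]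
    show "((\<lambda>t. f (?x + t *\<^sub>R v)) has_real_derivative \<Xi> ?x) (at 0)" .
  qed
  have D: "smooth_on O1 (\<lambda>x. frechet_derivative (\<alpha> i) (at x) v)" "smooth_on O1 (\<lambda>x. frechet_derivative (\<beta> i) (at x) v)"
    if "i \<in> I" for i using smooth_on_frechet_derivative[OF O(1)] sm that by blast+
  have "((\<lambda>s. \<Xi> (x0 + s *\<^sub>R u)) has_real_derivative (\<Sum>i\<in>I. 0)) (at 0)"
    unfolding \<Xi>_def
  proof (rule DERIV_sum)
    fix i assume i: "i \<in> I"
    from DERIV_add[OF DERIV_mult[OF line[OF D(1)[OF i] O(2), of u] line[OF sm(2)[OF i] O(2), of u]]
        DERIV_mult[OF line[OF sm(1)[OF i] O(2), of u] line[OF D(2)[OF i] O(2), of u]]]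
    show "((\<lambda>s. frechet_derivative (\<alpha> i) (at (x0 + s *\<^sub>R u)) v * \<beta> i (x0 + s *\<^sub>R u) +
       \<alpha> i (x0 + s *\<^sub>R u) * frechet_derivative (\<beta> i) (at (x0 + s *\<^sub>R u)) v) has_real_derivative 0) (at 0)"
      by (simp add: o_def z[OF i] d[OF i])
  qed
  note Dsum = this
  have "open ((\<lambda>s. x0 + s *\<^sub>R u) -` O1)"
    by (rule open_vimage[OF O(1)]) (intro continuous_intros)
  then have "\<forall>\<^sub>F s in nhds 0. x0 + s *\<^sub>R u \<in> O1"
    using O(2) eventually_nhds_in_open[of "(\<lambda>s. x0 + s *\<^sub>R u) -` O1" 0] by simp
  then have "\<forall>\<^sub>F s in nhds 0. deriv (\<lambda>t. f (x0 + s *\<^sub>R u + t *\<^sub>R v)) 0 = \<Xi> (x0 + s *\<^sub>R u)"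
    by (rule eventually_mono) (rule inner)
  from DERIV_cong_ev[OF refl this refl, THEN iffD2, OF Dsum]
  have "((\<lambda>s. deriv (\<lambda>t. f (x0 + s *\<^sub>R u + t *\<^sub>R v)) 0) has_real_derivative 0) (at 0)" by simp
  then show ?thesis by (rule DERIV_imp_deriv)
qed

section \<open>The map in bundle charts around a point of the zero section\<close>

locale local_representative = equivariant_bundle_map E ip N E' ip' N' G \<rho> \<rho>' \<phi> +
    C: bundle_chart E U \<beta> \<gamma> Bs Vb W \<tau> \<Psi> + C': bundle_chart E' U' \<beta>' \<gamma>' Bs' Vb' W' \<tau>' \<Psi>'
  for E :: "('e, 'a::euclidean_space, 'f, 'b::euclidean_space) vbundle" and ip N
    and E' :: "('e2, 'a2::euclidean_space, 'f2, 'b2::euclidean_space) vbundle" and ip' N'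
    and G :: "'g monoid" and \<rho> \<rho>' \<phi> U \<beta> \<gamma> Bs Vb W \<tau> \<Psi> U' \<beta>' \<gamma>' Bs' Vb' W' \<tau>' \<Psi>' +
  fixes b0 :: 'b and Qb :: "'b \<Rightarrow> 'b" and Qw :: "'a \<Rightarrow> 'a"
  assumes b0: "b0 \<in> Bs" and \<phi>b0: "\<phi> (\<Psi> (b0, 0)) \<in> bundle_chart.P E' U'"
    and Qb: "linear Qb" "range Qb \<subseteq> Vb" "\<And>v. v \<in> Vb \<Longrightarrow> Qb v = v"
    and Qw: "linear Qw" "range Qw \<subseteq> W" "\<And>v. v \<in> W \<Longrightarrow> Qw v = v"
begin

text \<open>\<open>A\<close> is relatively open in \<open>Vb \<times> W\<close> and carries the
  coordinate expression \<open>F\<close> of \<phi>. The projection \<open>Q\<close> extends both to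
  an open set \<open>A1\<close> of the ambient Euclidean space, so that derivatives are available;
  \<open>f\<close> is the extended fibre component.\<close>

definition A :: "('b \<times> 'a) set" where "A = {y \<in> Bs \<times> W. \<Psi> y \<in> N \<and> \<phi> (\<Psi> y) \<in> C'.P}"
definition F :: "'b \<times> 'a \<Rightarrow> 'b2 \<times> 'a2" where "F y = C'.\<Theta> (\<phi> (\<Psi> y))"
definition Q :: "'b \<times> 'a \<Rightarrow> 'b \<times> 'a" where "Q y = (Qb (fst y), Qw (snd y))"
definition A1 :: "('b \<times> 'a) set" where "A1 = Q -` A"
definition f :: "'b \<times> 'a \<Rightarrow> 'a2" where "f y = snd (F (Q y))"

lemma A_sub: "y \<in> A \<Longrightarrow> y \<in> Bs \<times> W" "y \<in> A \<Longrightarrow> \<Psi> y \<in> N" "y \<in> A \<Longrightarrow> \<phi> (\<Psi> y) \<in> C'.P"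
  by (simp_all add: A_def)

lemma VbW: "y \<in> Bs \<times> W \<Longrightarrow> y \<in> Vb \<times> W"
  using openin_imp_subset[OF C.open_\<Theta>_range] by (rule subsetD)

lemma Q: "linear Q" "range Q \<subseteq> Vb \<times> W" "\<And>y. y \<in> Vb \<times> W \<Longrightarrow> Q y = y"
proof -
  show "linear Q" unfolding Q_def
    by (rule linearI) (simp_all add: linear_add[OF Qb(1)] linear_add[OF Qw(1)] linear_scale[OF Qb(1)] linear_scale[OF Qw(1)])
  show "range Q \<subseteq> Vb \<times> W" using Qb(2) Qw(2) by (auto simp: Q_def)
  show "Q y = y" if "y \<in> Vb \<times> W" for y using that Qb(3) Qw(3) by (simp add: Q_def mem_Times_iff prod_eq_iff)
qed

lemma F_in: "y \<in> A \<Longrightarrow> F y \<in> Bs' \<times> W'" "y \<in> A \<Longrightarrow> \<phi> (\<Psi> y) = \<Psi>' (F y)"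
  using C'.\<Theta>_in[OF A_sub(3)] C'.\<Psi>_\<Theta>[OF A_sub(3)] by (simp_all add: F_def)

lemma F_zero_iff: "y \<in> A \<Longrightarrow> snd (F y) = 0 \<longleftrightarrow> snd y = 0"
  using C'.zero_section_\<Theta>_iff[OF A_sub(3)] zero_iff[OF A_sub(2)] C.\<Psi>_zero_section_iff[of "fst y" "snd y"] A_sub(1)[of y]
  by (simp add: F_def mem_Times_iff)

lemma zero_in_A: "(b0, 0) \<in> A"
proof -
  have "\<Psi> (b0, 0) \<in> N" using C.\<Psi>_zero_section_iff[OF b0 C.zero_in_W] E.zero_N by blast
  then show ?thesis using b0 \<phi>b0 C.zero_in_W by (simp add: A_def)
qed

lemma smooth_F: "smooth_on A F" and open_A: "openin (top_of_set (Vb \<times> W)) A"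
proof -
  obtain O1 where O1: "open O1" "{y \<in> Bs \<times> W. \<Psi> y \<in> N} = (Bs \<times> W) \<inter> O1"
    by (rule continuous_map_openin_preimage[OF smooth_intoD(1)[OF C.smooth_\<Psi>] E.open_N]) (rule that; assumption)
  have s1: "smooth_into ((Bs \<times> W) \<inter> O1) (total E) \<Psi>" by (rule smooth_into_subset[OF C.smooth_\<Psi>]) simp
  have inN: "\<Psi> y \<in> N" if "y \<in> (Bs \<times> W) \<inter> O1" for y using that unfolding O1(2)[symmetric] by simp
  have s2: "smooth_into ((Bs \<times> W) \<inter> O1) (total E') (\<lambda>y. \<phi> (\<Psi> y))" by (rule smooth_into_\<phi>[OF s1 inN])
  obtain O2 where O2: "open O2" "{y \<in> (Bs \<times> W) \<inter> O1. \<phi> (\<Psi> y) \<in> C'.P} = ((Bs \<times> W) \<inter> O1) \<inter> O2"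
    by (rule continuous_map_openin_preimage[OF smooth_intoD(1)[OF s2] C'.open_P]) (rule that; assumption)
  have "((Bs \<times> W) \<inter> O1) \<inter> O2 = {y \<in> {y \<in> Bs \<times> W. \<Psi> y \<in> N}. \<phi> (\<Psi> y) \<in> C'.P}"
    unfolding O2(2)[symmetric] O1(2) ..
  also have "\<dots> = A" by (auto simp: A_def)
  finally have A: "A = ((Bs \<times> W) \<inter> O1) \<inter> O2" ..
  have "smooth_into A (total E') (\<lambda>y. \<phi> (\<Psi> y))" by (rule smooth_into_subset[OF s2]) (simp only: A Int_lower1)
  from smooth_on_smooth_to_compose[OF E'.charted_total C'.smooth_\<Theta> this]
  show "smooth_on A F" unfolding F_def[abs_def] using A_sub(3) by blast
  have "openin (top_of_set (Vb \<times> W)) ((Bs \<times> W) \<inter> (O1 \<inter> O2))"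
    using C.open_\<Theta>_range O1(1) O2(1) by (simp add: openin_Int_open open_Int)
  then show "openin (top_of_set (Vb \<times> W)) A" unfolding A by (simp only: Int_assoc)
qed

lemma QA: "y \<in> A \<Longrightarrow> Q y = y" using Q(3) VbW A_sub(1) by blast

lemma open_A1: "open A1" and smooth_F1: "smooth_on A1 (\<lambda>y. F (Q y))"
  unfolding A1_def using smooth_on_subspace_projection[OF Q(1) QA Q(2) open_A smooth_F] by blast+

lemma smooth_f: "smooth_on A1 f" unfolding f_def[abs_def] by (rule smooth_on_snd[OF smooth_F1])

lemma A_A1: "y \<in> A \<Longrightarrow> y \<in> A1" using QA by (simp add: A1_def)

lemma zero_in_A1: "(b0, 0) \<in> A1" by (rule A_A1[OF zero_in_A])

lemma f_derivative: "y \<in> A1 \<Longrightarrow> (f has_derivative frechet_derivative f (at y)) (at y)"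
  by (rule smooth_on_has_derivative[OF open_A1 smooth_f])

lemma f_zero: "f (b0, 0) = 0" using F_zero_iff[OF zero_in_A] QA[OF zero_in_A] by (simp add: f_def)

text \<open>By contradiction: let \<open>u\<close> be the vertical vector \<eta> seen in a chart of
  the total space. It is not tangent to the zero section, so the Hessian pairs it with some
  \<open>v\<close> to a nonzero value. But the squared norm of \<phi> is a sum of products of
  components of \<open>f\<close>, which vanish at the point together with their derivatives along
  \<open>u\<close>.\<close>

lemma vertical_derivative_injective:
  assumes hess: "hessian_nondegenerate_on_normal_bundle (open_submfd (total E) N) (zero_section E) (\<lambda>e. (fnorm ip' (\<phi> e))\<^sup>2)"
    and \<eta>: "\<eta> \<in> W" "frechet_derivative f (at (b0, 0)) (0, \<eta>) = 0"
  shows "\<eta> = 0"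
proof (rule ccontr)
  assume \<eta>0: "\<eta> \<noteq> 0"
  define p where "p = \<Psi> (b0, 0)"
  have pz: "p \<in> zero_section E" using C.\<Psi>_zero_section_iff[OF b0 C.zero_in_W] by (simp add: p_def)
  have pN: "p \<in> N" using pz E.zero_N by blast
  have pP: "p \<in> C.P" unfolding p_def by (rule C.\<Psi>_in) (use b0 C.zero_in_W in simp)
  have \<Theta>p: "C.\<Theta> p = (b0, 0)" unfolding p_def by (rule C.\<Theta>_\<Psi>) (use b0 C.zero_in_W in simp)
  have "p \<in> points (total E)" using pN E.N_points by blast
  then obtain U1 c where c: "(U1, c) \<in> atlas (total E)" "p \<in> U1"
    by (rule charted_cover[OF E.charted_total]) (rule that; assumption)
  note inj = chartedD(2)[OF E.charted_total c(1)]
  define X where "X = c ` (U1 \<inter> N)"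
  have atl: "(U1 \<inter> N, c) \<in> atlas (open_submfd (total E) N)" using c(1) by (force simp: open_submfd_def)
  obtain V where V: "subspace V" "openin (top_of_set V) (c ` U1)"
    by (rule manifold_chart_open[OF E.manifold_total c(1)]) (rule that; assumption)
  have spanV: "span X \<subseteq> V"
  proof (rule span_minimal[OF _ V(1)])
    show "X \<subseteq> V" using openin_imp_subset[OF V(2)] by (auto simp: X_def)
  qed
  have s1: "smooth_on {y \<in> Bs \<times> W. \<Psi> y \<in> U1} (\<lambda>y. c (\<Psi> y))" by (rule smooth_intoD(2)[OF C.smooth_\<Psi> c(1)])
  have s2: "smooth_on (c ` (U1 \<inter> C.P)) (\<lambda>x. C.\<Theta> (inv_into U1 c x))" by (rule smooth_toD(2)[OF C.smooth_\<Theta> c(1)])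
  have in1: "(b0, 0) \<in> {y \<in> Bs \<times> W. \<Psi> y \<in> U1}" using b0 C.zero_in_W c(2) by (simp add: p_def)
  have in2: "c p \<in> c ` (U1 \<inter> C.P)" using c(2) pP by blast
  obtain Ug g where g: "open Ug" "(b0, 0) \<in> Ug" "smooth_on Ug g"
    "\<And>y. y \<in> {y \<in> Bs \<times> W. \<Psi> y \<in> U1} \<inter> Ug \<Longrightarrow> g y = c (\<Psi> y)"
    "(g has_derivative frechet_derivative g (at (b0, 0))) (at (b0, 0))"
    by (rule smooth_on_extension_has_derivative[OF s1 in1]) (rule that; assumption)
  obtain Uk k where k: "open Uk" "c p \<in> Uk" "smooth_on Uk k"
    "\<And>x. x \<in> c ` (U1 \<inter> C.P) \<inter> Uk \<Longrightarrow> k x = C.\<Theta> (inv_into U1 c x)"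
    "(k has_derivative frechet_derivative k (at (c p))) (at (c p))"
    by (rule smooth_on_extension_has_derivative[OF s2 in2]) (rule that; assumption)
  have gp: "g (b0, 0) = c p" using g(2) g(4)[of "(b0, 0)"] in1 by (simp add: p_def)
  have kp': "k (c q) = C.\<Theta> q" if "q \<in> U1" "q \<in> C.P" "c q \<in> Uk" for q
    using k(4)[of "c q"] that inj by (simp add: inv_into_f_f)
  have kp: "k (c p) = (b0, 0)" using kp'[OF c(2) pP k(2)] \<Theta>p by simp
  define u where "u = frechet_derivative g (at (b0, 0)) (0, \<eta>)"
  obtain T1 where T1: "open T1" "{y \<in> Bs \<times> W. \<Psi> y \<in> U1 \<inter> N} = (Bs \<times> W) \<inter> T1"
    by (rule continuous_map_openin_preimage[OF smooth_intoD(1)[OF C.smooth_\<Psi>] openin_Int[OF chartedD(1)[OF E.charted_total c(1)] E.open_N]])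
      (rule that; assumption)
  have gcont: "((\<lambda>t. g ((b0, 0) + t *\<^sub>R (0, \<eta>))) \<longlongrightarrow> c p) (at_right 0)"
  proof -
    have "isCont g (b0, 0)" using g(5) has_derivative_continuous by blast
    then have "((\<lambda>t. g ((b0, 0) + t *\<^sub>R (0, \<eta>))) \<longlongrightarrow> g (b0, 0)) (at_right 0)"
      by (rule isCont_tendsto_compose) (auto intro!: tendsto_eq_intros simp: zero_prod_def)
    then show ?thesis unfolding gp .
  qed
  have ev: "\<forall>\<^sub>F t in at_right 0. k (g ((b0, 0) + t *\<^sub>R (0, \<eta>))) = (b0, 0) + t *\<^sub>R (0, \<eta>) \<and>
      g ((b0, 0) + t *\<^sub>R (0, \<eta>)) \<in> X"
  proof -
    have "(b0, 0) \<in> (Bs \<times> W) \<inter> T1" unfolding T1(2)[symmetric] using in1 pN by (simp add: p_def)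
    then have "(b0, 0) \<in> T1 \<inter> Ug" using g(2) by simp
    then have "\<forall>\<^sub>F t in at_right 0. (b0, 0) + t *\<^sub>R (0, \<eta>) \<in> T1 \<inter> Ug"
      by (intro eventually_path_in_open open_Int T1 g)
    moreover have "\<forall>\<^sub>F t in at_right 0. g ((b0, 0) + t *\<^sub>R (0, \<eta>)) \<in> Uk"
      by (rule topological_tendstoD[OF gcont k(1,2)])
    ultimately show ?thesis
    proof eventually_elim
      case (elim t)
      let ?y = "(b0, 0) + t *\<^sub>R (0, \<eta>)"
      have yBW: "?y \<in> Bs \<times> W" using b0 subspace_scale[OF C.subspace_W \<eta>(1), of t] by simp
      then have "?y \<in> (Bs \<times> W) \<inter> T1" using elim(1) by simp
      then have y: "\<Psi> ?y \<in> U1" "\<Psi> ?y \<in> N" unfolding T1(2)[symmetric] by simp_all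
      have gy: "g ?y = c (\<Psi> ?y)" using g(4)[of ?y] yBW y elim(1) by simp
      have "k (g ?y) = C.\<Theta> (\<Psi> ?y)" using kp'[OF y(1) C.\<Psi>_in[OF yBW]] elim(2) gy by simp
      then show ?case using C.\<Theta>_\<Psi>[OF yBW] gy y by (simp add: X_def)
    qed
  qed
  have Dku: "frechet_derivative k (at (c p)) u = (0, \<eta>)"
    unfolding u_def
    by (rule derivative_left_inverse[OF g(5), of k]) (use k(5) gp kp ev in \<open>auto elim: eventually_mono\<close>)
  have uX: "u \<in> span X"
  proof (rule tendsto_at_right_in_closed[OF has_derivative_directional[OF g(5), of "(0, \<eta>)", folded u_def] closed_span])
    show "\<forall>\<^sub>F t in at_right 0. (g ((b0, 0) + t *\<^sub>R (0, \<eta>)) - g (b0, 0)) /\<^sub>R t \<in> span X"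
      using ev
    proof eventually_elim
      case (elim t)
      have "c p \<in> X" using c(2) pN by (simp add: X_def)
      then show ?case unfolding gp using elim by (intro span_scale span_diff span_base) simp_all
    qed
  qed
  \<comment> \<open>A curve in the zero section has vanishing fibre coordinate, so its velocity
    cannot have the fibre component \<eta>.\<close>
  have "u \<notin> tangent_in_chart (open_submfd (total E) N) c (zero_section E) p"
  proof
    assume "u \<in> tangent_in_chart (open_submfd (total E) N) c (zero_section E) p"
    then obtain \<kappa> where \<kappa>: "smooth_map real_mfd (open_submfd (total E) N) \<kappa>" "range \<kappa> \<subseteq> zero_section E" "\<kappa> 0 = p"
      "((c \<circ> \<kappa>) has_vector_derivative u) (at 0)" unfolding tangent_in_chart_def by blast
    have "continuous_map euclideanreal (mtop (total E)) \<kappa>"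
      using \<kappa>(1) by (simp add: smooth_map_def std_mfd_def open_submfd_def continuous_map_in_subtopology)
    from openin_continuous_map_preimage[OF this openin_Int[OF chartedD(1)[OF E.charted_total c(1)] C.open_P]]
    have "open {t. \<kappa> t \<in> U1 \<inter> C.P}" by simp
    then have e1: "\<forall>\<^sub>F t in at_right 0. \<kappa> t \<in> U1 \<inter> C.P"
      using eventually_path_in_open[of "{t. \<kappa> t \<in> U1 \<inter> C.P}" 0 1] c(2) pP \<kappa>(3) by simp
    have dc: "((c \<circ> \<kappa>) has_derivative (\<lambda>t. t *\<^sub>R u)) (at 0)" using \<kappa>(4) by (simp add: has_vector_derivative_def)
    have c0: "(c \<circ> \<kappa>) 0 = c p" using \<kappa>(3) by simp
    have "isCont (c \<circ> \<kappa>) 0" using dc has_derivative_continuous by blast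
    then have "((\<lambda>t. (c \<circ> \<kappa>) t) \<longlongrightarrow> c p) (at_right 0)"
      using c0 by (metis continuous_within isCont_def tendsto_within_subset top_greatest UNIV_I subset_UNIV)
    then have e2: "\<forall>\<^sub>F t in at_right 0. (c \<circ> \<kappa>) t \<in> Uk" by (rule topological_tendstoD[OF _ k(1,2)])
    have "((\<lambda>t. k ((c \<circ> \<kappa>) t)) has_derivative (\<lambda>t. frechet_derivative k (at (c p)) (t *\<^sub>R u))) (at 0)"
      by (rule has_derivative_compose[OF dc]) (use k(5) c0 in simp)
    then have "((\<lambda>t. snd (k ((c \<circ> \<kappa>) t))) has_derivative (\<lambda>t. snd (frechet_derivative k (at (c p)) (t *\<^sub>R u)))) (at 0)"
      by (rule has_derivative_snd)
    from has_derivative_directional[OF this, of 1]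
    have "((\<lambda>t. (snd (k ((c \<circ> \<kappa>) (0 + t *\<^sub>R 1))) - snd (k ((c \<circ> \<kappa>) 0))) /\<^sub>R t) \<longlongrightarrow> \<eta>) (at_right 0)"
      using Dku by simp
    moreover have "\<forall>\<^sub>F t in at_right 0. (snd (k ((c \<circ> \<kappa>) (0 + t *\<^sub>R 1))) - snd (k ((c \<circ> \<kappa>) 0))) /\<^sub>R t = 0"
      using e1 e2
    proof eventually_elim
      case (elim t)
      have "k (c (\<kappa> t)) = C.\<Theta> (\<kappa> t)" using kp' elim by simp
      moreover have "snd (C.\<Theta> (\<kappa> t)) = 0" using C.zero_section_\<Theta>_iff[of "\<kappa> t"] \<kappa>(2) elim(1) by auto
      ultimately show ?case using c0 kp by simp
    qed
    then have "((\<lambda>t. (snd (k ((c \<circ> \<kappa>) (0 + t *\<^sub>R 1))) - snd (k ((c \<circ> \<kappa>) 0))) /\<^sub>R t) \<longlongrightarrow> 0) (at_right 0)"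
      by (rule tendsto_eventually)
    ultimately have "\<eta> = 0" by (rule tendsto_unique[rotated]) simp
    then show False using \<eta>0 by simp
  qed
  then obtain v where v: "v \<in> span X" "hessian_in_chart (U1 \<inter> N) c (\<lambda>e. (fnorm ip' (\<phi> e))\<^sup>2) p u v \<noteq> 0"
    using hess pz atl c(2) pN uX unfolding hessian_nondegenerate_on_normal_bundle_def X_def by fastforce
  obtain Fr where Fr: "finite Fr" "Fr \<subseteq> W'"
    "\<And>b \<eta> \<xi>. b \<in> Bs' \<Longrightarrow> \<eta> \<in> W' \<Longrightarrow> \<xi> \<in> W' \<Longrightarrow> ip' (\<Psi>' (b, \<eta>)) (\<Psi>' (b, \<xi>)) =
       (\<Sum>u\<in>Fr. \<Sum>u'\<in>Fr. (\<eta> \<bullet> u) * (\<xi> \<bullet> u') * ip' (\<Psi>' (b, u)) (\<Psi>' (b, u')))"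
    by (rule C'.ip_expansion[OF E'.ip]) (rule that; assumption)
  define O1 where "O1 = Uk \<inter> k -` A1"
  have openO1: "open O1"
    unfolding O1_def using k(1) open_A1 smooth_on_imp_continuous_on[OF k(3)]
    by (metis Int_commute continuous_on_open_vimage)
  have pO1: "c p \<in> O1" using k(2) kp zero_in_A1 by (simp add: O1_def)
  have kO1: "smooth_on O1 k" by (rule smooth_on_subset[OF k(3)]) (simp add: O1_def)
  have wO1: "smooth_on O1 (\<lambda>x. f (k x))" by (rule smooth_on_compose'[OF smooth_f kO1]) (simp add: O1_def)
  have yO1: "smooth_on O1 (\<lambda>x. fst (F (Q (k x))))"
    by (rule smooth_on_compose'[OF smooth_on_fst[OF smooth_F1] kO1]) (simp add: O1_def)
  have yB: "fst (F (Q (k x))) \<in> Bs'" "f (k x) \<in> W'" if "x \<in> O1" for x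
    using F_in(1)[of "Q (k x)"] that by (auto simp: O1_def A1_def f_def mem_Times_iff)
  \<comment> \<open>The Gram matrix of \<open>ip'\<close> at the moving base point; the products
    \<open>al i x * be i x\<close> are then the terms of the squared norm of \<phi>.\<close>
  define n where "n i x = ip' (\<Psi>' (fst (F (Q (k x))), fst i)) (\<Psi>' (fst (F (Q (k x))), snd i))" for i x
  define al where "al i x = f (k x) \<bullet> fst i" for i :: "'a2 \<times> 'a2" and x
  define be where "be i x = (f (k x) \<bullet> snd i) * n i x" for i x
  have sn: "smooth_on O1 (n i)" if "i \<in> Fr \<times> Fr" for i
    unfolding n_def
    by (rule smooth_on_compose'[OF C'.smooth_on_ip_frame[OF E'.ip] yO1]) (use that Fr(2) yB in auto)
  have sal: "smooth_on O1 (al i)" for i unfolding al_def by (intro smooth_on_inner wO1 smooth_on_const)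
  have sbe: "smooth_on O1 (be i)" if "i \<in> Fr \<times> Fr" for i
    unfolding be_def by (intro smooth_on_mult smooth_on_inner wO1 smooth_on_const sn that)
  have w0: "f (k (c p)) = 0" using kp f_zero by simp
  have Dw: "((\<lambda>x. f (k x)) has_derivative (\<lambda>z. frechet_derivative f (at (b0, 0)) (frechet_derivative k (at (c p)) z))) (at (c p))"
    by (rule has_derivative_compose[OF k(5)]) (use f_derivative[OF zero_in_A1] kp in simp)
  have Dal: "frechet_derivative (al i) (at (c p)) u = 0" for i
  proof -
    have "(al i has_derivative (\<lambda>z. frechet_derivative f (at (b0, 0)) (frechet_derivative k (at (c p)) z) \<bullet> fst i)) (at (c p))"
      unfolding al_def by (rule has_derivative_inner_left[OF Dw])
    from fun_cong[OF frechet_derivative_at[OF this], of u] show ?thesis using Dku \<eta>(2) by simp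
  qed
  have Dbe: "frechet_derivative (be i) (at (c p)) u = 0" if "i \<in> Fr \<times> Fr" for i
  proof -
    have 1: "((\<lambda>x. f (k x) \<bullet> snd i) has_derivative (\<lambda>z. frechet_derivative f (at (b0, 0)) (frechet_derivative k (at (c p)) z) \<bullet> snd i)) (at (c p))"
      by (rule has_derivative_inner_left[OF Dw])
    from has_derivative_mult[OF 1 smooth_on_has_derivative[OF openO1 sn[OF that] pO1]]
    have "(be i has_derivative (\<lambda>z. (f (k (c p)) \<bullet> snd i) * frechet_derivative (n i) (at (c p)) z +
        (frechet_derivative f (at (b0, 0)) (frechet_derivative k (at (c p)) z) \<bullet> snd i) * n i (c p))) (at (c p))"
      unfolding be_def .
    from fun_cong[OF frechet_derivative_at[OF this], of u] show ?thesis using Dku \<eta>(2) w0 by simp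
  qed
  obtain T2 where T2: "open T2" "{x \<in> c ` U1. inv_into U1 c x \<in> N \<inter> C.P} = c ` U1 \<inter> T2"
    by (rule continuous_map_openin_preimage[OF chartedD(4)[OF E.charted_total c(1)] openin_Int[OF E.open_N C.open_P]])
      (rule that; assumption)
  obtain T3 where T3: "open T3" "c ` U1 = V \<inter> T3" using V(2) by (auto simp: openin_open)
  \<comment> \<open>Points of \<open>V\<close> in \<open>O2\<close> are chart images of points of
    \<open>N\<close> inside the bundle chart, where the quadratic expansion is valid.\<close>
  define O2 where "O2 = O1 \<inter> T2 \<inter> T3"
  have O2O1: "O2 \<subseteq> O1" by (auto simp: O2_def)
  have openO2: "open O2" unfolding O2_def using openO1 T2(1) T3(1) by (intro open_Int)
  have cpV: "c p \<in> V \<inter> T3" unfolding T3(2)[symmetric] using c(2) by simp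
  have "c p \<in> c ` U1 \<inter> T2" unfolding T2(2)[symmetric] using c(2) pN pP inj by simp
  then have pO2: "c p \<in> O2" using pO1 cpV by (simp add: O2_def)
  have "deriv (\<lambda>s. deriv (\<lambda>t. ((\<lambda>e. (fnorm ip' (\<phi> e))\<^sup>2) \<circ> inv_into (U1 \<inter> N) c) (c p + s *\<^sub>R u + t *\<^sub>R v)) 0) 0 = 0"
  proof (rule iterated_deriv_zero[OF openO2 pO2, where I = "Fr \<times> Fr" and \<alpha> = al and \<beta> = be])
    show "smooth_on O2 (al i)" "smooth_on O2 (be i)" if "i \<in> Fr \<times> Fr" for i
      by (rule smooth_on_subset[OF sal O2O1], rule smooth_on_subset[OF sbe[OF that] O2O1])
    show "al i (c p) = 0" "be i (c p) = 0" for i by (simp_all add: al_def be_def w0)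
    show "frechet_derivative (al i) (at (c p)) u = 0" for i by (rule Dal)
    show "frechet_derivative (be i) (at (c p)) u = 0" if "i \<in> Fr \<times> Fr" for i by (rule Dbe[OF that])
    fix s t assume st: "c p + s *\<^sub>R u + t *\<^sub>R v \<in> O2"
    let ?x = "c p + s *\<^sub>R u + t *\<^sub>R v"
    have "?x \<in> V" using cpV uX v(1) spanV by (intro subspace_add[OF V(1)] subspace_scale[OF V(1)]) auto
    then have "?x \<in> V \<inter> T3" using st by (simp add: O2_def)
    then have "?x \<in> c ` U1 \<inter> T2" unfolding T3(2)[symmetric] using st by (simp add: O2_def)
    then have x1: "?x \<in> c ` U1" "inv_into U1 c ?x \<in> N" "inv_into U1 c ?x \<in> C.P" unfolding T2(2)[symmetric] by simp_all
    then obtain q where q: "q \<in> U1" "?x = c q" by blast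
    then have q2: "q \<in> N" "q \<in> C.P" using x1 inj by (simp_all add: inv_into_f_f)
    have iq: "inv_into (U1 \<inter> N) c ?x = q" unfolding q(2) by (rule inv_into_f_f[OF inj_on_subset[OF inj]]) (use q q2 in auto)
    have xO1: "c q \<in> O1" using st unfolding q(2) O2_def by simp
    have kq: "k (c q) = C.\<Theta> q" by (rule kp'[OF q(1) q2(2)]) (use xO1 in \<open>simp add: O1_def\<close>)
    have Qk: "Q (k (c q)) = C.\<Theta> q" unfolding kq by (rule Q(3)[OF VbW[OF C.\<Theta>_in[OF q2(2)]]])
    have yA: "C.\<Theta> q \<in> A" using xO1 Qk by (simp add: O1_def A1_def)
    have \<phi>q: "\<phi> q = \<Psi>' (F (C.\<Theta> q))" using F_in(2)[OF yA] C.\<Psi>_\<Theta>[OF q2(2)] by simp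
    have split: "F (C.\<Theta> q) = (fst (F (Q (k (c q)))), f (k (c q)))" by (simp add: f_def Qk)
    have "(fnorm ip' (\<phi> q))\<^sup>2 = ip' (\<phi> q) (\<phi> q)" by (rule E'.norm(4)[OF \<phi>_points[OF q2(1)]])
    also have "\<dots> = (\<Sum>u\<in>Fr. \<Sum>u'\<in>Fr. al (u, u') (c q) * be (u, u') (c q))"
      unfolding \<phi>q split Fr(3)[OF yB[OF xO1] yB(2)[OF xO1]] by (simp add: al_def be_def n_def mult.assoc)
    also have "\<dots> = (\<Sum>i\<in>Fr \<times> Fr. al i (c q) * be i (c q))"
      by (simp add: sum.cartesian_product split_beta)
    finally show "((\<lambda>e. (fnorm ip' (\<phi> e))\<^sup>2) \<circ> inv_into (U1 \<inter> N) c) ?x = (\<Sum>i\<in>Fr \<times> Fr. al i ?x * be i ?x)"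
      unfolding o_def iq unfolding q(2) .
  qed
  then show False using v(2) by (simp add: hessian_in_chart_def)
qed

end

section \<open>The local form of the lift\<close>

context local_representative
begin

context
  assumes hess: "hessian_nondegenerate_on_normal_bundle (open_submfd (total E) N) (zero_section E) (\<lambda>e. (fnorm ip' (\<phi> e))\<^sup>2)"
begin

text \<open>An injective linear map on \<open>W\<close> is bounded below by some factor
  \<open>m > 0\<close>. Where the derivative differs from it by at most \<open>m / 2\<close>, the
  mean value inequality keeps \<open>f\<close> injective in the fibre direction.\<close>

lemma fibrewise_injective:
  obtains r where "r > 0" "ball (b0, 0) r \<subseteq> A1"
    "\<And>b \<eta> \<xi>. \<eta> \<in> W \<Longrightarrow> \<xi> \<in> W \<Longrightarrow> (b, \<eta>) \<in> ball (b0, 0) r \<Longrightarrow> (b, \<xi>) \<in> ball (b0, 0) r \<Longrightarrow> f (b, \<eta>) = f (b, \<xi>) \<Longrightarrow> \<eta> = \<xi>"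
proof -
  define D where "D = frechet_derivative f (at (b0, 0))"
  have linD: "linear D" unfolding D_def using has_derivative_linear[OF f_derivative[OF zero_in_A1]] .
  have blD: "bounded_linear (\<lambda>\<eta>. D (0, \<eta>))"
  proof -
    have "linear (\<lambda>\<eta>. D (0, \<eta>))"
      using linear_add[OF linD, of "(0, _)" "(0, _)"] linear_scale[OF linD, of _ "(0, _)"] by (intro linearI) simp_all
    then show ?thesis by (simp add: linear_linear)
  qed
  have "\<forall>\<eta>\<in>W. D (0, \<eta>) = 0 \<longrightarrow> \<eta> = 0"
    unfolding D_def using vertical_derivative_injective[OF hess] by blast
  from injective_imp_isometric[OF closed_subspace[OF C.subspace_W] C.subspace_W blD this]
  obtain m where m: "m > 0" "\<forall>\<eta>\<in>W. m * norm \<eta> \<le> norm (D (0, \<eta>))" by blast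
  have lin: "linear (frechet_derivative f (at y))" if "y \<in> A1" for y
    using has_derivative_linear[OF f_derivative[OF that]] .
  have cont: "continuous_on A1 (\<lambda>y. frechet_derivative f (at y) v)" for v
    by (rule smooth_on_imp_continuous_on[OF smooth_on_frechet_derivative[OF open_A1 smooth_f]])
  have m2: "m / 2 > 0" using m by simp
  obtain r where r: "r > 0" "ball (b0, 0) r \<subseteq> A1"
    "\<And>y v. y \<in> ball (b0, 0) r \<Longrightarrow> norm (frechet_derivative f (at y) v - frechet_derivative f (at (b0, 0)) v) \<le> m / 2 * norm v"
    by (rule continuous_linear_family[OF open_A1 zero_in_A1 cont _ m2], erule lin) (rule that; assumption)
  show ?thesis
  proof (rule that[OF r(1,2)])
    fix b \<eta> \<xi> assume h: "\<eta> \<in> W" "\<xi> \<in> W" "(b, \<eta>) \<in> ball (b0, 0) r" "(b, \<xi>) \<in> ball (b0, 0) r" "f (b, \<eta>) = f (b, \<xi>)"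
    have "norm (f (b, \<eta>) - f (b, \<xi>) - D ((b, \<eta>) - (b, \<xi>))) \<le> m / 2 * norm ((b, \<eta>) - (b, \<xi>))"
    proof (rule norm_diff_le_of_derivative_close[OF convex_ball _ linD _ h(3,4)])
      show "(f has_derivative frechet_derivative f (at y)) (at y)" if "y \<in> ball (b0, 0) r" for y
        by (rule f_derivative) (use that r(2) in blast)
      show "norm (frechet_derivative f (at y) v - D v) \<le> m / 2 * norm v" if "y \<in> ball (b0, 0) r" for y v
        unfolding D_def by (rule r(3)[OF that])
    qed
    then have "norm (D (0, \<eta> - \<xi>)) \<le> m / 2 * norm (\<eta> - \<xi>)" using h(5) by (simp add: norm_Pair)
    moreover have "m * norm (\<eta> - \<xi>) \<le> norm (D (0, \<eta> - \<xi>))" using m(2) subspace_diff[OF C.subspace_W h(1,2)] by blast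
    ultimately have "m / 2 * norm (\<eta> - \<xi>) \<le> 0" by (simp add: field_simps)
    then show "\<eta> = \<xi>" using m(1) by (simp add: mult_le_0_iff)
  qed
qed

text \<open>Compactness of a ball of base points times the unit sphere of \<open>W\<close>. It links
  the chart norm, in which the calculus is done, with the invariant length given by
  \<open>ip\<close>.\<close>

lemma norm_comparison:
  obtains r m M where "r > 0" "m > 0" "M > 0"
    "\<And>b \<eta>. b \<in> Bs \<Longrightarrow> \<eta> \<in> W \<Longrightarrow> dist b0 b \<le> r \<Longrightarrow> m * (norm \<eta>)\<^sup>2 \<le> ip (\<Psi> (b, \<eta>)) (\<Psi> (b, \<eta>)) \<and> ip (\<Psi> (b, \<eta>)) (\<Psi> (b, \<eta>)) \<le> M * (norm \<eta>)\<^sup>2"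
proof -
  define q where "q y = ip (\<Psi> y) (\<Psi> y)" for y
  have smq: "smooth_on (Bs \<times> W) q" unfolding q_def[abs_def] by (rule C.smooth_on_ip[OF E.ip])
  obtain O1 where O1: "open O1" "Bs = Vb \<inter> O1" using C.open_Bs by (auto simp: openin_open)
  have "b0 \<in> O1" using b0 O1(2) by simp
  then obtain r where r: "r > 0" "cball b0 r \<subseteq> O1" using O1(1) open_contains_cball_eq by metis
  define K where "K = (Vb \<inter> cball b0 r) \<times> (W \<inter> sphere 0 1)"
  have KBW: "K \<subseteq> Bs \<times> W" using r(2) O1(2) by (auto simp: K_def)
  have "compact (Vb \<inter> cball b0 r)" "compact (W \<inter> sphere 0 1)"
    using closed_subspace[OF C.subspace_Vb] closed_subspace[OF C.subspace_W] by (auto intro: closed_Int_compact)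
  then have K: "compact K" unfolding K_def by (rule compact_Times)
  have cq: "continuous_on K q" by (rule continuous_on_subset[OF smooth_on_imp_continuous_on[OF smq] KBW])
  have qp: "0 < q y" if "y \<in> K" for y
  proof -
    have "fst y \<in> Bs" "snd y \<in> W" "snd y \<noteq> 0" using that KBW by (auto simp: K_def)
    then show ?thesis using C.ip_pos[OF E.ip, of "fst y" "snd y"] by (simp add: q_def)
  qed
  have "\<exists>m M. m > 0 \<and> M > 0 \<and> (\<forall>y\<in>K. m \<le> q y \<and> q y \<le> M)"
  proof (cases "K = {}")
    case True
    then show ?thesis by (intro exI[of _ 1]) simp
  next
    case False
    obtain y1 y2 where "y1 \<in> K" "\<forall>y\<in>K. q y1 \<le> q y" "y2 \<in> K" "\<forall>y\<in>K. q y \<le> q y2"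
      using continuous_attains_inf[OF K False cq] continuous_attains_sup[OF K False cq] by blast
    then show ?thesis using qp by (intro exI[of _ "q y1"] exI[of _ "q y2"]) simp
  qed
  then obtain m M where mM: "m > 0" "M > 0" "\<forall>y\<in>K. m \<le> q y \<and> q y \<le> M" by blast
  have "m * (norm \<eta>)\<^sup>2 \<le> q (b, \<eta>) \<and> q (b, \<eta>) \<le> M * (norm \<eta>)\<^sup>2" if h: "b \<in> Bs" "\<eta> \<in> W" "dist b0 b \<le> r" for b \<eta>
  proof (cases "\<eta> = 0")
    case True
    then show ?thesis using C.ip_scale2[OF E.ip h(1) C.zero_in_W, of 0] by (simp add: q_def)
  next
    case False
    define \<xi> where "\<xi> = (1 / norm \<eta>) *\<^sub>R \<eta>"
    have \<xi>: "\<xi> \<in> W" "norm \<xi> = 1" using h(2) False subspace_scale[OF C.subspace_W] by (auto simp: \<xi>_def)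
    have "b \<in> Vb" using h(1) O1(2) by simp
    then have "(b, \<xi>) \<in> K" using \<xi> h(3) by (simp add: K_def)
    then have "m \<le> q (b, \<xi>)" "q (b, \<xi>) \<le> M" using mM(3) by blast+
    moreover have "q (b, \<eta>) = (norm \<eta>)\<^sup>2 * q (b, \<xi>)"
      using C.ip_scale2[OF E.ip h(1) \<xi>(1), of "norm \<eta>"] False by (simp add: q_def \<xi>_def)
    ultimately show ?thesis by (auto intro!: mult_right_mono simp: mult.commute[of "(norm \<eta>)\<^sup>2"])
  qed
  then show ?thesis unfolding q_def by (rule that[OF r(1) mM(1,2)])
qed

text \<open>The orbit of a small vector stays in the ball on which \<open>f\<close> is fibrewise
  injective. So \<open>\<phi> (\<rho> g e) = \<phi> e\<close> forces \<open>\<rho> g e = e\<close>,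
  which is the assumption of \<open>\<phi>_antipodal\<close>.\<close>

lemma antipodal_F:
  obtains d where "d > 0"
    "\<And>b \<eta>. b \<in> Bs \<Longrightarrow> \<eta> \<in> W \<Longrightarrow> dist b0 b < d \<Longrightarrow> norm \<eta> < d \<Longrightarrow>
      (b, \<eta>) \<in> A \<and> (b, - \<eta>) \<in> A \<and> F (b, - \<eta>) = (fst (F (b, \<eta>)), - snd (F (b, \<eta>)))"
proof -
  obtain r where r: "r > 0" "ball (b0, 0) r \<subseteq> A1"
    "\<And>b \<eta> \<xi>. \<eta> \<in> W \<Longrightarrow> \<xi> \<in> W \<Longrightarrow> (b, \<eta>) \<in> ball (b0, 0) r \<Longrightarrow> (b, \<xi>) \<in> ball (b0, 0) r \<Longrightarrow> f (b, \<eta>) = f (b, \<xi>) \<Longrightarrow> \<eta> = \<xi>"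
    by (rule fibrewise_injective) (rule that; assumption)
  obtain r1 m M where c: "r1 > 0" "m > 0" "M > 0"
    "\<And>b \<eta>. b \<in> Bs \<Longrightarrow> \<eta> \<in> W \<Longrightarrow> dist b0 b \<le> r1 \<Longrightarrow> m * (norm \<eta>)\<^sup>2 \<le> ip (\<Psi> (b, \<eta>)) (\<Psi> (b, \<eta>)) \<and> ip (\<Psi> (b, \<eta>)) (\<Psi> (b, \<eta>)) \<le> M * (norm \<eta>)\<^sup>2"
    by (rule norm_comparison) (rule that; assumption)
  \<comment> \<open>The \<open>ip\<close>-length is constant on an orbit, so the chart norm grows by
    at most this factor; \<open>d\<close> is chosen small enough to absorb it.\<close>
  define k where "k = sqrt (M / m)"
  have k: "k > 0" using c by (simp add: k_def)
  define d where "d = min (min (r / 2) r1) (r / (2 * k))"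
  have d: "d > 0" "d \<le> r / 2" "d \<le> r1" using r(1) c(1) k
    by (simp_all add: d_def)
  have "d \<le> r / (2 * k)" by (simp add: d_def)
  then have kd: "k * d \<le> r / 2" using k by (simp add: field_simps)
  have inball: "(b, \<eta>) \<in> ball (b0, 0) r" if "dist b0 b < d" "norm \<eta> < r / 2" for b \<eta>
  proof -
    have "dist (b0, 0) (b, \<eta>) \<le> dist b0 b + norm \<eta>"
      unfolding dist_norm using norm_Pair_le[of "b0 - b" "0 - \<eta>"] by simp
    then show ?thesis using that d(2) by simp
  qed
  have inA: "(b, \<eta>) \<in> A" if "b \<in> Bs" "\<eta> \<in> W" "(b, \<eta>) \<in> ball (b0, 0) r" for b \<eta>
  proof -
    have "(b, \<eta>) \<in> A1" using r(2) that(3) by blast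
    then show ?thesis using Q(3)[OF VbW[of "(b, \<eta>)"]] that(1,2) by (simp add: A1_def)
  qed
  show ?thesis
  proof (rule that[OF d(1)])
    fix b \<eta> assume h: "b \<in> Bs" "\<eta> \<in> W" "dist b0 b < d" "norm \<eta> < d"
    have n\<eta>: "- \<eta> \<in> W" using subspace_neg[OF C.subspace_W h(2)] .
    have bl: "(b, \<eta>) \<in> ball (b0, 0) r" "(b, - \<eta>) \<in> ball (b0, 0) r"
      using inball[OF h(3), of \<eta>] inball[OF h(3), of "- \<eta>"] order_less_le_trans[OF h(4) d(2)] by simp_all
    have yA: "(b, \<eta>) \<in> A" "(b, - \<eta>) \<in> A" using inA[OF h(1,2) bl(1)] inA[OF h(1) n\<eta> bl(2)] by simp_all
    have "F (b, - \<eta>) = (fst (F (b, \<eta>)), - snd (F (b, \<eta>)))"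
    proof (cases "\<eta> = 0")
      case True
      then show ?thesis using F_zero_iff[OF yA(1)] by (simp add: prod_eq_iff)
    next
      case False
      define e where "e = \<Psi> (b, \<eta>)"
      have e: "e \<in> N" "e \<notin> zero_section E" using A_sub(2)[OF yA(1)] C.\<Psi>_zero_section_iff[OF h(1,2)] False by (simp_all add: e_def)
      have ep: "e \<in> points (total E)" using e(1) E.N_points by blast
      have "\<phi> (vscale E (-1) e) = vscale E' (-1) (\<phi> e)"
      proof (rule \<phi>_antipodal[OF e])
        fix g assume g: "g \<in> carrier G" "\<phi> (\<rho> g e) = \<phi> e"
        have "\<rho> g e \<in> fibre E (\<gamma> b)"
          using E.action_points[OF g(1) ep] E.action_fibre[OF g(1) ep] C.\<Psi>(2)[OF h(1,2)] by (simp add: fibre_def e_def)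
        from C.fibre_\<Psi>[OF h(1) this] obtain \<xi> where \<xi>: "\<xi> \<in> W" "\<rho> g e = \<Psi> (b, \<xi>)" by blast
        have bd: "dist b0 b \<le> r1" using h(3) d(3) by simp
        have "ip (\<rho> g e) (\<rho> g e) = ip e e"
          using E.norm(4)[OF ep] E.norm(4)[OF E.action_points[OF g(1) ep]] E.action_norm[OF g(1) ep] by simp
        then have "m * (norm \<xi>)\<^sup>2 \<le> M * (norm \<eta>)\<^sup>2"
          using c(4)[OF h(1) \<xi>(1) bd] c(4)[OF h(1,2) bd] \<xi>(2) by (simp add: e_def)
        then have "(norm \<xi>)\<^sup>2 \<le> (M / m) * (norm \<eta>)\<^sup>2" using c(2) by (simp add: field_simps)
        also have "\<dots> = (k * norm \<eta>)\<^sup>2" using c(2,3) by (simp add: k_def power_mult_distrib)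
        finally have "norm \<xi> \<le> k * norm \<eta>" by (rule power2_le_imp_le) (use k in simp)
        also have "\<dots> < k * d" using k h(4) by simp
        finally have "norm \<xi> < r / 2" using kd by simp
        then have bl': "(b, \<xi>) \<in> ball (b0, 0) r" by (rule inball[OF h(3)])
        have "F (b, \<xi>) = F (b, \<eta>)" using g(2) \<xi>(2) by (simp add: F_def e_def)
        then have "f (b, \<eta>) = f (b, \<xi>)"
          using Q(3)[OF VbW[of "(b, \<eta>)"]] Q(3)[OF VbW[of "(b, \<xi>)"]] h(1,2) \<xi>(1) by (simp add: f_def)
        then have "\<eta> = \<xi>" by (rule r(3)[OF h(2) \<xi>(1) bl(1) bl'])
        then show "\<rho> g e = e" using \<xi>(2) by (simp add: e_def)
      qed
      moreover have "vscale E (-1) e = \<Psi> (b, - \<eta>)" unfolding e_def using C.vscale_\<Psi>[OF h(1,2), of "-1"] by simp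
      ultimately have "F (b, - \<eta>) = C'.\<Theta> (vscale E' (-1) (\<phi> (\<Psi> (b, \<eta>))))" by (simp add: F_def e_def)
      then show ?thesis using C'.vscale_\<Theta>(2)[OF A_sub(3)[OF yA(1)], of "-1"] by (simp add: F_def)
    qed
    then show "(b, \<eta>) \<in> A \<and> (b, - \<eta>) \<in> A \<and> F (b, - \<eta>) = (fst (F (b, \<eta>)), - snd (F (b, \<eta>)))" using yA by blast
  qed
qed

text \<open>In the fibre direction \<open>\<phi>\<close> is even in the base coordinate and odd in the fibre coordinate, so that
  \<open>\<phi> (t * e) / t\<close> is a smooth function of \<open>t\<^sup>2\<close>.\<close>

lemma local_lift:
  assumes \<eta>0: "\<eta>0 \<in> W" "\<eta>0 \<noteq> 0"
  obtains Z r \<omega> where "open Z" "(b0, \<eta>0) \<in> Z" "r > 0"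
    "smooth_into ((Z \<inter> (Bs \<times> W)) \<times> {0..<r}) (total E') \<omega>"
    "\<And>y s. y \<in> Z \<inter> (Bs \<times> W) \<Longrightarrow> 0 \<le> s \<Longrightarrow> s < r \<Longrightarrow> \<omega> (y, s) \<notin> zero_section E' \<and>
      \<Psi> (fst y, sqrt s *\<^sub>R snd y) \<in> N \<and> vscale E' (sqrt s) (\<omega> (y, s)) = \<phi> (\<Psi> (fst y, sqrt s *\<^sub>R snd y))"
proof -
  obtain d where d: "d > 0"
    "\<And>b \<eta>. b \<in> Bs \<Longrightarrow> \<eta> \<in> W \<Longrightarrow> dist b0 b < d \<Longrightarrow> norm \<eta> < d \<Longrightarrow>
      (b, \<eta>) \<in> A \<and> (b, - \<eta>) \<in> A \<and> F (b, - \<eta>) = (fst (F (b, \<eta>)), - snd (F (b, \<eta>)))"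
    by (rule antipodal_F) (rule that; assumption)
  obtain O1 where O1: "open O1" "Bs = Vb \<inter> O1" using C.open_Bs by (auto simp: openin_open)
  \<comment> \<open>The projections extend the small region supplied by \<open>antipodal_F\<close>
    to an open subset of the ambient Euclidean space.\<close>
  define R where "R = {y :: 'b \<times> 'a. Qb (fst y) \<in> O1 \<and> dist b0 (Qb (fst y)) < d \<and> norm (Qw (snd y)) < d}"
  have cQb: "continuous_on UNIV Qb" and cQw: "continuous_on UNIV Qw"
    using Qb(1) Qw(1) linear_continuous_on linear_linear by blast+
  have cf: "continuous_on UNIV (\<lambda>y :: 'b \<times> 'a. Qb (fst y))" and cs: "continuous_on UNIV (\<lambda>y :: 'b \<times> 'a. Qw (snd y))"
    by (rule continuous_on_compose2[OF cQb], auto intro!: continuous_intros,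
        rule continuous_on_compose2[OF cQw], auto intro!: continuous_intros)
  have openR: "open R"
  proof -
    have "R = (\<lambda>y. Qb (fst y)) -` (O1 \<inter> ball b0 d) \<inter> (\<lambda>y. Qw (snd y)) -` ball 0 d"
      by (auto simp: R_def)
    then show ?thesis
      using O1(1) cf cs by (simp only:) (intro open_Int open_vimage open_ball; assumption)
  qed
  have RA: "Q y \<in> A" "Q (fst y, - snd y) \<in> A" "F (Q (fst y, - snd y)) = (fst (F (Q y)), - snd (F (Q y)))" if "y \<in> R" for y
  proof -
    have "Qb (fst y) \<in> Bs" "Qw (snd y) \<in> W" using that Qb(2) Qw(2) O1(2) by (auto simp: R_def)
    from d(2)[OF this] that
    have "(Qb (fst y), Qw (snd y)) \<in> A \<and> (Qb (fst y), - Qw (snd y)) \<in> A \<and>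
      F (Qb (fst y), - Qw (snd y)) = (fst (F (Qb (fst y), Qw (snd y))), - snd (F (Qb (fst y), Qw (snd y))))"
      by (simp add: R_def)
    then show "Q y \<in> A" "Q (fst y, - snd y) \<in> A" "F (Q (fst y, - snd y)) = (fst (F (Q y)), - snd (F (Q y)))"
      by (simp_all add: Q_def linear_neg[OF Qw(1)])
  qed
  \<comment> \<open>Scaling of the fibre coordinate by \<open>t\<close>, with both signs of
    \<open>t\<close> allowed so that parity can be expressed.\<close>
  define m where "m x = (fst (fst x), snd x *\<^sub>R snd (fst x))" for x :: "('b \<times> 'a) \<times> real"
  have smm: "smooth_on X m" for X unfolding m_def by (intro smooth_on_intros)
  have "open (m -` R)" by (rule open_vimage[OF openR smooth_on_imp_continuous_on[OF smm]])
  moreover have "((b0, \<eta>0), 0) \<in> m -` R"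
  proof -
    have "b0 \<in> Vb" "b0 \<in> O1" using b0 O1(2) by simp_all
    then show ?thesis using Qb(3) d(1) linear_0[OF Qw(1)] by (simp add: m_def R_def)
  qed
  ultimately obtain Z0 T where ZT: "open Z0" "open T" "(b0, \<eta>0) \<in> Z0" "0 \<in> T" "Z0 \<times> T \<subseteq> m -` R"
    by (rule open_prod_elim) blast
  obtain d1 where d1: "d1 > 0" "ball 0 d1 \<subseteq> T" using ZT(2,4) open_contains_ball by blast
  have mR: "m (y, t) \<in> R" if "y \<in> Z0" "t \<in> {-d1<..<d1}" for y t
  proof -
    have "t \<in> T" using d1(2) that(2) by (auto simp: dist_norm)
    then have "(y, t) \<in> m -` R" using ZT(5) that(1) by blast
    then show ?thesis by simp
  qed
  define J where "J = Z0 \<times> {-d1<..<d1}"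
  have openJ: "open J" unfolding J_def by (intro open_Times ZT(1)) auto
  have sF: "smooth_on J (\<lambda>x. F (Q (m x)))"
  proof (rule smooth_on_compose'[OF smooth_F1 smm])
    fix x assume "x \<in> J"
    then show "m x \<in> A1" using RA(1)[OF mR[of "fst x" "snd x"]] by (simp add: J_def A1_def mem_Times_iff)
  qed
  have f1: "smooth_on (Z0 \<times> {-d1<..<d1}) (\<lambda>x. fst (F (Q (m x))))"
    and f2: "smooth_on (Z0 \<times> {-d1<..<d1}) (\<lambda>x. snd (F (Q (m x))))"
    using smooth_on_fst[OF sF] smooth_on_snd[OF sF] by (simp_all add: J_def)
  have par: "F (Q (m (y, - t))) = (fst (F (Q (m (y, t)))), - snd (F (Q (m (y, t)))))" if "y \<in> Z0" "t \<in> {-d1<..<d1}" for y t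
    using RA(3)[OF mR[OF that]] by (simp add: m_def)
  have f20: "snd (F (Q (m (y, 0)))) = 0" if "y \<in> Z0" for y
  proof -
    have "Q (m (y, 0)) \<in> A" using RA(1)[OF mR[OF that]] d1(1) by simp
    moreover have "snd (Q (m (y, 0))) = 0" by (simp add: Q_def m_def linear_0[OF Qw(1)])
    ultimately show ?thesis using F_zero_iff by blast
  qed
  \<comment> \<open>The fibre component vanishes at \<open>t = 0\<close> and is odd in
    \<open>t\<close>, so Hadamard's lemma gives a quotient \<open>h\<close> that is even.\<close>
  obtain h where h: "smooth_on (Z0 \<times> {-d1<..<d1}) h"
    "\<And>y t. y \<in> Z0 \<Longrightarrow> t \<in> {-d1<..<d1} \<Longrightarrow> snd (F (Q (m (y, t)))) = t *\<^sub>R h (y, t)"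
    by (rule smooth_on_divide_coordinate[OF ZT(1) f2 f20], assumption) (rule that; assumption)
  have hev: "h (y, - t) = h (y, t)" if "y \<in> Z0" "t \<in> {-d1<..<d1}" for y t
  proof (cases "t = 0")
    case False
    have "- t \<in> {-d1<..<d1}" using that(2) by auto
    from h(2)[OF that(1) this] h(2)[OF that] par[OF that] have "t *\<^sub>R h (y, - t) = t *\<^sub>R h (y, t)" by auto
    then show ?thesis using False by simp
  qed simp
  have conth: "((\<lambda>t. h (y, t)) \<longlongrightarrow> h (y, 0)) (at_right 0)" if "y \<in> Z0" for y
  proof -
    have "isCont h (y, 0)" using smooth_on_imp_continuous_on[OF h(1)] openJ that d1(1)
      by (simp add: continuous_on_eq_continuous_at J_def)
    then show ?thesis by (rule isCont_tendsto_compose) (auto intro!: tendsto_eq_intros)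
  qed
  have evd1: "\<forall>\<^sub>F t in at_right 0. t \<in> {0<..<d1}" by (rule eventually_at_right_real[OF d1(1)])
  \<comment> \<open>At \<open>t = 0\<close> the quotient is the vertical derivative of
    \<open>f\<close>; the Hessian condition keeps it from vanishing.\<close>
  have h00: "h ((b0, \<eta>0), 0) = frechet_derivative f (at (b0, 0)) (0, \<eta>0)"
  proof (rule tendsto_unique[OF _ conth[OF ZT(3)]])
    have "\<forall>\<^sub>F t in at_right 0. (f ((b0, 0) + t *\<^sub>R (0, \<eta>0)) - f (b0, 0)) /\<^sub>R t = h ((b0, \<eta>0), t)"
      using evd1
    proof eventually_elim
      case (elim t)
      then show ?case using h(2)[OF ZT(3), of t] by (simp add: f_zero) (simp add: f_def m_def)
    qed
    with has_derivative_directional[OF f_derivative[OF zero_in_A1], of "(0, \<eta>0)"]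
    show "((\<lambda>t. h ((b0, \<eta>0), t)) \<longlongrightarrow> frechet_derivative f (at (b0, 0)) (0, \<eta>0)) (at_right 0)"
      by (rule Lim_transform_eventually)
  qed simp
  have h0: "h ((b0, \<eta>0), 0) \<noteq> 0" unfolding h00 using vertical_derivative_injective[OF hess \<eta>0(1)] \<eta>0(2) by blast
  have "open (J \<inter> h -` (- {0}))"
    using smooth_on_imp_continuous_on[OF h(1)] openJ
    by (metis Int_commute J_def continuous_on_open_vimage open_Compl closed_singleton)
  moreover have "((b0, \<eta>0), 0) \<in> J \<inter> h -` (- {0})" using h0 ZT(3) d1(1) by (simp add: J_def)
  ultimately obtain Z T2 where Z: "open Z" "open T2" "(b0, \<eta>0) \<in> Z" "0 \<in> T2" "Z \<times> T2 \<subseteq> J \<inter> h -` (- {0})"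
    by (rule open_prod_elim) blast
  obtain d2 where d2: "d2 > 0" "ball 0 d2 \<subseteq> T2" using Z(2,4) open_contains_ball by blast
  have ZJ: "(y, t) \<in> J \<and> h (y, t) \<noteq> 0" if "y \<in> Z" "\<bar>t\<bar> < d2" for y t
  proof -
    have "t \<in> T2" using d2(2) that(2) by (auto simp: dist_norm)
    then have "(y, t) \<in> J \<inter> h -` (- {0})" using Z(5) that(1) by blast
    then show ?thesis by simp
  qed
  have ZZ0: "y \<in> Z0" if "y \<in> Z" for y using ZJ[OF that, of 0] d2(1) by (simp add: J_def)
  \<comment> \<open>The first bound is the range of the theorem on even functions, the second keeps
    \<open>sqrt s\<close> where \<open>h\<close> has no zeros.\<close>
  define r where "r = min ((d1 / 2)\<^sup>2) (d2\<^sup>2)"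
  have r: "r > 0" using d1(1) d2(1) by (simp add: r_def)
  have sq: "sqrt s \<in> {-d1<..<d1}" "\<bar>sqrt s\<bar> < d2" if "0 \<le> s" "s < r" for s
  proof -
    have "sqrt s < d1 / 2" "sqrt s < d2"
      using that d1(1) d2(1) by - (rule real_less_lsqrt, simp_all add: r_def)+
    then show "sqrt s \<in> {-d1<..<d1}" "\<bar>sqrt s\<bar> < d2" using d1(1) that(1) by (auto simp: order_less_le_trans[of "- d1" 0])
  qed
  define Y where "Y x = (fst (F (Q (m (fst x, sqrt (snd x))))), h (fst x, sqrt (snd x)))" for x :: "('b \<times> 'a) \<times> real"
  define X where "X = (Z \<inter> (Bs \<times> W)) \<times> {0..<r}"
  have XZ: "X \<subseteq> Z0 \<times> {0..<(d1 / 2)\<^sup>2}" using ZZ0 by (auto simp: X_def r_def)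
  have smY: "smooth_on X Y"
    unfolding Y_def
  proof (rule smooth_on_Pair)
    show "smooth_on X (\<lambda>x. fst (F (Q (m (fst x, sqrt (snd x))))))"
      by (rule smooth_on_subset[OF smooth_on_even_sqrt[OF ZT(1) d1(1) f1] XZ]) (simp add: par)
    show "smooth_on X (\<lambda>x. h (fst x, sqrt (snd x)))"
      by (rule smooth_on_subset[OF smooth_on_even_sqrt[OF ZT(1) d1(1) h(1)] XZ]) (rule hev)
  qed
  have QAm: "Q (m (y, t)) = m (y, t)" "m (y, t) \<in> A" if y: "y \<in> Z \<inter> (Bs \<times> W)" and t: "t \<in> {-d1<..<d1}" for y t
  proof -
    have "m (y, t) \<in> Bs \<times> W" using y subspace_scale[OF C.subspace_W] by (auto simp: m_def mem_Times_iff)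
    then show *: "Q (m (y, t)) = m (y, t)" by (rule Q(3)[OF VbW])
    show "m (y, t) \<in> A" using RA(1)[OF mR[OF ZZ0[of y] t]] y * by simp
  qed
  have YW: "Y (y, s) \<in> Bs' \<times> W'" if y: "y \<in> Z \<inter> (Bs \<times> W)" and s: "0 \<le> s" "s < r" for y s
  proof -
    have yZ: "y \<in> Z0" using ZZ0 y by blast
    have hW: "h (y, t) \<in> W'" if t: "t \<in> {0<..<d1}" for t
    proof -
      have t': "t \<in> {-d1<..<d1}" using t d1(1) by auto
      have "snd (F (Q (m (y, t)))) \<in> W'" using F_in(1)[OF QAm(2)[OF y t']] QAm(1)[OF y t'] by (simp add: mem_Times_iff)
      then have "(1 / t) *\<^sub>R (t *\<^sub>R h (y, t)) \<in> W'" unfolding h(2)[OF yZ t'] by (rule subspace_scale[OF C'.subspace_W])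
      then show ?thesis using t by simp
    qed
    \<comment> \<open>For \<open>t > 0\<close> one can divide by \<open>t\<close> inside
      \<open>W'\<close>; at \<open>t = 0\<close> membership follows because subspaces are
      closed.\<close>
    have "h (y, 0) \<in> W'"
      by (rule tendsto_at_right_in_closed[OF conth[OF yZ] closed_subspace[OF C'.subspace_W]])
        (rule eventually_mono[OF evd1], rule hW)
    then have "h (y, sqrt s) \<in> W'" using hW[of "sqrt s"] sq(1)[OF s] s(1) by (cases "s = 0") auto
    moreover have "fst (F (Q (m (y, sqrt s)))) \<in> Bs'"
      using F_in(1)[OF QAm(2)[OF y sq(1)[OF s]]] QAm(1)[OF y sq(1)[OF s]] by (simp add: mem_Times_iff)
    ultimately show ?thesis by (simp add: Y_def)
  qed
  show ?thesis
  proof (rule that[OF Z(1,3) r, of "\<lambda>x. \<Psi>' (Y x)"])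
    show "smooth_into ((Z \<inter> (Bs \<times> W)) \<times> {0..<r}) (total E') (\<lambda>x. \<Psi>' (Y x))"
      by (rule smooth_into_compose_smooth_on[OF C'.smooth_\<Psi> smY[unfolded X_def]]) (use YW in auto)
    fix y s assume y: "y \<in> Z \<inter> (Bs \<times> W)" and s: "0 \<le> s" "s < r"
    note t = sq[OF s]
    have Ys: "Y (y, s) = (fst (F (m (y, sqrt s))), h (y, sqrt s))" using QAm(1)[OF y t(1)] by (simp add: Y_def)
    have YB: "fst (F (m (y, sqrt s))) \<in> Bs'" "h (y, sqrt s) \<in> W'" using YW[OF y s] by (simp_all add: Ys)
    have "h (y, sqrt s) \<noteq> 0" using ZJ[of y "sqrt s"] y t(2) by blast
    then have "\<Psi>' (Y (y, s)) \<notin> zero_section E'" unfolding Ys using C'.\<Psi>_zero_section_iff[OF YB] by simp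
    moreover have my: "m (y, sqrt s) = (fst y, sqrt s *\<^sub>R snd y)" by (simp add: m_def)
    have "\<Psi> (fst y, sqrt s *\<^sub>R snd y) \<in> N" using A_sub(2)[OF QAm(2)[OF y t(1)]] by (simp add: my)
    moreover have "vscale E' (sqrt s) (\<Psi>' (Y (y, s))) = \<phi> (\<Psi> (fst y, sqrt s *\<^sub>R snd y))"
    proof -
      have "vscale E' (sqrt s) (\<Psi>' (Y (y, s))) = \<Psi>' (fst (F (m (y, sqrt s))), sqrt s *\<^sub>R h (y, sqrt s))"
        unfolding Ys by (rule C'.vscale_\<Psi>[OF YB])
      also have "sqrt s *\<^sub>R h (y, sqrt s) = snd (F (m (y, sqrt s)))"
        using h(2)[OF ZZ0 t(1), of y] y QAm(1)[OF y t(1)] by simp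
      finally show ?thesis using F_in(2)[OF QAm(2)[OF y t(1)]] by (simp add: my)
    qed
    ultimately show "\<Psi>' (Y (y, s)) \<notin> zero_section E' \<and> \<Psi> (fst y, sqrt s *\<^sub>R snd y) \<in> N \<and>
      vscale E' (sqrt s) (\<Psi>' (Y (y, s))) = \<phi> (\<Psi> (fst y, sqrt s *\<^sub>R snd y))" by blast
  qed
qed

end

end

section \<open>The rescaled map and its extension to the boundary\<close>

lemma limitin_at_right_zero:
  fixes r :: real
  assumes "continuous_map (top_of_set {0..<r}) X f" "0 < r"
  shows "limitin X f (f 0) (at_right 0)"
  unfolding limitin_def
proof (intro conjI allI impI)
  show "f 0 \<in> topspace X"
    using continuous_map_image_subset_topspace[OF assms(1)] assms(2) by auto
  fix U assume U: "openin X U \<and> f 0 \<in> U"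
  obtain V where V: "open V" "{x \<in> {0..<r}. f x \<in> U} = {0..<r} \<inter> V"
    by (rule continuous_map_openin_preimage[OF assms(1) conjunct1[OF U]]) (rule that; assumption)
  have "0 \<in> {x \<in> {0..<r}. f x \<in> U}" using U assms(2) by simp
  then have "0 \<in> V" unfolding V(2) by blast
  then have "\<forall>\<^sub>F t in at_right 0. t \<in> V" using eventually_path_in_open[OF V(1), of 0 1] by simp
  moreover have "\<forall>\<^sub>F t in at_right 0. t \<in> {0<..<r}" by (rule eventually_at_right_real[OF assms(2)])
  ultimately show "\<forall>\<^sub>F t in at_right 0. f t \<in> U"
  proof eventually_elim
    case (elim t)
    then have "t \<in> {0..<r} \<inter> V" by simp
    then show ?case unfolding V(2)[symmetric] by simp
  qed
qed

locale nondegenerate_bundle_map = equivariant_bundle_map E ip N E' ip' N' G \<rho> \<rho>' \<phi>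
  for E :: "('e, 'a::euclidean_space, 'f, 'b::euclidean_space) vbundle" and ip N
    and E' :: "('e2, 'a2::euclidean_space, 'f2, 'b2::euclidean_space) vbundle" and ip' N'
    and G :: "'g monoid" and \<rho> \<rho>' \<phi> +
  assumes hess: "hessian_nondegenerate_on_normal_bundle (open_submfd (total E) N) (zero_section E) (\<lambda>e. (fnorm ip' (\<phi> e))\<^sup>2)"
begin

text \<open>The outcome of the local lift with the bundle charts hidden:
  \<open>\<omega> (\<Theta> e, s)\<close> is the quotient of \<open>\<phi> (sqrt s * e)\<close> by
  \<open>sqrt s\<close>, smooth up to \<open>s = 0\<close> and without zeros.\<close>

definition rescaling_chart :: "'e set \<Rightarrow> ('b \<times> 'a) set \<Rightarrow> real \<Rightarrow> ('e \<Rightarrow> 'b \<times> 'a) \<Rightarrow> (('b \<times> 'a) \<times> real \<Rightarrow> 'e2) \<Rightarrow> bool" where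
  "rescaling_chart A Y r \<Theta> \<omega> \<longleftrightarrow> 0 < r \<and> smooth_to (total E) A \<Theta> \<and> smooth_into (Y \<times> {0..<r}) (total E') \<omega> \<and>
     (\<forall>e\<in>A. \<Theta> e \<in> Y \<and> (\<forall>s. 0 \<le> s \<and> s < r \<longrightarrow> \<omega> (\<Theta> e, s) \<notin> zero_section E' \<and>
        vscale E (sqrt s) e \<in> N \<and> vscale E' (sqrt s) (\<omega> (\<Theta> e, s)) = \<phi> (vscale E (sqrt s) e)))"

lemma rescaling_chartD:
  assumes "rescaling_chart A Y r \<Theta> \<omega>"
  shows "0 < r" "smooth_to (total E) A \<Theta>" "smooth_into (Y \<times> {0..<r}) (total E') \<omega>" "e \<in> A \<Longrightarrow> \<Theta> e \<in> Y"
    "e \<in> A \<Longrightarrow> 0 \<le> s \<Longrightarrow> s < r \<Longrightarrow> \<omega> (\<Theta> e, s) \<notin> zero_section E' \<and>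
      vscale E (sqrt s) e \<in> N \<and> vscale E' (sqrt s) (\<omega> (\<Theta> e, s)) = \<phi> (vscale E (sqrt s) e)"
  using assms unfolding rescaling_chart_def by blast+

lemma exists_rescaling_chart:
  assumes e0: "e0 \<in> points (total E)" "e0 \<notin> zero_section E"
  obtains A Y r and \<Theta> :: "'e \<Rightarrow> 'b \<times> 'a" and \<omega> where "e0 \<in> A" "rescaling_chart A Y r \<Theta> \<omega>"
proof -
  obtain U \<beta> \<gamma> Bs Vb W \<tau> \<Psi> where bc: "bundle_chart E U \<beta> \<gamma> Bs Vb W \<tau> \<Psi>" and eP: "e0 \<in> bundle_chart.P E U"
    using exists_bundle_chart_at[OF E.vb e0(1)] by (elim exE conjE)
  interpret C: bundle_chart E U \<beta> \<gamma> Bs Vb W \<tau> \<Psi> by (rule bc)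
  define b0 where "b0 = fst (C.\<Theta> e0)"
  define \<eta>0 where "\<eta>0 = snd (C.\<Theta> e0)"
  have b0: "b0 \<in> Bs" and \<eta>0: "\<eta>0 \<in> W" using C.\<Theta>_in[OF eP] by (simp_all add: b0_def \<eta>0_def mem_Times_iff)
  have \<eta>00: "\<eta>0 \<noteq> 0" using C.zero_section_\<Theta>_iff[OF eP] e0(2) by (simp add: \<eta>0_def)
  have "\<Psi> (b0, 0) \<in> N" using C.\<Psi>_zero_section_iff[OF b0 C.zero_in_W] E.zero_N by blast
  then have p: "\<phi> (\<Psi> (b0, 0)) \<in> points (total E')" by (rule \<phi>_points)
  obtain U' \<beta>' \<gamma>' Bs' Vb' W' \<tau>' \<Psi>' where bc': "bundle_chart E' U' \<beta>' \<gamma>' Bs' Vb' W' \<tau>' \<Psi>'"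
    and eP': "\<phi> (\<Psi> (b0, 0)) \<in> bundle_chart.P E' U'"
    using exists_bundle_chart_at[OF E'.vb p] by (elim exE conjE)
  interpret C': bundle_chart E' U' \<beta>' \<gamma>' Bs' Vb' W' \<tau>' \<Psi>' by (rule bc')
  obtain Qb where Qb: "linear Qb" "range Qb \<subseteq> Vb" "\<And>v. v \<in> Vb \<Longrightarrow> Qb v = v"
    by (rule linear_closest_point_subspace[OF C.subspace_Vb]) (rule that; assumption)
  obtain Qw where Qw: "linear Qw" "range Qw \<subseteq> W" "\<And>v. v \<in> W \<Longrightarrow> Qw v = v"
    by (rule linear_closest_point_subspace[OF C.subspace_W]) (rule that; assumption)
  interpret L: local_representative E ip N E' ip' N' G \<rho> \<rho>' \<phi> U \<beta> \<gamma> Bs Vb W \<tau> \<Psi> U' \<beta>' \<gamma>' Bs' Vb' W' \<tau>' \<Psi>' b0 Qb Qw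
    by unfold_locales (fact b0 eP' Qb(2,3) Qw(2,3) linear_add[OF Qb(1)] linear_scale[OF Qb(1)] linear_add[OF Qw(1)] linear_scale[OF Qw(1)])+
  obtain Z r \<omega> where Z: "open Z" "(b0, \<eta>0) \<in> Z" "r > 0"
    "smooth_into ((Z \<inter> (Bs \<times> W)) \<times> {0..<r}) (total E') \<omega>"
    "\<And>y s. y \<in> Z \<inter> (Bs \<times> W) \<Longrightarrow> 0 \<le> s \<Longrightarrow> s < r \<Longrightarrow> \<omega> (y, s) \<notin> zero_section E' \<and>
      \<Psi> (fst y, sqrt s *\<^sub>R snd y) \<in> N \<and> vscale E' (sqrt s) (\<omega> (y, s)) = \<phi> (\<Psi> (fst y, sqrt s *\<^sub>R snd y))"
    by (rule L.local_lift[OF hess \<eta>0 \<eta>00]) (rule that; assumption)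
  define A where "A = {e \<in> C.P. C.\<Theta> e \<in> Z}"
  have "topspace (subtopology (mtop (total E)) C.P) = C.P" using C.P_subset by auto
  then have "openin (subtopology (mtop (total E)) C.P) A"
    using openin_continuous_map_preimage[OF C.continuous_map_\<Theta>, of Z] Z(1) by (simp only: A_def open_openin)
  from openin_trans_full[OF this C.open_P] have openA: "openin (mtop (total E)) A" .
  have "\<omega> (C.\<Theta> e, s) \<notin> zero_section E' \<and>
      vscale E (sqrt s) e \<in> N \<and> vscale E' (sqrt s) (\<omega> (C.\<Theta> e, s)) = \<phi> (vscale E (sqrt s) e)"
    if e: "e \<in> A" and s: "0 \<le> s" "s < r" for e s
  proof -
    have eP: "e \<in> C.P" using e by (simp add: A_def)
    have y: "C.\<Theta> e \<in> Z \<inter> (Bs \<times> W)" using e C.\<Theta>_in by (simp add: A_def)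
    have "fst (C.\<Theta> e) \<in> Bs" "snd (C.\<Theta> e) \<in> W" using C.\<Theta>_in[OF eP] by (simp_all add: mem_Times_iff)
    from C.vscale_\<Psi>[OF this] have "\<Psi> (fst (C.\<Theta> e), sqrt s *\<^sub>R snd (C.\<Theta> e)) = vscale E (sqrt s) e"
      using C.\<Psi>_\<Theta>[OF eP] by simp
    with Z(5)[OF y s] show ?thesis by simp
  qed
  moreover have "C.\<Theta> e \<in> Z \<inter> (Bs \<times> W)" if "e \<in> A" for e using that C.\<Theta>_in by (simp add: A_def)
  moreover have "smooth_to (total E) A C.\<Theta>" by (rule smooth_to_subset[OF C.smooth_\<Theta> openA]) (auto simp: A_def)
  ultimately have "rescaling_chart A (Z \<inter> (Bs \<times> W)) r C.\<Theta> \<omega>"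
    using Z(3,4) unfolding rescaling_chart_def by simp
  moreover have "e0 \<in> A" using eP Z(2) by (simp add: A_def b0_def \<eta>0_def)
  ultimately show ?thesis by (intro that)
qed

text \<open>The function \<open>X\<close> of the polar form, now for all nonzero vectors. Taking its
  value at \<open>s = 0\<close> as a limit makes it global and independent of charts; the limit is
  unique because the total space is Hausdorff.\<close>

definition rescaled :: "'e \<Rightarrow> real \<Rightarrow> 'e2" where
  "rescaled e s = (if 0 < s then vscale E' (1 / sqrt s) (\<phi> (vscale E (sqrt s) e))
     else THE l. limitin (mtop (total E')) (\<lambda>t. vscale E' (1 / t) (\<phi> (vscale E t e))) l (at_right 0))"

definition Dm :: "('e \<times> real) set" where
  "Dm = {(e, s). e \<in> points (total E) \<and> e \<notin> zero_section E \<and> 0 \<le> s \<and> vscale E (sqrt s) e \<in> N}"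

lemma Hausdorff_total': "Hausdorff_space (mtop (total E'))"
  using E'.manifold_total by (simp add: manifold_def manifold_with_boundary_def)

lemma limit_unique:
  fixes g :: "real \<Rightarrow> 'e2"
  shows "limitin (mtop (total E')) g l (at_right 0) \<Longrightarrow> limitin (mtop (total E')) g l' (at_right 0) \<Longrightarrow> l = l'"
  using limitin_Hausdorff_unique[OF _ _ trivial_limit_at_right_real Hausdorff_total'] by blast

context
  fixes A :: "'e set" and Y r and \<Theta> :: "'e \<Rightarrow> 'b \<times> 'a" and \<omega>
  assumes chart: "rescaling_chart A Y r \<Theta> \<omega>"
begin

lemmas r = rescaling_chartD(1)[OF chart] and \<omega> = rescaling_chartD(3)[OF chart]
  and in_Y = rescaling_chartD(4)[OF chart] and fact = rescaling_chartD(5)[OF chart]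

lemma chart_points: "e \<in> A \<Longrightarrow> 0 \<le> s \<Longrightarrow> s < r \<Longrightarrow> \<omega> (\<Theta> e, s) \<in> points (total E')"
  using smooth_intoD(3)[OF \<omega>, of "(\<Theta> e, s)"] in_Y by simp

lemma chart_rescaled:
  assumes "e \<in> A" "0 < s" "s < r"
  shows "vscale E' (1 / sqrt s) (\<phi> (vscale E (sqrt s) e)) = \<omega> (\<Theta> e, s)"
proof -
  have p: "\<omega> (\<Theta> e, s) \<in> points (total E')" by (rule chart_points) (use assms in auto)
  have eq: "\<phi> (vscale E (sqrt s) e) = vscale E' (sqrt s) (\<omega> (\<Theta> e, s))" using fact[of e s] assms by simp
  show ?thesis unfolding eq E'.scale(3)[OF p] using assms E'.scale(4)[OF p] by simp
qed

text \<open>Continuity of \<omega> at \<open>s = 0\<close>, read along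
  \<open>s = t\<^sup>2\<close>.\<close>

lemma chart_limit:
  assumes e: "e \<in> A"
  shows "limitin (mtop (total E')) (\<lambda>t. vscale E' (1 / t) (\<phi> (vscale E t e))) (\<omega> (\<Theta> e, 0)) (at_right 0)"
proof -
  have "smooth_on {0..<sqrt r} (\<lambda>t. (\<Theta> e, t\<^sup>2))" by (intro smooth_on_intros)
  then have "smooth_into {0..<sqrt r} (total E') (\<lambda>t. \<omega> (\<Theta> e, t\<^sup>2))"
  proof (rule smooth_into_compose_smooth_on[OF \<omega>])
    fix t assume t: "t \<in> {0..<sqrt r}"
    have "t\<^sup>2 < (sqrt r)\<^sup>2" using t by (intro power_strict_mono) auto
    then show "(\<Theta> e, t\<^sup>2) \<in> Y \<times> {0..<r}" using in_Y[OF e] r by simp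
  qed
  then have "limitin (mtop (total E')) (\<lambda>t. \<omega> (\<Theta> e, t\<^sup>2)) (\<omega> (\<Theta> e, 0\<^sup>2)) (at_right 0)"
    by (intro limitin_at_right_zero[of "sqrt r"]) (use r in \<open>auto dest: smooth_intoD(1)\<close>)
  moreover have "\<forall>\<^sub>F t in at_right 0. \<omega> (\<Theta> e, t\<^sup>2) = vscale E' (1 / t) (\<phi> (vscale E t e))"
    using eventually_at_right_real[of 0 "sqrt r"] r
  proof (rule_tac eventually_mono)
    fix t :: real assume t: "t \<in> {0<..<sqrt r}"
    have "t\<^sup>2 < (sqrt r)\<^sup>2" using t by (intro power_strict_mono) auto
    then show "\<omega> (\<Theta> e, t\<^sup>2) = vscale E' (1 / t) (\<phi> (vscale E t e))"
      using chart_rescaled[OF e, of "t\<^sup>2"] t r by simp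
  qed simp
  ultimately show ?thesis by (simp add: limitin_transform_eventually)
qed

lemma rescaled_chart: "e \<in> A \<Longrightarrow> 0 \<le> s \<Longrightarrow> s < r \<Longrightarrow> rescaled e s = \<omega> (\<Theta> e, s)"
  using chart_rescaled[of e s] the_equality[where P = "\<lambda>l. limitin (mtop (total E')) (\<lambda>t. vscale E' (1 / t) (\<phi> (vscale E t e))) l (at_right 0)",
      OF chart_limit limit_unique[OF _ chart_limit]]
  by (cases "s = 0") (simp_all add: rescaled_def)

end

lemma rescaled_limit:
  assumes "e \<in> points (total E)" "e \<notin> zero_section E"
  shows "limitin (mtop (total E')) (\<lambda>t. vscale E' (1 / t) (\<phi> (vscale E t e))) (rescaled e 0) (at_right 0)"
    and "\<forall>\<^sub>F t in at_right 0. vscale E t e \<in> N"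
proof -
  obtain A Y r and \<Theta> :: "'e \<Rightarrow> 'b \<times> 'a" and \<omega> where c: "e \<in> A" "rescaling_chart A Y r \<Theta> \<omega>"
    by (rule exists_rescaling_chart[OF assms]) (rule that; assumption)
  show "limitin (mtop (total E')) (\<lambda>t. vscale E' (1 / t) (\<phi> (vscale E t e))) (rescaled e 0) (at_right 0)"
    using chart_limit[OF c(2,1)] rescaled_chart[OF c(2,1) order_refl rescaling_chartD(1)[OF c(2)]] by simp
  note r = rescaling_chartD(1)[OF c(2)]
  then have "0 < sqrt r" by simp
  then have "\<forall>\<^sub>F t in at_right 0. t \<in> {0<..<sqrt r}" by (rule eventually_at_right_real)
  then show "\<forall>\<^sub>F t in at_right 0. vscale E t e \<in> N"
  proof (rule eventually_mono)
    fix t :: real assume t: "t \<in> {0<..<sqrt r}"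
    have "t\<^sup>2 < (sqrt r)\<^sup>2" using t by (intro power_strict_mono) auto
    then show "vscale E t e \<in> N" using rescaling_chartD(5)[OF c(2,1), of "t\<^sup>2"] t r by simp
  qed
qed

lemma rescaled_in:
  assumes "(e, s) \<in> Dm"
  shows "rescaled e s \<in> points (total E')" "rescaled e s \<notin> zero_section E'"
    "vscale E' (sqrt s) (rescaled e s) = \<phi> (vscale E (sqrt s) e)"
proof -
  have e: "e \<in> points (total E)" "e \<notin> zero_section E" "0 \<le> s" "vscale E (sqrt s) e \<in> N" using assms by (auto simp: Dm_def)
  have "rescaled e s \<in> points (total E') \<and> rescaled e s \<notin> zero_section E' \<and>
    vscale E' (sqrt s) (rescaled e s) = \<phi> (vscale E (sqrt s) e)"
  proof (cases "s = 0")
    case False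
    then have s: "0 < s" using e(3) by simp
    have p: "\<phi> (vscale E (sqrt s) e) \<in> points (total E')" "\<phi> (vscale E (sqrt s) e) \<notin> zero_section E'"
      using \<phi>_points[OF e(4)] zero_iff[OF e(4)] E.scale(5)[OF e(1)] e(2) s by auto
    then show ?thesis using E'.scale(1,3,4,5)[OF p(1)] s by (simp add: rescaled_def)
  next
    case True
    obtain A Y r and \<Theta> :: "'e \<Rightarrow> 'b \<times> 'a" and \<omega> where c: "e \<in> A" "rescaling_chart A Y r \<Theta> \<omega>"
      by (rule exists_rescaling_chart[OF e(1,2)]) (rule that; assumption)
    show ?thesis unfolding True rescaled_chart[OF c(2,1) order_refl rescaling_chartD(1)[OF c(2)]]
      using chart_points[OF c(2,1) order_refl rescaling_chartD(1)[OF c(2)]] rescaling_chartD(5)[OF c(2,1) order_refl rescaling_chartD(1)[OF c(2)]] by blast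
  qed
  then show "rescaled e s \<in> points (total E')" "rescaled e s \<notin> zero_section E'"
    "vscale E' (sqrt s) (rescaled e s) = \<phi> (vscale E (sqrt s) e)" by blast+
qed

text \<open>Where \<open>h\<close> is positive the explicit formula is smooth; near its zeros a
  rescaling chart takes over.\<close>

lemma smooth_into_rescaled:
  assumes g: "smooth_into X (total E) g" and h: "smooth_on X h" and D: "\<And>x. x \<in> X \<Longrightarrow> (g x, h x) \<in> Dm"
  shows "smooth_into X (total E') (\<lambda>x. rescaled (g x) (h x))"
proof (rule smooth_into_local)
  fix x assume x: "x \<in> X"
  have Dx: "g y \<in> points (total E)" "g y \<notin> zero_section E" "0 \<le> h y" "vscale E (sqrt (h y)) (g y) \<in> N" if "y \<in> X" for y
    using D[OF that] by (auto simp: Dm_def)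
  have conth: "continuous_map (top_of_set X) euclideanreal h"
    using smooth_on_imp_continuous_on[OF h] by simp
  show "\<exists>V. open V \<and> x \<in> V \<and> smooth_into (X \<inter> V) (total E') (\<lambda>x. rescaled (g x) (h x))"
  proof (cases "h x = 0")
    case False
    obtain V where V: "open V" "{y \<in> X. h y \<in> {0<..}} = X \<inter> V"
      by (rule continuous_map_openin_preimage[OF conth, of "{0<..}"], simp flip: open_openin) (rule that; assumption)
    have pos: "0 < h y" if "y \<in> X \<inter> V" for y using that unfolding V(2)[symmetric] by simp
    have "x \<in> {y \<in> X. h y \<in> {0<..}}" using x False Dx(3)[OF x] by simp
    then have "x \<in> V" unfolding V(2) by simp
    have sg: "smooth_into (X \<inter> V) (total E) g" and sh: "smooth_on (X \<inter> V) h"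
      by (rule smooth_into_subset[OF g], simp, rule smooth_on_subset[OF h], simp)
    have sq: "smooth_on (X \<inter> V) (\<lambda>y. sqrt (h y))" by (rule smooth_on_sqrt[OF sh pos])
    have iq: "smooth_on (X \<inter> V) (\<lambda>y. 1 / sqrt (h y))"
      by (rule smooth_on_divide[OF smooth_on_const sq]) (use pos in force)
    have "smooth_into (X \<inter> V) (total E') (\<lambda>y. \<phi> (vscale E (sqrt (h y)) (g y)))"
      by (rule smooth_into_\<phi>[OF smooth_into_vscale[OF E.vb sg sq]]) (use Dx(4) in blast)
    from smooth_into_vscale[OF E'.vb this iq]
    have "smooth_into (X \<inter> V) (total E') (\<lambda>y. vscale E' (1 / sqrt (h y)) (\<phi> (vscale E (sqrt (h y)) (g y))))" .
    then have "smooth_into (X \<inter> V) (total E') (\<lambda>y. rescaled (g y) (h y))"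
      by (rule smooth_into_cong) (use pos in \<open>simp add: rescaled_def\<close>)
    then show ?thesis using V(1) \<open>x \<in> V\<close> by blast
  next
    case True
    obtain A Y r and \<Theta> :: "'e \<Rightarrow> 'b \<times> 'a" and \<omega> where c: "g x \<in> A" "rescaling_chart A Y r \<Theta> \<omega>"
      by (rule exists_rescaling_chart[OF Dx(1,2)[OF x]]) (rule that; assumption)
    obtain V where V: "open V" "{y \<in> X. h y \<in> {..<r}} = X \<inter> V"
      by (rule continuous_map_openin_preimage[OF conth, of "{..<r}"], simp flip: open_openin) (rule that; assumption)
    obtain V2 where V2: "open V2" "{y \<in> X. g y \<in> A} = X \<inter> V2"
      by (rule continuous_map_openin_preimage[OF smooth_intoD(1)[OF g] smooth_toD(1)[OF rescaling_chartD(2)[OF c(2)]]]) (rule that; assumption)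
    have "x \<in> {y \<in> X. h y \<in> {..<r}}" "x \<in> {y \<in> X. g y \<in> A}" using x True c(1) rescaling_chartD(1)[OF c(2)] by simp_all
    then have xV: "x \<in> V \<inter> V2" unfolding V(2) V2(2) by simp
    let ?X = "X \<inter> (V \<inter> V2)"
    have hr: "h y < r" "g y \<in> A" "0 \<le> h y" if "y \<in> ?X" for y
    proof -
      have "y \<in> X \<inter> V" "y \<in> X \<inter> V2" "y \<in> X" using that by simp_all
      then show "h y < r" "g y \<in> A" "0 \<le> h y" unfolding V(2)[symmetric] V2(2)[symmetric] using Dx(3) by simp_all
    qed
    have sg: "smooth_into ?X (total E) g" and sh: "smooth_on ?X h"
      by (rule smooth_into_subset[OF g], simp, rule smooth_on_subset[OF h], simp)
    have "smooth_on ?X (\<lambda>y. \<Theta> (g y))" by (rule smooth_on_smooth_to_compose[OF E.charted_total rescaling_chartD(2)[OF c(2)] sg hr(2)])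
    from smooth_on_Pair[OF this sh]
    have "smooth_into ?X (total E') (\<lambda>y. \<omega> (\<Theta> (g y), h y))"
      by (rule smooth_into_compose_smooth_on[OF rescaling_chartD(3)[OF c(2)]]) (use hr rescaling_chartD(4)[OF c(2)] in simp)
    then have "smooth_into ?X (total E') (\<lambda>y. rescaled (g y) (h y))"
      by (rule smooth_into_cong) (use rescaled_chart[OF c(2)] hr in simp)
    then show ?thesis using open_Int[OF V(1) V2(1)] xV by blast
  qed
qed

text \<open>For \<open>s > 0\<close> the formula is equivariant term by term; at
  \<open>s = 0\<close> continuity of \<open>\<rho>' g\<close> carries this to the limit.\<close>

lemma rescaled_equivariant:
  assumes g: "g \<in> carrier G" and D: "(e, s) \<in> Dm"
  shows "rescaled (\<rho> g e) s = \<rho>' g (rescaled e s)"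
proof -
  have e: "e \<in> points (total E)" "e \<notin> zero_section E" "0 \<le> s" "vscale E (sqrt s) e \<in> N" using D by (auto simp: Dm_def)
  have ge: "\<rho> g e \<in> points (total E)" "\<rho> g e \<notin> zero_section E"
    using E.action_points[OF g e(1)] E.action_zero_iff[OF g e(1)] e(2) by simp_all
  have eq: "vscale E' c (\<phi> (vscale E t (\<rho> g e))) = \<rho>' g (vscale E' c (\<phi> (vscale E t e)))" if "vscale E t e \<in> N" for t c
    using E.action_scale[OF g e(1), of t] equiv[OF g that] E'.action_scale[OF g \<phi>_points[OF that], of c] by simp
  show ?thesis
  proof (cases "s = 0")
    case False
    then show ?thesis using eq[OF e(4)] e(3) by (simp add: rescaled_def)
  next
    case True
    have "limitin (mtop (total E')) (\<rho>' g \<circ> (\<lambda>t. vscale E' (1 / t) (\<phi> (vscale E t e)))) (\<rho>' g (rescaled e 0)) (at_right 0)"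
      by (rule continuous_map_limit[OF E'.action_continuous[OF g] rescaled_limit(1)[OF e(1,2)]])
    moreover have "\<forall>\<^sub>F t in at_right 0. (\<rho>' g \<circ> (\<lambda>t. vscale E' (1 / t) (\<phi> (vscale E t e)))) t =
        vscale E' (1 / t) (\<phi> (vscale E t (\<rho> g e)))"
      using rescaled_limit(2)[OF e(1,2)] by (rule eventually_mono) (simp add: eq)
    ultimately have "limitin (mtop (total E')) (\<lambda>t. vscale E' (1 / t) (\<phi> (vscale E t (\<rho> g e)))) (\<rho>' g (rescaled e 0)) (at_right 0)"
      using limitin_transform_eventually by fast
    then show ?thesis unfolding True using limit_unique[OF rescaled_limit(1)[OF ge]] by blast
  qed
qed

end

section \<open>The lift to the blowups\<close>

lemma smooth_on_imp_has_derivative_within: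
  assumes "smooth_on A f" "x \<in> A"
  obtains D where "(f has_derivative D) (at x within A)"
proof -
  obtain U g where g: "open U" "x \<in> U" "smooth_on U g" "\<And>y. y \<in> A \<inter> U \<Longrightarrow> g y = f y"
    "(g has_derivative frechet_derivative g (at x)) (at x)"
    by (rule smooth_on_extension_has_derivative[OF assms]) (rule that; assumption)
  have "(g has_derivative frechet_derivative g (at x)) (at x within A \<inter> U)"
    by (rule has_derivative_at_withinI[OF g(5)])
  then have "(f has_derivative frechet_derivative g (at x)) (at x within A \<inter> U)"
    by (rule has_derivative_transform[rotated 2]) (use g assms in auto)
  moreover have "at x within A \<inter> U = at x within A"
    by (rule at_within_nhd[of x U]) (use g in auto)
  ultimately show ?thesis by (intro that) simp
qed

lemma smooth_on_imp_has_vector_derivative: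
  fixes f :: "real \<Rightarrow> 'a::euclidean_space"
  assumes "smooth_on A f" "x \<in> A"
  obtains v where "(f has_vector_derivative v) (at x within A)"
proof -
  obtain D where D: "(f has_derivative D) (at x within A)"
    by (rule smooth_on_imp_has_derivative_within[OF assms]) (rule that; assumption)
  have "D = (\<lambda>h. h *\<^sub>R D 1)"
  proof
    fix h :: real
    show "D h = h *\<^sub>R D 1" using linear_scale[OF has_derivative_linear[OF D], of h 1] by simp
  qed
  with D have "(f has_derivative (\<lambda>h. h *\<^sub>R D 1)) (at x within A)" by (rule subst[rotated])
  then show ?thesis unfolding has_vector_derivative_def[symmetric] by (rule that)
qed

text \<open>A one-sided chain rule: derivatives within a chart image are tested along paths that
  start at a boundary point.\<close>

lemma has_vector_derivative_along_path:
  assumes f: "(f has_derivative D) (at x within A)" and y: "(y has_vector_derivative v) (at 0 within {0..d})"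
    and "y 0 = x" "\<And>t. t \<in> {0..d} \<Longrightarrow> y t \<in> A"
  shows "((\<lambda>t. f (y t)) has_vector_derivative D v) (at (0::real) within {0..d})"
proof -
  have "(f has_derivative D) (at (y 0) within y ` {0..d})"
    unfolding assms(3) by (rule has_derivative_subset[OF f]) (use assms(4) in blast)
  from vector_derivative_diff_chain_within[OF y this] show ?thesis by (simp add: o_def)
qed

lemma vector_derivative_unique_right:
  fixes f :: "real \<Rightarrow> 'a::real_normed_vector"
  assumes "0 < d" "(f has_vector_derivative v) (at 0 within {0..d})" "(f has_vector_derivative w) (at 0 within {0..d})"
  shows "v = w"
proof (rule vector_derivative_unique_within[OF _ assms(2,3)])
  show "at 0 within {0..d} \<noteq> bot" using assms(1) by (simp add: at_within_Icc_at_right)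
qed

lemma has_vector_derivative_linear_path: "((\<lambda>t. x + t *\<^sub>R v) has_vector_derivative v) (at 0 within X)"
  by (auto intro!: derivative_eq_intros)

context blowup_domain
begin

lemma blowdown_unpol:
  assumes "u \<in> S" "0 \<le> s"
  shows "blowdown B (unpol u s) = vscale B (sqrt s) u"
proof -
  note u = S_points[OF assms(1)]
  have u1: "u \<in> ray B u" using scale(4)[OF u] unfolding ray_def by (intro CollectI exI[of _ 1]) simp
  have "proj B x = proj B u" if "x \<in> ray B u" for x using that scale(2)[OF u] by (auto simp: ray_def)
  then have "proj B ` ray B u = (\<lambda>_. proj B u) ` ray B u" by (rule image_cong[OF refl])
  also have "\<dots> = {proj B u}" by (rule image_constant[OF u1])
  finally have "proj B ` ray B u = {proj B u}" .
  then show ?thesis using scale(6)[OF u] by (simp add: blowdown_def unpol_def)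
qed

lemma blowdown_pol: "z \<in> BN \<Longrightarrow> blowdown B z = vscale B (sqrt (snd (pol z))) (fst (pol z))"
  using blowdown_unpol[of "fst (pol z)" "snd (pol z)"] pol_in[of z] by simp

lemma boundary_iff: "z \<in> BN \<Longrightarrow> z \<in> boundary Bl \<longleftrightarrow> snd (pol z) = 0"
  unfolding boundary_Bl by (elim BN_cases) (auto simp: pol_Inl pol_Inr norm(1))

lemma smooth_map_from_Bl:
  assumes "\<And>U c W. slice_chart U c W \<Longrightarrow> smooth_into (image_Bl U c) M (\<lambda>x. h (unpol (inv_into U c (fst x)) (snd x)))"
  shows "smooth_map Bl M h"
proof (rule smooth_mapI[OF charted_Bl])
  fix U' c' assume "(U', c') \<in> atlas Bl"
  then obtain U c W where eq: "U' = dom_Bl U" "c' = chart_Bl c" and sl: "slice_chart U c W" unfolding atlas_Bl by blast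
  show "smooth_into (c' ` U') M (\<lambda>x. h (inv_into U' c' x))"
    unfolding eq image_chart_Bl[OF sl]
    by (rule smooth_into_cong[OF assms[OF sl]]) (simp add: inv_chart_Bl[OF sl])
qed

lemma pol_inject: "z \<in> BN \<Longrightarrow> z' \<in> BN \<Longrightarrow> fst (pol z) = fst (pol z') \<Longrightarrow> snd (pol z) = snd (pol z') \<Longrightarrow> z = z'"
  by (metis pol_in(3))

lemma continuous_map_unpol:
  assumes "\<And>t. t \<in> X \<Longrightarrow> 0 \<le> t \<and> vscale B (sqrt t) u \<in> N" and u: "u \<in> S"
  shows "continuous_map (top_of_set X) (mtop Bl) (unpol u)"
proof (rule continuous_map_into_Bl)
  have pu: "unpol u t \<in> BN" "pol (unpol u t) = (u, t)" if "t \<in> X" for t using unpol_in[OF u, of t] assms(1)[OF that] by simp_all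
  show "unpol u t \<in> BN" if "t \<in> topspace (top_of_set X)" for t using pu(1) that by simp
  have "continuous_map (top_of_set X) (mtop (total B)) (\<lambda>t. u)" using S_points[OF u] by simp
  then show "continuous_map (top_of_set X) (mtop (total B)) (\<lambda>t. fst (pol (unpol u t)))"
    by (rule continuous_map_eq) (simp add: pu)
  have "continuous_map (top_of_set X) euclideanreal (\<lambda>t. t)" by simp
  then show "continuous_map (top_of_set X) euclideanreal (\<lambda>t. snd (pol (unpol u t)))"
    by (rule continuous_map_eq) (simp add: pu)
qed

end

lemma (in sphere_transitive_bundle) action_unpol:
  assumes "g \<in> carrier G" "u \<in> points (total B)"
  shows "blowup_action \<rho> g (unpol u s) = unpol (\<rho> g u) s"
  using action_ray[OF assms] action_scale[OF assms] by (simp add: unpol_def blowup_action_def)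

lemma (in sphere_transitive_bundle) action_S: "g \<in> carrier G \<Longrightarrow> u \<in> S \<Longrightarrow> \<rho> g u \<in> S"
  using action_points action_norm by (simp add: S_def)

section \<open>The lift in polar coordinates, its uniqueness and equivariance\<close>

context nondegenerate_bundle_map
begin

definition unit_rescaled :: "'e \<Rightarrow> real \<Rightarrow> 'e2" where
  "unit_rescaled u s = vscale E' (1 / fnorm ip' (rescaled u s)) (rescaled u s)"

definition \<psi> :: "'e + 'e set \<Rightarrow> 'e2 + 'e2 set" where
  "\<psi> z = (let u = fst (E.pol z); s = snd (E.pol z) in E'.unpol (unit_rescaled u s) (s * (fnorm ip' (rescaled u s))\<^sup>2))"

lemma DmI: "u \<in> E.S \<Longrightarrow> 0 \<le> s \<Longrightarrow> vscale E (sqrt s) u \<in> N \<Longrightarrow> (u, s) \<in> Dm"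
  using E.S_points E.S_nonzero by (simp add: Dm_def)

context
  fixes u s assumes u: "u \<in> E.S" "0 \<le> s" "vscale E (sqrt s) u \<in> N"
begin

lemma fnorm_rescaled: "0 < fnorm ip' (rescaled u s)"
  using E'.fnorm_pos rescaled_in[OF DmI[OF u]] by blast

lemma unit_rescaled_S: "unit_rescaled u s \<in> E'.S"
  unfolding unit_rescaled_def by (rule E'.unit_in_S[OF rescaled_in(1,2)[OF DmI[OF u]]])

lemma vscale_unit_rescaled: "vscale E' (sqrt (s * (fnorm ip' (rescaled u s))\<^sup>2)) (unit_rescaled u s) = \<phi> (vscale E (sqrt s) u)"
  unfolding unit_rescaled_def E'.scale(3)[OF rescaled_in(1)[OF DmI[OF u]]] rescaled_in(3)[OF DmI[OF u], symmetric]
  using fnorm_rescaled u(2) by (simp add: real_sqrt_mult)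

lemma \<psi>_unpol: "\<psi> (E.unpol u s) = E'.unpol (unit_rescaled u s) (s * (fnorm ip' (rescaled u s))\<^sup>2)"
  by (simp add: \<psi>_def E.unpol_in(2)[OF u])

lemma \<psi>_unpol_in: "\<psi> (E.unpol u s) \<in> E'.BN"
  and pol_\<psi>_unpol: "E'.pol (\<psi> (E.unpol u s)) = (unit_rescaled u s, s * (fnorm ip' (rescaled u s))\<^sup>2)"
  unfolding \<psi>_unpol using E'.unpol_in[OF unit_rescaled_S, of "s * (fnorm ip' (rescaled u s))\<^sup>2"]
    vscale_unit_rescaled \<phi>_N'[OF u(3)] u(2) by simp_all

end

lemma \<psi>_in: "z \<in> E.BN \<Longrightarrow> \<psi> z \<in> E'.BN"
  using \<psi>_unpol_in[OF E.pol_in(1,2,4)] E.pol_in(3) by simp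

lemma pol_\<psi>:
  assumes "z \<in> E.BN"
  shows "E'.pol (\<psi> z) = (unit_rescaled (fst (E.pol z)) (snd (E.pol z)), snd (E.pol z) * (fnorm ip' (rescaled (fst (E.pol z)) (snd (E.pol z))))\<^sup>2)"
  using pol_\<psi>_unpol[OF E.pol_in(1,2,4)[OF assms]] E.pol_in(3)[OF assms] by simp

lemma blowdown_\<psi>: "z \<in> E.BN \<Longrightarrow> blowdown E' (\<psi> z) = \<phi> (blowdown E z)"
  using E'.blowdown_pol[OF \<psi>_in] E.blowdown_pol pol_\<psi> vscale_unit_rescaled[OF E.pol_in(1,2,4)] by simp

lemma smooth_rescaled_norm:
  assumes g: "smooth_into X (total E) g" and h: "smooth_on X h"
    and S: "\<And>x. x \<in> X \<Longrightarrow> g x \<in> E.S \<and> 0 \<le> h x \<and> vscale E (sqrt (h x)) (g x) \<in> N"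
  shows "smooth_into X (total E') (\<lambda>x. unit_rescaled (g x) (h x))"
    and "smooth_on X (\<lambda>x. (fnorm ip' (rescaled (g x) (h x)))\<^sup>2)"
proof -
  have R: "smooth_into X (total E') (\<lambda>x. rescaled (g x) (h x))"
    by (rule smooth_into_rescaled[OF g h]) (use S DmI in blast)
  have P: "rescaled (g x) (h x) \<in> points (total E')" if "x \<in> X" for x using smooth_intoD(3)[OF R that] .
  have pos: "0 < fnorm ip' (rescaled (g x) (h x))" if "x \<in> X" for x using fnorm_rescaled S[OF that] by blast
  have "smooth_on X (\<lambda>x. ip' (rescaled (g x) (h x)) (rescaled (g x) (h x)))"
    by (rule smooth_on_smooth_to_compose[OF E'.charted_total smooth_to_ip[OF E'.vb E'.ip] R P])
  then show sq: "smooth_on X (\<lambda>x. (fnorm ip' (rescaled (g x) (h x)))\<^sup>2)"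
    by (rule smooth_on_cong) (simp add: E'.norm(4)[OF P])
  have "smooth_on X (\<lambda>x. sqrt ((fnorm ip' (rescaled (g x) (h x)))\<^sup>2))"
    by (rule smooth_on_sqrt[OF sq]) (rule zero_less_power, rule pos)
  then have "smooth_on X (\<lambda>x. fnorm ip' (rescaled (g x) (h x)))"
    by (rule smooth_on_cong) (simp add: pos order_less_imp_le)
  then have "smooth_on X (\<lambda>x. 1 / fnorm ip' (rescaled (g x) (h x)))"
  proof (rule smooth_on_divide[OF smooth_on_const])
    fix x assume "x \<in> X"
    from pos[OF this] show "fnorm ip' (rescaled (g x) (h x)) \<noteq> 0" by simp
  qed
  then show "smooth_into X (total E') (\<lambda>x. unit_rescaled (g x) (h x))"
    unfolding unit_rescaled_def by (rule smooth_into_vscale[OF E'.vb R])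
qed

lemma smooth_into_\<psi>_unpol:
  assumes g: "smooth_into X (total E) g" and h: "smooth_on X h"
    and S: "\<And>x. x \<in> X \<Longrightarrow> g x \<in> E.S \<and> 0 \<le> h x \<and> vscale E (sqrt (h x)) (g x) \<in> N"
  shows "smooth_into X E'.Bl (\<lambda>x. \<psi> (E.unpol (g x) (h x)))"
proof (rule E'.smooth_into_Bl)
  have p: "\<psi> (E.unpol (g x) (h x)) \<in> E'.BN" "E'.pol (\<psi> (E.unpol (g x) (h x))) = (unit_rescaled (g x) (h x), h x * (fnorm ip' (rescaled (g x) (h x)))\<^sup>2)"
    if "x \<in> X" for x using \<psi>_unpol_in pol_\<psi>_unpol S[OF that] by blast+
  show "\<psi> (E.unpol (g x) (h x)) \<in> E'.BN" if "x \<in> X" for x by (rule p(1)[OF that])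
  show "smooth_into X (total E') (\<lambda>x. fst (E'.pol (\<psi> (E.unpol (g x) (h x)))))"
    by (rule smooth_into_cong[OF smooth_rescaled_norm(1)[OF g h S]]) (simp_all add: p)
  show "smooth_on X (\<lambda>x. snd (E'.pol (\<psi> (E.unpol (g x) (h x)))))"
    by (rule smooth_on_cong[OF smooth_on_mult[OF h smooth_rescaled_norm(2)[OF g h S]]]) (simp_all add: p)
qed

lemma smooth_\<psi>: "smooth_map E.Bl E'.Bl \<psi>"
proof (rule E.smooth_map_from_Bl)
  fix U c W assume sl: "E.slice_chart U c W"
  show "smooth_into (E.image_Bl U c) E'.Bl (\<lambda>x. \<psi> (E.unpol (inv_into U c (fst x)) (snd x)))"
  proof (rule smooth_into_\<psi>_unpol[OF E.smooth_into_unchart_fst[OF sl]])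
    show "smooth_on (E.image_Bl U c) snd" by (intro smooth_on_snd[of _ "\<lambda>x. x"] smooth_on_id)
    fix x assume "x \<in> E.image_Bl U c"
    then show "inv_into U c (fst x) \<in> E.S \<and> 0 \<le> snd x \<and> vscale E (sqrt (snd x)) (inv_into U c (fst x)) \<in> N"
      using E.inv_slice[OF sl, of "fst x"] by (simp add: E.image_Bl_def)
  qed
qed

lemma is_blowup_lift_\<psi>: "is_blowup_lift E ip N E' ip' N' \<phi> \<psi>"
  using smooth_\<psi> blowdown_\<psi> by (simp add: is_blowup_lift_def)

text \<open>\<open>N\<close> contains an initial piece of every ray, expressed in the squared
  radius; the square of the bound for the radius appears for this reason.\<close>

lemma exists_radius:
  assumes "u \<in> E.S"
  obtains d where "0 < d" "\<And>t. t \<in> {0..<d} \<Longrightarrow> 0 \<le> t \<and> vscale E (sqrt t) u \<in> N"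
proof -
  note up = E.S_points[OF assms] and uz = E.S_nonzero[OF assms]
  have "\<forall>\<^sub>F t in at_right 0. vscale E t u \<in> N" by (rule rescaled_limit(2)[OF up uz])
  then obtain d where d: "0 < d" "\<And>t. 0 < t \<Longrightarrow> t < d \<Longrightarrow> vscale E t u \<in> N"
    by (auto simp: eventually_at_right_field)
  have "0 \<le> t \<and> vscale E (sqrt t) u \<in> N" if "t \<in> {0..<d\<^sup>2}" for t
  proof (cases "t = 0")
    case True
    then show ?thesis using E.scale(5)[OF up, of 0] E.zero_N by auto
  next
    case False
    moreover have "sqrt t < d" by (rule real_less_lsqrt) (use that d(1) in auto)
    ultimately show ?thesis using that d(2)[of "sqrt t"] by simp
  qed
  moreover have "0 < d\<^sup>2" using d(1) by simp
  ultimately show ?thesis by (rule that[rotated])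
qed

text \<open>Off the boundary the blow-down map of the target is injective, and no interior point can
  go to the boundary because \<phi> has no zeros off the zero section. So two lifts agree in the
  interior. A boundary point is approached along its ray, and limits are unique in both polar
  coordinates.\<close>

lemma blowup_lift_unique:
  assumes L: "is_blowup_lift E ip N E' ip' N' \<phi> \<psi>2" and z: "z \<in> E.BN"
  shows "\<psi>2 z = \<psi> z"
proof -
  have cont: "continuous_map (mtop E.Bl) (mtop E'.Bl) h" and in_BN: "\<And>z. z \<in> E.BN \<Longrightarrow> h z \<in> E'.BN"
    and down: "\<And>z. z \<in> E.BN \<Longrightarrow> blowdown E' (h z) = \<phi> (blowdown E z)"
    if "is_blowup_lift E ip N E' ip' N' \<phi> h" for h
  proof -
    show c: "continuous_map (mtop E.Bl) (mtop E'.Bl) h" using that by (simp add: is_blowup_lift_def smooth_map_def)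
    show "h z \<in> E'.BN" if "z \<in> E.BN" for z
      using continuous_map_image_subset_topspace[OF c] that unfolding E.points_Bl E'.points_Bl by blast
    show "blowdown E' (h z) = \<phi> (blowdown E z)" if "z \<in> E.BN" for z using \<open>is_blowup_lift _ _ _ _ _ _ _ h\<close> that by (simp add: is_blowup_lift_def)
  qed
  have inner: "h (Inl e) = Inl (\<phi> e)" if h: "is_blowup_lift E ip N E' ip' N' \<phi> h" and e: "e \<in> N" "e \<notin> zero_section E" for h e
  proof -
    have zB: "Inl e \<in> E.BN" using e by (auto simp: blowup_set_def)
    have d: "blowdown E' (h (Inl e)) = \<phi> e" using down[OF h zB] by (simp add: blowdown_def)
    have nz: "\<phi> e \<notin> zero_section E'" using zero_iff[OF e(1)] e(2) by simp
    show ?thesis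
    proof (rule E'.BN_cases[OF in_BN[OF h zB]])
      fix e' assume "h (Inl e) = Inl e'"
      then show ?thesis using d by (simp add: blowdown_def)
    next
      fix r assume "h (Inl e) = Inr r" "r \<in> sphere_bundle E'"
      then have "snd (E'.pol (h (Inl e))) = 0" by (simp add: E'.pol_Inr)
      then have "\<phi> e \<in> zero_section E'"
        using E'.blowdown_pol[OF in_BN[OF h zB]] d E'.scale(5)[OF E'.S_points[OF E'.pol_in(1)[OF in_BN[OF h zB]]], of 0] by simp
      then show ?thesis using nz by blast
    qed
  qed
  show ?thesis
    using z
  proof (cases rule: E.BN_cases)
    case (1 e)
    then show ?thesis using inner[OF L] inner[OF is_blowup_lift_\<psi>] by simp
  next
    case (2 r)
    define u where "u = E.rep r"
    have u: "u \<in> E.S" "ray E u = r" using E.sphere_bundle_rep[OF 2(2)] by (simp_all add: u_def)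
    note up = E.S_points[OF u(1)] and uz = E.S_nonzero[OF u(1)]
    obtain d where d2: "0 < d" and tN: "\<And>t. t \<in> {0..<d} \<Longrightarrow> 0 \<le> t \<and> vscale E (sqrt t) u \<in> N"
      by (rule exists_radius[OF u(1)]) (rule that; assumption)
    note cp = E.continuous_map_unpol[OF tN u(1)]
    have z0: "z = E.unpol u 0" using 2(1) u(2) by (simp add: E.unpol_def)
    have agree: "\<forall>\<^sub>F t in at_right 0. h (E.unpol u t) = Inl (\<phi> (vscale E (sqrt t) u))"
      if h: "is_blowup_lift E ip N E' ip' N' \<phi> h" for h
      using eventually_at_right_real[OF d2]
    proof (rule eventually_mono)
      fix t assume t: "t \<in> {0<..<d}"
      have "vscale E (sqrt t) u \<in> N" "vscale E (sqrt t) u \<notin> zero_section E"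
        using tN[of t] t E.scale(5)[OF up, of "sqrt t"] uz by auto
      then show "h (E.unpol u t) = Inl (\<phi> (vscale E (sqrt t) u))" using inner[OF h] t by (simp add: E.unpol_def)
    qed
    have lim: "limitin (mtop E'.Bl) (\<lambda>t. Inl (\<phi> (vscale E (sqrt t) u))) (h z) (at_right 0)"
      if h: "is_blowup_lift E ip N E' ip' N' \<phi> h" for h
      using limitin_transform_eventually[OF agree[OF h] limitin_at_right_zero[OF continuous_map_compose[OF cp cont[OF h], unfolded o_def] d2]]
      by (simp add: z0)
    let ?p = "\<lambda>t. Inl (\<phi> (vscale E (sqrt t) u)) :: 'e2 + 'e2 set"
    have l1: "limitin (mtop (total E')) ((\<lambda>z. fst (E'.pol z)) \<circ> ?p) (fst (E'.pol (h z))) (at_right 0)"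
      and l2: "limitin euclideanreal ((\<lambda>z. snd (E'.pol z)) \<circ> ?p) (snd (E'.pol (h z))) (at_right 0)"
      if "is_blowup_lift E ip N E' ip' N' \<phi> h" for h
      using continuous_map_limit[OF E'.continuous_map_fst_pol lim[OF that]]
        continuous_map_limit[OF E'.continuous_map_snd_pol lim[OF that]] by simp_all
    have "fst (E'.pol (\<psi>2 z)) = fst (E'.pol (\<psi> z))" by (rule limit_unique[OF l1[OF L] l1[OF is_blowup_lift_\<psi>]])
    moreover have "snd (E'.pol (\<psi>2 z)) = snd (E'.pol (\<psi> z))"
      using tendsto_unique[OF trivial_limit_at_right_real] l2[OF L] l2[OF is_blowup_lift_\<psi>] by simp
    ultimately show ?thesis by (rule E'.pol_inject[OF in_BN[OF L z] \<psi>_in[OF z]])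
  qed
qed

lemma equivariant_\<psi>: "equivariant G E.BN (blowup_action \<rho>) (blowup_action \<rho>') \<psi>"
  unfolding equivariant_def
proof (intro ballI)
  fix g z assume g: "g \<in> carrier G" and z: "z \<in> E.BN"
  define u where "u = fst (E.pol z)"
  define s where "s = snd (E.pol z)"
  have zu: "z = E.unpol u s" using E.pol_in(3)[OF z] by (simp add: u_def s_def)
  have us: "u \<in> E.S" "0 \<le> s" "vscale E (sqrt s) u \<in> N" using E.pol_in[OF z] by (simp_all add: u_def s_def)
  note up = E.S_points[OF us(1)]
  have gus: "\<rho> g u \<in> E.S" "0 \<le> s" "vscale E (sqrt s) (\<rho> g u) \<in> N"
    using E.action_S[OF g us(1)] us(2) E.action_N[OF g us(3)] E.action_scale[OF g up] by simp_all
  note R = rescaled_in(1)[OF DmI[OF us]]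
  have r: "rescaled (\<rho> g u) s = \<rho>' g (rescaled u s)" by (rule rescaled_equivariant[OF g DmI[OF us]])
  have n: "fnorm ip' (\<rho>' g (rescaled u s)) = fnorm ip' (rescaled u s)" by (rule E'.action_norm[OF g R])
  have "unit_rescaled (\<rho> g u) s = \<rho>' g (unit_rescaled u s)"
    unfolding unit_rescaled_def r n by (rule E'.action_scale[OF g R, symmetric])
  then show "\<psi> (blowup_action \<rho> g z) = blowup_action \<rho>' g (\<psi> z)"
    unfolding zu E.action_unpol[OF g up] \<psi>_unpol[OF us] \<psi>_unpol[OF gus] r n
      E'.action_unpol[OF g E'.S_points[OF unit_rescaled_S[OF us]]] by simp
qed

end

section \<open>Boundary-defining functions\<close>

context blowup_domain
begin

context
  fixes U :: "'e set" and c :: "'e \<Rightarrow> 'a" and W u and k :: "'a \<times> real \<Rightarrow> real" and D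
  assumes slice: "slice_chart U c W" and u: "u \<in> U" "u \<in> S"
    and D: "(k has_derivative D) (at (c u, 0) within image_Bl U c)"
    and zero: "\<And>x. x \<in> image_Bl U c \<Longrightarrow> snd x = 0 \<Longrightarrow> k x = 0"
begin

text \<open>Every direction of \<open>T\<close> is the velocity of a path from
  \<open>(c u, 0)\<close> within the face \<open>snd x = 0\<close>, on which \<open>k\<close>
  vanishes.\<close>

lemma derivative_along_boundary:
  obtains T where "subspace T" "c ` (U \<inter> S) \<subseteq> T" "image_Bl U c \<subseteq> T \<times> UNIV" "\<And>w. w \<in> T \<Longrightarrow> D (w, 0) = 0"
proof -
  obtain T where T: "subspace T" "c ` (U \<inter> S) \<subseteq> T" "openin (top_of_set (T \<times> {0..})) (image_Bl U c)"
    by (rule image_Bl_open[OF slice]) (rule that; assumption)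
  obtain O1 where O1: "open O1" "image_Bl U c = (T \<times> {0..}) \<inter> O1" using T(3) by (auto simp: openin_open)
  have cu: "c u \<in> T" using T(2) u by blast
  have "vscale B 0 u \<in> N" using scale(5)[OF S_points[OF u(2)], of 0] zero_N by auto
  moreover have "inv_into U c (c u) = u" using slice_smooth(3)[OF slice] u(1) by (rule inv_into_f_f)
  ultimately have "(c u, 0) \<in> image_Bl U c" using u by (simp add: image_Bl_def)
  then have x0: "(c u, 0) \<in> O1" unfolding O1(2) by simp
  have "D (w, 0) = 0" if w: "w \<in> T" for w
  proof -
    obtain e where e: "0 < e" "\<And>t. 0 < t \<Longrightarrow> t < e \<Longrightarrow> (c u, 0) + t *\<^sub>R (w, 0) \<in> O1"
      using eventually_path_in_open[OF O1(1) x0, of "(w, 0)"] by (auto simp: eventually_at_right_field)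
    have p: "(c u, 0) + t *\<^sub>R (w, 0::real) \<in> image_Bl U c" if "t \<in> {0..e / 2}" for t
    proof -
      have "(c u, 0) + t *\<^sub>R (w, 0) \<in> O1" using that e x0 by (cases "t = 0") auto
      moreover have "c u + t *\<^sub>R w \<in> T" using T(1) cu w by (intro subspace_add subspace_scale)
      ultimately show ?thesis unfolding O1(2) by simp
    qed
    have "((\<lambda>t. k ((c u, 0) + t *\<^sub>R (w, 0))) has_vector_derivative D (w, 0)) (at 0 within {0..e / 2})"
      by (rule has_vector_derivative_along_path[OF D has_vector_derivative_linear_path _ p]) simp
    moreover have "((\<lambda>t. k ((c u, 0) + t *\<^sub>R (w, 0))) has_vector_derivative 0) (at 0 within {0..e / 2})"
      by (rule has_vector_derivative_transform[OF _ _ has_vector_derivative_const[of 0]]) (use e(1) zero[OF p] in auto)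
    moreover have "0 < e / 2" using e(1) by simp
    ultimately show ?thesis using vector_derivative_unique_right by blast
  qed
  moreover have "image_Bl U c \<subseteq> T \<times> UNIV" unfolding O1(2) by blast
  ultimately show ?thesis using T(1,2) by (intro that)
qed

text \<open>The chart image spans at most \<open>T \<times> UNIV\<close>, and \<open>D\<close>
  vanishes on the first factor; so a differential that is nonzero on the span is nonzero on the
  normal direction.\<close>

lemma normal_derivative_nonzero:
  assumes v: "v \<in> span (image_Bl U c)" "D v \<noteq> 0"
  shows "D (0, 1) \<noteq> 0"
proof -
  obtain T where T: "subspace T" "c ` (U \<inter> S) \<subseteq> T" "image_Bl U c \<subseteq> T \<times> UNIV" "\<And>w. w \<in> T \<Longrightarrow> D (w, 0) = 0"
    by (rule derivative_along_boundary) (rule that; assumption)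
  have "v \<in> T \<times> UNIV" using span_minimal[OF T(3) subspace_Times[OF T(1) subspace_UNIV]] v(1) by (rule subsetD)
  then have "D (fst v, 0) = 0" using T(4) by (simp add: mem_Times_iff)
  moreover have "v = (fst v, 0) + snd v *\<^sub>R (0, 1)" by (simp add: prod_eq_iff)
  then have "D v = D (fst v, 0) + snd v *\<^sub>R D (0, 1)"
    using linear_add[OF has_derivative_linear[OF D], of "(fst v, 0)" "snd v *\<^sub>R (0, 1)"]
      linear_scale[OF has_derivative_linear[OF D], of "snd v" "(0, 1)"] by metis
  ultimately show ?thesis using v(2) by auto
qed

end

lemma smooth_into_const: "u \<in> S \<Longrightarrow> smooth_into X (total B) (\<lambda>_. u)"
proof -
  assume u: "u \<in> S"
  obtain U c W where sl: "slice_chart U c W" "u \<in> U" by (rule slice_chart_at[OF u]) (rule that; assumption)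
  have "smooth_into X (total B) (\<lambda>_. inv_into U c (c u))"
    by (rule smooth_into_compose_smooth_on[OF slice_smooth(1)[OF sl(1)] smooth_on_const]) (use sl(2) in blast)
  then show ?thesis using inv_into_f_f[OF slice_smooth(3)[OF sl(1)] sl(2)] by simp
qed

end

section \<open>Pullback of boundary-defining functions\<close>

context nondegenerate_bundle_map
begin

lemma \<psi>_boundary_iff: "z \<in> E.BN \<Longrightarrow> \<psi> z \<in> boundary E'.Bl \<longleftrightarrow> z \<in> boundary E.Bl"
  using E'.boundary_iff[OF \<psi>_in] E.boundary_iff[of z] pol_\<psi>[of z] fnorm_rescaled[OF E.pol_in(1,2,4)] by fastforce

text \<open>The normal curve at \<open>u\<close> is mapped to a curve that leaves the boundary with
  velocity \<open>(w, n 0)\<close>, where \<open>n 0 > 0\<close> is the squared norm of the rescaled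
  map. The differential \<open>D\<close> of \<open>f\<close> kills the tangential part, and
  \<open>n 0 * D (0, 1)\<close> remains.\<close>

lemma right_derivative_\<psi>:
  assumes bd: "boundary_defining E'.Bl f" and u: "u \<in> E.S"
  obtains d a where "0 < d" "\<And>t. t \<in> {0..d} \<Longrightarrow> vscale E (sqrt t) u \<in> N" "a \<noteq> 0"
    "((\<lambda>t. f (\<psi> (E.unpol u t))) has_vector_derivative a) (at 0 within {0..d})"
proof -
  obtain d1 where d1: "0 < d1" "\<And>t. t \<in> {0..<d1} \<Longrightarrow> 0 \<le> t \<and> vscale E (sqrt t) u \<in> N"
    by (rule exists_radius[OF u]) (rule that; assumption)
  have us: "u \<in> E.S \<and> 0 \<le> t \<and> vscale E (sqrt t) u \<in> N" if "t \<in> {0..<d1}" for t using d1(2)[OF that] u by blast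
  define y1 where "y1 t = unit_rescaled u t" for t
  define n where "n t = (fnorm ip' (rescaled u t))\<^sup>2" for t
  have sy: "smooth_into {0..<d1} (total E') y1" and sn: "smooth_on {0..<d1} n"
    unfolding y1_def[abs_def] n_def[abs_def]
    by (rule smooth_rescaled_norm[OF E.smooth_into_const[OF u] smooth_on_id us]; assumption)+
  have n0: "0 < n 0" using fnorm_rescaled[of u 0] us[of 0] d1(1) by (simp add: n_def)
  have p: "\<psi> (E.unpol u t) \<in> E'.BN" "E'.pol (\<psi> (E.unpol u t)) = (y1 t, t * n t)" "y1 t \<in> E'.S" if "t \<in> {0..<d1}" for t
    unfolding y1_def n_def using \<psi>_unpol_in pol_\<psi>_unpol unit_rescaled_S us[OF that] by blast+
  have in0: "0 \<in> {0..<d1}" using d1(1) by simp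
  obtain U c W where sl: "E'.slice_chart U c W" "y1 0 \<in> U"
    by (rule E'.slice_chart_at[OF p(3)[OF in0]]) (rule that; assumption)
  obtain V where V: "open V" "{t \<in> {0..<d1}. y1 t \<in> U} = {0..<d1} \<inter> V"
    by (rule continuous_map_openin_preimage[OF smooth_intoD(1)[OF sy] E'.slice_smooth(4)[OF sl(1)]]) (rule that; assumption)
  have "0 \<in> {t \<in> {0..<d1}. y1 t \<in> U}" using in0 sl(2) by simp
  then have "0 \<in> V" unfolding V(2) by simp
  then obtain e where e: "0 < e" "ball 0 e \<subseteq> V" using V(1) open_contains_ball by blast
  define d where "d = min d1 e / 2"
  have d: "0 < d" using d1(1) e(1) by (simp add: d_def)
  have sub: "t \<in> {0..<d1}" "y1 t \<in> U" if "t \<in> {0..d}" for t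
  proof -
    show t: "t \<in> {0..<d1}" using that d1(1) e(1) by (auto simp: d_def)
    have "t \<in> ball 0 e" using that d1(1) e(1) by (auto simp: d_def dist_norm)
    then have "t \<in> {0..<d1} \<inter> V" using t e(2) by blast
    then show "y1 t \<in> U" unfolding V(2)[symmetric] by simp
  qed
  have subd: "{0..d} \<subseteq> {0..<d1}" using sub(1) by blast
  have in0d: "0 \<in> {0..d}" using d by simp
  have sc: "smooth_on {0..d} (\<lambda>t. c (y1 t))"
    by (rule smooth_on_smooth_to_compose[OF E'.charted_total E'.slice_smooth(2)[OF sl(1)] smooth_into_subset[OF sy subd] sub(2)])
  obtain w where w: "((\<lambda>t. c (y1 t)) has_vector_derivative w) (at 0 within {0..d})"
    by (rule smooth_on_imp_has_vector_derivative[OF sc in0d]) (rule that; assumption)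
  obtain n' where n': "(n has_vector_derivative n') (at 0 within {0..d})"
    by (rule smooth_on_imp_has_vector_derivative[OF smooth_on_subset[OF sn subd] in0d]) (rule that; assumption)
  define y where "y t = (c (y1 t), t * n t)" for t
  have "((\<lambda>t. t * n t) has_vector_derivative (0 * n' + 1 * n 0)) (at 0 within {0..d})"
    by (rule has_vector_derivative_mult[OF _ n']) (auto intro!: derivative_eq_intros)
  then have y: "(y has_vector_derivative (w, n 0)) (at 0 within {0..d})"
    unfolding y_def[abs_def] using has_vector_derivative_Pair[OF w] by simp
  have dom: "\<psi> (E.unpol u t) \<in> E'.dom_Bl U" "E'.chart_Bl c (\<psi> (E.unpol u t)) = y t" if "t \<in> {0..d}" for t
    using p(1,2)[OF sub(1)[OF that]] sub(2)[OF that] by (simp_all add: y_def)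
  have yI: "y t \<in> E'.image_Bl U c" if "t \<in> {0..d}" for t
    using E'.chart_Bl_in[OF sl(1) dom(1)[OF that]] unfolding dom(2)[OF that] by blast
  define k where "k = f \<circ> inv_into (E'.dom_Bl U) (E'.chart_Bl c)"
  have kp: "k (y t) = f (\<psi> (E.unpol u t))" if "t \<in> {0..d}" for t
    unfolding k_def o_def dom(2)[OF that, symmetric] by (rule arg_cong[of _ _ f], rule inv_into_f_f[OF E'.inj_chart_Bl[OF sl(1)] dom(1)[OF that]])
  have zero: "k x = 0" if x: "x \<in> E'.image_Bl U c" "snd x = 0" for x
  proof -
    define z where "z = E'.unpol (inv_into U c (fst x)) (snd x)"
    have z: "z \<in> E'.BN" "snd (E'.pol z) = 0" using E'.unchart_Bl_in(1,2)[OF sl(1) x(1)] x(2) by (simp_all add: z_def)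
    then have "z \<in> {p \<in> points E'.Bl. f p = 0}"
      using bd E'.boundary_iff[OF z(1)] unfolding boundary_defining_def by blast
    then show ?thesis using E'.inv_chart_Bl[OF sl(1) x(1)] by (simp add: k_def z_def)
  qed
  have p0: "\<psi> (E.unpol u 0) \<in> boundary E'.Bl" using E'.boundary_iff[OF p(1)[OF in0]] p(2)[OF in0] by simp
  have "(E'.dom_Bl U, E'.chart_Bl c) \<in> atlas E'.Bl" unfolding E'.atlas_Bl using sl(1) by blast
  then obtain D v where D: "(k has_derivative D) (at (y 0) within E'.image_Bl U c)" and v: "v \<in> span (E'.image_Bl U c)" "D v \<noteq> 0"
    using bd p0 dom[OF in0d] unfolding boundary_defining_def differential_nonzero_def k_def E'.image_chart_Bl[OF sl(1), symmetric] by fastforce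
  have y0: "y 0 = (c (y1 0), 0)" by (simp add: y_def)
  note D' = D[unfolded y0] and y1S = p(3)[OF in0]
  obtain T where T: "subspace T" "c ` (U \<inter> E'.S) \<subseteq> T" "E'.image_Bl U c \<subseteq> T \<times> UNIV" "\<And>w. w \<in> T \<Longrightarrow> D (w, 0) = 0"
    by (rule E'.derivative_along_boundary[OF sl y1S D' zero], assumption, assumption) (rule that; assumption)
  have D01: "D (0, 1) \<noteq> 0" by (rule E'.normal_derivative_nonzero[OF sl y1S D' zero v])
  \<comment> \<open>The first coordinate runs inside \<open>T\<close>, so projecting to
    \<open>T\<close> does not change the path; hence its velocity \<open>w\<close> lies in
    \<open>T\<close>.\<close>
  obtain P where P: "linear P" "range P \<subseteq> T" "\<And>v. v \<in> T \<Longrightarrow> P v = v"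
    by (rule linear_closest_point_subspace[OF T(1)]) (rule that; assumption)
  have "((\<lambda>t. P (c (y1 t))) has_vector_derivative P w) (at 0 within {0..d})"
    using bounded_linear.has_vector_derivative[OF _ w] P(1) by (simp add: linear_linear)
  moreover have "c (y1 t) = P (c (y1 t))" if "t \<in> {0..d}" for t
    using P(3) T(2) p(3)[OF sub(1)[OF that]] sub(2)[OF that] by (metis Int_iff image_subset_iff)
  ultimately have "((\<lambda>t. c (y1 t)) has_vector_derivative P w) (at 0 within {0..d})"
    by (rule has_vector_derivative_transform[OF in0d, rotated])
  then have "w = P w" by (rule vector_derivative_unique_right[OF d w])
  then have wT: "w \<in> T" using P(2) by (metis rangeI subsetD)
  have "(w, n 0) = (w, 0) + n 0 *\<^sub>R (0, 1)" by simp
  then have "D (w, n 0) = D (w, 0) + n 0 *\<^sub>R D (0, 1)"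
    using linear_add[OF has_derivative_linear[OF D], of "(w, 0)" "n 0 *\<^sub>R (0, 1)"]
      linear_scale[OF has_derivative_linear[OF D], of "n 0" "(0, 1)"] by metis
  then have nz: "D (w, n 0) \<noteq> 0" using T(4)[OF wT] n0 D01 by simp
  have "((\<lambda>t. k (y t)) has_vector_derivative D (w, n 0)) (at 0 within {0..d})"
    by (rule has_vector_derivative_along_path[OF D y refl yI])
  then have "((\<lambda>t. f (\<psi> (E.unpol u t))) has_vector_derivative D (w, n 0)) (at 0 within {0..d})"
    by (rule has_vector_derivative_transform[OF in0d, rotated]) (simp add: kp)
  then show ?thesis using d1(2) sub(1) by (intro that[OF d _ nz]) blast+
qed

text \<open>Non-vanishing of the differential is tested on the inward normal \<open>(0, 1)\<close>,
  where it equals the one-sided derivative found in \<open>right_derivative_\<psi>\<close>.\<close>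

lemma boundary_defining_\<psi>:
  assumes bd: "boundary_defining E'.Bl f"
  shows "boundary_defining E.Bl (f \<circ> \<psi>)"
proof -
  have smf: "smooth_map E'.Bl real_mfd f" and nn: "\<And>p. p \<in> E'.BN \<Longrightarrow> 0 \<le> f p"
    and zs: "{p \<in> E'.BN. f p = 0} = boundary E'.Bl"
    using bd by (simp_all add: boundary_defining_def E'.points_Bl)
  have smk: "smooth_into (E.image_Bl U c) real_mfd (\<lambda>x. (f \<circ> \<psi>) (E.unpol (inv_into U c (fst x)) (snd x)))"
    if sl: "E.slice_chart U c W" for U c W
    using smooth_into_smooth_map_compose[OF E'.charted_Bl charted_std_mfd smf
        smooth_into_smooth_map_compose[OF E.charted_Bl E'.charted_Bl smooth_\<psi> E.smooth_into_unchart_Bl[OF sl]]]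
    by simp
  have "differential_nonzero E.Bl (f \<circ> \<psi>) p" if p: "p \<in> boundary E.Bl" for p
    unfolding differential_nonzero_def
  proof (safe)
    fix U' c' assume "(U', c') \<in> atlas E.Bl" and pU: "p \<in> U'"
    then obtain U c W where eq: "U' = E.dom_Bl U" "c' = E.chart_Bl c" and sl: "E.slice_chart U c W"
      unfolding E.atlas_Bl by blast
    define u where "u = fst (E.pol p)"
    have pB: "p \<in> E.BN" and uU: "u \<in> U" using pU by (simp_all add: eq u_def)
    have sp: "snd (E.pol p) = 0" using E.boundary_iff[OF pB] p by simp
    have uS: "u \<in> E.S" using E.pol_in(1)[OF pB] by (simp add: u_def)
    have cp: "c' p = (c u, 0)" by (simp add: eq u_def sp)
    have inv: "inv_into U c (c u) = u" using E.slice_smooth(3)[OF sl] uU by (rule inv_into_f_f)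
    define k where "k x = (f \<circ> \<psi>) (E.unpol (inv_into U c (fst x)) (snd x))" for x
    have img: "c' ` U' = E.image_Bl U c" unfolding eq by (rule E.image_chart_Bl[OF sl])
    obtain d a where d: "0 < d" "\<And>t. t \<in> {0..d} \<Longrightarrow> vscale E (sqrt t) u \<in> N" "a \<noteq> 0"
      "((\<lambda>t. f (\<psi> (E.unpol u t))) has_vector_derivative a) (at 0 within {0..d})"
      by (rule right_derivative_\<psi>[OF bd uS]) (rule that; assumption)
    have I: "(c u, t) \<in> E.image_Bl U c" if "t \<in> {0..d}" for t
      using d(2)[OF that] that uU uS by (simp add: E.image_Bl_def inv)
    have x0: "(c u, 0) \<in> E.image_Bl U c" using I[of 0] d(1) by simp
    have "smooth_on (E.image_Bl U c) k" using smk[OF sl] by (simp add: smooth_into_std_mfd_iff k_def[abs_def])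
    then obtain D where D: "(k has_derivative D) (at (c u, 0) within E.image_Bl U c)"
      by (rule smooth_on_imp_has_derivative_within[OF _ x0]) (rule that; assumption)
    have kD: "((f \<circ> \<psi> \<circ> inv_into U' c') has_derivative D) (at (c' p) within c' ` U')"
      unfolding img cp
      by (rule has_derivative_transform[OF x0 _ D]) (simp add: eq k_def E.inv_chart_Bl[OF sl])
    have "((\<lambda>t. k ((c u, 0) + t *\<^sub>R (0, 1))) has_vector_derivative D (0, 1)) (at 0 within {0..d})"
      by (rule has_vector_derivative_along_path[OF D has_vector_derivative_linear_path]) (simp_all add: I)
    then have "((\<lambda>t. f (\<psi> (E.unpol u t))) has_vector_derivative D (0, 1)) (at 0 within {0..d})"
      by (simp add: k_def inv)
    then have "D (0, 1) = a" using vector_derivative_unique_right[OF d(1) _ d(4)] by blast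
    \<comment> \<open>Up to scaling, the normal vector is the difference of two points of the chart
      image on the same normal line.\<close>
    moreover have "(0, 1) \<in> span (c' ` U')"
    proof -
      have "(1 / d) *\<^sub>R ((c u, d) - (c u, 0)) \<in> span (E.image_Bl U c)"
        using I[of d] x0 d(1) by (intro span_scale span_diff span_base) simp_all
      then show ?thesis using d(1) by (simp add: img)
    qed
    ultimately show "\<exists>D. ((f \<circ> \<psi> \<circ> inv_into U' c') has_derivative D) (at (c' p) within c' ` U') \<and> (\<exists>v\<in>span (c' ` U'). D v \<noteq> 0)"
      using kD d(3) by (intro exI[of _ D] conjI bexI[of _ "(0, 1)"]) simp_all
  qed
  moreover have "smooth_map E.Bl real_mfd (f \<circ> \<psi>)" by (rule E.smooth_map_from_Bl[OF smk])
  moreover have "0 \<le> (f \<circ> \<psi>) z" if "z \<in> E.BN" for z using nn[OF \<psi>_in[OF that]] by simp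
  moreover have "{z \<in> E.BN. (f \<circ> \<psi>) z = 0} = boundary E.Bl"
  proof -
    have "f (\<psi> z) = 0 \<longleftrightarrow> z \<in> boundary E.Bl" if "z \<in> E.BN" for z
      using \<psi>_boundary_iff[OF that] \<psi>_in[OF that] unfolding zs[symmetric] by simp
    moreover have "boundary E.Bl \<subseteq> E.BN" unfolding E.boundary_Bl blowup_set_def by blast
    ultimately show ?thesis by auto
  qed
  ultimately show ?thesis by (simp add: boundary_defining_def E.points_Bl)
qed

end

text \<open>Breaks the packaged hypotheses into pointwise facts. Continuity of a single
  \<open>\<rho> g\<close> comes from the joint action map, restricted to the slice at
  \<open>g\<close>.\<close>

lemma sphere_transitive_bundleI:
  fixes B :: "('e, 'a::euclidean_space, 'f, 'b::euclidean_space) vbundle" and MG :: "('g, 'k::euclidean_space) mfd"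
  assumes MG: "points MG = carrier G" and vb: "vector_bundle B" and act: "fibrewise_linear_action G MG B \<rho>"
    and trans: "transitive_on_sphere_fibres G B \<rho>" and ip: "invariant_inner_product G B \<rho> ip"
    and N: "invariant_zero_nbhd G B \<rho> N"
  shows "sphere_transitive_bundle B ip N G \<rho>"
proof -
  have fib: "proj B e \<in> points (base B)" "e \<in> fibre B (proj B e)" if "e \<in> points (total B)" for e
    using vector_bundle_scale(7)[OF vb that] that by (simp_all add: fibre_def)
  have lin: "\<rho> g e \<in> fibre B (proj B e)" "e' \<in> fibre B (proj B e) \<Longrightarrow> \<rho> g (vadd B e e') = vadd B (\<rho> g e) (\<rho> g e')"
    "\<rho> g (vscale B r e) = vscale B r (\<rho> g e)"
    if "g \<in> carrier G" "e \<in> points (total B)" for g e e' r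
    using act fib[OF that(2)] that(1) unfolding fibrewise_linear_action_def by blast+
  show ?thesis
  proof (intro sphere_transitive_bundle.intro blowup_domain.intro sphere_transitive_bundle_axioms.intro)
    show "vector_bundle B" by (rule vb)
    show "fibrewise_inner_product B ip" using ip by (simp add: invariant_inner_product_def)
    show "openin (mtop (total B)) N" "zero_section B \<subseteq> N" using N by (simp_all add: invariant_zero_nbhd_def)
    show "transitive_on_sphere_fibres G B \<rho>" by (rule trans)
    show "group_action G (points (total B)) \<rho>" using act by (simp add: fibrewise_linear_action_def)
    fix g assume g: "g \<in> carrier G"
    show "\<rho> g e \<in> N" if "e \<in> N" for e using N g that by (auto simp: invariant_zero_nbhd_def)
    have c1: "continuous_map (prod_topology (mtop MG) (mtop (total B))) (mtop (total B)) (\<lambda>(g, e). \<rho> g e)"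
      using act by (simp add: fibrewise_linear_action_def smooth_map_def prod_mfd_def)
    have c2: "continuous_map (mtop (total B)) (prod_topology (mtop MG) (mtop (total B))) (\<lambda>e. (g, e))"
      using g MG by (intro continuous_map_pairedI) simp_all
    show "continuous_map (mtop (total B)) (mtop (total B)) (\<rho> g)"
      using continuous_map_compose[OF c2 c1] by (simp add: o_def)
    fix e assume e: "e \<in> points (total B)"
    show "proj B (\<rho> g e) = proj B e" using lin(1)[OF g e] by (simp add: fibre_def)
    show "\<rho> g (vadd B e e') = vadd B (\<rho> g e) (\<rho> g e')"
      if "e' \<in> points (total B)" "proj B e = proj B e'" for e'
      by (rule lin(2)[OF g e]) (use that in \<open>simp add: fibre_def\<close>)
    show "\<rho> g (vscale B r e) = vscale B r (\<rho> g e)" for r by (rule lin(3)[OF g e])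
    have "ip (\<rho> g e) (\<rho> g e) = ip e e"
      using ip g fib[OF e] unfolding invariant_inner_product_def by blast
    then show "fnorm ip (\<rho> g e) = fnorm ip e" by (simp add: fnorm_def)
  qed
qed

text \<open>Uniqueness is expressed as agreement on \<open>blowup_set E N\<close>, since functions
  are total and their values elsewhere are arbitrary.\<close>

theorem lemma16p2:
  fixes G :: "'g monoid" and MG :: "('g, 'k::euclidean_space) mfd"
    and E :: "('e, 'a::euclidean_space, 'f, 'b::euclidean_space) vbundle"
    and E' :: "('e2, 'a2::euclidean_space, 'f2, 'b2::euclidean_space) vbundle"
    and \<rho> :: "'g \<Rightarrow> 'e \<Rightarrow> 'e" and \<rho>' :: "'g \<Rightarrow> 'e2 \<Rightarrow> 'e2"
    and ip :: "'e \<Rightarrow> 'e \<Rightarrow> real" and ip' :: "'e2 \<Rightarrow> 'e2 \<Rightarrow> real"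
    and N :: "'e set" and N' :: "'e2 set" and \<phi> :: "'e \<Rightarrow> 'e2"
  assumes "lie_group G MG" and "compact_space (mtop MG)"
    and "vector_bundle E" and "vector_bundle E'"
    and "fibrewise_linear_action G MG E \<rho>" and "fibrewise_linear_action G MG E' \<rho>'"
    and "transitive_on_sphere_fibres G E \<rho>" and "transitive_on_sphere_fibres G E' \<rho>'"
    and "invariant_inner_product G E \<rho> ip" and "invariant_inner_product G E' \<rho>' ip'"
    and "invariant_zero_nbhd G E \<rho> N" and "invariant_zero_nbhd G E' \<rho>' N'"
    and "smooth_map (open_submfd (total E) N) (open_submfd (total E') N') \<phi>"
    and "equivariant G N \<rho> \<rho>' \<phi>"
    and "{e \<in> N. (fnorm ip' (\<phi> e))\<^sup>2 = 0} = zero_section E"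
    and "hessian_nondegenerate_on_normal_bundle (open_submfd (total E) N) (zero_section E)
           (\<lambda>e. (fnorm ip' (\<phi> e))\<^sup>2)"
  shows "\<exists>\<psi>. is_blowup_lift E ip N E' ip' N' \<phi> \<psi> \<and>
    (\<forall>\<psi>2. is_blowup_lift E ip N E' ip' N' \<phi> \<psi>2 \<longrightarrow> (\<forall>z\<in>blowup_set E N. \<psi>2 z = \<psi> z)) \<and>
    equivariant G (blowup_set E N) (blowup_action \<rho>) (blowup_action \<rho>') \<psi> \<and>
    (\<forall>f. boundary_defining (blowup_nbhd E' ip' N') f \<longrightarrow>
         boundary_defining (blowup_nbhd E ip N) (f \<circ> \<psi>))"
proof -
  have MG: "points MG = carrier G" using assms(1) by (simp add: lie_group_def)
  interpret E: sphere_transitive_bundle E ip N G \<rho>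
    by (rule sphere_transitive_bundleI[OF MG assms(3,5,7,9,11)])
  interpret E': sphere_transitive_bundle E' ip' N' G \<rho>'
    by (rule sphere_transitive_bundleI[OF MG assms(4,6,8,10,12)])
  have cont: "continuous_map (subtopology (mtop (total E)) N) (subtopology (mtop (total E')) N') \<phi>"
    using assms(13) by (simp add: smooth_map_def open_submfd_def)
  have pts: "\<phi> e \<in> points (total E')" if "e \<in> N" for e
    using continuous_map_image_subset_topspace[OF cont] that E.N_points by auto
  interpret nondegenerate_bundle_map E ip N E' ip' N' G \<rho> \<rho>' \<phi>
  proof
    show "smooth_map (open_submfd (total E) N) (open_submfd (total E') N') \<phi>" by (rule assms(13))
    show "\<phi> (\<rho> g e) = \<rho>' g (\<phi> e)" if "g \<in> carrier G" "e \<in> N" for g e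
      using assms(14) that by (simp add: equivariant_def)
    show "\<phi> e \<in> zero_section E' \<longleftrightarrow> e \<in> zero_section E" if "e \<in> N" for e
      unfolding assms(15)[symmetric] using E'.norm(1)[OF pts[OF that]] that by simp
    show "hessian_nondegenerate_on_normal_bundle (open_submfd (total E) N) (zero_section E) (\<lambda>e. (fnorm ip' (\<phi> e))\<^sup>2)"
      by (rule assms(16))
  qed
  show ?thesis
    using is_blowup_lift_\<psi> blowup_lift_unique equivariant_\<psi> boundary_defining_\<psi> by (intro exI[of _ \<psi>]) blast
qed

end
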